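(* Let $C\cong kQ_C/I$ be an algebra of global dimension at most two over an algebraically closed field $k$, where $Q_C$ is the quiver of $C$ and $I$ is an admissible ideal of the path algebra $kQ_C$. Assume that $Q_C$ has no oriented cycles, and let $R$ be a system of relations for $C\cong kQ_C/I$. Then the quiver $Q_{\tilde C}$ of the relation-extension algebra $\tilde C=C\ltimes \operatorname{Ext}^2_C(DC,C)$ is constructed as follows: (a) $(Q_{\tilde C})_0=(Q_C)_0$; (b) for $x,y\in (Q_C)_0$, the set of arrows in $Q_{\tilde C}$ from $x$ to $y$ equals the set of arrows in $Q_C$ from $x$ to $y$ plus $\operatorname{Card}\left(R\cap (e_y I e_x)\right)$ additional arrows.
   Context: Conventions. Algebras are basic, connected, finite-dimensional algebras over the algebraically closed field $k$; modules are finitely generated right modules; $D=\operatorname{Hom}_k(-,k)$. For a quiver $Q$, $Q_0$ denotes its set of points and $Q_1$ its set of arrows; $e_x$ denotes the primitive idempotent corresponding to the point $x$. Paths are composed so that $e_x(kQ)e_y$ is spanned by the paths from $x$ to $y$; accordingly, for a basic algebra $B$ the number of arrows from $x$ to $y$ in its quiver is $\dim_k e_x(\operatorname{rad}B/\operatorname{rad}^2B)e_y$. System of relations. A system of relations for $C\cong kQ_C/I$ is a subset $R$ of $\bigcup_{x,y\in (Q_C)_0} e_xIe_y$ such that $R$, but no proper subset of $R$, generates $I$ as a two-sided ideal of $kQ_C$. Relation-extension. For a $C$-$C$-bimodule $M$, the trivial extension $C\ltimes M$ is the vector space $C\oplus M$ with multiplication $(c,m)(c',m')=(cc',cm'+mc')$.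 For $C$ of global dimension at most two, the relation-extension of $C$ is $C\ltimes \operatorname{Ext}^2_C(DC,C)$, where $\operatorname{Ext}^2_C(DC,C)$ has its natural $C$-$C$-bimodule structure: the left action is induced by the left $C$-action on the second argument $C$, and the right action is induced (contravariantly) by the left $C$-action on the first argument $DC$. The points of the quiver of $C\ltimes \operatorname{Ext}^2_C(DC,C)$ are identified with those of $Q_C$ via the idempotents $(e_x,0)$. *)

theory Defs
  imports
    "HOL-Algebra.Algebra"
    "Jordan_Normal_Form.Missing_VectorSpace"
    "Graph_Theory.Graph_Theory"
begin

hide_const (open) Multiset.mult Wellorder_Constructions.zero

section \<open>Finite-dimensional algebras\<close>

locale kalgebra = vectorspace K A + A?: ring A for K and A (structure) +
  assumes smult_mult_left:
      "\<lbrakk>a \<in> carrier K; x \<in> carrier A; y \<in> carrier A\<rbrakk> \<Longrightarrow>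
        a \<odot>\<^bsub>A\<^esub> (x \<otimes>\<^bsub>A\<^esub> y) = (a \<odot>\<^bsub>A\<^esub> x) \<otimes>\<^bsub>A\<^esub> y"
    and smult_mult_right:
      "\<lbrakk>a \<in> carrier K; x \<in> carrier A; y \<in> carrier A\<rbrakk> \<Longrightarrow>
        a \<odot>\<^bsub>A\<^esub> (x \<otimes>\<^bsub>A\<^esub> y) = x \<otimes>\<^bsub>A\<^esub> (a \<odot>\<^bsub>A\<^esub> y)"

definition algebra_iso ::
  "'k ring \<Rightarrow> ('k, 'a) module \<Rightarrow> ('k, 'b) module \<Rightarrow> ('a \<Rightarrow> 'b) \<Rightarrow> bool"
  where "algebra_iso K A B h \<longleftrightarrow> h \<in> ring_iso A B \<and>
    (\<forall>a\<in>carrier K. \<forall>x\<in>carrier A. h (a \<odot>\<^bsub>A\<^esub> x) = a \<odot>\<^bsub>B\<^esub> h x)"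

text \<open>The library quotient \<^term>\<open>A Quot I\<close> together with the induced scalar multiplication. It is
  used for quotients of algebras by ideals and, ignoring the multiplication, for quotients of vector
  spaces by subspaces.\<close>

definition quotient_module :: "('k, 'a) module \<Rightarrow> 'a set \<Rightarrow> ('k, 'a set) module"
  where "quotient_module A I = \<lparr>carrier = carrier (A Quot I), mult = mult (A Quot I),
    one = one (A Quot I), zero = zero (A Quot I), add = add (A Quot I),
    smult = (\<lambda>a S. \<Union>x\<in>S. I +>\<^bsub>A\<^esub> (a \<odot>\<^bsub>A\<^esub> x))\<rparr>"

definition connected_algebra :: "('k, 'a) module \<Rightarrow> bool"
  where "connected_algebra A \<longleftrightarrow> \<one>\<^bsub>A\<^esub> \<noteq> \<zero>\<^bsub>A\<^esub> \<and>
    (\<forall>e\<in>carrier A. e \<otimes>\<^bsub>A\<^esub> e = e \<and> (\<forall>a\<in>carrier A. e \<otimes>\<^bsub>A\<^esub> a = a \<otimes>\<^bsub>A\<^esub> e)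
      \<longrightarrow> e = \<zero>\<^bsub>A\<^esub> \<or> e = \<one>\<^bsub>A\<^esub>)"

definition right_ideal :: "'a set \<Rightarrow> ('k, 'a) module \<Rightarrow> bool"
  where "right_ideal I A \<longleftrightarrow>
    additive_subgroup I A \<and> (\<forall>i\<in>I. \<forall>a\<in>carrier A. i \<otimes>\<^bsub>A\<^esub> a \<in> I)"

definition maximal_right_ideal :: "'a set \<Rightarrow> ('k, 'a) module \<Rightarrow> bool"
  where "maximal_right_ideal I A \<longleftrightarrow> right_ideal I A \<and> I \<noteq> carrier A \<and>
    (\<forall>J. right_ideal J A \<and> I \<subseteq> J \<longrightarrow> J = I \<or> J = carrier A)"

definition radical :: "('k, 'a) module \<Rightarrow> 'a set"
  where "radical A = carrier A \<inter> \<Inter>{I. maximal_right_ideal I A}"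

primrec ideal_power :: "('k, 'a) module \<Rightarrow> 'a set \<Rightarrow> nat \<Rightarrow> 'a set"
  where
    "ideal_power A I 0 = carrier A"
  | "ideal_power A I (Suc n) = ideal_prod A (ideal_power A I n) I"


section \<open>Right modules\<close>

text \<open>In a module record over an algebra \<open>C\<close>, the operation \<^term>\<open>c \<odot>\<^bsub>M\<^esub> m\<close> stands for the
  right action \<open>m \<cdot> c\<close>; the multiplication and unit fields of the record are ignored.\<close>

locale right_module = C?: ring C + M?: abelian_group M
  for C :: "('k, 'c) module" and M :: "('c, 'm) module" +
  assumes act_closed: "\<lbrakk>c \<in> carrier C; m \<in> carrier M\<rbrakk> \<Longrightarrow> c \<odot>\<^bsub>M\<^esub> m \<in> carrier M"
    and act_add_left: "\<lbrakk>c \<in> carrier C; d \<in> carrier C; m \<in> carrier M\<rbrakk> \<Longrightarrow>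
        (c \<oplus>\<^bsub>C\<^esub> d) \<odot>\<^bsub>M\<^esub> m = c \<odot>\<^bsub>M\<^esub> m \<oplus>\<^bsub>M\<^esub> d \<odot>\<^bsub>M\<^esub> m"
    and act_add_right: "\<lbrakk>c \<in> carrier C; m \<in> carrier M; m' \<in> carrier M\<rbrakk> \<Longrightarrow>
        c \<odot>\<^bsub>M\<^esub> (m \<oplus>\<^bsub>M\<^esub> m') = c \<odot>\<^bsub>M\<^esub> m \<oplus>\<^bsub>M\<^esub> c \<odot>\<^bsub>M\<^esub> m'"
    and act_mult: "\<lbrakk>c \<in> carrier C; d \<in> carrier C; m \<in> carrier M\<rbrakk> \<Longrightarrow>
        (c \<otimes>\<^bsub>C\<^esub> d) \<odot>\<^bsub>M\<^esub> m = d \<odot>\<^bsub>M\<^esub> (c \<odot>\<^bsub>M\<^esub> m)"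
    and act_one: "m \<in> carrier M \<Longrightarrow> \<one>\<^bsub>C\<^esub> \<odot>\<^bsub>M\<^esub> m = m"

text \<open>Homomorphisms are taken \<^const>\<open>undefined\<close> outside the carrier of their domain, so that equality
  of homomorphisms is equality of functions.\<close>

definition mod_hom_set :: "('k, 'c) module \<Rightarrow> ('c, 'm) module \<Rightarrow> ('c, 'n) module \<Rightarrow> ('m \<Rightarrow> 'n) set"
  where "mod_hom_set C M N = LinearCombinations.module_hom C M N \<inter> extensional (carrier M)"

definition mod_iso :: "('k, 'c) module \<Rightarrow> ('c, 'm) module \<Rightarrow> ('c, 'n) module \<Rightarrow> bool"
  where "mod_iso C M N \<longleftrightarrow> (\<exists>f\<in>mod_hom_set C M N. bij_betw f (carrier M) (carrier N))"

definition regular_module :: "('k, 'c) module \<Rightarrow> ('c, 'c) module"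
  where "regular_module C = \<lparr>carrier = carrier C, mult = mult C, one = \<one>\<^bsub>C\<^esub>,
    zero = \<zero>\<^bsub>C\<^esub>, add = add C, smult = (\<lambda>c a. a \<otimes>\<^bsub>C\<^esub> c)\<rparr>"

definition free_module :: "('k, 'c) module \<Rightarrow> nat \<Rightarrow> ('c, nat \<Rightarrow> 'c) module"
  where "free_module C n = \<lparr>carrier = {..<n} \<rightarrow>\<^sub>E carrier C, mult = undefined, one = undefined,
    zero = (\<lambda>i\<in>{..<n}. \<zero>\<^bsub>C\<^esub>), add = (\<lambda>u v. \<lambda>i\<in>{..<n}. u i \<oplus>\<^bsub>C\<^esub> v i),
    smult = (\<lambda>c u. \<lambda>i\<in>{..<n}. u i \<otimes>\<^bsub>C\<^esub> c)\<rparr>"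

definition fin_gen_module :: "('k, 'c) module \<Rightarrow> ('c, 'm) module \<Rightarrow> bool"
  where "fin_gen_module C M \<longleftrightarrow> right_module C M \<and>
    (\<exists>n. \<exists>f\<in>mod_hom_set C (free_module C n) M. f ` carrier (free_module C n) = carrier M)"

text \<open>Finitely generated projective modules: the direct summands of finitely generated free
  modules.\<close>

definition fg_projective :: "('k, 'c) module \<Rightarrow> ('c, 'm) module \<Rightarrow> bool"
  where "fg_projective C P \<longleftrightarrow> right_module C P \<and>
    (\<exists>n. \<exists>f\<in>mod_hom_set C P (free_module C n). \<exists>g\<in>mod_hom_set C (free_module C n) P.
      \<forall>p\<in>carrier P. g (f p) = p)"

text \<open>The dual \<open>D C = Hom\<^sub>k(C, k)\<close> as a right module, \<open>(\<phi> \<cdot> c)(a) = \<phi>(c a)\<close>, and its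
  left action, \<open>(c \<cdot> \<phi>)(a) = \<phi>(a c)\<close>.\<close>

definition dual_module :: "'k ring \<Rightarrow> ('k, 'c) module \<Rightarrow> ('c, 'c \<Rightarrow> 'k) module"
  where "dual_module K C = \<lparr>
    carrier = {\<phi> \<in> carrier C \<rightarrow>\<^sub>E carrier K.
      (\<forall>x\<in>carrier C. \<forall>y\<in>carrier C. \<phi> (x \<oplus>\<^bsub>C\<^esub> y) = \<phi> x \<oplus>\<^bsub>K\<^esub> \<phi> y) \<and>
      (\<forall>a\<in>carrier K. \<forall>x\<in>carrier C. \<phi> (a \<odot>\<^bsub>C\<^esub> x) = a \<otimes>\<^bsub>K\<^esub> \<phi> x)},
    mult = undefined, one = undefined,
    zero = (\<lambda>x\<in>carrier C. \<zero>\<^bsub>K\<^esub>), add = (\<lambda>\<phi> \<psi>. \<lambda>x\<in>carrier C. \<phi> x \<oplus>\<^bsub>K\<^esub> \<psi> x),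
    smult = (\<lambda>c \<phi>. \<lambda>a\<in>carrier C. \<phi> (c \<otimes>\<^bsub>C\<^esub> a))\<rparr>"

definition dual_left_action :: "('k, 'c) module \<Rightarrow> 'c \<Rightarrow> ('c \<Rightarrow> 'k) \<Rightarrow> 'c \<Rightarrow> 'k"
  where "dual_left_action C c \<phi> = (\<lambda>a\<in>carrier C. \<phi> (a \<otimes>\<^bsub>C\<^esub> c))"


section \<open>Projective resolutions and global dimension\<close>

text \<open>A resolution \<open>\<cdots> \<rightarrow> P\<^sub>2 \<rightarrow> P\<^sub>1 \<rightarrow> P\<^sub>0 \<rightarrow> M \<rightarrow> 0\<close>: the map \<^term>\<open>boundary P n\<close> goes from
  the term of index \<open>n + 1\<close> to the term of index \<open>n\<close>.\<close>

record ('c, 'p, 'm) resolution =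
  terms :: "nat \<Rightarrow> ('c, 'p) module"
  boundary :: "nat \<Rightarrow> 'p \<Rightarrow> 'p"
  augmentation :: "'p \<Rightarrow> 'm"

definition projective_resolution ::
  "('k, 'c) module \<Rightarrow> ('c, 'm) module \<Rightarrow> ('c, 'p, 'm) resolution \<Rightarrow> bool"
  where "projective_resolution C M P \<longleftrightarrow>
    (\<forall>n. fg_projective C (terms P n)) \<and>
    (\<forall>n. boundary P n \<in> mod_hom_set C (terms P (Suc n)) (terms P n)) \<and>
    augmentation P \<in> mod_hom_set C (terms P 0) M \<and>
    augmentation P ` carrier (terms P 0) = carrier M \<and>
    boundary P 0 ` carrier (terms P 1) =
      {p \<in> carrier (terms P 0). augmentation P p = \<zero>\<^bsub>M\<^esub>} \<and>
    (\<forall>n. boundary P (Suc n) ` carrier (terms P (Suc (Suc n))) =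
      {p \<in> carrier (terms P (Suc n)). boundary P n p = \<zero>\<^bsub>terms P n\<^esub>})"

text \<open>A finitely generated module over a finite-dimensional \<open>k\<close>-algebra is a finite-dimensional vector
  space, hence isomorphic to one whose elements are finitely supported sequences of scalars.
  Quantifying over modules with elements of type \<^typ>\<open>nat \<Rightarrow> 'k\<close> therefore covers all finitely
  generated modules up to isomorphism.\<close>

definition gl_dim_le :: "('k, 'c) module \<Rightarrow> nat \<Rightarrow> bool"
  where "gl_dim_le C d \<longleftrightarrow> (\<forall>M :: ('c, nat \<Rightarrow> 'k) module. fin_gen_module C M \<longrightarrow>
    (\<exists>P :: ('c, nat \<Rightarrow> 'k, nat \<Rightarrow> 'k) resolution. projective_resolution C M P \<and>
      (\<forall>n>d. carrier (terms P n) = {\<zero>\<^bsub>terms P n\<^esub>})))"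


section \<open>Extension groups\<close>

definition hom_space ::
  "('k, 'c) module \<Rightarrow> ('c, 'm) module \<Rightarrow> ('c, 'n) module \<Rightarrow> ('k, 'm \<Rightarrow> 'n) module"
  where "hom_space C M N = \<lparr>carrier = mod_hom_set C M N, mult = undefined, one = undefined,
    zero = (\<lambda>m\<in>carrier M. \<zero>\<^bsub>N\<^esub>), add = (\<lambda>f g. \<lambda>m\<in>carrier M. f m \<oplus>\<^bsub>N\<^esub> g m),
    smult = (\<lambda>a f. \<lambda>m\<in>carrier M. (a \<odot>\<^bsub>C\<^esub> \<one>\<^bsub>C\<^esub>) \<odot>\<^bsub>N\<^esub> f m)\<rparr>"

definition cocycles ::
  "('k, 'c) module \<Rightarrow> ('c, 'p, 'm) resolution \<Rightarrow> nat \<Rightarrow> ('c, 'n) module \<Rightarrow> ('p \<Rightarrow> 'n) set"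
  where "cocycles C P n N = {f \<in> mod_hom_set C (terms P n) N.
    \<forall>p\<in>carrier (terms P (Suc n)). f (boundary P n p) = \<zero>\<^bsub>N\<^esub>}"

fun coboundaries ::
  "('k, 'c) module \<Rightarrow> ('c, 'p, 'm) resolution \<Rightarrow> nat \<Rightarrow> ('c, 'n) module \<Rightarrow> ('p \<Rightarrow> 'n) set"
  where
    "coboundaries C P 0 N = {\<lambda>p\<in>carrier (terms P 0). \<zero>\<^bsub>N\<^esub>}"
  | "coboundaries C P (Suc n) N =
      (\<lambda>g. compose (carrier (terms P (Suc n))) g (boundary P n)) ` mod_hom_set C (terms P n) N"

text \<open>\<open>Ext\<^sup>n(M, N)\<close>, computed from a projective resolution \<open>P\<close> of \<open>M\<close>.\<close>

definition Ext ::
  "('k, 'c) module \<Rightarrow> ('c, 'p, 'm) resolution \<Rightarrow> nat \<Rightarrow> ('c, 'n) module \<Rightarrow>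
    ('k, ('p \<Rightarrow> 'n) set) module"
  where "Ext C P n N =
    quotient_module ((hom_space C (terms P n) N)\<lparr>carrier := cocycles C P n N\<rparr>) (coboundaries C P n N)"

text \<open>The map of \<open>Ext\<^sup>n(M, N)\<close> induced by an endomorphism \<open>\<psi>\<close> of \<open>N\<close> is \<open>[f] \<mapsto> [\<psi> \<circ> f]\<close>.\<close>

definition Ext_covariant ::
  "('k, 'c) module \<Rightarrow> ('c, 'p, 'm) resolution \<Rightarrow> nat \<Rightarrow> ('c, 'n) module \<Rightarrow> ('n \<Rightarrow> 'n) \<Rightarrow>
    ('p \<Rightarrow> 'n) set \<Rightarrow> ('p \<Rightarrow> 'n) set"
  where "Ext_covariant C P n N \<psi> S =
    (\<Union>f\<in>S. coboundaries C P n N +>\<^bsub>hom_space C (terms P n) N\<^esub>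
      compose (carrier (terms P n)) \<psi> f)"

definition chain_lifts ::
  "('k, 'c) module \<Rightarrow> ('c, 'p, 'm) resolution \<Rightarrow> ('m \<Rightarrow> 'm) \<Rightarrow> (nat \<Rightarrow> 'p \<Rightarrow> 'p) set"
  where "chain_lifts C P \<phi> = {l. (\<forall>n. l n \<in> mod_hom_set C (terms P n) (terms P n)) \<and>
    (\<forall>p\<in>carrier (terms P 0). augmentation P (l 0 p) = \<phi> (augmentation P p)) \<and>
    (\<forall>n. \<forall>p\<in>carrier (terms P (Suc n)). boundary P n (l (Suc n) p) = l n (boundary P n p))}"

text \<open>The map of \<open>Ext\<^sup>n(M, N)\<close> induced by an endomorphism \<open>\<phi>\<close> of \<open>M\<close> is \<open>[f] \<mapsto> [f \<circ> l\<^sub>n]\<close>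
  for any lift \<open>l\<close> of \<open>\<phi>\<close> to the resolution. All lifts give the same class, so the union over
  all of them is that class.\<close>

definition Ext_contravariant ::
  "('k, 'c) module \<Rightarrow> ('c, 'p, 'm) resolution \<Rightarrow> nat \<Rightarrow> ('c, 'n) module \<Rightarrow> ('m \<Rightarrow> 'm) \<Rightarrow>
    ('p \<Rightarrow> 'n) set \<Rightarrow> ('p \<Rightarrow> 'n) set"
  where "Ext_contravariant C P n N \<phi> S =
    (\<Union>f\<in>S. \<Union>l\<in>chain_lifts C P \<phi>. coboundaries C P n N +>\<^bsub>hom_space C (terms P n) N\<^esub>
      compose (carrier (terms P n)) f (l n))"


section \<open>Relation-extensions\<close>

definition trivial_extension ::
  "('k, 'c) module \<Rightarrow> ('k, 'e) module \<Rightarrow> ('c \<Rightarrow> 'e \<Rightarrow> 'e) \<Rightarrow> ('e \<Rightarrow> 'c \<Rightarrow> 'e) \<Rightarrow>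
    ('k, 'c \<times> 'e) module"
  where "trivial_extension C M lact ract = \<lparr>carrier = carrier C \<times> carrier M,
    mult = (\<lambda>(c, m) (c', m'). (c \<otimes>\<^bsub>C\<^esub> c', lact c m' \<oplus>\<^bsub>M\<^esub> ract m c')),
    one = (\<one>\<^bsub>C\<^esub>, \<zero>\<^bsub>M\<^esub>), zero = (\<zero>\<^bsub>C\<^esub>, \<zero>\<^bsub>M\<^esub>),
    add = (\<lambda>(c, m) (c', m'). (c \<oplus>\<^bsub>C\<^esub> c', m \<oplus>\<^bsub>M\<^esub> m')),
    smult = (\<lambda>a (c, m). (a \<odot>\<^bsub>C\<^esub> c, a \<odot>\<^bsub>M\<^esub> m))\<rparr>"

text \<open>Here \<open>P\<close> is a projective resolution of \<^term>\<open>dual_module K C\<close>, so that the second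
  component is \<open>Ext\<^sup>2(D C, C)\<close>, with left action induced by left multiplication on \<open>C\<close> and right
  action induced by the left action on \<open>D C\<close>.\<close>

definition relation_extension ::
  "('k, 'c) module \<Rightarrow> ('c, 'p, 'c \<Rightarrow> 'k) resolution \<Rightarrow> ('k, 'c \<times> ('p \<Rightarrow> 'c) set) module"
  where "relation_extension C P = trivial_extension C (Ext C P 2 (regular_module C))
    (\<lambda>c. Ext_covariant C P 2 (regular_module C) (\<lambda>a\<in>carrier C. c \<otimes>\<^bsub>C\<^esub> a))
    (\<lambda>S c. Ext_contravariant C P 2 (regular_module C) (dual_left_action C c) S)"


section \<open>The quiver of a basic algebra\<close>

definition orthogonal_idempotents :: "('k, 'a) module \<Rightarrow> 'a \<Rightarrow> 'a \<Rightarrow> bool"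
  where "orthogonal_idempotents A f g \<longleftrightarrow> f \<in> carrier A \<and> g \<in> carrier A \<and>
    f \<otimes>\<^bsub>A\<^esub> f = f \<and> g \<otimes>\<^bsub>A\<^esub> g = g \<and> f \<otimes>\<^bsub>A\<^esub> g = \<zero>\<^bsub>A\<^esub> \<and> g \<otimes>\<^bsub>A\<^esub> f = \<zero>\<^bsub>A\<^esub>"

definition primitive_idempotent :: "('k, 'a) module \<Rightarrow> 'a \<Rightarrow> bool"
  where "primitive_idempotent A e \<longleftrightarrow> e \<in> carrier A \<and> e \<noteq> \<zero>\<^bsub>A\<^esub> \<and> e \<otimes>\<^bsub>A\<^esub> e = e \<and>
    (\<forall>f g. orthogonal_idempotents A f g \<and> e = f \<oplus>\<^bsub>A\<^esub> g \<longrightarrow> f = \<zero>\<^bsub>A\<^esub> \<or> g = \<zero>\<^bsub>A\<^esub>)"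

definition complete_primitive_orthogonal ::
  "('k, 'a) module \<Rightarrow> 'i set \<Rightarrow> ('i \<Rightarrow> 'a) \<Rightarrow> bool"
  where "complete_primitive_orthogonal A V e \<longleftrightarrow> finite V \<and>
    (\<forall>x\<in>V. primitive_idempotent A (e x)) \<and>
    (\<forall>x\<in>V. \<forall>y\<in>V. x \<noteq> y \<longrightarrow> orthogonal_idempotents A (e x) (e y)) \<and>
    finsum A e V = \<one>\<^bsub>A\<^esub>"

definition corner_module :: "('k, 'a) module \<Rightarrow> 'a \<Rightarrow> ('a, 'a) module"
  where "corner_module A e = (regular_module A)\<lparr>carrier := (\<lambda>a. e \<otimes>\<^bsub>A\<^esub> a) ` carrier A\<rparr>"

definition basic_algebra :: "('k, 'a) module \<Rightarrow> bool"
  where "basic_algebra A \<longleftrightarrow> (\<exists>S. complete_primitive_orthogonal A S (\<lambda>e. e) \<and>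
    (\<forall>e\<in>S. \<forall>f\<in>S. e \<noteq> f \<longrightarrow> \<not> mod_iso A (corner_module A e) (corner_module A f)))"

definition arrows :: "('v, 'a) pre_digraph \<Rightarrow> 'v \<Rightarrow> 'v \<Rightarrow> 'a set"
  where "arrows Q x y = {a \<in> arcs Q. tail Q a = x \<and> head Q a = y}"

text \<open>The subspace \<open>e (rad A / rad\<^sup>2 A) f\<close> of \<open>A / rad\<^sup>2 A\<close>.\<close>

definition arrow_space :: "('k, 'a) module \<Rightarrow> 'a \<Rightarrow> 'a \<Rightarrow> ('k, 'a set) module"
  where "arrow_space A e f = (quotient_module A (ideal_power A (radical A) 2))
    \<lparr>carrier := {ideal_power A (radical A) 2 +>\<^bsub>A\<^esub> (e \<otimes>\<^bsub>A\<^esub> r \<otimes>\<^bsub>A\<^esub> f) | r. r \<in> radical A}\<rparr>"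

text \<open>\<open>Q\<close> is the quiver of the basic finite-dimensional algebra \<open>A\<close>, the point \<open>x\<close>
  corresponding to the primitive idempotent \<open>e x\<close>.\<close>

definition is_quiver_of ::
  "'k ring \<Rightarrow> ('k, 'a) module \<Rightarrow> ('v, 'b) pre_digraph \<Rightarrow> ('v \<Rightarrow> 'a) \<Rightarrow> bool"
  where "is_quiver_of K A Q e \<longleftrightarrow>
    kalgebra K A \<and> vectorspace.fin_dim K A \<and> basic_algebra A \<and>
    fin_digraph Q \<and> complete_primitive_orthogonal A (verts Q) e \<and>
    (\<forall>x\<in>verts Q. \<forall>y\<in>verts Q.
      card (arrows Q x y) = vectorspace.dim K (arrow_space A (e x) (e y)))"

text \<open>The quiver with the same points as \<open>Q\<close>, and with \<open>n x y\<close> new arrows from \<open>x\<close> to \<open>y\<close> in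
  addition to those of \<open>Q\<close>.\<close>

definition add_arrows ::
  "('v, 'a) pre_digraph \<Rightarrow> ('v \<Rightarrow> 'v \<Rightarrow> nat) \<Rightarrow> ('v, 'a + 'v \<times> 'v \<times> nat) pre_digraph"
  where "add_arrows Q n = \<lparr>verts = verts Q,
    arcs = Inl ` arcs Q \<union> {Inr (x, y, i) | x y i. x \<in> verts Q \<and> y \<in> verts Q \<and> i < n x y},
    tail = case_sum (tail Q) (\<lambda>(x, y, i). x),
    head = case_sum (head Q) (\<lambda>(x, y, i). y)\<rparr>"


section \<open>Path algebras and relations\<close>

text \<open>A path is a pair of its source and its list of arrows, so that \<open>(x, [])\<close> is the trivial path
  at \<open>x\<close>. Elements of the path algebra are finitely supported families of coefficients.\<close>

type_synonym ('v, 'a) path = "'v \<times> 'a list"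

definition paths :: "('v, 'a) pre_digraph \<Rightarrow> ('v, 'a) path set"
  where "paths Q = {(x, p). \<exists>y. pre_digraph.awalk Q x p y}"

definition acyclic_quiver :: "('v, 'a) pre_digraph \<Rightarrow> bool"
  where "acyclic_quiver Q \<longleftrightarrow> \<not> (\<exists>x p. p \<noteq> [] \<and> pre_digraph.awalk Q x p x)"

text \<open>The product of two paths is \<open>p\<close> followed by \<open>q\<close>; the coefficient of a product at a path is
  accordingly the sum over all ways of cutting that path in two.\<close>

definition path_algebra ::
  "'k ring \<Rightarrow> ('v, 'a) pre_digraph \<Rightarrow> ('k, ('v, 'a) path \<Rightarrow> 'k) module"
  where "path_algebra K Q = \<lparr>
    carrier = {f. (\<forall>w. f w \<in> carrier K) \<and> finite {w. f w \<noteq> \<zero>\<^bsub>K\<^esub>} \<and>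
      (\<forall>w. w \<notin> paths Q \<longrightarrow> f w = \<zero>\<^bsub>K\<^esub>)},
    mult = (\<lambda>f g. \<lambda>(x, p). \<Oplus>\<^bsub>K\<^esub>i\<in>{..length p}.
      f (x, take i p) \<otimes>\<^bsub>K\<^esub> g (last (pre_digraph.awalk_verts Q x (take i p)), drop i p)),
    one = (\<lambda>(x, p). if x \<in> verts Q \<and> p = [] then \<one>\<^bsub>K\<^esub> else \<zero>\<^bsub>K\<^esub>),
    zero = (\<lambda>w. \<zero>\<^bsub>K\<^esub>),
    add = (\<lambda>f g w. f w \<oplus>\<^bsub>K\<^esub> g w),
    smult = (\<lambda>a f w. a \<otimes>\<^bsub>K\<^esub> f w)\<rparr>"

definition path_element :: "'k ring \<Rightarrow> ('v, 'a) path \<Rightarrow> ('v, 'a) path \<Rightarrow> 'k"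
  where "path_element K w = (\<lambda>w'. if w' = w then \<one>\<^bsub>K\<^esub> else \<zero>\<^bsub>K\<^esub>)"

abbreviation vertex_idempotent :: "'k ring \<Rightarrow> 'v \<Rightarrow> ('v, 'a) path \<Rightarrow> 'k"
  where "vertex_idempotent K x \<equiv> path_element K (x, [])"

definition arrow_ideal ::
  "'k ring \<Rightarrow> ('v, 'a) pre_digraph \<Rightarrow> (('v, 'a) path \<Rightarrow> 'k) set"
  where "arrow_ideal K Q =
    genideal (path_algebra K Q) {path_element K (tail Q a, [a]) | a. a \<in> arcs Q}"

definition admissible_ideal ::
  "'k ring \<Rightarrow> ('v, 'a) pre_digraph \<Rightarrow> (('v, 'a) path \<Rightarrow> 'k) set \<Rightarrow> bool"
  where "admissible_ideal K Q I \<longleftrightarrow> ideal I (path_algebra K Q) \<and>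
    I \<subseteq> ideal_power (path_algebra K Q) (arrow_ideal K Q) 2 \<and>
    (\<exists>m\<ge>2. ideal_power (path_algebra K Q) (arrow_ideal K Q) m \<subseteq> I)"

text \<open>The set \<open>e\<^sub>x I e\<^sub>y\<close>.\<close>

definition corner ::
  "'k ring \<Rightarrow> ('v, 'a) pre_digraph \<Rightarrow> 'v \<Rightarrow> (('v, 'a) path \<Rightarrow> 'k) set \<Rightarrow> 'v \<Rightarrow>
    (('v, 'a) path \<Rightarrow> 'k) set"
  where "corner K Q x I y =
    (\<lambda>f. vertex_idempotent K x \<otimes>\<^bsub>path_algebra K Q\<^esub> f \<otimes>\<^bsub>path_algebra K Q\<^esub> vertex_idempotent K y) ` I"

definition system_of_relations ::
  "'k ring \<Rightarrow> ('v, 'a) pre_digraph \<Rightarrow> (('v, 'a) path \<Rightarrow> 'k) set \<Rightarrow>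
    (('v, 'a) path \<Rightarrow> 'k) set \<Rightarrow> bool"
  where "system_of_relations K Q I R \<longleftrightarrow>
    R \<subseteq> (\<Union>x\<in>verts Q. \<Union>y\<in>verts Q. corner K Q x I y) \<and>
    genideal (path_algebra K Q) R = I \<and>
    (\<forall>R'. R' \<subset> R \<longrightarrow> genideal (path_algebra K Q) R' \<noteq> I)"

end

theory Submission
  imports Defs
begin
text \<open>The relations and the arrows index the second and first terms of the minimal resolution of the
 top of \<open>C\<close>. Replacing \<open>e_y C\<close> by spaces of endomaps of \<open>C\<close> yields a resolution of \<open>DC\<close> whose
 terms are indexed in the same way. Since it is functorial in \<open>DC\<close>, it computes the bimodule
 \<open>Ext\<^sup>2(DC, C)\<close>, which is generated by one class for each relation \<open>r\<close>. Coefficient functionals that vanish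
 on products with the radical show that these classes are a basis of the top of the bimodule, and the
 arrows of a trivial extension are those of \<open>C\<close> plus such a basis.\<close>

\<comment> \<open>A minimal resolution of \<open>DC\<close> carries the left action of
  \<open>C\<close> only up to homotopy. The one used here carries it strictly: it is
  \<open>DC\<close> tensored over \<open>C\<close> with the start of a bimodule resolution of
  \<open>C\<close>, whose terms are sums of \<open>C s\<close> tensor \<open>t C\<close>. As
  \<open>DC\<close> tensored with \<open>C s\<close> is the dual of \<open>s C\<close>, each summand
  becomes \<open>Hom_k(s C, t C)\<close>; the augmentation becomes a trace, and the left action
  becomes precomposition with right multiplications, which commutes with all differentials.
  Acyclicity supplies a numbering of the points that drops along arrows. On the highest layer the
  differentials reduce to those of the minimal resolution of the top of \<open>C\<close>, and
  exactness is transferred layer by layer. The bound on the global dimension speaks of modules with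
  elements in \<open>nat => 'k\<close>. It is applied to the top of \<open>C\<close>, modelled on
  such functions, and reaches \<open>DC\<close> through the same layers. The given resolution
  \<open>P\<close> of \<open>DC\<close> is arbitrary and is linked to the concrete complex by
  comparison maps in both directions.\<close>
syntax (input) "_index" :: "logic => index" ("\<^sub>_" [1000] 1000)
section \<open>Right modules and comparison of resolutions\<close>

context right_module
begin
lemma act_zero: "c : carrier C ==> c \<odot>\<^sub>M \<zero>\<^sub>M = \<zero>\<^sub>M"
 using act_add_right[of c "\<zero>\<^sub>M" "\<zero>\<^sub>M"] act_closed[of c "\<zero>\<^sub>M"]
 by (metis M.add.l_cancel_one' M.add.one_closed M.l_zero)

lemma zero_act: "m : carrier M ==> \<zero>\<^sub>C \<odot>\<^sub>M m = \<zero>\<^sub>M"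
 using act_add_left[of "\<zero>\<^sub>C" "\<zero>\<^sub>C" m] act_closed[of "\<zero>\<^sub>C" m]
 by (metis M.add.l_cancel_one' C.add.one_closed C.l_zero)

lemma act_neg: "c : carrier C ==> m : carrier M ==> c \<odot>\<^sub>M (\<ominus>\<^sub>M m) = \<ominus>\<^sub>M (c \<odot>\<^sub>M m)"
 using act_add_right[of c "\<ominus>\<^sub>M m" m] by (simp add: M.l_neg act_zero act_closed M.minus_equality)

lemma act_finsum: "[|finite S; c : carrier C; g : S \<rightarrow> carrier M|] ==>
 c \<odot>\<^sub>M finsum M g S = (\<Oplus>\<^sub>M i\<in>S. c \<odot>\<^sub>M g i)"
proof (induction S rule: finite_induct)
 case empty thus ?case by (simp add: act_zero)
next
 case (insert x F)
 hence "g x : carrier M" "g : F \<rightarrow> carrier M" by auto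
 with insert show ?case by (simp add: act_closed act_add_right Pi_def)
qed

end

lemma mod_homI:
 assumes "f : extensional (carrier M)" and "!!x. x : carrier M ==> f x : carrier N"
 and "!!x y. [|x : carrier M; y : carrier M|] ==> f (x \<oplus>\<^sub>M y) = f x \<oplus>\<^sub>N f y"
 and "!!c x. [|c : carrier C; x : carrier M|] ==> f (c \<odot>\<^sub>M x) = c \<odot>\<^sub>N f x" shows "f : mod_hom_set C M N"
 using assms by (auto simp: mod_hom_set_def LinearCombinations.module_hom_def)

lemma mod_hom_restrictI:
 assumes "right_module C M" and "!!x. x : carrier M ==> f x : carrier N"
 and "!!x y. [|x : carrier M; y : carrier M|] ==> f (x \<oplus>\<^sub>M y) = f x \<oplus>\<^sub>N f y"
 and "!!c x. [|c : carrier C; x : carrier M|] ==> f (c \<odot>\<^sub>M x) = c \<odot>\<^sub>N f x"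
 shows "restrict f (carrier M) : mod_hom_set C M N"
proof -
 interpret M: right_module C M by fact
 show ?thesis using assms by (intro mod_homI) (auto simp: M.act_closed)
qed

lemma
 assumes "f : mod_hom_set C M N" shows mod_hom_closed: "x : carrier M ==> f x : carrier N"
 and mod_hom_add: "[|x : carrier M; y : carrier M|] ==> f (x \<oplus>\<^sub>M y) = f x \<oplus>\<^sub>N f y"
 and mod_hom_act: "[|c : carrier C; x : carrier M|] ==> f (c \<odot>\<^sub>M x) = c \<odot>\<^sub>N f x"
 and mod_hom_ext: "f : extensional (carrier M)" using assms by (auto simp: mod_hom_set_def LinearCombinations.module_hom_def)


lemma
 assumes "right_module C M" "right_module C N" and f: "f : mod_hom_set C M N" shows mod_hom_zero: "f \<zero>\<^sub>M = \<zero>\<^sub>N"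
 and mod_hom_neg: "x : carrier M ==> f (\<ominus>\<^sub>M x) = \<ominus>\<^sub>N f x"
 and mod_hom_minus: "[|x : carrier M; y : carrier M|] ==> f (x \<ominus>\<^sub>M y) = f x \<ominus>\<^sub>N f y"
 and mod_hom_finsum: "[|finite S; g : S \<rightarrow> carrier M|] ==>
 f (finsum M g S) = (\<Oplus>\<^sub>N i\<in>S. f (g i))"
proof -
 interpret M: right_module C M by fact
 interpret N: right_module C N by fact
 show z: "f \<zero>\<^sub>M = \<zero>\<^sub>N"
 using mod_hom_add[OF f, of "\<zero>\<^sub>M" "\<zero>\<^sub>M"] mod_hom_closed[OF f, of "\<zero>\<^sub>M"]
 by (metis M.M.add.one_closed M.M.l_zero N.M.add.l_cancel_one')
 show n: "f (\<ominus>\<^sub>M x) = \<ominus>\<^sub>N f x" if x: "x : carrier M" for x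
 using mod_hom_add[OF f, of "\<ominus>\<^sub>M x" x] mod_hom_closed[OF f] x by (simp add: M.M.l_neg z N.M.minus_equality)
 show "f (x \<ominus>\<^sub>M y) = f x \<ominus>\<^sub>N f y" if "x : carrier M" "y : carrier M"
 using that by (simp add: a_minus_def mod_hom_add[OF f] n)
 show "[|finite S; g : S \<rightarrow> carrier M|] ==> f (finsum M g S) = (\<Oplus>\<^sub>N i\<in>S. f (g i))"
 proof (induction S rule: finite_induct)
 case empty thus ?case by (simp add: z)
 next
 case (insert x F)
 hence "g x : carrier M" "g : F \<rightarrow> carrier M" by auto
 with insert show ?case using mod_hom_closed[OF f] by (simp add: mod_hom_add[OF f] Pi_def)
 qed
qed

lemma mod_hom_compose:
 assumes "right_module C M" "f : mod_hom_set C M N" "g : mod_hom_set C N L" shows "compose (carrier M) g f : mod_hom_set C M L"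
proof -
 interpret M: right_module C M by fact
 show ?thesis using assms(2,3) by (intro mod_homI)
 (auto simp: compose_eq mod_hom_add mod_hom_act mod_hom_closed M.act_closed)
qed

lemma mod_hom_sub:
 assumes "right_module C M" "right_module C N" and f: "f : mod_hom_set C M N" and g: "g : mod_hom_set C M N"
 shows "(\<lambda>x\<in>carrier M. f x \<ominus>\<^sub>N g x) : mod_hom_set C M N"
proof -
 interpret M: right_module C M by fact
 interpret N: right_module C N by fact
 note c = mod_hom_closed[OF f] mod_hom_closed[OF g]
 show ?thesis
 proof (rule mod_hom_restrictI[OF assms(1)])
 fix x y assume "x : carrier M" "y : carrier M"
 thus "f (x \<oplus>\<^sub>M y) \<ominus>\<^sub>N g (x \<oplus>\<^sub>M y) = f x \<ominus>\<^sub>N g x \<oplus>\<^sub>N (f y \<ominus>\<^sub>N g y)"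
 using c by (simp add: mod_hom_add[OF f] mod_hom_add[OF g] a_minus_def N.M.minus_add N.M.a_ac)
 next
 fix d x assume "d : carrier C" "x : carrier M"
 thus "f (d \<odot>\<^sub>M x) \<ominus>\<^sub>N g (d \<odot>\<^sub>M x) = d \<odot>\<^sub>N (f x \<ominus>\<^sub>N g x)"
 using c by (simp add: mod_hom_act[OF f] mod_hom_act[OF g] a_minus_def N.act_add_right N.act_neg)
 qed (use c in auto)
qed

lemma mod_hom_id: "right_module C M ==> (\<lambda>x\<in>carrier M. x) : mod_hom_set C M M" by (rule mod_hom_restrictI) auto

section \<open>The regular module and projectivity through dual bases\<close>

lemma regular_module_simps [simp]:
 "carrier (regular_module C) = carrier C" "\<zero>\<^bsub>regular_module C\<^esub> = \<zero>\<^sub>C"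
 "x \<oplus>\<^bsub>regular_module C\<^esub> y = x \<oplus>\<^sub>C y" "c \<odot>\<^bsub>regular_module C\<^esub> x = x \<otimes>\<^sub>C c"
 by (simp_all add: regular_module_def)

lemma abelian_group_regular: "ring C ==> abelian_group (regular_module C)"
proof -
 assume "ring C"
 then interpret ring C .
 show ?thesis by (rule abelian_groupI) (auto intro: a_assoc a_comm l_neg)
qed

lemma right_module_regular: "ring C ==> right_module C (regular_module C)"
proof -
 assume r: "ring C"
 then interpret ring C .
 show ?thesis by (intro right_module.intro abelian_group_regular right_module_axioms.intro r)
 (auto simp: l_distr r_distr m_assoc)
qed

lemma finsum_regular: "ring C ==> finsum (regular_module C) f S = finsum C f S" by (simp add: finsum_def finprod_def regular_module_def)
text \<open>The dual basis form of finitely generated projectivity, with \<open>c \<odot> m\<close>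
  standing for \<open>m c\<close>. It can be verified directly for the function modules below and is
  what the lifting arguments consume. The index set is an initial segment of the naturals because a
  definition cannot quantify over an index type.\<close>

definition has_dual_basis :: "('k, 'c) module => ('c, 'm) module => bool"
 where "has_dual_basis C L \<longleftrightarrow> right_module C L & (EX n g f.
 (\<forall>i<n::nat. g i : carrier L & f i : mod_hom_set C L (regular_module C)) \<and>
 (ALL x:carrier L. x = (\<Oplus>\<^sub>L i\<in>{..<n}. f i x \<odot>\<^sub>L g i)))"

lemma has_dual_basisI:
 fixes S :: "'i set"
 assumes L: "right_module C L" and fin: "finite S" and g: "!!i. i : S ==> g i : carrier L"
 and f: "!!i. i : S ==> f i : mod_hom_set C L (regular_module C)"
 and b: "!!x. x : carrier L ==> x = (\<Oplus>\<^sub>L i\<in>S. f i x \<odot>\<^sub>L g i)" shows "has_dual_basis C L"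
proof -
 interpret L: right_module C L by fact
 obtain h where h: "bij_betw h {..<card S} S" using ex_bij_betw_nat_finite[OF fin] by (auto simp: atLeast0LessThan)
 have hS: "h i : S" if "i < card S" for i using h that by (auto simp: bij_betw_def)
 have "x = (\<Oplus>\<^sub>L i\<in>{..<card S}. f (h i) x \<odot>\<^sub>L g (h i))" if x: "x : carrier L" for x
 proof -
 have "(%i. f i x \<odot>\<^sub>L g i) : h ` {..<card S} \<rightarrow> carrier L"
 using h mod_hom_closed[OF f] g x by (auto simp: bij_betw_def intro!: L.act_closed)
 from L.M.finsum_reindex[OF this] b[OF x, symmetric] h show ?thesis by (simp add: bij_betw_def)
 qed
 thus ?thesis unfolding has_dual_basis_def using L hS g f by (intro conjI exI[of _ "card S"] exI[of _ "%i. g (h i)"] exI[of _ "%i. f (h i)"]) blast+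
qed

text \<open>Preimages \<open>y i\<close> of \<open>\<phi> (g i)\<close> determine the lift, which
  sends \<open>x\<close> to the sum of the \<open>y i\<close> acted on by \<open>f i x\<close>.
  Instead of surjectivity of \<open>d\<close> it is asked that the image of \<open>\<phi>\<close>
  lie in that of \<open>d\<close>, the form suited to lifting into kernels.\<close>

lemma has_dual_basis_lift:
 assumes L: "has_dual_basis C L" and Y: "right_module C Y" and Z: "right_module C Z" and \<phi>: "\<phi> : mod_hom_set C L Z" and d: "d : mod_hom_set C Y Z"
 and sub: "!!x. x : carrier L ==> \<phi> x : d ` carrier Y"
 obtains \<psi> where "\<psi> : mod_hom_set C L Y" "!!x. x : carrier L ==> d (\<psi> x) = \<phi> x"
proof -
 interpret Y: right_module C Y by fact
 interpret Z: right_module C Z by fact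
 from L have XM: "right_module C L" by (simp add: has_dual_basis_def)
 from L obtain n g f where *: "\<forall>i<n::nat. g i : carrier L & f i : mod_hom_set C L (regular_module C)"
 and b: "ALL x:carrier L. x = (\<Oplus>\<^sub>L i\<in>{..<n}. f i x \<odot>\<^sub>L g i)" unfolding has_dual_basis_def by blast
 from * have g: "!!i. i < n ==> g i : carrier L" and f: "!!i. i < n ==> f i : mod_hom_set C L (regular_module C)" by auto
 interpret L: right_module C L by fact
 have "EX y. y : carrier Y & d y = \<phi> (g i)" if "i < n" for i using sub[OF g[OF that]] by (auto simp: image_iff)
 then obtain y where y: "!!i. i < n ==> y i : carrier Y" "!!i. i < n ==> d (y i) = \<phi> (g i)" by metis
 have fc: "f i x : carrier C" if "i < n" "x : carrier L" for i x using mod_hom_closed[OF f[OF that(1)] that(2)] by simp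
 define \<psi> where "\<psi> = (\<lambda>x\<in>carrier L. \<Oplus>\<^sub>Y i\<in>{..<n}. f i x \<odot>\<^sub>Y y i)"
 have fy: "(%i. f i x \<odot>\<^sub>Y y i) : {..<n} \<rightarrow> carrier Y" if "x : carrier L" for x
 using that y fc by (auto intro!: Y.act_closed)
 have "\<psi> : mod_hom_set C L Y" unfolding \<psi>_def
 proof (rule mod_hom_restrictI[OF XM])
 show "(\<Oplus>\<^sub>Y i\<in>{..<n}. f i x \<odot>\<^sub>Y y i) : carrier Y" if "x : carrier L" for x
 using fy[OF that] by (rule Y.M.finsum_closed)
 next
 fix x x' assume x: "x : carrier L" "x' : carrier L"
 have "(\<Oplus>\<^sub>Y i\<in>{..<n}. f i (x \<oplus>\<^sub>L x') \<odot>\<^sub>Y y i)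
 = (\<Oplus>\<^sub>Y i\<in>{..<n}. f i x \<odot>\<^sub>Y y i \<oplus>\<^sub>Y f i x' \<odot>\<^sub>Y y i)"
 using x fc y by (intro Y.M.finsum_cong') (auto simp: mod_hom_add[OF f] Y.act_add_left Y.act_closed)
 thus "(\<Oplus>\<^sub>Y i\<in>{..<n}. f i (x \<oplus>\<^sub>L x') \<odot>\<^sub>Y y i)
 = (\<Oplus>\<^sub>Y i\<in>{..<n}. f i x \<odot>\<^sub>Y y i) \<oplus>\<^sub>Y (\<Oplus>\<^sub>Y i\<in>{..<n}. f i x' \<odot>\<^sub>Y y i)"
 using Y.M.finsum_addf[OF fy[OF x(1)] fy[OF x(2)]] by simp
 next
 fix c x assume x: "c : carrier C" "x : carrier L"
 have "(\<Oplus>\<^sub>Y i\<in>{..<n}. f i (c \<odot>\<^sub>L x) \<odot>\<^sub>Y y i)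
 = (\<Oplus>\<^sub>Y i\<in>{..<n}. c \<odot>\<^sub>Y (f i x \<odot>\<^sub>Y y i))"
 using x fc y by (intro Y.M.finsum_cong') (auto simp: mod_hom_act[OF f] Y.act_mult Y.act_closed)
 thus "(\<Oplus>\<^sub>Y i\<in>{..<n}. f i (c \<odot>\<^sub>L x) \<odot>\<^sub>Y y i) = c \<odot>\<^sub>Y (\<Oplus>\<^sub>Y i\<in>{..<n}. f i x \<odot>\<^sub>Y y i)"
 using Y.act_finsum[OF _ x(1) fy[OF x(2)]] by simp
 qed
 moreover have "d (\<psi> x) = \<phi> x" if x: "x : carrier L" for x
 proof -
 have "d (\<psi> x) = (\<Oplus>\<^sub>Z i\<in>{..<n}. d (f i x \<odot>\<^sub>Y y i))"
 unfolding \<psi>_def using x fy[OF x] by (simp add: mod_hom_finsum[OF Y Z d])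
 also have "... = (\<Oplus>\<^sub>Z i\<in>{..<n}. \<phi> (f i x \<odot>\<^sub>L g i))" using x fc y g mod_hom_closed[OF \<phi>] 
 by (intro Z.M.finsum_cong') (auto simp: mod_hom_act[OF d] mod_hom_act[OF \<phi>] Z.act_closed)
 also have "... = \<phi> (\<Oplus>\<^sub>L i\<in>{..<n}. f i x \<odot>\<^sub>L g i)"
 using x fc g by (intro mod_hom_finsum[OF XM Z \<phi>, symmetric]) (auto intro!: L.act_closed)
 also have "(\<Oplus>\<^sub>L i\<in>{..<n}. f i x \<odot>\<^sub>L g i) = x" using b x by metis
 finally show ?thesis .
 qed
 ultimately show thesis by (rule that)
qed

lemma has_dual_basis_right_module: "has_dual_basis C L ==> right_module C L" by (simp add: has_dual_basis_def)

lemma has_dual_basis_regular: assumes "ring C" shows "has_dual_basis C (regular_module C)"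
proof -
 interpret R: ring C by fact
 interpret L: right_module C "regular_module C" by (rule right_module_regular[OF assms])
 show ?thesis
 proof (rule has_dual_basisI[where S = "{()}" and g = "%_. \<one>\<^sub>C" and f = "%_. \<lambda>x\<in>carrier C. x"])
 show "(\<lambda>x\<in>carrier C. x) : mod_hom_set C (regular_module C) (regular_module C)" using mod_hom_id[OF L.right_module_axioms] by simp
 qed (auto simp: L.right_module_axioms finsum_regular[OF assms] R.finsum_insert)
qed
subsection \<open>Coordinatewise right modules\<close>
text \<open>Free modules, sums of right ideals \<open>t j C\<close>, and families of linear maps are
  all instances: only the carrier \<open>U\<close> changes, so the module axioms and the formula for
  finite sums are proved once.\<close>

definition fun_module :: "('k, 'c) module => 'j set => ('j => 'c) set => ('c, 'j => 'c) module"
 where "fun_module C J U = \<lparr>carrier = U, mult = undefined, one = undefined,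
 zero = (\<lambda>i\<in>J. \<zero>\<^sub>C), add = (%u v. \<lambda>i\<in>J. u i \<oplus>\<^sub>C v i),
 smult = (%c u. \<lambda>i\<in>J. u i \<otimes>\<^sub>C c)\<rparr>"

lemma fun_module_simps [simp]:
 "carrier (fun_module C J U) = U" "\<zero>\<^bsub>fun_module C J U\<^esub> = (\<lambda>i\<in>J. \<zero>\<^sub>C)"
 "u \<oplus>\<^bsub>fun_module C J U\<^esub> v = (\<lambda>i\<in>J. u i \<oplus>\<^sub>C v i)"
 "c \<odot>\<^bsub>fun_module C J U\<^esub> u = (\<lambda>i\<in>J. u i \<otimes>\<^sub>C c)" by (simp_all add: fun_module_def)

lemma right_module_fun_module:
 assumes "ring C" and sub: "U \<subseteq> J \<rightarrow>\<^sub>E carrier C" and z: "(\<lambda>i\<in>J. \<zero>\<^sub>C) : U"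
 and add: "!!u v. u : U ==> v : U ==> (\<lambda>i\<in>J. u i \<oplus>\<^sub>C v i) : U"
 and act: "!!c u. c : carrier C ==> u : U ==> (\<lambda>i\<in>J. u i \<otimes>\<^sub>C c) : U" shows "right_module C (fun_module C J U)"
proof -
 interpret ring C by fact
 have c: "u i : carrier C" if "u : U" "i : J" for u i using that sub by auto
 have e: "u = v" if "u : U" "v : U" "!!i. i : J ==> u i = v i" for u v using that sub by (meson PiE_ext subsetD)
 have neg: "(\<lambda>i\<in>J. u i \<otimes>\<^sub>C (\<ominus>\<^sub>C \<one>\<^sub>C)) : U" if "u : U" for u using act that by simp
 show ?thesis
 proof (intro right_module.intro right_module_axioms.intro)
 show "ring C" by fact
 show "abelian_group (fun_module C J U)"
 proof (rule abelian_groupI)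
 fix x assume x: "x : carrier (fun_module C J U)"
 have "(\<lambda>i\<in>J. (\<lambda>i\<in>J. \<zero>\<^sub>C) i \<oplus>\<^sub>C x i) = x" using x add[OF z] c by (intro e) auto
 thus "\<zero>\<^bsub>fun_module C J U\<^esub> \<oplus>\<^bsub>fun_module C J U\<^esub> x = x" by simp
 show "EX y:carrier (fun_module C J U). y \<oplus>\<^bsub>fun_module C J U\<^esub> x = \<zero>\<^bsub>fun_module C J U\<^esub>"
 using x neg c by (intro bexI[of _ "\<lambda>i\<in>J. x i \<otimes>\<^sub>C (\<ominus>\<^sub>C \<one>\<^sub>C)"])
 (auto simp: fun_eq_iff r_minus l_neg)
 next
 show "x \<oplus>\<^bsub>fun_module C J U\<^esub> y : carrier (fun_module C J U)"
 if "x : carrier (fun_module C J U)" "y : carrier (fun_module C J U)" for x y using that add by simp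
 show "\<zero>\<^bsub>fun_module C J U\<^esub> : carrier (fun_module C J U)" using z by simp
 qed (auto simp: fun_eq_iff a_assoc c intro: a_comm c)
 next
 fix m assume m: "m : carrier (fun_module C J U)"
 have "(\<lambda>i\<in>J. m i \<otimes>\<^sub>C \<one>\<^sub>C) = m" using m act[of "\<one>\<^sub>C"] c by (intro e) auto
 thus "\<one>\<^sub>C \<odot>\<^bsub>fun_module C J U\<^esub> m = m" by simp
 next
 show "c \<odot>\<^bsub>fun_module C J U\<^esub> m : carrier (fun_module C J U)" if "c : carrier C" "m : carrier (fun_module C J U)" for c m
 using that act by simp
 qed (auto simp: fun_eq_iff l_distr r_distr m_assoc c)
qed

lemma finsum_fun_module:
 assumes "right_module C (fun_module C J U)" "U \<subseteq> J \<rightarrow>\<^sub>E carrier C" and "finite S" "!!s. s : S ==> g s : U"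
 shows "finsum (fun_module C J U) g S = (\<lambda>j\<in>J. \<Oplus>\<^sub>C s\<in>S. g s j)" using assms(3,4)
proof (induction S rule: finite_induct)
 interpret F: right_module C "fun_module C J U" by fact
 case empty thus ?case by simp
next
 interpret F: right_module C "fun_module C J U" by fact
 case (insert x F)
 hence "g s j : carrier C" if "s : insert x F" "j : J" for s j using assms(2) that by (metis PiE_mem subsetD)
 with insert show ?case by (auto simp: fun_eq_iff Pi_def)
qed

lemma free_module_eq: "free_module C n = fun_module C {..<n} ({..<n} \<rightarrow>\<^sub>E carrier C)" by (simp add: free_module_def fun_module_def)

lemma right_module_free: "ring C ==> right_module C (free_module C n)" unfolding free_module_eq by (rule right_module_fun_module) (auto intro!: ring.ring_simprules)

text \<open>The dual basis consists of the images of the standard vectors under the retraction and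
  of the coordinates of the section.\<close>

lemma fg_projective_has_dual_basis:
 assumes "fg_projective C L" shows "has_dual_basis C L"
proof -
 from assms obtain n f g where L: "right_module C L" and f: "f : mod_hom_set C L (free_module C n)" and g: "g : mod_hom_set C (free_module C n) L"
 and gf: "!!p. p : carrier L ==> g (f p) = p" unfolding fg_projective_def by auto
 interpret L: right_module C L by fact
 define b where "b i = (\<lambda>j\<in>{..<n}. if i = j then \<one>\<^sub>C else \<zero>\<^sub>C)" for i
 have b: "b i : carrier (free_module C n)" for i by (auto simp: b_def free_module_eq)
 have fr: "right_module C (free_module C n)" by (rule right_module_free[OF L.C.ring_axioms])
 have fc: "f x i : carrier C" if "x : carrier L" "i < n" for x i using mod_hom_closed[OF f that(1)] that by (auto simp: free_module_eq)
 show ?thesis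
 proof (rule has_dual_basisI[where S = "{..<n}" and g = "%i. g (b i)" and f = "%i. \<lambda>x\<in>carrier L. f x i"])
 show "(\<lambda>x\<in>carrier L. f x i) : mod_hom_set C L (regular_module C)" if "i : {..<n}" for i using that fc by (intro mod_hom_restrictI L)
 (auto simp: mod_hom_add[OF f] mod_hom_act[OF f] free_module_eq)
 show "x = (\<Oplus>\<^sub>L i\<in>{..<n}. (\<lambda>x\<in>carrier L. f x i) x \<odot>\<^sub>L g (b i))" if x: "x : carrier L" for x
 proof -
 interpret F: right_module C "free_module C n" by fact
 have "f x = (\<Oplus>\<^bsub>free_module C n\<^esub>i\<in>{..<n}. f x i \<odot>\<^bsub>free_module C n\<^esub> b i)"
 proof -
 have "(\<Oplus>\<^bsub>free_module C n\<^esub>i\<in>{..<n}. f x i \<odot>\<^bsub>free_module C n\<^esub> b i)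
 = (\<lambda>j\<in>{..<n}. \<Oplus>\<^sub>C i\<in>{..<n}. (f x i \<odot>\<^bsub>free_module C n\<^esub> b i) j)" unfolding free_module_eq using x fc b
 by (intro finsum_fun_module F.right_module_axioms[unfolded free_module_eq]) (auto simp: b_def)
 also have "... = (\<lambda>j\<in>{..<n}. f x j)"
 proof (rule restrict_ext)
 fix j assume j: "j : {..<n}"
 have "(\<Oplus>\<^sub>C i\<in>{..<n}. (f x i \<odot>\<^bsub>free_module C n\<^esub> b i) j) = (\<Oplus>\<^sub>C i\<in>{..<n}. if j = i then f x i else \<zero>\<^sub>C)"
 using j x fc by (intro L.C.finsum_cong') (auto simp: b_def free_module_eq)
 also have "... = f x j" using j x fc by (intro L.C.finsum_singleton) auto
 finally show "(\<Oplus>\<^sub>C i\<in>{..<n}. (f x i \<odot>\<^bsub>free_module C n\<^esub> b i) j) = f x j" .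
 qed
 also have "... = f x" using mod_hom_closed[OF f x] by (auto simp: free_module_eq PiE_def extensional_restrict)
 finally show ?thesis by simp
 qed
 hence "g (f x) = (\<Oplus>\<^sub>L i\<in>{..<n}. g (f x i \<odot>\<^bsub>free_module C n\<^esub> b i))"
 using x fc b mod_hom_finsum[OF fr L g, of "{..<n}" "%i. f x i \<odot>\<^bsub>free_module C n\<^esub> b i"] by (simp add: F.act_closed)
 also have "... = (\<Oplus>\<^sub>L i\<in>{..<n}. (\<lambda>x\<in>carrier L. f x i) x \<odot>\<^sub>L g (b i))" using x fc b mod_hom_closed[OF g b]
 by (intro L.M.finsum_cong') (auto simp: mod_hom_act[OF g] L.act_closed)
 finally show ?thesis using gf[OF x] by simp
 qed
 qed (use L b mod_hom_closed[OF g] in auto)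
qed

section \<open>Comparison and homotopy for three-term complexes\<close>

definition three_term ::
 "('k, 'c) module => ('c, 'm) module => ('c, 'l0) module => ('c, 'l1) module => ('c, 'l2) module =>
 ('l0 => 'm) => ('l1 => 'l0) => ('l2 => 'l1) => bool"
 where "three_term C M L0 L1 L2 e d1 d2 \<longleftrightarrow>
 right_module C M & right_module C L0 & right_module C L1 & right_module C L2 \<and>
 e : mod_hom_set C L0 M & d1 : mod_hom_set C L1 L0 & d2 : mod_hom_set C L2 L1 \<and>
 (ALL x:carrier L1. e (d1 x) = \<zero>\<^sub>M) & (ALL x:carrier L2. d1 (d2 x) = \<zero>\<^sub>L0)"
text \<open>The kernel of \<open>d2\<close> is left free, so every projective resolution yields an
  instance by truncation.\<close>

definition exact_three ::
 "('k, 'c) module => ('c, 'm) module => ('c, 'l0) module => ('c, 'l1) module => ('c, 'l2) module =>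
 ('l0 => 'm) => ('l1 => 'l0) => ('l2 => 'l1) => bool"
 where "exact_three C M L0 L1 L2 e d1 d2 \<longleftrightarrow> three_term C M L0 L1 L2 e d1 d2 \<and>
 carrier M \<subseteq> e ` carrier L0 \<and>
 (ALL x:carrier L0. e x = \<zero>\<^sub>M --> x : d1 ` carrier L1) \<and>
 (ALL x:carrier L1. d1 x = \<zero>\<^sub>L0 --> x : d2 ` carrier L2)"

lemma has_dual_basis_lift_exact:
 assumes "has_dual_basis C L" "right_module C Y" "right_module C Z" and "d : mod_hom_set C Y Z" "\<phi> : mod_hom_set C L Z"
 and "!!z. z : carrier Z ==> d' z = w ==> z : d ` carrier Y" and "!!x. x : carrier L ==> d' (\<phi> x) = w"
 obtains \<psi> where "\<psi> : mod_hom_set C L Y" "!!x. x : carrier L ==> d (\<psi> x) = \<phi> x"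
 using has_dual_basis_lift[OF assms(1-3,5,4)] assms(6,7) mod_hom_closed[OF assms(5)] by metis

text \<open>The comparison theorem in degrees 0 to 2: each composite to be lifted dies under the
  next map of the target, hence lies in the image of the previous one. Projectivity is asked of the
  source and exactness of the target.\<close>

lemma comparison:
 assumes L: "three_term C M L0 L1 L2 e d1 d2" and pr: "has_dual_basis C L0" "has_dual_basis C L1" "has_dual_basis C L2"
 and N: "exact_three C N N0 N1 N2 e' d1' d2'" and \<phi>: "\<phi> : mod_hom_set C M N"
 obtains f0 f1 f2 where "f0 : mod_hom_set C L0 N0" "f1 : mod_hom_set C L1 N1" "f2 : mod_hom_set C L2 N2"
 and "!!x. x : carrier L0 ==> e' (f0 x) = \<phi> (e x)" and "!!x. x : carrier L1 ==> d1' (f1 x) = f0 (d1 x)"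
 and "!!x. x : carrier L2 ==> d2' (f2 x) = f1 (d2 x)"
proof -
 have l: "right_module C M" "right_module C L0" "right_module C L1" "right_module C L2"
 "e : mod_hom_set C L0 M" "d1 : mod_hom_set C L1 L0" "d2 : mod_hom_set C L2 L1"
 and le: "!!x. x : carrier L1 ==> e (d1 x) = \<zero>\<^sub>M" "!!x. x : carrier L2 ==> d1 (d2 x) = \<zero>\<^sub>L0"
 using L unfolding three_term_def by blast+
 have n: "right_module C N" "right_module C N0" "right_module C N1" "right_module C N2"
 "e' : mod_hom_set C N0 N" "d1' : mod_hom_set C N1 N0" "d2' : mod_hom_set C N2 N1"
 and ne: "carrier N \<subseteq> e' ` carrier N0" "!!x. x : carrier N0 ==> e' x = \<zero>\<^sub>N ==> x : d1' ` carrier N1"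
 "!!x. x : carrier N1 ==> d1' x = \<zero>\<^sub>N0 ==> x : d2' ` carrier N2" using N unfolding exact_three_def three_term_def by blast+
 note h0 = mod_hom_compose[OF l(2,5) \<phi>]
 obtain f0 where f0: "f0 : mod_hom_set C L0 N0"
 "!!x. x : carrier L0 ==> e' (f0 x) = compose (carrier L0) \<phi> e x" using has_dual_basis_lift[OF pr(1) n(2) n(1) h0 n(5)] ne(1) mod_hom_closed[OF h0] by blast
 hence f0': "!!x. x : carrier L0 ==> e' (f0 x) = \<phi> (e x)" by (simp add: compose_eq)
 note h1 = mod_hom_compose[OF l(3,6) f0(1)]
 have "e' (compose (carrier L1) f0 d1 x) = \<zero>\<^sub>N" if x: "x : carrier L1" for x
 using x f0'[OF mod_hom_closed[OF l(6) x]] le(1)[OF x] mod_hom_zero[OF l(1) n(1) \<phi>] by (simp add: compose_eq)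
 from has_dual_basis_lift_exact[where d' = e' and w = "\<zero>\<^sub>N", OF pr(2) n(3,2,6) h1 ne(2) this]
 obtain f1 where f1: "f1 : mod_hom_set C L1 N1"
 "!!x. x : carrier L1 ==> d1' (f1 x) = compose (carrier L1) f0 d1 x" by blast
 hence f1': "!!x. x : carrier L1 ==> d1' (f1 x) = f0 (d1 x)" by (simp add: compose_eq)
 note h2 = mod_hom_compose[OF l(4,7) f1(1)]
 have "d1' (compose (carrier L2) f1 d2 x) = \<zero>\<^sub>N0" if x: "x : carrier L2" for x
 using x f1'[OF mod_hom_closed[OF l(7) x]] le(2)[OF x] mod_hom_zero[OF l(2) n(2) f0(1)] by (simp add: compose_eq)
 from has_dual_basis_lift_exact[where d' = d1' and w = "\<zero>\<^sub>N0", OF pr(3) n(4,3,7) h2 ne(3) this]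
 obtain f2 where f2: "f2 : mod_hom_set C L2 N2"
 "!!x. x : carrier L2 ==> d2' (f2 x) = compose (carrier L2) f1 d2 x" by blast
 hence f2': "!!x. x : carrier L2 ==> d2' (f2 x) = f1 (d2 x)" by (simp add: compose_eq)
 show thesis using that f0(1) f1(1) f2(1) f0' f1' f2' by blast
qed

text \<open>With no third term at hand, the formula \<open>f2 = g2 + h d2\<close> can only hold up
  to the kernel of \<open>d2'\<close>, so the conclusion is stated after applying
  \<open>d2'\<close>. For an injective \<open>d2'\<close> it gives equality, and for a resolution it
  gives equality up to a boundary.\<close>

lemma homotopy:
 assumes L: "three_term C M L0 L1 L2 e d1 d2" and pr: "has_dual_basis C L0" "has_dual_basis C L1" and N: "exact_three C N N0 N1 N2 e' d1' d2'"
 and f: "f0 : mod_hom_set C L0 N0" "f1 : mod_hom_set C L1 N1" "f2 : mod_hom_set C L2 N2"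
 and g: "g0 : mod_hom_set C L0 N0" "g1 : mod_hom_set C L1 N1" "g2 : mod_hom_set C L2 N2" and fg: "!!x. x : carrier L0 ==> e' (f0 x) = e' (g0 x)"
 and fc: "!!x. x : carrier L1 ==> d1' (f1 x) = f0 (d1 x)" "!!x. x : carrier L2 ==> d2' (f2 x) = f1 (d2 x)"
 and gc: "!!x. x : carrier L1 ==> d1' (g1 x) = g0 (d1 x)" "!!x. x : carrier L2 ==> d2' (g2 x) = g1 (d2 x)"
 obtains h where "h : mod_hom_set C L1 N2"
 "!!x. x : carrier L2 ==> d2' (f2 x) = d2' (g2 x \<oplus>\<^sub>N2 h (d2 x))"
proof -
 have l: "right_module C M" "right_module C L0" "right_module C L1" "right_module C L2"
 "e : mod_hom_set C L0 M" "d1 : mod_hom_set C L1 L0" "d2 : mod_hom_set C L2 L1"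
 and le: "!!x. x : carrier L1 ==> e (d1 x) = \<zero>\<^sub>M" "!!x. x : carrier L2 ==> d1 (d2 x) = \<zero>\<^sub>L0"
 using L unfolding three_term_def by blast+
 have n: "right_module C N" "right_module C N0" "right_module C N1" "right_module C N2"
 "e' : mod_hom_set C N0 N" "d1' : mod_hom_set C N1 N0" "d2' : mod_hom_set C N2 N1"
 and ne: "!!x. x : carrier N0 ==> e' x = \<zero>\<^sub>N ==> x : d1' ` carrier N1"
 "!!x. x : carrier N1 ==> d1' x = \<zero>\<^sub>N0 ==> x : d2' ` carrier N2" using N unfolding exact_three_def three_term_def by blast+
 interpret N: right_module C N by fact
 interpret N0: right_module C N0 by fact
 interpret N1: right_module C N1 by fact
 interpret N2: right_module C N2 by fact
 interpret L0: right_module C L0 by fact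
 note c = mod_hom_closed[OF f(1)] mod_hom_closed[OF f(2)] mod_hom_closed[OF f(3)]
 mod_hom_closed[OF g(1)] mod_hom_closed[OF g(2)] mod_hom_closed[OF g(3)]
 mod_hom_closed[OF l(6)] mod_hom_closed[OF l(7)] mod_hom_closed[OF n(5)] mod_hom_closed[OF n(6)]
 note s0 = mod_hom_sub[OF l(2) n(2) f(1) g(1)]
 have "e' ((\<lambda>x\<in>carrier L0. f0 x \<ominus>\<^sub>N0 g0 x) x) = \<zero>\<^sub>N" if "x : carrier L0" for x
 using that fg[OF that] c by (simp add: mod_hom_minus[OF n(2,1,5)])
 from has_dual_basis_lift_exact[where d' = e' and w = "\<zero>\<^sub>N", OF pr(1) n(3,2,6) s0 ne(1) this]
 obtain h0 where h0: "h0 : mod_hom_set C L0 N1"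
 "!!x. x : carrier L0 ==> d1' (h0 x) = (\<lambda>x\<in>carrier L0. f0 x \<ominus>\<^sub>N0 g0 x) x" by blast
 hence h0': "!!x. x : carrier L0 ==> d1' (h0 x) = f0 x \<ominus>\<^sub>N0 g0 x" by simp
 note c0 = mod_hom_closed[OF h0(1)]
 \<comment> \<open>The difference \<open>f1 - g1 - h0 d1\<close> maps into the kernel of
   \<open>d1'\<close> because \<open>d1' h0 = f0 - g0\<close>; its lift is the required
   \<open>h\<close>.\<close>
 define s where "s = (\<lambda>x\<in>carrier L1. (\<lambda>x\<in>carrier L1. f1 x \<ominus>\<^sub>N1 g1 x) x \<ominus>\<^sub>N1 compose (carrier L1) h0 d1 x)"
 have s1: "s : mod_hom_set C L1 N1" unfolding s_def by (intro mod_hom_sub l n f g mod_hom_compose[OF _ l(6) h0(1)])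
 have sx: "s x = f1 x \<ominus>\<^sub>N1 g1 x \<ominus>\<^sub>N1 h0 (d1 x)" if "x : carrier L1" for x using that by (simp add: s_def compose_eq)
 have "d1' (s x) = \<zero>\<^sub>N0" if x: "x : carrier L1" for x
 proof -
 have sc: "f1 x \<ominus>\<^sub>N1 g1 x : carrier N1" using x c by (simp add: a_minus_def)
 have "d1' (s x) = (f0 (d1 x) \<ominus>\<^sub>N0 g0 (d1 x)) \<ominus>\<^sub>N0 (f0 (d1 x) \<ominus>\<^sub>N0 g0 (d1 x))"
 using x c c0 sc by (simp add: sx mod_hom_minus[OF n(3,2,6)] fc gc h0')
 thus ?thesis using x c by (simp add: N0.M.r_neg a_minus_def)
 qed
 from has_dual_basis_lift_exact[where d' = d1' and w = "\<zero>\<^sub>N0", OF pr(2) n(4,3,7) s1 ne(2) this]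
 obtain h where h: "h : mod_hom_set C L1 N2" "!!x. x : carrier L1 ==> d2' (h x) = s x" by blast
 have "d2' (f2 x) = d2' (g2 x \<oplus>\<^sub>N2 h (d2 x))" if x: "x : carrier L2" for x
 proof -
 have "d2' (g2 x \<oplus>\<^sub>N2 h (d2 x)) = g1 (d2 x) \<oplus>\<^sub>N1 s (d2 x)"
 using x c mod_hom_closed[OF h(1)] by (simp add: mod_hom_add[OF n(7)] gc h(2))
 also have "... = g1 (d2 x) \<oplus>\<^sub>N1 (f1 (d2 x) \<ominus>\<^sub>N1 g1 (d2 x))"
 using x c by (simp add: sx le mod_hom_zero[OF l(2) n(3) h0(1)] a_minus_def)
 also have "... = f1 (d2 x)" using x c by (simp add: a_minus_def N1.M.r_neg N1.M.a_lcomm)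
 finally show ?thesis using fc(2)[OF x] by simp
 qed
 with h(1) show thesis by (rule that)
qed

lemma projective_resolution_terms:
 assumes "projective_resolution C M P" shows "has_dual_basis C (terms P n)" "right_module C (terms P n)"
 "boundary P n : mod_hom_set C (terms P (Suc n)) (terms P n)"
 "augmentation P : mod_hom_set C (terms P 0) M" using assms fg_projective_has_dual_basis[of C "terms P n"]
 by (auto simp: projective_resolution_def has_dual_basis_def)

lemma projective_resolution_exact:
 assumes M: "right_module C M" and P: "projective_resolution C M P"
 shows "exact_three C M (terms P 0) (terms P 1) (terms P 2) (augmentation P) (boundary P 0) (boundary P 1)"
proof -
 note t = projective_resolution_terms[OF P]
 have e: "augmentation P ` carrier (terms P 0) = carrier M"
 "boundary P 0 ` carrier (terms P 1) = {p : carrier (terms P 0). augmentation P p = \<zero>\<^sub>M}"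
 "boundary P 1 ` carrier (terms P 2) = {p : carrier (terms P 1). boundary P 0 p = \<zero>\<^bsub>terms P 0\<^esub>}"
 using P unfolding projective_resolution_def by (auto simp: numeral_2_eq_2)
 show ?thesis unfolding exact_three_def three_term_def using M t(2)[of 0] t(2)[of 1] t(2)[of 2] t(3)[of 0] t(3)[of 1] t(4) e by (auto simp: numeral_2_eq_2)
qed

text \<open>\<open>Ext_contravariant\<close> is a union over all lifts and would be empty without
  one. A lift is an infinite family of maps, obtained by dependent choice; the invariant
  \<open>good\<close> records that each map preserves kernels, which is what the next lifting step
  needs.\<close>

lemma chain_lift_exists:
 assumes M: "right_module C M" and P: "projective_resolution C M P" and \<phi>: "\<phi> : mod_hom_set C M M" shows "chain_lifts C P \<phi> ~= {}"
proof -
 note t = projective_resolution_terms[OF P]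
 have im: "augmentation P ` carrier (terms P 0) = carrier M"
 "boundary P 0 ` carrier (terms P (Suc 0)) = {p : carrier (terms P 0). augmentation P p = \<zero>\<^sub>M}"
 "!!n. boundary P (Suc n) ` carrier (terms P (Suc (Suc n))) =
 {p : carrier (terms P (Suc n)). boundary P n p = \<zero>\<^bsub>terms P n\<^esub>}" using P unfolding projective_resolution_def by simp_all
 have ex: "carrier M \<subseteq> augmentation P ` carrier (terms P 0)"
 "!!p. p : carrier (terms P 0) ==> augmentation P p = \<zero>\<^sub>M ==> p : boundary P 0 ` carrier (terms P (Suc 0))"
 "!!n p. p : carrier (terms P (Suc n)) ==> boundary P n p = \<zero>\<^bsub>terms P n\<^esub> ==>
 p : boundary P (Suc n) ` carrier (terms P (Suc (Suc n)))"
 "!!p. p : carrier (terms P (Suc 0)) ==> augmentation P (boundary P 0 p) = \<zero>\<^sub>M"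
 "!!n p. p : carrier (terms P (Suc (Suc n))) ==> boundary P n (boundary P (Suc n) p) = \<zero>\<^bsub>terms P n\<^esub>" using im by blast+
 \<comment> \<open>\<open>ker n\<close> is the kernel of the map leaving term \<open>n\<close>;
   degree 0 is separate because the augmentation has another codomain.\<close>
 define ker where "ker n = (case n of 0 => {p : carrier (terms P 0). augmentation P p = \<zero>\<^sub>M}
 | Suc m => {p : carrier (terms P (Suc m)). boundary P m p = \<zero>\<^bsub>terms P m\<^esub>})" for n
 have ker_im: "z : boundary P n ` carrier (terms P (Suc n))" if "z : ker n" for n z using that ex(2,3) by (cases n) (auto simp: ker_def)
 have im_ker: "boundary P n p : ker n" if "p : carrier (terms P (Suc n))" for n p using that ex(4,5) mod_hom_closed[OF t(3)] by (cases n) (auto simp: ker_def)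
 define good where "good n l \<longleftrightarrow> l : mod_hom_set C (terms P n) (terms P n) \<and>
 (n = 0 --> (ALL p:carrier (terms P 0). augmentation P (l p) = \<phi> (augmentation P p))) \<and>
 (ALL p:ker n. l p : ker n)" for n l
 have "EX l. good 0 l"
 proof -
 note h0 = mod_hom_compose[OF t(2)[of 0] t(4) \<phi>]
 obtain l where l: "l : mod_hom_set C (terms P 0) (terms P 0)"
 "!!x. x : carrier (terms P 0) ==> augmentation P (l x) = compose (carrier (terms P 0)) \<phi> (augmentation P) x"
 using has_dual_basis_lift[OF t(1) t(2) M h0 t(4)] ex(1) mod_hom_closed[OF h0] by blast
 thus ?thesis using mod_hom_closed[OF l(1)] mod_hom_zero[OF M M \<phi>] by (intro exI[of _ l]) (auto simp: good_def compose_eq ker_def)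
 qed
 moreover have "\<exists>l'. good (Suc n) l' \<and>
 (ALL p:carrier (terms P (Suc n)). boundary P n (l' p) = l (boundary P n p))" if l: "good n l" for n l
 proof -
 have lh: "l : mod_hom_set C (terms P n) (terms P n)" and lk: "!!p. p : ker n ==> l p : ker n" using l by (auto simp: good_def)
 note h = mod_hom_compose[OF t(2) t(3) lh]
 have "compose (carrier (terms P (Suc n))) l (boundary P n) p : boundary P n ` carrier (terms P (Suc n))" if "p : carrier (terms P (Suc n))" for p
 using that by (simp add: compose_eq ker_im lk im_ker)
 from has_dual_basis_lift[OF t(1) t(2) t(2) h t(3) this]
 obtain l' where l': "l' : mod_hom_set C (terms P (Suc n)) (terms P (Suc n))"
 "!!x. x : carrier (terms P (Suc n)) ==> boundary P n (l' x) = compose (carrier (terms P (Suc n))) l (boundary P n) x" by blast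
 thus ?thesis using mod_hom_closed[OF l'(1)] mod_hom_zero[OF t(2) t(2) lh] by (intro exI[of _ l']) (auto simp: good_def compose_eq ker_def)
 qed
 ultimately obtain l where "!!n. good n (l n)"
 "!!n. ALL p:carrier (terms P (Suc n)). boundary P n (l (Suc n) p) = l n (boundary P n p)"
 using dependent_nat_choice[of good "%n l l'. ALL p:carrier (terms P (Suc n)). boundary P n (l' p) = l (boundary P n p)"] by blast
 hence "l : chain_lifts C P \<phi>" by (auto simp: chain_lifts_def good_def)
 thus ?thesis by blast
qed
section \<open>Quotient modules\<close>

text \<open>Module laws pass along a surjection that respects the operations. This serves records
  with ad hoc carriers, such as \<open>quotient_module\<close> and
  \<open>arrow_space\<close>.\<close>

lemma module_surj:
 assumes W: "module K W" and surj: "\<phi> ` carrier W = carrier V"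
 and add: "!!x y. [|x : carrier W; y : carrier W|] ==> \<phi> (x \<oplus>\<^sub>W y) = \<phi> x \<oplus>\<^sub>V \<phi> y"
 and zero: "\<phi> \<zero>\<^sub>W = \<zero>\<^sub>V"
 and smult: "!!a x. [|a : carrier K; x : carrier W|] ==> \<phi> (a \<odot>\<^sub>W x) = a \<odot>\<^sub>V \<phi> x" shows "module K V"
proof -
 interpret W: module K W by fact
 have pre: "EX w:carrier W. v = \<phi> w" if "v : carrier V" for v using that surj by auto
 have cl: "\<phi> w : carrier V" if "w : carrier W" for w using that surj by auto
 note bk = add[symmetric] smult[symmetric] zero[symmetric]
 show ?thesis
 proof (rule moduleI)
 show "cring K" by (rule W.R.is_cring)
 show "abelian_group V"
 proof (rule abelian_groupI)
 fix x y assume "x : carrier V" "y : carrier V"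
 then obtain u v where uv: "u : carrier W" "v : carrier W" "x = \<phi> u" "y = \<phi> v" using pre by metis
 thus "x \<oplus>\<^sub>V y : carrier V" by (simp add: bk cl)
 show "x \<oplus>\<^sub>V y = y \<oplus>\<^sub>V x" using uv by (simp add: bk W.M.a_comm)
 fix z assume "z : carrier V"
 then obtain w where "w : carrier W" "z = \<phi> w" using pre by metis
 with uv show "x \<oplus>\<^sub>V y \<oplus>\<^sub>V z = x \<oplus>\<^sub>V (y \<oplus>\<^sub>V z)" by (simp add: bk W.M.a_assoc)
 next
 fix x assume "x : carrier V"
 then obtain u where u: "u : carrier W" "x = \<phi> u" using pre by metis
 thus "\<zero>\<^sub>V \<oplus>\<^sub>V x = x" by (simp add: bk)
 show "EX y:carrier V. y \<oplus>\<^sub>V x = \<zero>\<^sub>V"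
 using u cl[of "\<ominus>\<^sub>W u"] by (intro bexI[of _ "\<phi> (\<ominus>\<^sub>W u)"]) (simp_all add: bk W.M.l_neg)
 next
 show "\<zero>\<^sub>V : carrier V" by (simp add: bk cl)
 qed
 next
 fix a x assume a: "a : carrier K" and "x : carrier V"
 then obtain u where u: "u : carrier W" "x = \<phi> u" using pre by metis
 thus "a \<odot>\<^sub>V x : carrier V" using a by (simp add: bk cl)
 fix b assume b: "b : carrier K"
 show "(a \<oplus>\<^sub>K b) \<odot>\<^sub>V x = a \<odot>\<^sub>V x \<oplus>\<^sub>V b \<odot>\<^sub>V x"
 using a b u by (simp add: bk W.smult_l_distr)
 show "(a \<otimes>\<^sub>K b) \<odot>\<^sub>V x = a \<odot>\<^sub>V (b \<odot>\<^sub>V x)"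
 using a b u by (simp add: bk W.smult_assoc1)
 next
 fix a x y assume a: "a : carrier K" and "x : carrier V" "y : carrier V"
 then obtain u v where "u : carrier W" "v : carrier W" "x = \<phi> u" "y = \<phi> v" using pre by metis
 thus "a \<odot>\<^sub>V (x \<oplus>\<^sub>V y) = a \<odot>\<^sub>V x \<oplus>\<^sub>V a \<odot>\<^sub>V y"
 using a by (simp add: bk W.smult_r_distr)
 next
 fix x assume "x : carrier V"
 then obtain u where "u : carrier W" "x = \<phi> u" using pre by metis
 thus "\<one>\<^sub>K \<odot>\<^sub>V x = x" by (simp add: bk)
 qed
qed

lemma submodule_abelian_subgroup:
 assumes "submodule K I M" shows "abelian_subgroup I M"
proof -
 interpret submodule K I M by fact
 interpret M: module K M by (rule module)
 show ?thesis
 proof (rule abelian_subgroupI3[OF additive_subgroupI M.M.abelian_group_axioms])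
 show "subgroup I (add_monoid M)"
 proof
 fix x assume x: "x : I"
 hence "(\<ominus>\<^sub>K \<one>\<^sub>K) \<odot>\<^sub>M x = \<ominus>\<^sub>M x" using subset by (auto simp: M.smult_l_minus)
 hence "\<ominus>\<^sub>M x : I" using x smult_closed[of "\<ominus>\<^sub>K \<one>\<^sub>K" x] by simp
 thus "inv\<^bsub>add_monoid M\<^esub> x : I" by (simp add: a_inv_def)
 qed (use subset in auto)
 qed
qed

lemma carrier_quotient_module:
 "carrier (quotient_module A I) = (%x. I +>\<^bsub>A\<^esub> x) ` carrier A"
 by (auto simp: quotient_module_def FactRing_def A_RCOSETS_def RCOSETS_def a_r_coset_def)

lemma zero_quotient_module: "\<zero>\<^bsub>quotient_module A I\<^esub> = I" by (simp add: quotient_module_def FactRing_def)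

context
 fixes K :: "'k ring" and A :: "('k, 'a) module" and I :: "'a set"
 assumes sub: "submodule K I A"
begin
interpretation submodule K I A by (rule sub)
interpretation A: module K A by (rule module)
interpretation I: abelian_subgroup I A by (rule submodule_abelian_subgroup[OF sub])

lemma coset_eq_iff:
 assumes "x : carrier A" "y : carrier A" shows "I +>\<^bsub>A\<^esub> x = I +>\<^bsub>A\<^esub> y \<longleftrightarrow> x \<ominus>\<^sub>A y : I"
proof -
 have "x \<ominus>\<^sub>A y : I \<longleftrightarrow> x : I +>\<^bsub>A\<^esub> y" using I.a_rcos_module[OF assms(2,1)] by (simp add: a_minus_def)
 also have "... \<longleftrightarrow> I +>\<^bsub>A\<^esub> x = I +>\<^bsub>A\<^esub> y" using I.a_repr_independence' I.a_rcos_self assms by metis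
 finally show ?thesis by simp
qed

lemma quotient_add: "[|x : carrier A; y : carrier A|] ==>
 (I +>\<^bsub>A\<^esub> x) \<oplus>\<^bsub>quotient_module A I\<^esub> (I +>\<^bsub>A\<^esub> y) = I +>\<^bsub>A\<^esub> (x \<oplus>\<^sub>A y)"
 by (simp add: quotient_module_def FactRing_def I.a_rcos_sum)

lemma coset_mem_iff: "[|x : carrier A|] ==> y : I +>\<^bsub>A\<^esub> x \<longleftrightarrow> y : carrier A & I +>\<^bsub>A\<^esub> y = I +>\<^bsub>A\<^esub> x"
 by (metis I.a_elemrcos_carrier I.a_rcos_self I.a_repr_independence')

text \<open>The scalar action is defined as a union over representatives; congruent representatives
  have congruent multiples, so all members of the union coincide.\<close>

lemma quotient_smult:
 assumes "a : carrier K" "x : carrier A"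
 shows "a \<odot>\<^bsub>quotient_module A I\<^esub> (I +>\<^bsub>A\<^esub> x) = I +>\<^bsub>A\<^esub> (a \<odot>\<^sub>A x)"
proof -
 have "I +>\<^bsub>A\<^esub> (a \<odot>\<^sub>A y) = I +>\<^bsub>A\<^esub> (a \<odot>\<^sub>A x)" if "y : I +>\<^bsub>A\<^esub> x" for y
 proof -
 from that assms have y: "y : carrier A" "y \<ominus>\<^sub>A x : I" by (auto simp: coset_mem_iff coset_eq_iff)
 hence "a \<odot>\<^sub>A (y \<ominus>\<^sub>A x) : I" using assms by simp
 hence "a \<odot>\<^sub>A y \<ominus>\<^sub>A a \<odot>\<^sub>A x : I"
 using y assms by (simp add: a_minus_def A.smult_r_distr A.smult_r_minus)
 thus ?thesis using y assms by (simp add: coset_eq_iff)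
 qed
 moreover have "x : I +>\<^bsub>A\<^esub> x" using assms by (simp add: I.a_rcos_self)
 ultimately have "(\<Union>y\<in>I +>\<^bsub>A\<^esub> x. I +>\<^bsub>A\<^esub> (a \<odot>\<^sub>A y)) = I +>\<^bsub>A\<^esub> (a \<odot>\<^sub>A x)"
 by (intro SUP_eq_const) blast+
 thus ?thesis by (simp add: quotient_module_def)
qed

lemma module_quotient: "module K (quotient_module A I)"
proof (rule module_surj[OF A.module_axioms])
 show "I +>\<^bsub>A\<^esub> \<zero>\<^sub>A = \<zero>\<^bsub>quotient_module A I\<^esub>" using subset by (simp add: zero_quotient_module A.M.a_coset_add_zero)
qed (simp_all add: carrier_quotient_module quotient_add quotient_smult)
end
section \<open>Path algebras of acyclic quivers\<close>

lemma kalgebraD: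
 assumes "kalgebra K A" shows "field K" "ring A" "module K A" "vectorspace K A"
proof -
 interpret kalgebra K A by fact
 show "field K" "ring A" "module K A" "vectorspace K A" by (rule field_axioms ring_axioms module_axioms vectorspace_axioms A.ring_axioms)+
qed

text \<open>That the path algebra is a ring enters as an assumption because it is contained in the
  hypothesis that \<open>I\<close> is an ideal of it.\<close>

locale acyclic_path_algebra =
 fixes K :: "'k ring" and Q :: "('v, 'a) pre_digraph"
 assumes field_K: "field K" and fin_Q: "fin_digraph Q" and acyclic: "acyclic_quiver Q" and ring_A: "ring (path_algebra K Q)"
begin
interpretation K: field K by (rule field_K)
interpretation Q: fin_digraph Q by (rule fin_Q)
interpretation A: ring "path_algebra K Q" by (rule ring_A)
abbreviation A where "A == path_algebra K Q"
abbreviation "\<A> == carrier A"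
abbreviation vid :: "'v => ('v, 'a) path => 'k" where "vid x == vertex_idempotent K x"
abbreviation arr where "arr a == path_element K (tail Q a, [a])"
text \<open>Left division by the arrow \<open>a\<close>: a path \<open>a q\<close> goes to
  \<open>q\<close>, every other path to zero. Together with the coefficients at trivial paths the
  derivatives determine an element (\<open>expand_der\<close>), and their values on relations form
  the matrix of the second differential.\<close>

definition der :: "'a => (('v, 'a) path => 'k) => ('v, 'a) path => 'k"
 where "der a f = (%(y, q). if y = head Q a then f (tail Q a, a # q) else \<zero>\<^sub>K)"
text \<open>The span of the paths of length at least \<open>n\<close>, that is the
  \<open>n\<close>-th power of the arrow ideal, described by coefficients.\<close>

definition filt :: "nat => (('v, 'a) path => 'k) set"
 where "filt n = {f : \<A>. ALL x p. length p < n --> f (x, p) = \<zero>\<^sub>K}"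

text \<open>A repeated point on a walk would give a closed subwalk. The finiteness of the set of
  paths and the nilpotency \<open>filt_top\<close> of the arrow ideal rest on this bound.\<close>

lemma path_length: "(x, p) : paths Q ==> length p < card (verts Q)"
proof -
 assume "(x, p) : paths Q"
 then obtain y where w: "Q.awalk x p y" by (auto simp: paths_def)
 have d: "distinct (Q.awalk_verts x p)"
 proof (rule ccontr)
 assume "\<not> distinct (Q.awalk_verts x p)"
 from Q.awalk_not_distinct_decomp[OF w this] show False using acyclic unfolding acyclic_quiver_def by blast
 qed
 have "set (Q.awalk_verts x p) \<subseteq> verts Q" using w unfolding Q.awalk_conv by blast
 hence "card (set (Q.awalk_verts x p)) \<le> card (verts Q)" by (intro card_mono) auto
 thus ?thesis using d by (simp add: distinct_card Q.length_awalk_verts)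
qed

lemma paths_Nil [simp]: "(x, []) : paths Q \<longleftrightarrow> x : verts Q" by (auto simp: paths_def Q.awalk_simps)

lemma paths_Cons [simp]: "(x, a # p) : paths Q \<longleftrightarrow> a : arcs Q & x = tail Q a & (head Q a, p) : paths Q" by (auto simp: paths_def Q.awalk_simps)

lemma finite_paths: "finite (paths Q)"
proof (rule finite_subset)
 show "paths Q \<subseteq> verts Q \<times> {p. set p \<subseteq> arcs Q & length p \<le> card (verts Q)}" using path_length by (force simp: paths_def Q.awalk_def)
 show "finite (verts Q \<times> {p. set p \<subseteq> arcs Q & length p \<le> card (verts Q)})" by (intro finite_cartesian_product finite_lists_length_le) auto
qed

lemma mem_A: "f : \<A> \<longleftrightarrow> (ALL w. f w : carrier K) & (ALL w. w \<notin> paths Q --> f w = \<zero>\<^sub>K)"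
proof -
 have "finite {w. f w ~= \<zero>\<^sub>K}" if "ALL w. w \<notin> paths Q --> f w = \<zero>\<^sub>K"
 using that by (intro finite_subset[OF _ finite_paths]) auto
 thus ?thesis by (auto simp: path_algebra_def)
qed

lemma A_simps [simp]:
 "(f \<oplus>\<^sub>A g) w = f w \<oplus>\<^sub>K g w" "\<zero>\<^sub>A w = \<zero>\<^sub>K" "(c \<odot>\<^sub>A f) w = c \<otimes>\<^sub>K f w"
 by (simp_all add: path_algebra_def)

lemma A_mult: "(f \<otimes>\<^sub>A g) (x, p) = (\<Oplus>\<^sub>K i\<in>{..length p}.
 f (x, take i p) \<otimes>\<^sub>K g (Q.awlast x (take i p), drop i p))" by (simp add: path_algebra_def)

lemma A_val: "f : \<A> ==> f w : carrier K" unfolding mem_A by blast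

lemma A_neg: "f : \<A> ==> (\<ominus>\<^sub>A f) w = \<ominus>\<^sub>K f w"
proof -
 assume f: "f : \<A>"
 have "(\<ominus>\<^sub>A f) w \<oplus>\<^sub>K f w = \<zero>\<^sub>K" using A.l_neg[OF f] A_simps(1)[of "\<ominus>\<^sub>A f" f w] by simp
 thus ?thesis using A_val[OF f] A_val[OF A.a_inv_closed[OF f]] by (simp add: K.minus_equality)
qed

lemma A_finsum: "finite S ==> (!!s. s : S ==> g s : \<A>) ==>
 finsum A g S w = (\<Oplus>\<^sub>K s\<in>S. g s w)" by (induction S rule: finite_induct) (auto simp: Pi_def A_val)

lemma vid_closed [simp]: "x : verts Q ==> vid x : \<A>" by (auto simp: mem_A path_element_def)

lemma arr_closed [simp]: "a : arcs Q ==> arr a : \<A>" by (auto simp: mem_A path_element_def)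

lemma vid_mult:
 assumes f: "f : \<A>" shows "(vid y \<otimes>\<^sub>A f) (x, p) = (if x = y then f (x, p) else \<zero>\<^sub>K)"
proof -
 have "(vid y \<otimes>\<^sub>A f) (x, p) = (\<Oplus>\<^sub>K i\<in>{..length p}. if 0 = i then (if x = y then f (x, p) else \<zero>\<^sub>K) else \<zero>\<^sub>K)"
 unfolding A_mult using A_val[OF f] by (intro K.finsum_cong') (auto simp: path_element_def)
 also have "... = (if x = y then f (x, p) else \<zero>\<^sub>K)"
 using A_val[OF f] K.finsum_singleton[of 0 "{..length p}" "%_. if x = y then f (x, p) else \<zero>\<^sub>K"] by auto
 finally show ?thesis .
qed

lemma arr_mult:
 assumes f: "f : \<A>" shows "(arr a \<otimes>\<^sub>A f) (x, p) = (case p of [] => \<zero>\<^sub>K | b # q =>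
 if x = tail Q a & b = a then f (head Q a, q) else \<zero>\<^sub>K)"
proof (cases p)
 case Nil
 thus ?thesis using A_val[OF f] by (simp add: A_mult path_element_def)
next
 case (Cons b q)
 let ?v = "if x = tail Q a & b = a then f (head Q a, q) else \<zero>\<^sub>K"
 have "(arr a \<otimes>\<^sub>A f) (x, p) = (\<Oplus>\<^sub>K i\<in>{..length p}. if 1 = i then ?v else \<zero>\<^sub>K)" unfolding A_mult
 proof (rule K.finsum_cong')
 fix i assume i: "i : {..length p}"
 show "arr a (x, take i p) \<otimes>\<^sub>K f (Q.awlast x (take i p), drop i p) = (if 1 = i then ?v else \<zero>\<^sub>K)"
 proof (cases i)
 case 0 thus ?thesis using A_val[OF f] by (simp add: path_element_def)
 next
 case (Suc j)
 thus ?thesis using Cons i A_val[OF f] by (cases j) (auto simp: path_element_def take_Cons' split: if_splits)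
 qed
 qed (use A_val[OF f] in auto)
 also have "... = ?v" using A_val[OF f] Cons K.finsum_singleton[of 1 "{..length p}" "%_. ?v"] by auto
 finally show ?thesis using Cons by simp
qed

lemma kalgebra_A: "kalgebra K A"
proof -
 have sc: "c \<odot>\<^sub>A f : \<A>" if "c : carrier K" "f : \<A>" for c f using that by (auto simp: mem_A)
 have m: "module K A" by (rule moduleI[OF K.is_cring A.abelian_group_axioms])
 (auto simp: fun_eq_iff sc A_val K.l_distr K.r_distr K.m_assoc)
 show ?thesis
 proof (intro kalgebra.intro vectorspace.intro m field_K ring_A kalgebra_axioms.intro)
 fix c f g assume h: "c : carrier K" "f : \<A>" "g : \<A>"
 have t: "f (x, take i p) : carrier K" "g (Q.awlast x (take i p), drop i p) : carrier K" for x p i using h A_val by auto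
 show "c \<odot>\<^sub>A (f \<otimes>\<^sub>A g) = (c \<odot>\<^sub>A f) \<otimes>\<^sub>A g"
 proof (rule ext, clarify)
 fix x p
 show "(c \<odot>\<^sub>A (f \<otimes>\<^sub>A g)) (x, p) = ((c \<odot>\<^sub>A f) \<otimes>\<^sub>A g) (x, p)"
 using h t[of x _ p] by (simp add: A_mult K.finsum_rdistr Pi_def K.m_assoc)
 qed
 show "c \<odot>\<^sub>A (f \<otimes>\<^sub>A g) = f \<otimes>\<^sub>A (c \<odot>\<^sub>A g)"
 proof (rule ext, clarify)
 fix x p
 show "(c \<odot>\<^sub>A (f \<otimes>\<^sub>A g)) (x, p) = (f \<otimes>\<^sub>A (c \<odot>\<^sub>A g)) (x, p)"
 using h t[of x _ p] by (simp add: A_mult K.finsum_rdistr Pi_def K.m_lcomm)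
 qed
 qed
qed
interpretation M: module K A by (rule kalgebraD(3)[OF kalgebra_A])
interpretation kA: kalgebra K A by (rule kalgebra_A)

lemma vid_mult_vid: "[|x : verts Q; y : verts Q|] ==> vid x \<otimes>\<^sub>A vid y = (if x = y then vid x else \<zero>\<^sub>A)"
 by (auto simp: fun_eq_iff vid_mult) (auto simp: path_element_def)

lemma vid_mult_arr: "a : arcs Q ==> vid (tail Q a) \<otimes>\<^sub>A arr a = arr a" by (auto simp: fun_eq_iff vid_mult) (auto simp: path_element_def)

lemma arr_mult_vid: "a : arcs Q ==> arr a \<otimes>\<^sub>A vid (head Q a) = arr a"
 by (auto simp: fun_eq_iff arr_mult split: list.split) (auto simp: path_element_def)

lemma vid_fixed_val: "[|f : \<A>; vid x \<otimes>\<^sub>A f = f; y ~= x|] ==> f (y, p) = \<zero>\<^sub>K"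
 using vid_mult[of f x y p] by simp

lemma val_mult: "[|f : \<A>; g : \<A>|] ==> (f \<otimes>\<^sub>A g) (x, []) = f (x, []) \<otimes>\<^sub>K g (x, [])"
 by (simp add: A_mult A_val)

lemma val_one: "\<one>\<^sub>A (x, []) = (if x : verts Q then \<one>\<^sub>K else \<zero>\<^sub>K)" by (simp add: path_algebra_def)

lemma val_vid: "vid y (x, []) = (if x = y then \<one>\<^sub>K else \<zero>\<^sub>K)" by (simp add: path_element_def)

lemma der_closed [simp]: "[|a : arcs Q; f : \<A>|] ==> der a f : \<A>" by (auto simp: mem_A der_def)

lemma der_add: "[|f : \<A>; g : \<A>|] ==> der a (f \<oplus>\<^sub>A g) = der a f \<oplus>\<^sub>A der a g"
 by (auto simp: fun_eq_iff der_def)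


lemma der_zero: "der a \<zero>\<^sub>A = \<zero>\<^sub>A" by (auto simp: fun_eq_iff der_def)

lemma der_finsum: "[|finite S; !!s. s : S ==> g s : \<A>; a : arcs Q|] ==>
 der a (finsum A g S) = (\<Oplus>\<^sub>A s\<in>S. der a (g s))" by (induction S rule: finite_induct) (auto simp: der_zero der_add Pi_def)

lemma der_arr: "[|a : arcs Q; b : arcs Q; f : \<A>|] ==>
 der a (arr b \<otimes>\<^sub>A f) = (if a = b then vid (head Q a) \<otimes>\<^sub>A f else \<zero>\<^sub>A)"
 by (auto simp: fun_eq_iff der_def arr_mult vid_mult)

lemma vid_der: "[|a : arcs Q; f : \<A>|] ==> vid (head Q a) \<otimes>\<^sub>A der a f = der a f"
 by (auto simp: fun_eq_iff vid_mult) (auto simp: der_def)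

lemma der_outside: "[|f : \<A>; vid x \<otimes>\<^sub>A f = f; tail Q a ~= x|] ==> der a f = \<zero>\<^sub>A"
 using vid_fixed_val[of f x] by (auto simp: fun_eq_iff der_def)

text \<open>Compared coefficientwise, each nontrivial path is contributed by its first arrow alone,
  and each trivial path by its point.\<close>

lemma expand_der:
 assumes f: "f : \<A>"
 shows "f = (\<Oplus>\<^sub>A x\<in>verts Q. f (x, []) \<odot>\<^sub>A vid x) \<oplus>\<^sub>A (\<Oplus>\<^sub>A a\<in>arcs Q. arr a \<otimes>\<^sub>A der a f)"
proof (rule ext, clarify)
 fix x p
 have v: "(\<Oplus>\<^sub>A x\<in>verts Q. f (x, []) \<odot>\<^sub>A vid x) (x, p) = (if p = [] then f (x, []) else \<zero>\<^sub>K)"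
 proof -
 have "(\<Oplus>\<^sub>A x\<in>verts Q. f (x, []) \<odot>\<^sub>A vid x) (x, p) =
 (\<Oplus>\<^sub>K y\<in>verts Q. f (y, []) \<otimes>\<^sub>K vid y (x, p))" using A_val[OF f] by (subst A_finsum) auto
 also have "... = (\<Oplus>\<^sub>K y\<in>verts Q. if x = y then (if p = [] then f (x, []) else \<zero>\<^sub>K) else \<zero>\<^sub>K)"
 using A_val[OF f] by (intro K.finsum_cong') (auto simp: path_element_def)
 also have "... = (if p = [] then f (x, []) else \<zero>\<^sub>K)"
 proof (cases "x : verts Q")
 case True
 thus ?thesis using A_val[OF f] by (intro K.finsum_singleton) auto
 next
 case False
 hence "f (x, []) = \<zero>\<^sub>K" using f by (auto simp: mem_A)
 thus ?thesis using False by (auto intro!: K.add.finprod_one_eqI)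
 qed
 finally show ?thesis .
 qed
 have a: "(\<Oplus>\<^sub>A a\<in>arcs Q. arr a \<otimes>\<^sub>A der a f) (x, p) = (if p = [] then \<zero>\<^sub>K else f (x, p))"
 proof -
 have "(\<Oplus>\<^sub>A a\<in>arcs Q. arr a \<otimes>\<^sub>A der a f) (x, p) = (\<Oplus>\<^sub>K a\<in>arcs Q. (arr a \<otimes>\<^sub>A der a f) (x, p))"
 using f by (subst A_finsum) auto
 also have "... = (if p = [] then \<zero>\<^sub>K else f (x, p))"
 proof (cases p)
 case Nil
 thus ?thesis using f by (simp add: arr_mult K.add.finprod_one_eqI)
 next
 case (Cons b q)
 have "(\<Oplus>\<^sub>K a\<in>arcs Q. (arr a \<otimes>\<^sub>A der a f) (x, p)) = (\<Oplus>\<^sub>K a\<in>arcs Q. if b = a then f (x, p) else \<zero>\<^sub>K)"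
 using A_val[OF f] f by (intro K.finsum_cong') (auto simp: arr_mult Cons der_def mem_A)
 also have "... = f (x, p)"
 proof (cases "b : arcs Q")
 case True
 thus ?thesis using A_val[OF f] by (intro K.finsum_singleton) auto
 next
 case False
 hence "f (x, p) = \<zero>\<^sub>K" using f by (auto simp: mem_A Cons)
 thus ?thesis using False by (auto intro!: K.add.finprod_one_eqI)
 qed
 finally show ?thesis using Cons by simp
 qed
 finally show ?thesis .
 qed
 show "f (x, p) = ((\<Oplus>\<^sub>A x\<in>verts Q. f (x, []) \<odot>\<^sub>A vid x) \<oplus>\<^sub>A (\<Oplus>\<^sub>A a\<in>arcs Q. arr a \<otimes>\<^sub>A der a f)) (x, p)"
 using A_val[OF f] by (simp add: v a)
qed

section \<open>The filtration by path length\<close>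

lemma filt_carrier: "f : filt n ==> f : \<A>" by (simp add: filt_def)
lemma filt_0: "filt 0 = \<A>" by (auto simp: filt_def)
lemma filt_zero: "\<zero>\<^sub>A : filt n" by (simp add: filt_def)
lemma filt_add: "[|f : filt n; g : filt n|] ==> f \<oplus>\<^sub>A g : filt n" by (simp add: filt_def)
lemma filt_neg: "f : filt n ==> \<ominus>\<^sub>A f : filt n" by (simp add: filt_def A_neg)
lemma filt_antimono: "m \<le> n ==> filt n \<subseteq> filt m" by (auto simp: filt_def)

lemma filt_mult:
 assumes "f : filt m" "g : filt n" shows "f \<otimes>\<^sub>A g : filt (m + n)" unfolding filt_def
proof (intro CollectI conjI allI impI)
 show "f \<otimes>\<^sub>A g : \<A>" using assms by (auto simp: filt_def)
 fix x p assume l: "length (p :: 'a list) < m + n"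
 have "f (x, take i p) \<otimes>\<^sub>K g (Q.awlast x (take i p), drop i p) = \<zero>\<^sub>K" if i: "i : {..length p}" for i
 proof (cases "i < m")
 case True thus ?thesis using assms i A_val by (auto simp: filt_def)
 next
 case False thus ?thesis using assms l i A_val by (auto simp: filt_def)
 qed
 thus "(f \<otimes>\<^sub>A g) (x, p) = \<zero>\<^sub>K" unfolding A_mult by (intro K.add.finprod_one_eqI)
qed

lemma filt_ideal: "ideal (filt n) A"
proof (rule idealI[OF ring_A])
 show "subgroup (filt n) (add_monoid A)" by standard (auto simp: filt_carrier filt_add filt_zero filt_neg a_inv_def[symmetric])
qed (use filt_mult[of _ 0 _ n] filt_mult[of _ n _ 0] filt_0 in auto)

lemma filt_top: "filt (card (verts Q)) = {\<zero>\<^sub>A}"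
proof -
 have "f = \<zero>\<^sub>A" if f: "f : filt (card (verts Q))" for f
 proof (rule ext, clarify)
 fix x p
 show "f (x, p) = \<zero>\<^sub>A (x, p)"
 proof (cases "(x, p) : paths Q")
 case True thus ?thesis using path_length[OF True] f by (simp add: filt_def)
 next
 case False thus ?thesis using f by (auto simp: filt_def mem_A)
 qed
 qed
 thus ?thesis using filt_zero by auto
qed


lemma arr_filt: "a : arcs Q ==> arr a : filt 1" using arr_closed[of a] by (simp add: filt_def) (simp add: path_element_def)

lemma filt_1_iff: "f : \<A> ==> f : filt 1 \<longleftrightarrow> (ALL x:verts Q. f (x, []) = \<zero>\<^sub>K)" by (auto simp: filt_def) (auto simp: mem_A)

lemma expand_filt_1:
 assumes f: "f : filt 1" shows "f = (\<Oplus>\<^sub>A a\<in>arcs Q. arr a \<otimes>\<^sub>A der a f)"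
proof -
 have fc: "f : \<A>" using f by (rule filt_carrier)
 have "(\<Oplus>\<^sub>A x\<in>verts Q. f (x, []) \<odot>\<^sub>A vid x) = (\<Oplus>\<^sub>A x\<in>verts Q. \<zero>\<^sub>A)"
 proof (rule A.finsum_cong')
 fix x assume x: "x : verts Q"
 hence "f (x, []) = \<zero>\<^sub>K" using f filt_1_iff[OF fc] by blast
 thus "f (x, []) \<odot>\<^sub>A vid x = \<zero>\<^sub>A" using x by (simp add: M.lmult_0)
 qed auto
 hence z: "(\<Oplus>\<^sub>A x\<in>verts Q. f (x, []) \<odot>\<^sub>A vid x) = \<zero>\<^sub>A" by simp
 have "(\<Oplus>\<^sub>A a\<in>arcs Q. arr a \<otimes>\<^sub>A der a f) : \<A>" using fc by auto
 with expand_der[OF fc] z show ?thesis by simp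
qed

text \<open>Multiplication by \<open>arr b\<close> discards the part of \<open>g b\<close> that does
  not start at the head of \<open>b\<close>, so the derivative returns \<open>g a\<close> cut by
  that idempotent.\<close>

lemma der_sum_arr:
 assumes g: "!!b. b : arcs Q ==> g b : \<A>" and a: "a : arcs Q"
 shows "der a (\<Oplus>\<^sub>A b\<in>arcs Q. arr b \<otimes>\<^sub>A g b) = vid (head Q a) \<otimes>\<^sub>A g a"
proof -
 have "der a (\<Oplus>\<^sub>A b\<in>arcs Q. arr b \<otimes>\<^sub>A g b) = (\<Oplus>\<^sub>A b\<in>arcs Q. der a (arr b \<otimes>\<^sub>A g b))"
 using g a by (intro der_finsum) auto
 also have "... = (\<Oplus>\<^sub>A b\<in>arcs Q. if a = b then vid (head Q a) \<otimes>\<^sub>A g b else \<zero>\<^sub>A)"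
 using g a by (intro A.finsum_cong') (auto simp: der_arr)
 also have "... = vid (head Q a) \<otimes>\<^sub>A g a" using g a by (intro A.finsum_singleton) auto
 finally show ?thesis .
qed

text \<open>If \<open>f\<close> has no trivial paths, the first arrow of a product path is the first
  arrow of its left factor. For \<open>f\<close> an idempotent the formula fails in general.\<close>

lemma der_mult:
 assumes f: "f : filt 1" and g: "g : \<A>" and a: "a : arcs Q" shows "der a (f \<otimes>\<^sub>A g) = der a f \<otimes>\<^sub>A g"
proof -
 have fc: "f : \<A>" using f by (rule filt_carrier)
 have "f \<otimes>\<^sub>A g = (\<Oplus>\<^sub>A a\<in>arcs Q. arr a \<otimes>\<^sub>A der a f) \<otimes>\<^sub>A g"
 using expand_filt_1[OF f] by simp
 also have "... = (\<Oplus>\<^sub>A b\<in>arcs Q. arr b \<otimes>\<^sub>A (der b f \<otimes>\<^sub>A g))"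
 using fc g by (simp add: A.finsum_ldistr Pi_def A.m_assoc cong: A.finsum_cong)
 finally have "der a (f \<otimes>\<^sub>A g) = vid (head Q a) \<otimes>\<^sub>A (der a f \<otimes>\<^sub>A g)"
 using der_sum_arr[of "%b. der b f \<otimes>\<^sub>A g" a] fc g a by simp
 also have "... = der a f \<otimes>\<^sub>A g" using fc g a by (simp add: A.m_assoc[symmetric] vid_der)
 finally show ?thesis .
qed

text \<open>The number of paths starting at a point decreases along arrows.\<close>
definition level :: "'v => nat" where "level x = card {p. (x, p) : paths Q}"

text \<open>Prefixing \<open>a\<close> embeds the paths from its head into the paths from its tail,
  and the trivial path at the tail is missed.\<close>

lemma level_arr:
 assumes a: "a : arcs Q" shows "level (head Q a) < level (tail Q a)"
proof -
 have fin: "finite {p. (x, p) : paths Q}" for x using finite_paths by (rule finite_subset[of _ "snd ` paths Q", rotated, OF finite_imageI]) force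
 have "level (head Q a) = card ((#) a ` {p. (head Q a, p) : paths Q})" by (simp add: level_def card_image)
 also have "... < card {p. (tail Q a, p) : paths Q}" using fin a by (intro psubset_card_mono psubsetI) auto
 finally show ?thesis by (simp add: level_def)
qed

text \<open>A nontrivial path from \<open>y\<close> to \<open>x\<close> would force
  \<open>level x < level y\<close>, so only the trivial path can contribute. The induction strips
  first arrows with \<open>der\<close>, each strip lowering the level of the starting point.\<close>

lemma corner_level:
 assumes "f : \<A>" "x : verts Q" "y : verts Q" "level y \<le> level x"
 shows "vid y \<otimes>\<^sub>A f \<otimes>\<^sub>A vid x = (if x = y then f (x, []) \<odot>\<^sub>A vid x else \<zero>\<^sub>A)"
 using assms
proof (induction "level y" arbitrary: y f rule: less_induct)
 case less
 define g where "g = vid y \<otimes>\<^sub>A f \<otimes>\<^sub>A vid x"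
 define w where "w = vid y \<otimes>\<^sub>A f"
 have wc: "w : \<A>" and vw: "vid y \<otimes>\<^sub>A w = w" using less.prems by (auto simp: w_def A.m_assoc[symmetric] vid_mult_vid)
 have d: "der a w \<otimes>\<^sub>A vid x = \<zero>\<^sub>A" if a: "a : arcs Q" for a
 proof (cases "tail Q a = y")
 case True
 hence l: "level (head Q a) < level y" using level_arr[OF a] by simp
 hence "vid (head Q a) \<otimes>\<^sub>A der a w \<otimes>\<^sub>A vid x = \<zero>\<^sub>A"
 using less.hyps[OF l, of "der a w"] less.prems wc a by (auto simp: Q.head_in_verts)
 thus ?thesis using vid_der[OF a wc] by simp
 next
 case False
 thus ?thesis using der_outside[OF wc vw False] less.prems by simp
 qed
 have "w \<otimes>\<^sub>A vid x = (\<Oplus>\<^sub>A z\<in>verts Q. w (z, []) \<odot>\<^sub>A vid z) \<otimes>\<^sub>A vid x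
 \<oplus>\<^sub>A (\<Oplus>\<^sub>A a\<in>arcs Q. arr a \<otimes>\<^sub>A der a w) \<otimes>\<^sub>A vid x"
 using expand_der[OF wc] wc less.prems(2) A_val[OF wc]
 by (metis (no_types, lifting) A.finsum_closed A.l_distr A.m_closed M.smult_closed Pi_I arr_closed der_closed vid_closed)
 also have "(\<Oplus>\<^sub>A a\<in>arcs Q. arr a \<otimes>\<^sub>A der a w) \<otimes>\<^sub>A vid x = \<zero>\<^sub>A"
 using wc less.prems(2) d by (simp add: A.finsum_ldistr Pi_def A.m_assoc A.add.finprod_one_eqI)
 also have "(\<Oplus>\<^sub>A z\<in>verts Q. w (z, []) \<odot>\<^sub>A vid z) \<otimes>\<^sub>A vid x
 = (\<Oplus>\<^sub>A z\<in>verts Q. if x = z then w (x, []) \<odot>\<^sub>A vid x else \<zero>\<^sub>A)"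
 proof -
 have "(\<Oplus>\<^sub>A z\<in>verts Q. w (z, []) \<odot>\<^sub>A vid z) \<otimes>\<^sub>A vid x
 = (\<Oplus>\<^sub>A z\<in>verts Q. w (z, []) \<odot>\<^sub>A vid z \<otimes>\<^sub>A vid x)"
 using wc less.prems(2) A_val[OF wc] by (intro A.finsum_ldistr) auto
 also have "... = (\<Oplus>\<^sub>A z\<in>verts Q. if x = z then w (x, []) \<odot>\<^sub>A vid x else \<zero>\<^sub>A)"
 using wc less.prems(2) A_val[OF wc] by (intro A.finsum_cong') (auto simp: kA.smult_mult_left[symmetric] vid_mult_vid)
 finally show ?thesis .
 qed
 also have "... = w (x, []) \<odot>\<^sub>A vid x" using A_val[OF wc] less.prems(2) by (intro A.finsum_singleton) auto
 finally have "w \<otimes>\<^sub>A vid x = w (x, []) \<odot>\<^sub>A vid x" using A_val[OF wc] less.prems(2) by (simp del: A_simps)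
 moreover have "w (x, []) = (if x = y then f (x, []) else \<zero>\<^sub>K)" using less.prems by (simp add: w_def vid_mult)
 ultimately show ?case using less.prems by (simp add: w_def M.lmult_0)
qed

text \<open>On an element starting at a single point, left multiplication by \<open>y\<close> is a
  scalar plus a combination of arrows applied to further left multiples. This reduces closure under
  left multiplication to scalars and arrows.\<close>

lemma left_split:
 assumes y: "y : \<A>" and z: "z : \<A>" and s: "s : verts Q" "vid s \<otimes>\<^sub>A z = z"
 shows "y \<otimes>\<^sub>A z = y (s, []) \<odot>\<^sub>A z \<oplus>\<^sub>A (\<Oplus>\<^sub>A a\<in>arcs Q. arr a \<otimes>\<^sub>A (der a y \<otimes>\<^sub>A z))"
proof -
 have vz: "vid x \<otimes>\<^sub>A z = (if s = x then z else \<zero>\<^sub>A)" if "x : verts Q" for x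
 using that s z vid_mult_vid[of x s] by (metis A.l_null A.m_assoc vid_closed)
 let ?v = "\<Oplus>\<^sub>A x\<in>verts Q. y (x, []) \<odot>\<^sub>A vid x" and ?a = "\<Oplus>\<^sub>A a\<in>arcs Q. arr a \<otimes>\<^sub>A der a y"
 have c: "?v : \<A>" "?a : \<A>" using y A_val[OF y] by auto
 have "?v \<otimes>\<^sub>A z = (\<Oplus>\<^sub>A x\<in>verts Q. y (x, []) \<odot>\<^sub>A vid x \<otimes>\<^sub>A z)"
 using y z A_val[OF y] by (intro A.finsum_ldistr) auto
 also have "... = (\<Oplus>\<^sub>A x\<in>verts Q. if s = x then y (x, []) \<odot>\<^sub>A z else \<zero>\<^sub>A)"
 using y z A_val[OF y] by (intro A.finsum_cong') (auto simp: kA.smult_mult_left[symmetric] vz)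
 also have "... = y (s, []) \<odot>\<^sub>A z" using z s A_val[OF y] by (intro A.finsum_singleton) auto
 finally have v: "?v \<otimes>\<^sub>A z = y (s, []) \<odot>\<^sub>A z" .
 have a: "?a \<otimes>\<^sub>A z = (\<Oplus>\<^sub>A a\<in>arcs Q. arr a \<otimes>\<^sub>A (der a y \<otimes>\<^sub>A z))"
 using y z by (simp add: A.finsum_ldistr Pi_def A.m_assoc cong: A.finsum_cong)
 have "y \<otimes>\<^sub>A z = (?v \<oplus>\<^sub>A ?a) \<otimes>\<^sub>A z" using expand_der[OF y] by simp
 thus ?thesis using c z by (simp add: A.l_distr v a)
qed

lemma fin_dim_A: "vectorspace.fin_dim K A"
proof -
 let ?B = "path_element K ` paths Q"
 have pc: "path_element K w : \<A>" if "w : paths Q" for w using that by (auto simp: mem_A path_element_def)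
 hence B: "?B \<subseteq> \<A>" "finite ?B" using finite_paths by auto
 have inj: "inj_on (path_element K) (paths Q)" by (rule inj_onI) (metis K.one_not_zero path_element_def)
 have "\<A> \<subseteq> M.span ?B"
 proof
 fix f assume f: "f : \<A>"
 define a where "a v = f (the_inv_into (paths Q) (path_element K) v)" for v
 have aw: "a (path_element K w) = f w" if "w : paths Q" for w using the_inv_into_f_f[OF inj that] by (simp add: a_def)
 have ac: "a : ?B \<rightarrow> carrier K" using aw A_val[OF f] by auto
 have "M.lincomb a ?B = (\<Oplus>\<^sub>A w\<in>paths Q. a (path_element K w) \<odot>\<^sub>A path_element K w)"
 unfolding M.lincomb_def using inj ac pc by (intro A.finsum_reindex) auto
 also have "... = f"
 proof
 fix u
 have "(\<Oplus>\<^sub>A w\<in>paths Q. a (path_element K w) \<odot>\<^sub>A path_element K w) u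
 = (\<Oplus>\<^sub>K w\<in>paths Q. (a (path_element K w) \<odot>\<^sub>A path_element K w) u)"
 using finite_paths pc aw A_val[OF f] by (intro A_finsum) auto
 also have "... = (\<Oplus>\<^sub>K w\<in>paths Q. if u = w then f w else \<zero>\<^sub>K)"
 using aw A_val[OF f] by (intro K.finsum_cong') (auto simp: path_element_def)
 also have "... = f u"
 proof (cases "u : paths Q")
 case True thus ?thesis using finite_paths A_val[OF f] by (intro K.finsum_singleton) auto
 next
 case False
 hence "f u = \<zero>\<^sub>K" using f unfolding mem_A by blast
 moreover have "(\<Oplus>\<^sub>K w\<in>paths Q. if u = w then f w else \<zero>\<^sub>K) = \<zero>\<^sub>K"
 using False by (intro K.add.finprod_one_eqI) auto
 ultimately show ?thesis by simp
 qed
 finally show "(\<Oplus>\<^sub>A w\<in>paths Q. a (path_element K w) \<odot>\<^sub>A path_element K w) u = f u" .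
 qed
 finally show "f : M.span ?B" using M.finite_span[OF B(2,1)] ac by auto
 qed
 thus ?thesis using B M.span_is_subset2[OF B(1)] by (auto simp: kA.fin_dim_def)
qed
end
section \<open>Relations\<close>

locale quiver_relations = acyclic_path_algebra K Q for K :: "'k ring" and Q :: "('v, 'a) pre_digraph" +
 fixes I R :: "(('v, 'a) path => 'k) set"
 assumes ideal_I: "ideal I (path_algebra K Q)" and I_filt: "I \<subseteq> filt 2" and relations: "system_of_relations K Q I R"
begin
interpretation K: field K by (rule field_K)
interpretation Q: fin_digraph Q by (rule fin_Q)
interpretation A: ring "path_algebra K Q" by (rule ring_A)
interpretation kA: kalgebra K A by (rule kalgebra_A)
interpretation I: ideal I "path_algebra K Q" by (rule ideal_I)

declare A_simps [simp del]
text \<open>The endpoints of a relation are chosen at this stage: their uniqueness rests on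
  \<open>r\<close> being nonzero, which is shown in \<open>R_nonzero\<close>.\<close>

definition rsrc where "rsrc r = (SOME s. s : verts Q & vid s \<otimes>\<^sub>A r = r)"
definition rtrg where "rtrg r = (SOME t. t : verts Q & r \<otimes>\<^sub>A vid t = r)"

lemma I_carrier: "f : I ==> f : \<A>" by (rule I.Icarr)
lemma I_filt_1: "f : I ==> f : filt 1" using I_filt filt_antimono[of 1 2] by auto

lemma R_corner:
 assumes "r : R"
 shows "EX x:verts Q. EX y:verts Q. r : I & vid x \<otimes>\<^sub>A r = r & r \<otimes>\<^sub>A vid y = r"
proof -
 from assms relations obtain x y f where xy: "x : verts Q" "y : verts Q" "f : I"
 and r: "r = vid x \<otimes>\<^sub>A f \<otimes>\<^sub>A vid y" unfolding system_of_relations_def corner_def by blast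
 have f: "f : \<A>" using xy by (simp add: I_carrier)
 have "vid x \<otimes>\<^sub>A r = (vid x \<otimes>\<^sub>A vid x) \<otimes>\<^sub>A f \<otimes>\<^sub>A vid y"
 using xy f by (simp add: r A.m_assoc)
 moreover have "r \<otimes>\<^sub>A vid y = vid x \<otimes>\<^sub>A f \<otimes>\<^sub>A (vid y \<otimes>\<^sub>A vid y)"
 using xy f by (simp add: r A.m_assoc)
 ultimately show ?thesis using xy f r I.I_l_closed I.I_r_closed by (intro bexI[of _ x] bexI[of _ y]) (auto simp: vid_mult_vid)
qed

lemma
 assumes "r : R" shows R_I: "r : I" and R_carrier: "r : \<A>" and rsrc: "rsrc r : verts Q" "vid (rsrc r) \<otimes>\<^sub>A r = r"
 and rtrg: "rtrg r : verts Q" "r \<otimes>\<^sub>A vid (rtrg r) = r"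
proof -
 from R_corner[OF assms] obtain x y where xy: "x : verts Q & vid x \<otimes>\<^sub>A r = r" "y : verts Q & r \<otimes>\<^sub>A vid y = r"
 and I: "r : I" by blast
 show "r : I" "r : \<A>" using I I_carrier by auto
 show "rsrc r : verts Q" "vid (rsrc r) \<otimes>\<^sub>A r = r" unfolding rsrc_def by (rule someI2[of _ x], use xy in auto)+
 show "rtrg r : verts Q" "r \<otimes>\<^sub>A vid (rtrg r) = r" unfolding rtrg_def by (rule someI2[of _ y], use xy in auto)+
qed

lemma ideal_finsum:
 assumes "ideal J A" "finite S" "!!s. s : S ==> g s : J" shows "finsum A g S : J"
proof -
 interpret J: ideal J "path_algebra K Q" by fact
 show ?thesis using assms(2,3) by (induction S rule: finite_induct) (auto simp: Pi_def)
qed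

lemma mem_ideal_add: "z : J <+>\<^bsub>A\<^esub> J' \<longleftrightarrow> (EX a:J. EX b:J'. z = a \<oplus>\<^sub>A b)" by (auto simp: set_add_def')

text \<open>By nilpotency of the arrow ideal, a relation which lies in the ideal generated by the others
 modulo \<open>J I + I J\<close> already lies in that ideal.\<close>

lemma relations_independent:
 assumes F: "finite F" "F \<subseteq> R" and w: "!!r. r : F ==> w r : \<A>" "!!r. r : F ==> vid (rtrg r) \<otimes>\<^sub>A w r = w r"
 and i: "!!a. a : arcs Q ==> i a : I"
 and eq: "(\<Oplus>\<^sub>A r\<in>F. r \<otimes>\<^sub>A w r) = (\<Oplus>\<^sub>A a\<in>arcs Q. arr a \<otimes>\<^sub>A i a)"
 and r0: "r0 : F" shows "w r0 (rtrg r0, []) = \<zero>\<^sub>K"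
proof (rule ccontr)
 define c where "c = w r0 (rtrg r0, [])"
 assume "w r0 (rtrg r0, []) ~= \<zero>\<^sub>K"
 hence c: "c ~= \<zero>\<^sub>K" "c : carrier K" using A_val w r0 by (auto simp: c_def)
 have r0R: "r0 : R" using r0 F by auto
 have Rc: "R \<subseteq> \<A>" using R_carrier by auto
 define I' where "I' = genideal A (R - {r0})"
 have I': "ideal I' A" unfolding I'_def using Rc by (intro A.genideal_ideal) auto
 have RI': "R - {r0} \<subseteq> I'" unfolding I'_def using Rc by (intro A.genideal_self) auto
 interpret I': ideal I' "path_algebra K Q" by fact
 define t where "t = vid (rtrg r0)"
 have t: "t : \<A>" using rtrg[OF r0R] by (simp add: t_def)
 \<comment> \<open>Subtracting the constant term \<open>c\<close> leaves a coefficient without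
   trivial paths, so \<open>r0 w'\<close> belongs to \<open>I\<close> times the arrow ideal.\<close>
 define w' where "w' = w r0 \<ominus>\<^sub>A c \<odot>\<^sub>A t"
 have w0: "w r0 : \<A>" using w r0 by auto
 have w'c: "w' : \<A>" using w0 t c by (simp add: w'_def)
 have w': "w' : filt 1" unfolding filt_1_iff[OF w'c]
 proof
 fix x assume "x : verts Q"
 show "w' (x, []) = \<zero>\<^sub>K"
 proof (cases "x = rtrg r0")
 case True
 thus ?thesis using c t w0 A_val[OF w0] by (simp add: A_simps w'_def a_minus_def A_neg t_def val_vid c_def[symmetric] K.r_neg)
 next
 case False
 thus ?thesis using c t w0 vid_fixed_val[OF w0 w(2)[OF r0], of x] by (simp add: A_simps w'_def a_minus_def A_neg t_def val_vid)
 qed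
 qed
 \<comment> \<open>Substituting \<open>I \<subseteq> I' + filt n\<close> into products of
   \<open>I\<close> with elements of positive length moves the remainder one step down the
   filtration; it disappears once \<open>n\<close> reaches the number of points.\<close>
 have "I \<subseteq> I' <+>\<^bsub>A\<^esub> filt n" for n
 proof (induction n)
 case 0
 show ?case
 proof
 fix z assume "z : I"
 hence "z = \<zero>\<^sub>A \<oplus>\<^sub>A z" "z : filt 0" using I_carrier filt_0 by auto
 thus "z : I' <+>\<^bsub>A\<^esub> filt 0" using I'.zero_closed unfolding mem_ideal_add by blast
 qed
 next
 case (Suc n)
 define T where "T = I' <+>\<^bsub>A\<^esub> filt (Suc n)"
 have T: "ideal T A" unfolding T_def by (rule A.add_ideals[OF I' filt_ideal])
 interpret T: ideal T "path_algebra K Q" by fact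
 have I'T: "z : T" if "z : I'" for z
 proof -
 have "z = z \<oplus>\<^sub>A \<zero>\<^sub>A" using that I'.Icarr by simp
 thus ?thesis using that filt_zero unfolding T_def mem_ideal_add by blast
 qed
 have fT: "z : T" if "z : filt (Suc n)" for z
 proof -
 have "z = \<zero>\<^sub>A \<oplus>\<^sub>A z" using that filt_carrier by simp
 thus ?thesis using that I'.zero_closed unfolding T_def mem_ideal_add by blast
 qed
 have left: "y \<otimes>\<^sub>A z : T" if "y : filt 1" "z : I" for y z
 proof -
 from that(2) Suc obtain u v where "z = u \<oplus>\<^sub>A v" "u : I'" "v : filt n" unfolding mem_ideal_add by (auto simp: subset_iff mem_ideal_add)
 moreover from this have "y \<otimes>\<^sub>A z = y \<otimes>\<^sub>A u \<oplus>\<^sub>A y \<otimes>\<^sub>A v"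
 using that filt_carrier I'.Icarr by (simp add: A.r_distr)
 moreover have "y \<otimes>\<^sub>A u : T" using calculation that filt_carrier by (intro I'T I'.I_l_closed)
 moreover have "y \<otimes>\<^sub>A v : T" using calculation filt_mult[OF that(1), of v n] by (intro fT) simp
 ultimately show ?thesis by (simp add: T.a_closed)
 qed
 have right: "z \<otimes>\<^sub>A y : T" if "y : filt 1" "z : I" for y z
 proof -
 from that(2) Suc obtain u v where "z = u \<oplus>\<^sub>A v" "u : I'" "v : filt n" unfolding mem_ideal_add by (auto simp: subset_iff mem_ideal_add)
 moreover from this have "z \<otimes>\<^sub>A y = u \<otimes>\<^sub>A y \<oplus>\<^sub>A v \<otimes>\<^sub>A y"
 using that filt_carrier I'.Icarr by (simp add: A.l_distr)
 moreover have "u \<otimes>\<^sub>A y : T" using calculation that filt_carrier by (intro I'T I'.I_r_closed)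
 moreover have "v \<otimes>\<^sub>A y : T" using calculation filt_mult[OF _ that(1), of v n] by (intro fT) simp
 ultimately show ?thesis by (simp add: T.a_closed)
 qed
 have r0c: "r0 : \<A>" by (rule R_carrier[OF r0R])
 have rest: "(\<Oplus>\<^sub>A r\<in>F - {r0}. r \<otimes>\<^sub>A w r) : T" using F RI' w by (intro ideal_finsum[OF T] I'T I'.I_r_closed) auto
 have sum: "(\<Oplus>\<^sub>A a\<in>arcs Q. arr a \<otimes>\<^sub>A i a) : T" using i arr_filt by (intro ideal_finsum[OF T] left) auto
 have wr: "r \<otimes>\<^sub>A w r : \<A>" if "r : F" for r using that F w R_carrier by auto
 have "(\<Oplus>\<^sub>A r\<in>insert r0 (F - {r0}). r \<otimes>\<^sub>A w r) = r0 \<otimes>\<^sub>A w r0 \<oplus>\<^sub>A (\<Oplus>\<^sub>A r\<in>F - {r0}. r \<otimes>\<^sub>A w r)"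
 using F wr r0 by (intro A.finsum_insert) auto
 hence "r0 \<otimes>\<^sub>A w r0 = (\<Oplus>\<^sub>A a\<in>arcs Q. arr a \<otimes>\<^sub>A i a) \<ominus>\<^sub>A (\<Oplus>\<^sub>A r\<in>F - {r0}. r \<otimes>\<^sub>A w r)"
 using eq r0 wr[OF r0] T.Icarr[OF rest] by (simp add: insert_absorb a_minus_def A.a_assoc A.r_neg)
 hence "r0 \<otimes>\<^sub>A w r0 : T" using sum rest by (simp add: a_minus_def)
 moreover have "r0 \<otimes>\<^sub>A w' : T" using right[OF w' R_I[OF r0R]] .
 moreover have "c \<odot>\<^sub>A r0 = r0 \<otimes>\<^sub>A w r0 \<ominus>\<^sub>A r0 \<otimes>\<^sub>A w'"
 proof -
 have "w r0 = w' \<oplus>\<^sub>A c \<odot>\<^sub>A t" using w0 t c by (simp add: w'_def a_minus_def A.a_assoc A.l_neg)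
 hence "r0 \<otimes>\<^sub>A w r0 = r0 \<otimes>\<^sub>A w' \<oplus>\<^sub>A c \<odot>\<^sub>A r0"
 using r0c w'c t c rtrg[OF r0R] by (simp add: A.r_distr kA.smult_mult_right[symmetric] t_def)
 also have "... = c \<odot>\<^sub>A r0 \<oplus>\<^sub>A r0 \<otimes>\<^sub>A w'" using r0c w'c c by (intro A.a_comm) auto
 finally show ?thesis using r0c w'c c by (simp add: a_minus_def A.a_assoc A.r_neg)
 qed
 ultimately have "c \<odot>\<^sub>A r0 : T" by (simp add: a_minus_def)
 hence "(inv\<^bsub>K\<^esub> c \<odot>\<^sub>A \<one>\<^sub>A) \<otimes>\<^sub>A (c \<odot>\<^sub>A r0) : T"
 using c by (intro T.I_l_closed) (auto simp: K.field_Units)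
 hence "r0 : T" using c r0c by (simp add: kA.smult_mult_left[symmetric] kA.smult_assoc1[symmetric] K.field_Units)
 hence "R \<subseteq> T" using RI' I'T by auto
 hence "genideal A R \<subseteq> T" by (rule A.genideal_minimal[OF T])
 thus ?case using relations by (simp add: system_of_relations_def T_def)
 qed
 from this[of "card (verts Q)"] have "I \<subseteq> I'" using I'.Icarr by (auto simp: filt_top subset_iff mem_ideal_add)
 moreover have "I' \<subseteq> I" unfolding I'_def using R_I by (intro A.genideal_minimal[OF ideal_I]) auto
 ultimately have "genideal A (R - {r0}) = I" by (auto simp: I'_def)
 moreover have "R - {r0} \<subset> R" using r0R by auto
 ultimately show False using relations unfolding system_of_relations_def by blast
qed

text \<open>A linear dependency among relations is the case of \<open>relations_independent\<close>
  in which each \<open>w r\<close> is a scalar multiple of an idempotent and the arrow terms are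
  zero. Hence \<open>R\<close> is linearly independent in a finite-dimensional space.\<close>

lemma finite_R: "finite R"
proof (rule kA.fin_dim_li_fin[OF fin_dim_A])
 show "R \<subseteq> \<A>" using R_carrier by auto
 show "\<not> kA.lin_dep R"
 proof
 assume "kA.lin_dep R"
 then obtain F a r0 where F: "finite F" "F \<subseteq> R" and a: "a : F \<rightarrow> carrier K"
 and z: "kA.lincomb a F = \<zero>\<^sub>A" and r0: "r0 : F" "a r0 ~= \<zero>\<^sub>K" unfolding kA.lin_dep_def by blast
 have ac: "a r : carrier K" if "r : F" for r using a that by auto
 have "(\<Oplus>\<^sub>A r\<in>F. r \<otimes>\<^sub>A (a r \<odot>\<^sub>A vid (rtrg r))) = kA.lincomb a F" unfolding kA.lincomb_def
 using F ac R_carrier rtrg by (intro A.finsum_cong') (auto simp: kA.smult_mult_right[symmetric] subset_iff)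
 also have "... = (\<Oplus>\<^sub>A b\<in>arcs Q. arr b \<otimes>\<^sub>A \<zero>\<^sub>A)" using z by (subst A.add.finprod_one_eqI) auto
 finally have eq: "(\<Oplus>\<^sub>A r\<in>F. r \<otimes>\<^sub>A (a r \<odot>\<^sub>A vid (rtrg r))) = (\<Oplus>\<^sub>A b\<in>arcs Q. arr b \<otimes>\<^sub>A \<zero>\<^sub>A)" .
 have "(a r0 \<odot>\<^sub>A vid (rtrg r0)) (rtrg r0, []) = \<zero>\<^sub>K"
 proof (rule relations_independent[OF F _ _ _ eq r0(1)])
 fix r assume r: "r : F"
 hence rR: "r : R" using F by auto
 show "a r \<odot>\<^sub>A vid (rtrg r) : \<A>" using ac r rtrg[OF rR] by simp
 show "vid (rtrg r) \<otimes>\<^sub>A (a r \<odot>\<^sub>A vid (rtrg r)) = a r \<odot>\<^sub>A vid (rtrg r)"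
 using ac r rtrg[OF rR] by (simp add: kA.smult_mult_right[symmetric] vid_mult_vid)
 qed simp
 thus False using r0 ac by (simp add: A_simps val_vid)
 qed
qed

text \<open>If \<open>r\<close> were zero, the idempotent at its end would be an admissible
  coefficient in \<open>relations_independent\<close>, with constant term one.\<close>

lemma R_nonzero: "r : R ==> r ~= \<zero>\<^sub>A"
proof
 assume r: "r : R" "r = \<zero>\<^sub>A"
 have eq: "(\<Oplus>\<^sub>A q\<in>{r}. q \<otimes>\<^sub>A vid (rtrg q)) = (\<Oplus>\<^sub>A b\<in>arcs Q. arr b \<otimes>\<^sub>A \<zero>\<^sub>A)"
 using r rtrg[OF r(1)] by (subst (2) A.add.finprod_one_eqI) auto
 have "vid (rtrg r) (rtrg r, []) = \<zero>\<^sub>K"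
 by (rule relations_independent[OF _ _ _ _ _ eq]) (use r rtrg[OF r(1)] in \<open>auto simp: vid_mult_vid\<close>)
 thus False by (simp add: val_vid)
qed

text \<open>Modulo the arrow ideal times \<open>I\<close>, the relations generate \<open>I\<close>
  already from the right. The set \<open>T\<close> of all sums of this shape is shown to be a
  two-sided ideal containing \<open>R\<close>, so it contains \<open>I\<close>.\<close>

lemma relations_generate:
 assumes z: "z : I"
 shows "EX w i. (ALL r:R. w r : \<A> & vid (rtrg r) \<otimes>\<^sub>A w r = w r) & (ALL a:arcs Q. i a : I) \<and>
 z = (\<Oplus>\<^sub>A r\<in>R. r \<otimes>\<^sub>A w r) \<oplus>\<^sub>A (\<Oplus>\<^sub>A a\<in>arcs Q. arr a \<otimes>\<^sub>A i a)"
proof -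
 define sm where "sm w i = (\<Oplus>\<^sub>A r\<in>R. r \<otimes>\<^sub>A w r) \<oplus>\<^sub>A (\<Oplus>\<^sub>A a\<in>arcs Q. arr a \<otimes>\<^sub>A i a)" for w i
 define T where "T = {sm w i | w i. w : R \<rightarrow> \<A> & i : arcs Q \<rightarrow> I}"
 have rw: "(%r. r \<otimes>\<^sub>A w r) : R \<rightarrow> \<A>" if "w : R \<rightarrow> \<A>" for w using that R_carrier by auto
 have ai: "(%a. arr a \<otimes>\<^sub>A i a) : arcs Q \<rightarrow> \<A>" if "i : arcs Q \<rightarrow> I" for i
 using that by (intro Pi_I A.m_closed) (auto intro: I_carrier)
 have smT: "sm w i : T" if "w : R \<rightarrow> \<A>" "i : arcs Q \<rightarrow> I" for w i unfolding T_def using that by blast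
 have TI: "z : I" if z: "z : T" for z
 proof -
 from z obtain w i where wi: "z = sm w i" "w : R \<rightarrow> \<A>" "i : arcs Q \<rightarrow> I" by (auto simp: T_def)
 have "(\<Oplus>\<^sub>A r\<in>R. r \<otimes>\<^sub>A w r) : I" using wi R_I finite_R by (intro ideal_finsum[OF ideal_I] I.I_r_closed) auto
 moreover have "(\<Oplus>\<^sub>A a\<in>arcs Q. arr a \<otimes>\<^sub>A i a) : I" using wi by (intro ideal_finsum[OF ideal_I] I.I_l_closed) auto
 ultimately show ?thesis by (simp add: wi sm_def)
 qed
 have T_add: "z \<oplus>\<^sub>A z' : T" if zz: "z : T" "z' : T" for z z'
 proof -
 from zz obtain w i w' i' where wi: "z = sm w i" "w : R \<rightarrow> \<A>" "i : arcs Q \<rightarrow> I"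
 and wi': "z' = sm w' i'" "w' : R \<rightarrow> \<A>" "i' : arcs Q \<rightarrow> I" unfolding T_def by blast
 have "sm (%r. w r \<oplus>\<^sub>A w' r) (%a. i a \<oplus>\<^sub>A i' a) =
 ((\<Oplus>\<^sub>A r\<in>R. r \<otimes>\<^sub>A w r) \<oplus>\<^sub>A (\<Oplus>\<^sub>A r\<in>R. r \<otimes>\<^sub>A w' r)) \<oplus>\<^sub>A
 ((\<Oplus>\<^sub>A a\<in>arcs Q. arr a \<otimes>\<^sub>A i a) \<oplus>\<^sub>A (\<Oplus>\<^sub>A a\<in>arcs Q. arr a \<otimes>\<^sub>A i' a))"
 proof -
 have "(\<Oplus>\<^sub>A r\<in>R. r \<otimes>\<^sub>A (w r \<oplus>\<^sub>A w' r)) = (\<Oplus>\<^sub>A r\<in>R. r \<otimes>\<^sub>A w r \<oplus>\<^sub>A r \<otimes>\<^sub>A w' r)"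
 using wi wi' R_carrier by (intro A.finsum_cong') (auto simp: A.r_distr Pi_iff)
 moreover have "(\<Oplus>\<^sub>A a\<in>arcs Q. arr a \<otimes>\<^sub>A (i a \<oplus>\<^sub>A i' a)) = (\<Oplus>\<^sub>A a\<in>arcs Q. arr a \<otimes>\<^sub>A i a \<oplus>\<^sub>A arr a \<otimes>\<^sub>A i' a)"
 using wi wi' I_carrier by (intro A.finsum_cong') (auto simp: A.r_distr Pi_iff)
 ultimately show ?thesis unfolding sm_def using rw wi wi' ai by (simp add: A.finsum_addf)
 qed
 also have "... = z \<oplus>\<^sub>A z'" using A.finsum_closed[OF rw] A.finsum_closed[OF ai] wi wi' by (simp add: sm_def A.a_ac)
 finally have "z \<oplus>\<^sub>A z' = sm (%r. w r \<oplus>\<^sub>A w' r) (%a. i a \<oplus>\<^sub>A i' a)" ..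
 moreover have "(%r. w r \<oplus>\<^sub>A w' r) : R \<rightarrow> \<A>" "(%a. i a \<oplus>\<^sub>A i' a) : arcs Q \<rightarrow> I"
 using wi wi' by auto
 ultimately show ?thesis unfolding T_def by blast
 qed
 have T_zero: "\<zero>\<^sub>A : T"
 proof -
 have "sm (%_. \<zero>\<^sub>A) (%_. \<zero>\<^sub>A) = \<zero>\<^sub>A"
 unfolding sm_def using R_carrier by (subst (1 2) A.add.finprod_one_eqI) auto
 moreover have "sm (%_. \<zero>\<^sub>A) (%_. \<zero>\<^sub>A) : T" by (rule smT) auto
 ultimately show ?thesis by simp
 qed
 have T_right: "z \<otimes>\<^sub>A y : T" if z: "z : T" and y: "y : \<A>" for z y
 proof -
 from z obtain w i where wi: "z = sm w i" "w : R \<rightarrow> \<A>" "i : arcs Q \<rightarrow> I" unfolding T_def by blast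
 have "z \<otimes>\<^sub>A y = (\<Oplus>\<^sub>A r\<in>R. r \<otimes>\<^sub>A w r) \<otimes>\<^sub>A y \<oplus>\<^sub>A (\<Oplus>\<^sub>A a\<in>arcs Q. arr a \<otimes>\<^sub>A i a) \<otimes>\<^sub>A y"
 using A.finsum_closed[OF rw[OF wi(2)]] A.finsum_closed[OF ai[OF wi(3)]] y by (simp add: wi sm_def A.l_distr)
 also have "(\<Oplus>\<^sub>A r\<in>R. r \<otimes>\<^sub>A w r) \<otimes>\<^sub>A y = (\<Oplus>\<^sub>A r\<in>R. r \<otimes>\<^sub>A w r \<otimes>\<^sub>A y)"
 using finite_R y rw[OF wi(2)] by (rule A.finsum_ldistr)
 also have "... = (\<Oplus>\<^sub>A r\<in>R. r \<otimes>\<^sub>A (w r \<otimes>\<^sub>A y))"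
 using wi y R_carrier by (intro A.finsum_cong') (auto simp: A.m_assoc Pi_iff)
 also have "(\<Oplus>\<^sub>A a\<in>arcs Q. arr a \<otimes>\<^sub>A i a) \<otimes>\<^sub>A y = (\<Oplus>\<^sub>A a\<in>arcs Q. arr a \<otimes>\<^sub>A i a \<otimes>\<^sub>A y)"
 using Q.finite_arcs y ai[OF wi(3)] by (rule A.finsum_ldistr)
 also have "... = (\<Oplus>\<^sub>A a\<in>arcs Q. arr a \<otimes>\<^sub>A (i a \<otimes>\<^sub>A y))"
 proof (rule A.finsum_cong')
 fix a assume a: "a : arcs Q"
 hence "i a : \<A>" using wi by (auto intro: I_carrier)
 thus "arr a \<otimes>\<^sub>A i a \<otimes>\<^sub>A y = arr a \<otimes>\<^sub>A (i a \<otimes>\<^sub>A y)" using a y by (simp add: A.m_assoc)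
 next
 show "(%a. arr a \<otimes>\<^sub>A (i a \<otimes>\<^sub>A y)) : arcs Q \<rightarrow> \<A>"
 using wi y by (intro Pi_I A.m_closed) (auto intro: I_carrier)
 qed simp
 finally have "z \<otimes>\<^sub>A y = sm (%r. w r \<otimes>\<^sub>A y) (%a. i a \<otimes>\<^sub>A y)" by (simp add: sm_def)
 moreover have "(%r. w r \<otimes>\<^sub>A y) : R \<rightarrow> \<A>" "(%a. i a \<otimes>\<^sub>A y) : arcs Q \<rightarrow> I"
 using wi y I.I_r_closed by auto
 ultimately show ?thesis unfolding T_def by blast
 qed
 have T_r: "r \<otimes>\<^sub>A y : T" if r: "r : R" and y: "y : \<A>" for r y
 proof -
 have "(\<Oplus>\<^sub>A q\<in>R. q \<otimes>\<^sub>A (if r = q then y else \<zero>\<^sub>A)) = (\<Oplus>\<^sub>A q\<in>R. if r = q then r \<otimes>\<^sub>A y else \<zero>\<^sub>A)"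
 using r y R_carrier by (intro A.finsum_cong') auto
 also have "... = r \<otimes>\<^sub>A y" using r y R_carrier finite_R by (intro A.finsum_singleton) auto
 finally have "sm (%q. if r = q then y else \<zero>\<^sub>A) (%_. \<zero>\<^sub>A) = r \<otimes>\<^sub>A y"
 unfolding sm_def using r y R_carrier by (subst (2) A.add.finprod_one_eqI) auto
 moreover have "sm (%q. if r = q then y else \<zero>\<^sub>A) (%_. \<zero>\<^sub>A) : T" using y by (intro smT) auto
 ultimately show ?thesis by simp
 qed
 have T_a: "arr a \<otimes>\<^sub>A y : T" if a: "a : arcs Q" and y: "y : I" for a y
 proof -
 have yc: "y : \<A>" using y by (rule I_carrier)
 have "(\<Oplus>\<^sub>A b\<in>arcs Q. arr b \<otimes>\<^sub>A (if a = b then y else \<zero>\<^sub>A)) = (\<Oplus>\<^sub>A b\<in>arcs Q. if a = b then arr b \<otimes>\<^sub>A y else \<zero>\<^sub>A)"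
 using a yc by (intro A.finsum_cong') auto
 also have "... = arr a \<otimes>\<^sub>A y" using a yc by (intro A.finsum_singleton) auto
 finally have "sm (%_. \<zero>\<^sub>A) (%b. if a = b then y else \<zero>\<^sub>A) = arr a \<otimes>\<^sub>A y"
 unfolding sm_def using a yc R_carrier by (subst (1) A.add.finprod_one_eqI) auto
 moreover have "sm (%_. \<zero>\<^sub>A) (%b. if a = b then y else \<zero>\<^sub>A) : T" using y by (intro smT) auto
 ultimately show ?thesis by simp
 qed
 have T_sum: "finsum A g S : T" if "finite S" "!!s. s : S ==> g s : T" for g and S :: "'z set"
 proof -
 have "finsum A g S : T & finsum A g S : \<A>" using that
 proof (induction S rule: finite_induct)
 case (insert s S)
 hence "g s : \<A>" "g : S \<rightarrow> \<A>" using TI I_carrier by auto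
 thus ?case using insert T_add by auto
 qed (simp add: T_zero)
 thus ?thesis ..
 qed
 \<comment> \<open>For \<open>z\<close> starting at a single point, \<open>left_split\<close> writes
   \<open>y z\<close> as a scalar multiple of \<open>z\<close>, which stays in \<open>T\<close>,
   plus arrows times elements of \<open>I\<close>.\<close>
 have split: "y \<otimes>\<^sub>A z : T" if z: "z : T" and s: "s : verts Q" "vid s \<otimes>\<^sub>A z = z" and y: "y : \<A>" for s z y
 proof -
 have zc: "z : \<A>" "z : I" using z TI I_carrier by auto
 have k: "y (s, []) : carrier K" using A_val y by auto
 have "y (s, []) \<odot>\<^sub>A z = z \<otimes>\<^sub>A (y (s, []) \<odot>\<^sub>A \<one>\<^sub>A)"
 using zc k by (simp add: kA.smult_mult_right[symmetric])
 hence "y (s, []) \<odot>\<^sub>A z : T" using T_right[OF z, of "y (s, []) \<odot>\<^sub>A \<one>\<^sub>A"] k by simp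
 moreover have "(\<Oplus>\<^sub>A a\<in>arcs Q. arr a \<otimes>\<^sub>A (der a y \<otimes>\<^sub>A z)) : T"
 using y zc by (intro T_sum[OF Q.finite_arcs] T_a I.I_l_closed) auto
 ultimately show ?thesis using left_split[OF y zc(1) s] T_add by simp
 qed
 have T_left: "y \<otimes>\<^sub>A z : T" if z: "z : T" and y: "y : \<A>" for z y
 proof -
 from z obtain w i where wi: "z = sm w i" "w : R \<rightarrow> \<A>" "i : arcs Q \<rightarrow> I" unfolding T_def by blast
 have "y \<otimes>\<^sub>A z = y \<otimes>\<^sub>A (\<Oplus>\<^sub>A r\<in>R. r \<otimes>\<^sub>A w r) \<oplus>\<^sub>A y \<otimes>\<^sub>A (\<Oplus>\<^sub>A a\<in>arcs Q. arr a \<otimes>\<^sub>A i a)"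
 using A.finsum_closed[OF rw[OF wi(2)]] A.finsum_closed[OF ai[OF wi(3)]] y by (simp add: wi sm_def A.r_distr)
 also have "... = (\<Oplus>\<^sub>A r\<in>R. y \<otimes>\<^sub>A (r \<otimes>\<^sub>A w r)) \<oplus>\<^sub>A (\<Oplus>\<^sub>A a\<in>arcs Q. y \<otimes>\<^sub>A (arr a \<otimes>\<^sub>A i a))"
 using A.finsum_rdistr[OF finite_R y rw[OF wi(2)]] A.finsum_rdistr[OF Q.finite_arcs y ai[OF wi(3)]] by simp
 finally have eq: "y \<otimes>\<^sub>A z = ..." .
 have "(\<Oplus>\<^sub>A r\<in>R. y \<otimes>\<^sub>A (r \<otimes>\<^sub>A w r)) : T"
 proof (rule T_sum[OF finite_R])
 fix r assume r: "r : R"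
 have wr: "w r : \<A>" using r wi by auto
 show "y \<otimes>\<^sub>A (r \<otimes>\<^sub>A w r) : T" by (rule split[of _ "rsrc r"])
 (use wr T_r[OF r wr] rsrc[OF r] R_carrier[OF r] y in \<open>auto simp: A.m_assoc[symmetric]\<close>)
 qed
 moreover have "(\<Oplus>\<^sub>A a\<in>arcs Q. y \<otimes>\<^sub>A (arr a \<otimes>\<^sub>A i a)) : T"
 proof (rule T_sum[OF Q.finite_arcs])
 fix a assume a: "a : arcs Q"
 have ia: "i a : I" using wi a by auto
 hence "i a : \<A>" by (rule I_carrier)
 with ia show "y \<otimes>\<^sub>A (arr a \<otimes>\<^sub>A i a) : T" by (intro split[OF T_a[OF a] Q.tail_in_verts[OF a] _ y])
 (use a in \<open>auto simp: A.m_assoc[symmetric] vid_mult_arr\<close>)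
 qed
 ultimately show ?thesis using T_add by (simp add: eq)
 qed
 have "ideal T A"
 proof (rule idealI[OF ring_A])
 show "subgroup T (add_monoid A)"
 proof
 show "T \<subseteq> carrier (add_monoid A)" using TI I_carrier by auto
 fix z assume z: "z : T"
 have "z \<otimes>\<^sub>A (\<ominus>\<^sub>A \<one>\<^sub>A) : T" using z by (intro T_right) auto
 hence "\<ominus>\<^sub>A z : T" using z TI I_carrier by (simp add: A.r_minus)
 thus "inv\<^bsub>add_monoid A\<^esub> z : T" by (simp add: a_inv_def)
 qed (use T_add T_zero in auto)
 qed (use T_left T_right in auto)
 moreover have "R \<subseteq> T"
 proof
 fix r assume "r : R"
 thus "r : T" using T_r[of r "\<one>\<^sub>A"] R_carrier by simp
 qed
 ultimately have "genideal A R \<subseteq> T" by (rule A.genideal_minimal)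
 hence "z : T" using z relations by (auto simp: system_of_relations_def)
 then obtain w i where wi: "z = sm w i" "w : R \<rightarrow> \<A>" "i : arcs Q \<rightarrow> I" unfolding T_def by blast
 \<comment> \<open>The coefficients may be cut on the left by the idempotent at the end of
   \<open>r\<close>, since \<open>r\<close> absorbs it.\<close>
 have "sm w i = sm (%r. vid (rtrg r) \<otimes>\<^sub>A w r) i"
 proof -
 have "(\<Oplus>\<^sub>A r\<in>R. r \<otimes>\<^sub>A w r) = (\<Oplus>\<^sub>A r\<in>R. r \<otimes>\<^sub>A (vid (rtrg r) \<otimes>\<^sub>A w r))"
 proof (rule A.finsum_cong')
 fix r assume r: "r : R"
 hence "w r : \<A>" using wi by auto
 thus "r \<otimes>\<^sub>A w r = r \<otimes>\<^sub>A (vid (rtrg r) \<otimes>\<^sub>A w r)"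
 using rtrg[OF r] R_carrier[OF r] by (simp add: A.m_assoc[symmetric])
 qed (use wi R_carrier rtrg in \<open>auto simp: Pi_iff\<close>)
 thus ?thesis by (simp add: sm_def)
 qed
 moreover have "vid (rtrg r) \<otimes>\<^sub>A (vid (rtrg r) \<otimes>\<^sub>A w r) = vid (rtrg r) \<otimes>\<^sub>A w r" if "r : R" for r
 using that wi rtrg[OF that] by (auto simp: A.m_assoc[symmetric] vid_mult_vid Pi_iff)
 ultimately show ?thesis using wi rtrg by (intro exI[of _ "%r. vid (rtrg r) \<otimes>\<^sub>A w r"] exI[of _ i]) (auto simp: sm_def Pi_iff)
qed
end
section \<open>Algebras split over a nil ideal\<close>

text \<open>An algebra whose quotient by the nil ideal \<open>N\<close> is a product of copies of
  \<open>k\<close>, one for each point; \<open>\<k> x\<close> is the character belonging to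
  \<open>x\<close>. The relation-extension is treated through this interface.\<close>

locale split_nil_algebra =
 fixes K :: "'k ring" and A :: "('k, 'a) module" (structure) and V :: "'v set" and e :: "'v => 'a" and \<k> :: "'v => 'a => 'k"
 assumes kalgebra: "kalgebra K A" and finite_V: "finite V" and e_closed: "x : V ==> e x : carrier A"
 and e_mult: "[|x : V; y : V|] ==> e x \<otimes> e y = (if x = y then e x else \<zero>)" and e_sum: "finsum A e V = \<one>"
 and \<k>_closed: "[|x : V; a : carrier A|] ==> \<k> x a : carrier K"
 and \<k>_add: "[|x : V; a : carrier A; b : carrier A|] ==> \<k> x (a \<oplus> b) = \<k> x a \<oplus>\<^sub>K \<k> x b"
 and \<k>_mult: "[|x : V; a : carrier A; b : carrier A|] ==> \<k> x (a \<otimes> b) = \<k> x a \<otimes>\<^sub>K \<k> x b"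
 and \<k>_smult: "[|x : V; c : carrier K; a : carrier A|] ==> \<k> x (c \<odot> a) = c \<otimes>\<^sub>K \<k> x a"
 and \<k>_e: "[|x : V; y : V|] ==> \<k> x (e y) = (if x = y then \<one>\<^sub>K else \<zero>\<^sub>K)"
 and nil: "[|a : carrier A; !!x. x : V ==> \<k> x a = \<zero>\<^sub>K|] ==> \<exists>k::nat. a [^] k = \<zero>"
begin
interpretation K: field K by (rule kalgebraD(1)[OF kalgebra])
interpretation R: ring A by (rule kalgebraD(2)[OF kalgebra])
interpretation A: kalgebra K A by (rule kalgebra)
definition N :: "'a set" where "N = {a : carrier A. ALL x:V. \<k> x a = \<zero>\<^sub>K}"

lemma \<k>_zero: "x : V ==> \<k> x \<zero> = \<zero>\<^sub>K" using \<k>_add[of x "\<zero>" "\<zero>"] \<k>_closed[of x "\<zero>"]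
 by (metis K.add.l_cancel_one' R.add.one_closed R.l_zero)

lemma \<k>_neg: "x : V ==> a : carrier A ==> \<k> x (\<ominus> a) = \<ominus>\<^sub>K \<k> x a"
 using \<k>_add[of x "\<ominus> a" a] \<k>_closed[of x] \<k>_zero[of x] by (metis K.minus_equality R.a_inv_closed R.l_neg)

lemma \<k>_one: "x : V ==> \<k> x \<one> = \<one>\<^sub>K"
proof -
 assume x: "x : V"
 have "\<k> x (e x) = \<k> x (e x \<otimes> \<one>)" using e_closed[OF x] by simp
 also have "... = \<k> x \<one>" using x e_closed \<k>_closed[OF x] by (simp only: \<k>_mult R.one_closed) (simp add: \<k>_e)
 finally show ?thesis using x by (simp add: \<k>_e)
qed

lemma shows N_carrier: "n : N ==> n : carrier A" and N_zero: "\<zero> : N" and N_add: "[|m : N; n : N|] ==> m \<oplus> n : N"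
 and N_neg: "n : N ==> \<ominus> n : N" and N_smult: "[|c : carrier K; n : N|] ==> c \<odot> n : N"
 and N_mult_left: "[|a : carrier A; n : N|] ==> a \<otimes> n : N" and N_mult_right: "[|a : carrier A; n : N|] ==> n \<otimes> a : N"
 by (auto simp: N_def \<k>_zero \<k>_add \<k>_neg \<k>_smult \<k>_mult \<k>_closed A.smult_closed)

lemma nil_N: "n : N ==> \<exists>k::nat. n [^] k = \<zero>" using nil by (auto simp: N_def)

text \<open>The witness is a partial sum of the geometric series. For nilpotent \<open>n\<close> it
  shows that \<open>1 - n\<close> has a right inverse.\<close>

lemma geometric: "n : carrier A ==> EX b:carrier A. (\<one> \<ominus> n) \<otimes> b = \<one> \<ominus> n [^] (k::nat)"
proof (induction k)
 case 0
 thus ?case by (intro bexI[of _ "\<zero>"]) (auto simp: a_minus_def R.r_neg)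
next
 case (Suc k)
 then obtain b where b: "b : carrier A" "(\<one> \<ominus> n) \<otimes> b = \<one> \<ominus> n [^] k" by blast
 let ?p = "n [^] k"
 have p: "?p : carrier A" using Suc.prems by simp
 have s: "n [^] Suc k = n \<otimes> ?p" using Suc.prems by (rule R.nat_pow_Suc2)
 have "(\<one> \<ominus> n) \<otimes> (b \<oplus> ?p) = (\<one> \<ominus> ?p) \<oplus> (?p \<ominus> n \<otimes> ?p)"
 using Suc.prems b p by (simp add: R.r_distr R.l_distr a_minus_def R.l_minus)
 also have "... = \<one> \<ominus> n \<otimes> ?p" using Suc.prems p by (simp add: a_minus_def R.a_assoc R.r_neg1)
 finally show ?case using b p s by (intro bexI[of _ "b \<oplus> ?p"]) auto
qed

lemma idempotent_in_N:
 assumes f: "f : N" "f \<otimes> f = f" shows "f = \<zero>"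
proof -
 have c: "f : carrier A" using f(1) by (rule N_carrier)
 have p: "f [^] Suc k = f" for k by (induction k) (use c f(2) in auto)
 from nil_N[OF f(1)] obtain k :: nat where "f [^] k = \<zero>" by blast
 hence "f [^] Suc k = \<zero>" using c by simp
 thus ?thesis using p[of k] by simp
qed

text \<open>The kernel of each character is a maximal right ideal, which bounds the radical from
  above. Conversely, a maximal right ideal whose sum with \<open>N\<close> is everything would
  contain an element \<open>1 - m\<close> with \<open>m\<close> nilpotent, which is right invertible
  by \<open>geometric\<close>.\<close>

lemma radical_eq: "radical A = N"
proof
 show "radical A \<subseteq> N"
 proof
 fix a assume a: "a : radical A"
 hence ac: "a : carrier A" by (simp add: radical_def)
 have "\<k> x a = \<zero>\<^sub>K" if x: "x : V" for x
 proof -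
 define J where "J = {a : carrier A. \<k> x a = \<zero>\<^sub>K}"
 have "right_ideal J A" unfolding right_ideal_def
 proof (intro conjI ballI additive_subgroupI)
 show "subgroup J (add_monoid A)" by standard (auto simp: J_def x \<k>_add \<k>_zero \<k>_neg a_inv_def[symmetric])
 qed (auto simp: J_def x \<k>_mult \<k>_closed)
 moreover have "J ~= carrier A" using \<k>_one[OF x] R.one_closed K.one_not_zero unfolding J_def by (metis (mono_tags, lifting) mem_Collect_eq)
 moreover have "J' = J \<or> J' = carrier A" if J': "right_ideal J' A" "J \<subseteq> J'" for J'
 proof (rule disjCI)
 assume "J' ~= carrier A"
 interpret J': additive_subgroup J' A using J' by (simp add: right_ideal_def)
 have "J' \<subseteq> J"
 proof (rule ccontr)
 assume "\<not> J' \<subseteq> J"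
 then obtain j where j: "j : J'" "\<k> x j ~= \<zero>\<^sub>K" using J'.a_subset by (auto simp: J_def)
 have jc: "j : carrier A" using j by auto
 have kj: "\<k> x j : Units K" using j \<k>_closed[OF x jc] by (simp add: K.field_Units)
 have "b : J'" if b: "b : carrier A" for b
 proof -
 let ?s = "(inv\<^bsub>K\<^esub> \<k> x j \<otimes>\<^sub>K \<k> x b) \<odot> \<one>"
 have s: "?s : carrier A" using x b kj \<k>_closed by simp
 have js: "j \<otimes> ?s : J'" using J' j s by (simp add: right_ideal_def)
 have "\<k> x (j \<otimes> ?s) = \<k> x b" using x b kj jc s \<k>_closed by (simp add: \<k>_mult \<k>_smult \<k>_one K.m_assoc[symmetric])
 hence "b \<ominus> j \<otimes> ?s : J" using x b jc s \<k>_closed by (simp add: J_def a_minus_def \<k>_add \<k>_neg K.r_neg)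
 hence "b \<ominus> j \<otimes> ?s \<oplus> j \<otimes> ?s : J'" using J'(2) js by (intro J'.a_closed) auto
 thus "b : J'" using b jc s by (simp add: a_minus_def R.a_assoc R.l_neg)
 qed
 thus False using `J' ~= carrier A` J'.a_subset by auto
 qed
 thus "J' = J" using J'(2) by auto
 qed
 ultimately have "maximal_right_ideal J A" by (auto simp: maximal_right_ideal_def)
 hence "a : J" using a by (auto simp: radical_def)
 thus ?thesis by (simp add: J_def)
 qed
 thus "a : N" using ac by (simp add: N_def)
 qed
 show "N \<subseteq> radical A"
 proof
 fix n assume n: "n : N"
 have "n : J" if J: "maximal_right_ideal J A" for J
 proof -
 interpret J: additive_subgroup J A using J by (simp add: maximal_right_ideal_def right_ideal_def)
 define J' where "J' = {j \<oplus> m | j m. j : J & m : N}"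
 have "right_ideal J' A" unfolding right_ideal_def
 proof (intro conjI ballI additive_subgroupI)
 show "subgroup J' (add_monoid A)"
 proof
 show "J' \<subseteq> carrier (add_monoid A)" using N_carrier by (auto simp: J'_def)
 fix y z assume "y : J'" "z : J'"
 then obtain j m j' m' where "y = j \<oplus> m" "z = j' \<oplus> m'" "j : J" "m : N" "j' : J" "m' : N" by (auto simp: J'_def)
 moreover from this have "y \<oplus> z = (j \<oplus> j') \<oplus> (m \<oplus> m')" using N_carrier by (simp add: R.a_ac)
 ultimately show "y \<otimes>\<^bsub>add_monoid A\<^esub> z : J'" using N_add by (auto simp: J'_def)
 next
 have "\<zero> \<oplus> \<zero> : J'" using N_zero J.zero_closed unfolding J'_def by blast
 thus "\<one>\<^bsub>add_monoid A\<^esub> : J'" by simp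
 next
 fix y assume "y : J'"
 then obtain j m where "y = j \<oplus> m" "j : J" "m : N" by (auto simp: J'_def)
 moreover from this have "\<ominus> y = \<ominus> j \<oplus> \<ominus> m" using N_carrier by (simp add: R.minus_add)
 ultimately have "\<ominus> y : J'" using N_neg by (auto simp: J'_def)
 thus "inv\<^bsub>add_monoid A\<^esub> y : J'" by (simp add: a_inv_def)
 qed
 fix y a assume y: "y : J'" and a: "a : carrier A"
 then obtain j m where "y = j \<oplus> m" "j : J" "m : N" by (auto simp: J'_def)
 moreover from this a J have "j \<otimes> a : J" unfolding maximal_right_ideal_def right_ideal_def by blast
 moreover from calculation a have "y \<otimes> a = j \<otimes> a \<oplus> m \<otimes> a" using N_carrier by (simp add: R.l_distr)
 ultimately show "y \<otimes> a : J'" using N_mult_right[OF a] unfolding J'_def by blast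
 qed
 moreover have "J \<subseteq> J'"
 proof
 fix j assume "j : J"
 hence "j \<oplus> \<zero> : J'" using N_zero unfolding J'_def by blast
 thus "j : J'" using `j : J` by simp
 qed
 ultimately have "J' = J \<or> J' = carrier A" using J by (auto simp: maximal_right_ideal_def)
 moreover have "J' ~= carrier A"
 proof
 assume "J' = carrier A"
 hence "\<one> : J'" by simp
 then obtain j m where jm: "\<one> = j \<oplus> m" "j : J" "m : N" unfolding J'_def by blast
 hence "j = \<one> \<ominus> m" using N_carrier by (simp add: a_minus_def R.a_assoc R.r_neg)
 moreover obtain k :: nat where "m [^] k = \<zero>" using nil_N jm by blast
 ultimately obtain b where b: "b : carrier A" "j \<otimes> b = \<one>" using geometric[of m k] N_carrier[OF jm(3)] by (auto simp: a_minus_def)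
 hence "\<one> : J" using J jm by (metis maximal_right_ideal_def right_ideal_def)
 hence "carrier A \<subseteq> J" using J by (metis R.l_one maximal_right_ideal_def right_ideal_def subsetI)
 thus False using J J.a_subset by (auto simp: maximal_right_ideal_def)
 qed
 ultimately have "J' = J" by blast
 moreover have "\<zero> \<oplus> n : J'" using n J.zero_closed unfolding J'_def by blast
 ultimately show ?thesis using N_carrier[OF n] by simp
 qed
 thus "n : radical A" using N_carrier[OF n] by (auto simp: radical_def)
 qed
qed

lemma e_nonzero: "x : V ==> e x ~= \<zero>" using \<k>_e[of x x] \<k>_zero[of x] by auto

text \<open>On an orthogonal decomposition every character kills one of the two summands, and away
  from \<open>x\<close> it kills both. So one summand lies in \<open>N\<close>, where zero is the
  only idempotent.\<close>

lemma e_primitive: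
 assumes x: "x : V" shows "primitive_idempotent A (e x)" unfolding primitive_idempotent_def
proof (intro conjI allI impI)
 fix f g assume fg: "orthogonal_idempotents A f g & e x = f \<oplus> g"
 hence c: "f : carrier A" "g : carrier A" and i: "f \<otimes> f = f" "g \<otimes> g = g" and o: "f \<otimes> g = \<zero>" and s: "e x = f \<oplus> g"
 by (auto simp: orthogonal_idempotents_def)
 have kk: "\<k> y f \<otimes>\<^sub>K \<k> y f = \<k> y f" "\<k> y g \<otimes>\<^sub>K \<k> y g = \<k> y g" "\<k> y f \<otimes>\<^sub>K \<k> y g = \<zero>\<^sub>K"
 "\<k> y f \<oplus>\<^sub>K \<k> y g = \<k> y (e x)" "\<k> y f : carrier K" "\<k> y g : carrier K" if "y : V" for y
 using that c i o s by (simp_all add: \<k>_mult[symmetric] \<k>_add[symmetric] \<k>_zero \<k>_closed)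
 have other: "\<k> y f = \<zero>\<^sub>K & \<k> y g = \<zero>\<^sub>K" if y: "y : V" "y ~= x" for y
 proof -
 have "\<k> y f \<otimes>\<^sub>K (\<k> y f \<oplus>\<^sub>K \<k> y g) = \<k> y f" using kk(1,3,5,6)[OF y(1)] by (simp add: K.r_distr)
 hence "\<k> y f = \<zero>\<^sub>K" using kk[OF y(1)] y x by (simp add: \<k>_e)
 thus ?thesis using kk(4,6)[OF y(1)] y x by (simp add: \<k>_e)
 qed
 have "\<k> x f = \<zero>\<^sub>K \<or> \<k> x g = \<zero>\<^sub>K" using kk[OF x] K.integral by blast
 thus "f = \<zero> \<or> g = \<zero>"
 proof
 assume "\<k> x f = \<zero>\<^sub>K"
 hence "f : N" using other c by (auto simp: N_def)
 thus ?thesis using idempotent_in_N i by blast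
 next
 assume "\<k> x g = \<zero>\<^sub>K"
 hence "g : N" using other c by (auto simp: N_def)
 thus ?thesis using idempotent_in_N i by blast
 qed
qed (use x in \<open>auto simp: e_closed e_mult e_nonzero\<close>)

lemma complete_primitive: "complete_primitive_orthogonal A V e" by (auto simp: complete_primitive_orthogonal_def finite_V e_primitive e_sum
 orthogonal_idempotents_def e_closed e_mult)

lemma inj_e: "inj_on e V"
proof (rule inj_onI, rule ccontr)
 fix x y assume "x : V" "y : V" "e x = e y" "x ~= y"
 thus False using e_mult[of x y] e_mult[of x x] e_nonzero[of x] by simp
qed

text \<open>An isomorphism from \<open>e x A\<close> to \<open>e y A\<close> sends
  \<open>e x\<close> into \<open>e y A e x\<close>, on which all characters vanish if
  \<open>x\<close> and \<open>y\<close> differ. Its image would then lie in \<open>N\<close>, which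
  does not contain \<open>e y\<close>.\<close>

lemma basic: "basic_algebra A" unfolding basic_algebra_def
proof (intro exI conjI ballI impI)
 have "finsum A (%f. f) (e ` V) = \<one>" using R.finsum_reindex[of "%f. f" e V] inj_e e_closed e_sum by auto
 thus "complete_primitive_orthogonal A (e ` V) (%e. e)" using complete_primitive inj_e by (auto simp: complete_primitive_orthogonal_def inj_on_def)
 fix f g assume "f : e ` V" "g : e ` V" "f ~= g"
 then obtain x y where xy: "x : V" "y : V" "x ~= y" "f = e x" "g = e y" by auto
 show "\<not> mod_iso A (corner_module A f) (corner_module A g)"
 proof
 assume "mod_iso A (corner_module A f) (corner_module A g)"
 then obtain \<phi> where h: "\<phi> : mod_hom_set A (corner_module A f) (corner_module A g)"
 and b: "bij_betw \<phi> (carrier (corner_module A f)) (carrier (corner_module A g))" by (auto simp: mod_iso_def)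
 have act: "\<phi> (a \<otimes> c) = \<phi> a \<otimes> c" if "a : carrier (corner_module A f)" "c : carrier A" for a c
 using h that by (auto simp: mod_hom_set_def LinearCombinations.module_hom_def corner_module_def regular_module_def)
 have f: "f : carrier (corner_module A f)" "g : carrier (corner_module A g)"
 using e_closed xy by (auto simp: corner_module_def image_iff intro!: bexI[of _ "\<one>"])
 have "\<phi> f : carrier (corner_module A g)" using b f(1) by (auto simp: bij_betw_def)
 then obtain a where a: "a : carrier A" "\<phi> f = g \<otimes> a" by (auto simp: corner_module_def)
 have "\<phi> f = \<phi> f \<otimes> f" using act[OF f(1), of f] xy e_mult e_closed by simp
 hence "\<phi> f = g \<otimes> a \<otimes> f" using a by simp
 moreover have "g \<otimes> a \<otimes> f : N" using xy(1-3) a(1) e_closed \<k>_closed unfolding xy by (auto simp: N_def \<k>_mult \<k>_e)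
 ultimately have \<phi>f: "\<phi> f : N" by simp
 obtain c where c: "c : carrier (corner_module A f)" "\<phi> c = g" using b f(2) by (metis bij_betw_iff_bijections)
 then obtain d where d: "d : carrier A" "c = f \<otimes> d" by (auto simp: corner_module_def)
 hence "g = \<phi> f \<otimes> d" using act[OF f(1) d(1)] c by simp
 hence "g : N" using N_mult_right[OF d(1) \<phi>f] by simp
 thus False using xy \<k>_e[of y y] by (auto simp: N_def)
 qed
qed

section \<open>The square of the radical and the arrow spaces\<close>

abbreviation N2 :: "'a set" where "N2 == ideal_power A (radical A) 2"

text \<open>\<open>ideal_power\<close> starts from the whole algebra, so a product in the square is
  exhibited with an extra factor one.\<close>

lemma N2_prod: "[|m : N; n : N|] ==> m \<otimes> n : N2"
proof -
 assume mn: "m : N" "n : N"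
 have "\<one> \<otimes> m : ideal_prod A (carrier A) N" using mn by (intro ideal_prod.prod) auto
 thus ?thesis using mn N_carrier by (auto simp: numeral_2_eq_2 radical_eq intro!: ideal_prod.prod)
qed

lemma N2_induct [consumes 1, case_names prod sum]:
 assumes "a : N2" and prod: "!!m n. [|m : N; n : N|] ==> P (m \<otimes> n)" and sum: "!!a b. [|a : N2; b : N2; P a; P b|] ==> P (a \<oplus> b)"
 shows "P a"
proof -
 have N1: "m : ideal_prod A (carrier A) N ==> m : N" for m by (induction rule: ideal_prod.induct) (auto intro: N_mult_left N_add)
 have "a : ideal_prod A (ideal_prod A (carrier A) N) N" using assms(1) by (simp add: numeral_2_eq_2 radical_eq)
 thus ?thesis by (induction rule: ideal_prod.induct)
 (auto intro!: prod N1 sum simp: numeral_2_eq_2 radical_eq)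
qed

lemma N2_sum: "[|a : N2; b : N2|] ==> a \<oplus> b : N2" by (auto simp: numeral_2_eq_2 intro: ideal_prod.sum)

lemma N2_N: "a : N2 ==> a : N" by (induction rule: N2_induct) (auto intro: N_mult_left N_add N_carrier)

lemma N2_mult_left: "[|a : N2; b : carrier A|] ==> b \<otimes> a : N2" by (induction rule: N2_induct)
 (auto simp: R.m_assoc[symmetric] R.r_distr N_carrier N2_N intro!: N2_prod N2_sum N_mult_left)

lemma N2_mult_right: "[|a : N2; b : carrier A|] ==> a \<otimes> b : N2" by (induction rule: N2_induct)
 (auto simp: R.m_assoc R.l_distr N_carrier N2_N intro!: N2_prod N2_sum N_mult_right)

lemma N2_smult: "[|a : N2; c : carrier K|] ==> c \<odot> a : N2" by (induction rule: N2_induct)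
 (auto simp: A.smult_mult_left A.smult_r_distr N_carrier N2_N intro!: N2_prod N2_sum N_smult)

lemma N2_zero: "\<zero> : N2" using N2_prod[OF N_zero N_zero] by simp

lemma N2_submodule: "submodule K N2 A" by unfold_locales (use N2_sum N2_zero N2_smult N2_N N_carrier in auto)

text \<open>A basis criterion. Functionals that vanish on products factor through \<open>N\<close>
  modulo its square; their duality with the \<open>n i\<close> gives independence, and the expansion
  hypothesis gives spanning. Since every \<open>n i\<close> has fixed endpoints, the basis splits
  over pairs of points.\<close>

lemma dim_arrow_space:
 assumes S: "finite S" and n: "!!i. i : S ==> n i : N" and src: "!!i. i : S ==> src i : V" "!!i. i : S ==> e (src i) \<otimes> n i = n i"
 and trg: "!!i. i : S ==> trg i : V" "!!i. i : S ==> n i \<otimes> e (trg i) = n i"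
 and \<chi>: "!!i a. [|i : S; a : N|] ==> \<chi> i a : carrier K"
 and \<chi>_add: "!!i a b. [|i : S; a : N; b : N|] ==> \<chi> i (a \<oplus> b) = \<chi> i a \<oplus>\<^sub>K \<chi> i b"
 and \<chi>_smult: "!!i c a. [|i : S; c : carrier K; a : N|] ==> \<chi> i (c \<odot> a) = c \<otimes>\<^sub>K \<chi> i a"
 and \<chi>_prod: "!!i a b. [|i : S; a : N; b : N|] ==> \<chi> i (a \<otimes> b) = \<zero>\<^sub>K"
 and \<chi>_n: "!!i j. [|i : S; j : S|] ==> \<chi> i (n j) = (if i = j then \<one>\<^sub>K else \<zero>\<^sub>K)"
 and expand: "!!a. a : N ==> a \<ominus> (\<Oplus>i\<in>S. \<chi> i a \<odot> n i) : N2" and xy: "x : V" "y : V"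
 shows "vectorspace.dim K (arrow_space A (e x) (e y)) = card {i : S. src i = x & trg i = y}"
proof -
 define S' where "S' = {i : S. src i = x & trg i = y}"
 have S': "finite S'" "S' \<subseteq> S" using S by (auto simp: S'_def)
 let ?f = "e x" and ?g = "e y"
 have fg: "?f : carrier A" "?g : carrier A" "?f \<otimes> ?f = ?f" "?g \<otimes> ?g = ?g" using xy e_closed e_mult by auto
 define q where "q r = N2 +> r" for r
 define U where "U = {r : N. ?f \<otimes> r \<otimes> ?g = r}"
 have U_im: "U = {?f \<otimes> r \<otimes> ?g | r. r : N}"
 proof -
 have "?f \<otimes> (?f \<otimes> r \<otimes> ?g) \<otimes> ?g = ?f \<otimes> r \<otimes> ?g" if "r : N" for r
 proof -
 have "?f \<otimes> (?f \<otimes> r \<otimes> ?g) \<otimes> ?g = (?f \<otimes> ?f) \<otimes> r \<otimes> (?g \<otimes> ?g)"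
 using fg(1,2) N_carrier[OF that] by (simp add: R.m_assoc del: e_mult)
 thus ?thesis using fg by simp
 qed
 moreover have "?f \<otimes> r \<otimes> ?g : N" if "r : N" for r using that N_mult_left N_mult_right fg by blast
 ultimately have "{?f \<otimes> r \<otimes> ?g | r. r : N} \<subseteq> U" unfolding U_def by blast
 moreover have "U \<subseteq> {?f \<otimes> r \<otimes> ?g | r. r : N}" unfolding U_def by force
 ultimately show ?thesis by blast
 qed
 have UN: "r : N" "r : carrier A" if "r : U" for r using that N_carrier by (auto simp: U_def)
 have U_sub: "submodule K U A"
 proof unfold_locales
 show "v \<oplus> w : U" if "v : U" "w : U" for v w using that fg(1,2) N_carrier by (auto simp: U_def R.r_distr R.l_distr intro: N_add)
 show "c \<odot> v : U" if "c : carrier K" "v : U" for c v using that fg(1,2) N_carrier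
 by (auto simp: U_def A.smult_mult_left[symmetric] A.smult_mult_right[symmetric] intro: N_smult)
 show "U \<subseteq> carrier A" using UN by blast
 show "\<zero> : U" using N_zero fg(1,2) by (simp add: U_def)
 qed
 let ?W = "A\<lparr>carrier := U\<rparr>" and ?V = "arrow_space A ?f ?g"
 have carV: "carrier ?V = q ` U" by (auto simp: arrow_space_def U_im q_def radical_eq)
 have ops: "u \<oplus>\<^bsub>?V\<^esub> v = u \<oplus>\<^bsub>quotient_module A N2\<^esub> v" "c \<odot>\<^bsub>?V\<^esub> u = c \<odot>\<^bsub>quotient_module A N2\<^esub> u" "\<zero>\<^bsub>?V\<^esub> = N2"
 for u v c by (simp_all add: arrow_space_def zero_quotient_module)
 have qadd: "q (r \<oplus> s) = q r \<oplus>\<^bsub>?V\<^esub> q s" if "r : U" "s : U" for r s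
 using that UN by (simp add: ops q_def quotient_add[OF N2_submodule])
 have qsmult: "q (c \<odot> r) = c \<odot>\<^bsub>?V\<^esub> q r" if "c : carrier K" "r : U" for c r
 using that UN by (simp add: ops q_def quotient_smult[OF N2_submodule])
 have N2c: "N2 \<subseteq> carrier A" using N2_N N_carrier by blast
 have qz: "q \<zero> = \<zero>\<^bsub>?V\<^esub>" using N2c by (simp add: ops q_def)
 have qeq: "q r = q s \<longleftrightarrow> r \<ominus> s : N2" if "r : U" "s : U" for r s using that UN by (simp add: q_def coset_eq_iff[OF N2_submodule])
 interpret U: submodule K U A by (rule U_sub)
 have mV: "module K ?V"
 proof (rule module_surj[of K ?W q])
 show "module K ?W" by (rule A.submodule_is_module[OF U_sub])
 qed (simp_all add: carV qadd qsmult qz)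
 interpret V: vectorspace K ?V by (intro vectorspace.intro mV K.field_axioms)
 have nU: "n i : U" if "i : S'" for i using that n src trg by (auto simp: S'_def U_def)
 have fin: "finsum A g T : U & finsum ?V (%i. q (g i)) T = q (finsum A g T)" if "finite T" "!!i. i : T ==> g i : U" for g :: "'b => 'a" and T
 using that
 proof (induction T rule: finite_induct)
 case empty
 thus ?case using U.zero_closed by (simp add: qz)
 next
 case (insert i T)
 thus ?case using UN carV by (auto simp: Pi_def qadd)
 qed
 have \<chi>0: "\<chi> i \<zero> = \<zero>\<^sub>K" if "i : S" for i using \<chi>_prod[OF that N_zero N_zero] by simp
 have \<chi>N2: "\<chi> i a = \<zero>\<^sub>K" if "a : N2" "i : S" for i a
 using that by (induction rule: N2_induct) (auto simp: \<chi>_prod \<chi>_add N2_N)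
 have \<chi>fin: "finsum A g T : N & \<chi> i (finsum A g T) = (\<Oplus>\<^sub>K j\<in>T. \<chi> i (g j))"
 if "finite T" "i : S" "!!j. j : T ==> g j : N" for i T and g :: "'b => 'a" using that
 proof (induction T rule: finite_induct)
 case empty thus ?case by (simp add: N_zero \<chi>0)
 next
 case (insert j T)
 thus ?case using N_carrier by (auto simp: Pi_def \<chi>_add \<chi> intro!: N_add)
 qed
 have coef: "\<chi> j (\<Oplus>i\<in>S'. a i \<odot> n i) = a j" if a: "a : S' \<rightarrow> carrier K" and j: "j : S'" for a j
 proof -
 have "\<chi> j (\<Oplus>i\<in>S'. a i \<odot> n i) = (\<Oplus>\<^sub>K i\<in>S'. \<chi> j (a i \<odot> n i))"
 using \<chi>fin[of S' j "%i. a i \<odot> n i"] S' a j n by (auto intro!: N_smult)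
 also have "... = (\<Oplus>\<^sub>K i\<in>S'. if j = i then a i else \<zero>\<^sub>K)"
 proof (rule K.finsum_cong')
 fix i assume i: "i : S'"
 hence "i : S" "j : S" "a i : carrier K" using j S' a by auto
 thus "\<chi> j (a i \<odot> n i) = (if j = i then a i else \<zero>\<^sub>K)" using n by (simp add: \<chi>_smult \<chi>_n)
 qed (use a in auto)
 also have "... = a j" using S' a j by (intro K.finsum_singleton) auto
 finally show ?thesis .
 qed
 define Bs where "Bs = (%i. q (n i)) ` S'"
 have Bc: "Bs \<subseteq> carrier ?V" "finite Bs" using nU S' carV by (auto simp: Bs_def)
 have inj: "inj_on (%i. q (n i)) S'"
 proof (rule inj_onI, rule ccontr)
 fix i j assume ij: "i : S'" "j : S'" "q (n i) = q (n j)" "i ~= j"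
 hence d: "n i \<ominus> n j : N2" using qeq nU by blast
 have nn: "n i : N" "n j : N" "i : S" "j : S" using ij S' n by auto
 have "n i = (n i \<ominus> n j) \<oplus> n j" using N_carrier[OF nn(1)] N_carrier[OF nn(2)] by (simp add: a_minus_def R.a_assoc R.l_neg)
 hence "\<chi> i (n i) = \<chi> i (n i \<ominus> n j) \<oplus>\<^sub>K \<chi> i (n j)" using \<chi>_add[OF nn(3) N2_N[OF d] nn(2)] by simp
 thus False using \<chi>N2[OF d nn(3)] ij nn by (simp add: \<chi>_n)
 qed
 have lc: "V.lincomb a Bs = q (\<Oplus>i\<in>S'. a (q (n i)) \<odot> n i)"
 "(\<Oplus>i\<in>S'. a (q (n i)) \<odot> n i) : U" if a: "a : Bs \<rightarrow> carrier K" for a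
 proof -
 have aq: "a (q (n i)) : carrier K" if "i : S'" for i using a that by (auto simp: Bs_def)
 have qn: "q (n i) : carrier ?V" if "i : S'" for i using nU[OF that] carV by blast
 have "V.lincomb a Bs = (\<Oplus>\<^bsub>?V\<^esub>i\<in>S'. a (q (n i)) \<odot>\<^bsub>?V\<^esub> q (n i))"
 unfolding V.lincomb_def Bs_def using inj aq qn by (intro V.finsum_reindex) auto
 also have "... = (\<Oplus>\<^bsub>?V\<^esub>i\<in>S'. q (a (q (n i)) \<odot> n i))" using aq nU qn by (intro V.finsum_cong') (auto simp: qsmult)
 finally show "V.lincomb a Bs = q (\<Oplus>i\<in>S'. a (q (n i)) \<odot> n i)"
 "(\<Oplus>i\<in>S'. a (q (n i)) \<odot> n i) : U" using fin[of S' "%i. a (q (n i)) \<odot> n i"] S' aq nU by auto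
 qed
 have "V.lin_indpt Bs"
 proof (rule V.finite_lin_indpt2[OF Bc(2,1)])
 fix a assume a: "a : Bs \<rightarrow> carrier K" and z: "V.lincomb a Bs = \<zero>\<^bsub>?V\<^esub>"
 let ?s = "\<Oplus>i\<in>S'. a (q (n i)) \<odot> n i"
 have "q ?s = q \<zero>" using z lc(1)[OF a] qz by simp
 hence "?s : N2" using qeq[OF lc(2)[OF a] U.zero_closed] UN[OF lc(2)[OF a]] by (simp add: a_minus_def)
 moreover have aq: "(%i. a (q (n i))) : S' \<rightarrow> carrier K" using a by (auto simp: Bs_def)
 ultimately have "a (q (n j)) = \<zero>\<^sub>K" if "j : S'" for j using coef[OF aq that] \<chi>N2[of ?s j] that S' by auto
 thus "ALL v:Bs. a v = \<zero>\<^sub>K" by (auto simp: Bs_def)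
 qed
 moreover have "carrier ?V \<subseteq> V.span Bs"
 proof
 fix v assume "v : carrier ?V"
 then obtain r where r: "r : U" "v = q r" using carV by auto
 have rN: "r : N" "r : carrier A" using UN r by auto
 define s where "s = (\<Oplus>i\<in>S. \<chi> i r \<odot> n i)"
 have term_c: "\<chi> i r \<odot> n i : carrier A" if "i : S" for i using that \<chi> rN n N_carrier by auto
 have sc: "s : carrier A" unfolding s_def using term_c by auto
 have w: "r \<ominus> s : N2" using expand[OF rN(1)] by (simp add: s_def)
 \<comment> \<open>Cutting the expansion of \<open>r\<close> with the two idempotents deletes the
   generators with other endpoints and fixes the rest.\<close>
 have "?f \<otimes> s \<otimes> ?g = (\<Oplus>i\<in>S. ?f \<otimes> (\<chi> i r \<odot> n i) \<otimes> ?g)"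
 unfolding s_def using term_c fg S by (simp add: R.finsum_rdistr R.finsum_ldistr Pi_def)
 also have "... = (\<Oplus>i\<in>S. if i : S' then \<chi> i r \<odot> n i else \<zero>)"
 proof (rule R.finsum_cong')
 fix i assume i: "i : S"
 have nc: "n i : carrier A" using n i N_carrier by auto
 have "?f \<otimes> n i \<otimes> ?g = ?f \<otimes> (e (src i) \<otimes> n i \<otimes> e (trg i)) \<otimes> ?g" using src(2)[OF i] trg(2)[OF i] by simp
 also have "... = (?f \<otimes> e (src i)) \<otimes> n i \<otimes> (e (trg i) \<otimes> ?g)"
 using fg(1,2) nc e_closed[OF src(1)[OF i]] e_closed[OF trg(1)[OF i]] by (simp add: R.m_assoc)
 also have "... = (if i : S' then n i else \<zero>)" using i nc src trg xy fg by (auto simp: S'_def e_mult e_closed)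
 finally show "?f \<otimes> (\<chi> i r \<odot> n i) \<otimes> ?g = (if i : S' then \<chi> i r \<odot> n i else \<zero>)" using i nc fg(1,2) \<chi>[OF i rN(1)]
 by (simp add: A.smult_mult_left[symmetric] A.smult_mult_right[symmetric])
 qed (use term_c in auto)
 also have "... = (\<Oplus>i\<in>S'. \<chi> i r \<odot> n i)" using S S' term_c by (intro R.add.finprod_mono_neutral_cong_right) auto
 finally have fsg: "?f \<otimes> s \<otimes> ?g = (\<Oplus>i\<in>S'. \<chi> i r \<odot> n i)" .
 have "?f \<otimes> (r \<ominus> s) \<otimes> ?g = r \<ominus> ?f \<otimes> s \<otimes> ?g"
 using r(1) rN sc fg(1,2) by (simp add: U_def a_minus_def R.r_distr R.l_distr R.r_minus R.l_minus)
 hence "r \<ominus> (\<Oplus>i\<in>S'. \<chi> i r \<odot> n i) : N2" using N2_mult_left[OF w fg(1)] N2_mult_right[OF _ fg(2)] fsg by metis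
 moreover have "\<chi> i r \<odot> n i : U" if "i : S'" for i using that nU \<chi>[OF _ rN(1)] S'(2) by (intro U.smult_closed) auto
 hence "(\<Oplus>i\<in>S'. \<chi> i r \<odot> n i) : U" using fin[of S' "%i. \<chi> i r \<odot> n i"] S' by auto
 ultimately have vr: "v = q (\<Oplus>i\<in>S'. \<chi> i r \<odot> n i)" using qeq r by blast
 define a where "a u = \<chi> (the_inv_into S' (%i. q (n i)) u) r" for u
 have aq: "a (q (n i)) = \<chi> i r" if "i : S'" for i using the_inv_into_f_f[OF inj that] by (simp add: a_def)
 have a: "a : Bs \<rightarrow> carrier K" using aq \<chi> rN S' by (auto simp: Bs_def)
 have "(\<Oplus>i\<in>S'. a (q (n i)) \<odot> n i) = (\<Oplus>i\<in>S'. \<chi> i r \<odot> n i)" using aq term_c S' by (intro R.finsum_cong') auto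
 hence "v = V.lincomb a Bs" using vr lc(1)[OF a] by simp
 thus "v : V.span Bs" using a V.finite_span[OF Bc(2,1)] by auto
 qed
 ultimately have "V.basis Bs" using V.span_is_subset2[OF Bc(1)] Bc(1) by (auto simp: V.basis_def)
 hence "V.dim = card Bs" using V.dim_basis Bc(2) by blast
 also have "... = card S'" unfolding Bs_def by (rule card_image[OF inj])
 finally show ?thesis by (simp add: S'_def)
qed
end
section \<open>Bound quiver algebras\<close>

lemma coordinate_functionals:
 assumes "vectorspace K V" "vectorspace.fin_dim K V"
 obtains B \<t> where "finite B" "B \<subseteq> carrier V"
 "!!b v. [|b : B; v : carrier V|] ==> \<t> b v : carrier K"
 "!!b v w. [|b : B; v : carrier V; w : carrier V|] ==> \<t> b (v \<oplus>\<^sub>V w) = \<t> b v \<oplus>\<^sub>K \<t> b w"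
 "!!b c v. [|b : B; c : carrier K; v : carrier V|] ==> \<t> b (c \<odot>\<^sub>V v) = c \<otimes>\<^sub>K \<t> b v"
 "!!v. v : carrier V ==> (\<Oplus>\<^sub>V b\<in>B. \<t> b v \<odot>\<^sub>V b) = v"
proof -
 interpret vectorspace K V by fact
 obtain B where B: "finite B" "basis B" using finite_basis_exists assms(2) by blast
 hence Bc: "B \<subseteq> carrier V" by (simp add: basis_def)
 have ex1: "\<exists>!a. a : B \<rightarrow>\<^sub>E carrier K & lincomb a B = v" if "v : carrier V" for v
 using basis_criterion[OF B(1) Bc] B(2) that by blast
 define \<t> where "\<t> b v = (THE a. a : B \<rightarrow>\<^sub>E carrier K & lincomb a B = v) b" for b v
 have \<t>: "(%b. \<t> b v) : B \<rightarrow>\<^sub>E carrier K" "lincomb (%b. \<t> b v) B = v" if "v : carrier V" for v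
 using theI'[OF ex1[OF that]] by (simp_all add: \<t>_def)
 have \<t>K: "\<t> b v : carrier K" if "b : B" "v : carrier V" for b v using PiE_mem[OF \<t>(1)[OF that(2)] that(1)] .
 have uniq: "\<t> b v = a b" if "v : carrier V" "!!b. b : B ==> a b : carrier K"
 "(\<Oplus>\<^sub>V b\<in>B. a b \<odot>\<^sub>V b) = v" "b : B" for a v b
 proof -
 have "(\<Oplus>\<^sub>V b\<in>B. restrict a B b \<odot>\<^sub>V b) = (\<Oplus>\<^sub>V b\<in>B. a b \<odot>\<^sub>V b)"
 using that Bc by (intro M.finsum_cong') auto
 hence "restrict a B : B \<rightarrow>\<^sub>E carrier K" "lincomb (restrict a B) B = v" using that by (auto simp: lincomb_def)
 hence "restrict a B = (%b. \<t> b v)" using ex1[OF that(1)] \<t>[OF that(1)] by blast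
 thus ?thesis using that(4) by (metis restrict_apply')
 qed
 have sum: "(\<Oplus>\<^sub>V b\<in>B. \<t> b v \<odot>\<^sub>V b) = v" if "v : carrier V" for v
 using \<t>(2)[OF that] by (simp add: lincomb_def)
 show thesis
 proof (rule that[of B \<t>])
 show "finite B" "B \<subseteq> carrier V" by (fact B Bc)+
 fix b v assume bv: "b : B" "v : carrier V"
 show "\<t> b v : carrier K" using \<t>K bv .
 {
 fix w assume w: "w : carrier V"
 have "(\<Oplus>\<^sub>V b\<in>B. (\<t> b v \<oplus>\<^sub>K \<t> b w) \<odot>\<^sub>V b) = (\<Oplus>\<^sub>V b\<in>B. \<t> b v \<odot>\<^sub>V b \<oplus>\<^sub>V \<t> b w \<odot>\<^sub>V b)"
 using bv w Bc \<t>K by (intro M.finsum_cong') (auto simp: smult_l_distr subset_iff)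
 also have "... = (\<Oplus>\<^sub>V b\<in>B. \<t> b v \<odot>\<^sub>V b) \<oplus>\<^sub>V (\<Oplus>\<^sub>V b\<in>B. \<t> b w \<odot>\<^sub>V b)"
 using bv w Bc \<t>K by (intro M.finsum_addf) auto
 also have "... = v \<oplus>\<^sub>V w" using sum bv w by simp
 finally show "\<t> b (v \<oplus>\<^sub>V w) = \<t> b v \<oplus>\<^sub>K \<t> b w" using bv w \<t>K by (intro uniq) auto
 }
 fix c assume c: "c : carrier K"
 have "(\<Oplus>\<^sub>V b\<in>B. (c \<otimes>\<^sub>K \<t> b v) \<odot>\<^sub>V b) = (\<Oplus>\<^sub>V b\<in>B. c \<odot>\<^sub>V (\<t> b v \<odot>\<^sub>V b))"
 using bv c Bc \<t>K by (intro M.finsum_cong') (auto simp: smult_assoc1 subset_iff)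
 also have "... = c \<odot>\<^sub>V (\<Oplus>\<^sub>V b\<in>B. \<t> b v \<odot>\<^sub>V b)"
 using bv c Bc \<t>K B(1) by (intro finsum_smult[symmetric]) auto
 also have "... = c \<odot>\<^sub>V v" using sum bv by simp
 finally show "\<t> b (c \<odot>\<^sub>V v) = c \<otimes>\<^sub>K \<t> b v" using bv c \<t>K by (intro uniq) auto
 qed (use sum in auto)
qed
text \<open>The direct sum of the right ideals \<open>t j C\<close>, presented as families fixed by
  the idempotents; \<open>corner_unit\<close> supplies its standard generators.\<close>

definition corner_functions :: "('k, 'c) module => 'j set => ('j => 'c) => ('j => 'c) set"
 where "corner_functions C J t = {u : J \<rightarrow>\<^sub>E carrier C. ALL j:J. t j \<otimes>\<^sub>C u j = u j}"
abbreviation corner_free where "corner_free C J t == fun_module C J (corner_functions C J t)"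
definition corner_unit :: "('k, 'c) module => 'j set => ('j => 'c) => 'j => 'j => 'c"
 where "corner_unit C J t j = (\<lambda>i\<in>J. if j = i then t j else \<zero>\<^sub>C)"

lemma corner_functionsI:
 assumes "!!j. j : J ==> u j : carrier C" "!!j. j : J ==> t j \<otimes>\<^sub>C u j = u j"
 shows "(\<lambda>j\<in>J. u j) : corner_functions C J t" using assms by (auto simp: corner_functions_def)

lemma
 assumes "u : corner_functions C J t" "j : J"
 shows corner_functions_closed: "u j : carrier C" and corner_functions_fixed: "t j \<otimes>\<^sub>C u j = u j"
 using assms by (auto simp: corner_functions_def)

lemma corner_functions_eqI:
 assumes "u : corner_functions C J t" "v : corner_functions C J t'" "!!j. j : J ==> u j = v j" shows "u = v"
 using assms by (auto simp: corner_functions_def intro: PiE_ext)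

context
 fixes C :: "('k, 'c) module" and J :: "'j set" and t :: "'j => 'c"
 assumes ring: "ring C" and J: "finite J" and t: "!!j. j : J ==> t j : carrier C" "!!j. j : J ==> t j \<otimes>\<^sub>C t j = t j"
begin
interpretation C: ring C by (rule ring)

lemma right_module_corner_free: "right_module C (corner_free C J t)"
proof (rule right_module_fun_module[OF ring])
 fix u v c assume u: "u : corner_functions C J t" and v: "v : corner_functions C J t" and c: "c : carrier C"
 note cl = corner_functions_closed[OF u] corner_functions_closed[OF v]
 show "(\<lambda>i\<in>J. u i \<otimes>\<^sub>C c) : corner_functions C J t"
 using cl t corner_functions_fixed[OF u] c by (intro corner_functionsI) (simp_all add: C.m_assoc[symmetric])
next
 fix u v assume u: "u : corner_functions C J t" and v: "v : corner_functions C J t"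
 note cl = corner_functions_closed[OF u] corner_functions_closed[OF v]
 show "(\<lambda>i\<in>J. u i \<oplus>\<^sub>C v i) : corner_functions C J t" using cl t corner_functions_fixed[OF u] corner_functions_fixed[OF v]
 by (intro corner_functionsI) (simp_all add: C.r_distr)
qed (auto simp: corner_functions_def t)

lemma corner_unit_mem: "j : J ==> corner_unit C J t j : corner_functions C J t" using t by (auto simp: corner_unit_def corner_functions_def)

lemma corner_free_expand:
 assumes u: "u : corner_functions C J t"
 shows "(\<Oplus>\<^bsub>corner_free C J t\<^esub>j\<in>J. u j \<odot>\<^bsub>corner_free C J t\<^esub> corner_unit C J t j) = u"
proof -
 interpret F: right_module C "corner_free C J t" by (rule right_module_corner_free)
 have uc: "u j : carrier C" if "j : J" for j using u that by (rule corner_functions_closed)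
 have mem: "u j \<odot>\<^bsub>corner_free C J t\<^esub> corner_unit C J t j : corner_functions C J t" if "j : J" for j
 using F.act_closed[of "u j" "corner_unit C J t j"] corner_unit_mem uc that by simp
 have "(\<Oplus>\<^bsub>corner_free C J t\<^esub>j\<in>J. u j \<odot>\<^bsub>corner_free C J t\<^esub> corner_unit C J t j) =
 (\<lambda>i\<in>J. \<Oplus>\<^sub>C j\<in>J. (u j \<odot>\<^bsub>corner_free C J t\<^esub> corner_unit C J t j) i)"
 using J mem by (intro finsum_fun_module right_module_corner_free) (auto simp: corner_functions_def)
 also have "... = (\<lambda>i\<in>J. u i)"
 proof (rule restrict_ext)
 fix i assume i: "i : J"
 have "(\<Oplus>\<^sub>C j\<in>J. (u j \<odot>\<^bsub>corner_free C J t\<^esub> corner_unit C J t j) i) = (\<Oplus>\<^sub>C j\<in>J. if i = j then u j else \<zero>\<^sub>C)"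
 using i uc t corner_functions_fixed[OF u] by (intro C.finsum_cong') (auto simp: corner_unit_def)
 also have "... = u i" using i J uc by (intro C.finsum_singleton) auto
 finally show "(\<Oplus>\<^sub>C j\<in>J. (u j \<odot>\<^bsub>corner_free C J t\<^esub> corner_unit C J t j) i) = u i" .
 qed
 also have "... = u" using u by (auto simp: corner_functions_def PiE_def extensional_restrict)
 finally show ?thesis .
qed

lemma has_dual_basis_corner_free: "has_dual_basis C (corner_free C J t)"
proof -
 interpret F: right_module C "corner_free C J t" by (rule right_module_corner_free)
 show ?thesis
 proof (rule has_dual_basisI[OF right_module_corner_free J])
 show "corner_unit C J t j : carrier (corner_free C J t)" if "j : J" for j using corner_unit_mem that by simp
 show "(\<lambda>u\<in>carrier (corner_free C J t). u j) : mod_hom_set C (corner_free C J t) (regular_module C)" if "j : J" for j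
 using that by (intro mod_hom_restrictI right_module_corner_free) (auto intro: corner_functions_closed)
 show "u = (\<Oplus>\<^bsub>corner_free C J t\<^esub>j\<in>J. (\<lambda>u\<in>carrier (corner_free C J t). u j) u \<odot>\<^bsub>corner_free C J t\<^esub> corner_unit C J t j)"
 if "u : carrier (corner_free C J t)" for u using corner_free_expand[of u] that by (simp del: fun_module_simps(4))
 qed
qed
end

text \<open>\<open>\<pi>\<close> is the presentation of \<open>C\<close> by the path algebra with
  kernel \<open>I\<close>; it allows elements of \<open>C\<close> to be lifted to the path algebra
  without mentioning cosets.\<close>

locale bound_quiver_algebra = quiver_relations K Q I R for K :: "'k ring" and Q :: "('v, 'a) pre_digraph" and I R :: "(('v, 'a) path => 'k) set" +
 fixes C :: "('k, 'c) module" (structure) and \<pi> :: "(('v, 'a) path => 'k) => 'c"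
 assumes kalgebra_C: "kalgebra K C" and fin_dim_C: "vectorspace.fin_dim K C" and \<pi>_surj: "\<pi> ` carrier (path_algebra K Q) = carrier C"
 and \<pi>_add: "[|f : carrier (path_algebra K Q); g : carrier (path_algebra K Q)|] ==>
 \<pi> (f \<oplus>\<^bsub>path_algebra K Q\<^esub> g) = \<pi> f \<oplus>\<^sub>C \<pi> g"
 and \<pi>_mult: "[|f : carrier (path_algebra K Q); g : carrier (path_algebra K Q)|] ==>
 \<pi> (f \<otimes>\<^bsub>path_algebra K Q\<^esub> g) = \<pi> f \<otimes> \<pi> g" and \<pi>_smult: "[|c : carrier K; f : carrier (path_algebra K Q)|] ==>
 \<pi> (c \<odot>\<^bsub>path_algebra K Q\<^esub> f) = c \<odot> \<pi> f" and \<pi>_one: "\<pi> \<one>\<^bsub>path_algebra K Q\<^esub> = \<one>"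
 and \<pi>_ker: "f : carrier (path_algebra K Q) ==> \<pi> f = \<zero> \<longleftrightarrow> f : I"
begin
interpretation K: field K by (rule field_K)
interpretation Q: fin_digraph Q by (rule fin_Q)
interpretation A: ring "path_algebra K Q" by (rule ring_A)
interpretation kA: kalgebra K A by (rule kalgebra_A)
interpretation I: ideal I "path_algebra K Q" by (rule ideal_I)
interpretation C: ring C by (rule kalgebraD(2)[OF kalgebra_C])
interpretation kC: kalgebra K C by (rule kalgebra_C)
abbreviation V where "V == verts Q"
abbreviation "\<C> == carrier C"
abbreviation ev :: "'v => 'c" where "ev x == \<pi> (vid x)"
abbreviation av :: "'a => 'c" where "av a == \<pi> (arr a)"
abbreviation dv :: "'a => (('v, 'a) path => 'k) => 'c" where "dv a f == \<pi> (der a f)"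
abbreviation "ta == %a. ev (tail Q a)"
abbreviation "ha == %a. ev (head Q a)"
abbreviation "sr == %r. ev (rsrc r)"
abbreviation "tr1 == %r. ev (rtrg r)"
definition pre :: "'c => ('v, 'a) path => 'k" where "pre c = (SOME f. f : \<A> & \<pi> f = c)"
text \<open>The coefficient of an element of \<open>C\<close> at the trivial path of
  \<open>x\<close>, which is a character of \<open>C\<close>. It does not depend on the chosen
  preimage, because elements of \<open>I\<close> have no trivial paths
  (\<open>cf_\<pi>\<close>).\<close>

definition cf :: "'v => 'c => 'k" where "cf x c = pre c (x, [])"

lemma \<pi>_closed [simp]: "f : \<A> ==> \<pi> f : \<C>" using \<pi>_surj by auto

lemma pre: assumes "c : \<C>" shows "pre c : \<A>" "\<pi> (pre c) = c"
proof -
 have "c : \<pi> ` \<A>" using assms \<pi>_surj by simp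
 then obtain f where "f : \<A> & \<pi> f = c" by blast
 hence "pre c : \<A> & \<pi> (pre c) = c" using someI[of "%f. f : \<A> & \<pi> f = c" f] by (simp add: pre_def)
 thus "pre c : \<A>" "\<pi> (pre c) = c" by auto
qed

lemma \<pi>_zero: "\<pi> \<zero>\<^sub>A = \<zero>" using \<pi>_ker[of "\<zero>\<^sub>A"] by simp

lemma \<pi>_neg: "f : \<A> ==> \<pi> (\<ominus>\<^sub>A f) = \<ominus> \<pi> f"
 using \<pi>_add[of "\<ominus>\<^sub>A f" f] by (simp add: A.l_neg \<pi>_zero C.minus_equality)

lemma \<pi>_finsum: "[|finite S; !!s. s : S ==> g s : \<A>|] ==> \<pi> (finsum A g S) = (\<Oplus>s\<in>S. \<pi> (g s))"
 by (induction S rule: finite_induct) (auto simp: \<pi>_zero \<pi>_add Pi_def)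

lemma \<pi>_I: "f : I ==> \<pi> f = \<zero>" using \<pi>_ker I_carrier by blast

lemma cf_\<pi>: assumes f: "f : \<A>" shows "cf x (\<pi> f) = f (x, [])"
proof -
 let ?g = "pre (\<pi> f)"
 have g: "?g : \<A>" "\<pi> ?g = \<pi> f" using pre[of "\<pi> f"] f by auto
 have "\<pi> (?g \<ominus>\<^sub>A f) = \<zero>" using f g by (simp add: a_minus_def \<pi>_add \<pi>_neg C.r_neg)
 hence "?g \<ominus>\<^sub>A f : filt 1" using \<pi>_ker[of "?g \<ominus>\<^sub>A f"] f g I_filt_1 by auto
 hence "(?g \<ominus>\<^sub>A f) (x, []) = \<zero>\<^sub>K" by (simp add: filt_def)
 hence "?g (x, []) \<ominus>\<^sub>K f (x, []) = \<zero>\<^sub>K" using f by (simp add: A_simps a_minus_def A_neg)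
 thus ?thesis using A_val[OF f] A_val[OF g(1)] by (simp add: cf_def)
qed

lemma shows cf_closed: "c : \<C> ==> cf x c : carrier K"
 and cf_add: "[|c : \<C>; d : \<C>|] ==> cf x (c \<oplus>\<^sub>C d) = cf x c \<oplus>\<^sub>K cf x d"
 and cf_mult: "[|c : \<C>; d : \<C>|] ==> cf x (c \<otimes> d) = cf x c \<otimes>\<^sub>K cf x d"
 and cf_smult: "[|k : carrier K; c : \<C>|] ==> cf x (k \<odot> c) = k \<otimes>\<^sub>K cf x c"
proof -
 show "c : \<C> ==> cf x c : carrier K" using pre A_val by (simp add: cf_def)
 assume c: "c : \<C>"
 note pc = pre[OF c]
 { assume "d : \<C>"
 note pd = pre[OF this]
 show "cf x (c \<oplus>\<^sub>C d) = cf x c \<oplus>\<^sub>K cf x d"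
 using cf_\<pi>[of "pre c \<oplus>\<^sub>A pre d" x] pc pd by (simp add: \<pi>_add A_simps cf_def[of x c] cf_def[of x d])
 show "cf x (c \<otimes> d) = cf x c \<otimes>\<^sub>K cf x d"
 using cf_\<pi>[of "pre c \<otimes>\<^sub>A pre d" x] pc pd by (simp add: \<pi>_mult val_mult cf_def[of x c] cf_def[of x d]) }
 assume "k : carrier K"
 thus "cf x (k \<odot> c) = k \<otimes>\<^sub>K cf x c"
 using cf_\<pi>[of "k \<odot>\<^sub>A pre c" x] pc by (simp add: \<pi>_smult A_simps cf_def[of x c])
qed

lemma cf_zero: "cf x \<zero> = \<zero>\<^sub>K" using cf_\<pi>[of "\<zero>\<^sub>A" x] by (simp add: \<pi>_zero A_simps)

lemma cf_ev: "y : V ==> cf x (ev y) = (if x = y then \<one>\<^sub>K else \<zero>\<^sub>K)" by (simp add: cf_\<pi> val_vid)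

lemma cf_finsum: "[|finite S; !!s. s : S ==> g s : \<C>|] ==> cf x (finsum C g S) = (\<Oplus>\<^sub>K s\<in>S. cf x (g s))"
 by (induction S rule: finite_induct) (auto simp: cf_zero cf_add cf_closed Pi_def)

lemma ev_mult: "[|x : V; y : V|] ==> ev x \<otimes> ev y = (if x = y then ev x else \<zero>)" by (simp add: \<pi>_mult[symmetric] vid_mult_vid \<pi>_zero)

lemma ev_sum: "finsum C ev V = \<one>"
proof -
 have "\<one>\<^sub>A = finsum A vid V"
 proof (rule ext, clarify)
 fix x p
 have "finsum A vid V (x, p) = (\<Oplus>\<^sub>K y\<in>V. vid y (x, p))" by (intro A_finsum) auto
 also have "... = (\<Oplus>\<^sub>K y\<in>V. if x = y then (if p = [] then \<one>\<^sub>K else \<zero>\<^sub>K) else \<zero>\<^sub>K)"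
 by (intro K.finsum_cong') (auto simp: path_element_def)
 also have "... = \<one>\<^sub>A (x, p)"
 proof (cases "x : V")
 case True
 thus ?thesis using K.finsum_singleton[of x V "%_. if p = [] then \<one>\<^sub>K else \<zero>\<^sub>K"] by (simp add: path_algebra_def)
 next
 case False
 thus ?thesis by (subst K.add.finprod_one_eqI) (auto simp: path_algebra_def)
 qed
 finally show "\<one>\<^sub>A (x, p) = finsum A vid V (x, p)" ..
 qed
 thus ?thesis using \<pi>_one by (simp add: \<pi>_finsum)
qed

lemma av_corner: assumes "a : arcs Q" shows "av a : \<C>" "ev (tail Q a) \<otimes> av a = av a" "av a \<otimes> ev (head Q a) = av a"
 using assms by (simp_all add: \<pi>_mult[symmetric] vid_mult_arr arr_mult_vid)

lemma dv_corner: assumes "a : arcs Q" "f : \<A>" shows "dv a f : \<C>" "ev (head Q a) \<otimes> dv a f = dv a f"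
 using assms by (simp_all add: \<pi>_mult[symmetric] vid_der)

lemma dv_outside: "[|f : \<A>; vid x \<otimes>\<^sub>A f = f; tail Q a ~= x|] ==> dv a f = \<zero>" by (simp add: der_outside \<pi>_zero)

section \<open>The radical filtration of \<open>C\<close>\<close>

definition radf :: "nat => 'c set" where "radf n = \<pi> ` filt n"

lemma radf_1_iff: "c : \<C> ==> c : radf 1 \<longleftrightarrow> (ALL x:V. cf x c = \<zero>\<^sub>K)"
proof
 assume "c : \<C>" "ALL x:V. cf x c = \<zero>\<^sub>K"
 thus "c : radf 1" using pre[of c] filt_1_iff[of "pre c"] unfolding radf_def cf_def by (metis imageI)
next
 assume "c : radf 1"
 then obtain f where f: "f : filt 1" "c = \<pi> f" by (auto simp: radf_def)
 thus "ALL x:V. cf x c = \<zero>\<^sub>K" using cf_\<pi>[OF filt_carrier[OF f(1)]] by (simp add: filt_def)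
qed

lemma radf_carrier: "c : radf n ==> c : \<C>" using filt_carrier by (auto simp: radf_def)
lemma radf_0: "radf 0 = \<C>" using \<pi>_surj by (simp add: radf_def filt_0)
lemma radf_zero: "\<zero> : radf n" using filt_zero \<pi>_zero unfolding radf_def by (metis imageI)
lemma radf_top: "c : radf (card V) ==> c = \<zero>" by (simp add: radf_def filt_top \<pi>_zero)

lemma radf_add: assumes "c : radf n" "d : radf n" shows "c \<oplus>\<^sub>C d : radf n"
proof -
 from assms obtain f g where "f : filt n" "g : filt n" "c = \<pi> f" "d = \<pi> g" by (auto simp: radf_def)
 hence "c \<oplus>\<^sub>C d = \<pi> (f \<oplus>\<^sub>A g)" "f \<oplus>\<^sub>A g : filt n" using filt_carrier by (auto simp: \<pi>_add filt_add)
 thus ?thesis by (auto simp: radf_def)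
qed

lemma radf_neg: assumes "c : radf n" shows "\<ominus> c : radf n"
proof -
 from assms obtain f where "f : filt n" "c = \<pi> f" by (auto simp: radf_def)
 hence "\<ominus> c = \<pi> (\<ominus>\<^sub>A f)" "\<ominus>\<^sub>A f : filt n" using filt_carrier by (auto simp: \<pi>_neg filt_neg)
 thus ?thesis by (auto simp: radf_def)
qed

lemma radf_mult: assumes "c : radf m" "d : radf n" shows "c \<otimes> d : radf (m + n)"
proof -
 from assms obtain f g where "f : filt m" "g : filt n" "c = \<pi> f" "d = \<pi> g" by (auto simp: radf_def)
 hence "c \<otimes> d = \<pi> (f \<otimes>\<^sub>A g)" "f \<otimes>\<^sub>A g : filt (m + n)" using filt_carrier by (auto simp: \<pi>_mult filt_mult)
 thus ?thesis by (auto simp: radf_def)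
qed

lemma radf_finsum: "[|finite S; !!s. s : S ==> g s : radf n|] ==> finsum C g S : radf n"
proof (induction S rule: finite_induct)
 case (insert s S)
 hence "g s : \<C>" "g : S \<rightarrow> \<C>" using radf_carrier by auto
 thus ?case using insert radf_add by auto
qed (simp add: radf_zero)

lemma nil_radf: assumes c: "c : radf 1" shows "\<exists>k::nat. c [^] k = \<zero>"
proof -
 have "c [^] k : radf k" for k :: nat
 proof (induction k)
 case 0 thus ?case by (simp add: radf_0)
 next
 case (Suc k) thus ?case using radf_mult[OF Suc c] by simp
 qed
 thus ?thesis using radf_top by blast
qed


lemma radf_1_mult_left: "[|c : \<C>; d : radf 1|] ==> c \<otimes> d : radf 1" using radf_mult[of c 0 d 1] by (simp add: radf_0)

lemma radf_1_mult_right: "[|c : \<C>; d : radf 1|] ==> d \<otimes> c : radf 1" using radf_mult[of d 1 c 0] by (simp add: radf_0)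
section \<open>The minimal resolution of the semisimple quotient\<close>
abbreviation "G0 == regular_module C"
abbreviation "G1 == corner_free C (arcs Q) ha"
abbreviation "G2 == corner_free C R tr1"
definition g1 :: "('a => 'c) => 'c" where
 "g1 = (\<lambda>u\<in>carrier G1. \<Oplus>a\<in>arcs Q. av a \<otimes> u a)"
text \<open>The matrix of left derivatives of the relations, read in \<open>C\<close>. It comes from
  the identity in the path algebra that \<open>r\<close> is the sum of \<open>a\<close> times
  \<open>der a r\<close>.\<close>

definition g2 :: "((('v, 'a) path => 'k) => 'c) => 'a => 'c" where
 "g2 = (\<lambda>u\<in>carrier G2. \<lambda>a\<in>arcs Q. \<Oplus>r\<in>R. dv a r \<otimes> u r)"

lemma G1_dual: "has_dual_basis C G1" by (rule has_dual_basis_corner_free[OF C.ring_axioms]) (auto simp: ev_mult)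

lemma G2_dual: "has_dual_basis C G2" by (rule has_dual_basis_corner_free[OF C.ring_axioms finite_R]) (auto simp: ev_mult rtrg)

lemmas G1_module = has_dual_basis_right_module[OF G1_dual]
lemmas G2_module = has_dual_basis_right_module[OF G2_dual]

lemma G1_closed: "[|u : carrier G1; a : arcs Q|] ==> u a : \<C>"
 and G1_fixed: "[|u : carrier G1; a : arcs Q|] ==> ev (head Q a) \<otimes> u a = u a" and G2_closed: "[|v : carrier G2; r : R|] ==> v r : \<C>"
 and G2_fixed: "[|v : carrier G2; r : R|] ==> ev (rtrg r) \<otimes> v r = v r" by (auto simp: corner_functions_def)

lemma dvR: "[|a : arcs Q; r : R|] ==> dv a r : \<C>" using dv_corner R_carrier by blast

lemma g1_hom: "g1 : mod_hom_set C G1 G0" unfolding g1_def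
proof (rule mod_hom_restrictI[OF G1_module])
 have cl: "(%a. av a \<otimes> u a) : arcs Q \<rightarrow> \<C>" if "u : carrier G1" for u using that G1_closed by auto
 fix u v assume u: "u : carrier G1" and v: "v : carrier G1"
 show "(\<Oplus>a\<in>arcs Q. av a \<otimes> u a) : carrier G0" using cl[OF u] by simp
 have "(\<Oplus>a\<in>arcs Q. av a \<otimes> (u \<oplus>\<^sub>G1 v) a) = (\<Oplus>a\<in>arcs Q. av a \<otimes> u a \<oplus>\<^sub>C av a \<otimes> v a)"
 using u v G1_closed by (intro C.finsum_cong') (auto simp: C.r_distr)
 thus "(\<Oplus>a\<in>arcs Q. av a \<otimes> (u \<oplus>\<^sub>G1 v) a) =
 (\<Oplus>a\<in>arcs Q. av a \<otimes> u a) \<oplus>\<^sub>G0 (\<Oplus>a\<in>arcs Q. av a \<otimes> v a)" using cl[OF u] cl[OF v] by (simp add: C.finsum_addf)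
 fix c assume c: "c : \<C>"
 have "(\<Oplus>a\<in>arcs Q. av a \<otimes> (c \<odot>\<^sub>G1 u) a) = (\<Oplus>a\<in>arcs Q. av a \<otimes> u a \<otimes> c)"
 using u c G1_closed by (intro C.finsum_cong') (auto simp: C.m_assoc)
 thus "(\<Oplus>a\<in>arcs Q. av a \<otimes> (c \<odot>\<^sub>G1 u) a) = c \<odot>\<^sub>G0 (\<Oplus>a\<in>arcs Q. av a \<otimes> u a)"
 using cl[OF u] c by (simp add: C.finsum_ldistr)
qed

lemma g2_sum_closed: "[|v : carrier G2; a : arcs Q|] ==> (%r. dv a r \<otimes> v r) : R \<rightarrow> \<C>" using dvR G2_closed by auto

lemma g2_hom: "g2 : mod_hom_set C G2 G1" unfolding g2_def
proof (rule mod_hom_restrictI[OF G2_module])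
 fix u v assume u: "u : carrier G2" and v: "v : carrier G2"
 note cl = g2_sum_closed
 have "ev (head Q a) \<otimes> (\<Oplus>r\<in>R. dv a r \<otimes> u r) = (\<Oplus>r\<in>R. dv a r \<otimes> u r)" if a: "a : arcs Q" for a
 proof -
 have "ev (head Q a) \<otimes> (\<Oplus>r\<in>R. dv a r \<otimes> u r) = (\<Oplus>r\<in>R. ev (head Q a) \<otimes> (dv a r \<otimes> u r))"
 using finite_R a cl[OF u a] by (intro C.finsum_rdistr) auto
 also have "... = (\<Oplus>r\<in>R. dv a r \<otimes> u r)" using a dvR G2_closed[OF u] dv_corner(2)[OF a R_carrier]
 by (intro C.finsum_cong') (auto simp: C.m_assoc[symmetric])
 finally show ?thesis .
 qed
 thus "(\<lambda>a\<in>arcs Q. \<Oplus>r\<in>R. dv a r \<otimes> u r) : carrier G1" using cl[OF u] by (auto simp: corner_functions_def)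
 have "(\<Oplus>r\<in>R. dv a r \<otimes> (u \<oplus>\<^sub>G2 v) r) = (\<Oplus>r\<in>R. dv a r \<otimes> u r) \<oplus>\<^sub>C (\<Oplus>r\<in>R. dv a r \<otimes> v r)"
 if a: "a : arcs Q" for a
 proof -
 have "(\<Oplus>r\<in>R. dv a r \<otimes> (u \<oplus>\<^sub>G2 v) r) = (\<Oplus>r\<in>R. dv a r \<otimes> u r \<oplus>\<^sub>C dv a r \<otimes> v r)"
 using u v a G2_closed dvR by (intro C.finsum_cong') (auto simp: C.r_distr)
 thus ?thesis using cl[OF u a] cl[OF v a] by (simp add: C.finsum_addf)
 qed
 thus "(\<lambda>a\<in>arcs Q. \<Oplus>r\<in>R. dv a r \<otimes> (u \<oplus>\<^sub>G2 v) r) =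
 (\<lambda>a\<in>arcs Q. \<Oplus>r\<in>R. dv a r \<otimes> u r) \<oplus>\<^sub>G1 (\<lambda>a\<in>arcs Q. \<Oplus>r\<in>R. dv a r \<otimes> v r)"
 by (auto simp: fun_eq_iff)
 fix c assume c: "c : \<C>"
 have "(\<Oplus>r\<in>R. dv a r \<otimes> (c \<odot>\<^sub>G2 u) r) = (\<Oplus>r\<in>R. dv a r \<otimes> u r) \<otimes> c" if a: "a : arcs Q" for a
 proof -
 have "(\<Oplus>r\<in>R. dv a r \<otimes> (c \<odot>\<^sub>G2 u) r) = (\<Oplus>r\<in>R. dv a r \<otimes> u r \<otimes> c)"
 using u c a G2_closed dvR by (intro C.finsum_cong') (auto simp: C.m_assoc)
 thus ?thesis using cl[OF u a] c finite_R by (simp add: C.finsum_ldistr)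
 qed
 thus "(\<lambda>a\<in>arcs Q. \<Oplus>r\<in>R. dv a r \<otimes> (c \<odot>\<^sub>G2 u) r) = c \<odot>\<^sub>G1 (\<lambda>a\<in>arcs Q. \<Oplus>r\<in>R. dv a r \<otimes> u r)"
 by (auto simp: fun_eq_iff)
qed

lemma der_relation_sum:
 assumes w: "!!r. r : R ==> w r : \<A>" and a: "a : arcs Q"
 shows "der a (\<Oplus>\<^sub>A r\<in>R. r \<otimes>\<^sub>A w r) = (\<Oplus>\<^sub>A r\<in>R. der a r \<otimes>\<^sub>A w r)"
proof -
 have "der a (\<Oplus>\<^sub>A r\<in>R. r \<otimes>\<^sub>A w r) = (\<Oplus>\<^sub>A r\<in>R. der a (r \<otimes>\<^sub>A w r))"
 using finite_R w a R_carrier by (intro der_finsum) auto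
 also have "... = (\<Oplus>\<^sub>A r\<in>R. der a r \<otimes>\<^sub>A w r)"
 using w a R_carrier by (intro A.finsum_cong') (auto simp: der_mult[OF I_filt_1[OF R_I]])
 finally show ?thesis .
qed

lemma \<pi>_der_relation_sum:
 assumes w: "!!r. r : R ==> w r : \<A>" and a: "a : arcs Q"
 shows "\<pi> (\<Oplus>\<^sub>A r\<in>R. der a r \<otimes>\<^sub>A w r) = (\<Oplus>r\<in>R. dv a r \<otimes> \<pi> (w r))"
proof -
 have "\<pi> (\<Oplus>\<^sub>A r\<in>R. der a r \<otimes>\<^sub>A w r) = (\<Oplus>r\<in>R. \<pi> (der a r \<otimes>\<^sub>A w r))"
 using finite_R w a R_carrier by (intro \<pi>_finsum) auto
 also have "... = (\<Oplus>r\<in>R. dv a r \<otimes> \<pi> (w r))" using w a R_carrier by (intro C.finsum_cong') (auto simp: \<pi>_mult)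
 finally show ?thesis .
qed

text \<open>Lifted to the path algebra, the composite is the sum of \<open>a\<close> times
  \<open>der a z\<close>, where \<open>z\<close> is the sum of the \<open>r w r\<close>. That sum is
  \<open>z\<close> itself, an element of \<open>I\<close>.\<close>

lemma g1_g2: assumes v: "v : carrier G2" shows "g1 (g2 v) = \<zero>"
proof -
 define w where "w r = pre (v r)" for r
 have w: "w r : \<A>" "\<pi> (w r) = v r" if "r : R" for r using pre G2_closed[OF v that] by (auto simp: w_def)
 let ?z = "\<Oplus>\<^sub>A r\<in>R. r \<otimes>\<^sub>A w r"
 have zI: "?z : I" using finite_R w R_I by (intro ideal_finsum[OF ideal_I] I.I_r_closed) auto
 have "g1 (g2 v) = (\<Oplus>a\<in>arcs Q. av a \<otimes> (\<Oplus>r\<in>R. dv a r \<otimes> v r))" using mod_hom_closed[OF g2_hom v] v g2_sum_closed[OF v]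
 by (auto simp: g1_def g2_def intro!: C.finsum_cong')
 also have "... = (\<Oplus>a\<in>arcs Q. \<pi> (arr a \<otimes>\<^sub>A der a ?z))"
 proof (rule C.finsum_cong')
 fix a assume a: "a : arcs Q"
 have "\<pi> (der a ?z) = (\<Oplus>r\<in>R. dv a r \<otimes> \<pi> (w r))" using \<pi>_der_relation_sum[of w, OF w(1) a] der_relation_sum[of w, OF w(1) a] by simp
 also have "... = (\<Oplus>r\<in>R. dv a r \<otimes> v r)" using w g2_sum_closed[OF v a] by (intro C.finsum_cong') auto
 finally show "av a \<otimes> (\<Oplus>r\<in>R. dv a r \<otimes> v r) = \<pi> (arr a \<otimes>\<^sub>A der a ?z)"
 using a I_carrier[OF zI] by (simp add: \<pi>_mult)
 qed (use I_carrier[OF zI] in auto)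
 also have "... = \<pi> ?z"
 using \<pi>_finsum[of "arcs Q" "%a. arr a \<otimes>\<^sub>A der a ?z"] I_carrier[OF zI] expand_filt_1[OF I_filt_1[OF zI]] by simp
 also have "... = \<zero>" using zI by (rule \<pi>_I)
 finally show ?thesis .
qed

text \<open>A kernel element lifts to coefficients \<open>f a\<close> for which the sum of
  \<open>a\<close> times \<open>f a\<close> lies in \<open>I\<close>. Taking derivatives in the
  decomposition of \<open>relations_generate\<close> produces the preimage; the arrow part
  contributes elements of \<open>I\<close>, which vanish in \<open>C\<close>.\<close>

lemma G_exact_1:
 assumes u: "u : carrier G1" and z: "g1 u = \<zero>" shows "u : g2 ` carrier G2"
proof -
 define f where "f a = vid (head Q a) \<otimes>\<^sub>A pre (u a)" for a
 have f: "f a : \<A>" "\<pi> (f a) = u a" "vid (head Q a) \<otimes>\<^sub>A f a = f a" if "a : arcs Q" for a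
 using that pre[OF G1_closed[OF u that]] G1_fixed[OF u that] by (simp_all add: f_def \<pi>_mult A.m_assoc[symmetric] vid_mult_vid)
 let ?z = "\<Oplus>\<^sub>A a\<in>arcs Q. arr a \<otimes>\<^sub>A f a"
 have zc: "?z : \<A>" using f by auto
 have "\<pi> ?z = (\<Oplus>a\<in>arcs Q. \<pi> (arr a \<otimes>\<^sub>A f a))" using f by (intro \<pi>_finsum) auto
 also have "... = (\<Oplus>a\<in>arcs Q. av a \<otimes> u a)" using f G1_closed[OF u] by (intro C.finsum_cong') (auto simp: \<pi>_mult)
 also have "... = \<zero>" using z u by (simp add: g1_def)
 finally have "?z : I" using \<pi>_ker[OF zc] by simp
 from relations_generate[OF this] obtain w i
 where wv: "ALL r:R. w r : \<A> & vid (rtrg r) \<otimes>\<^sub>A w r = w r" and iv: "ALL a:arcs Q. i a : I"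
 and eq: "?z = (\<Oplus>\<^sub>A r\<in>R. r \<otimes>\<^sub>A w r) \<oplus>\<^sub>A (\<Oplus>\<^sub>A a\<in>arcs Q. arr a \<otimes>\<^sub>A i a)"
 by blast
 from wv iv have w: "!!r. r : R ==> w r : \<A>" "!!r. r : R ==> vid (rtrg r) \<otimes>\<^sub>A w r = w r"
 and i: "!!a. a : arcs Q ==> i a : I" by auto
 have ic: "i a : \<A>" if "a : arcs Q" for a using i[OF that] by (rule I_carrier)
 define v where "v = (\<lambda>r\<in>R. \<pi> (w r))"
 have v: "v : carrier G2" unfolding v_def fun_module_simps
 proof (rule corner_functionsI)
 fix r assume r: "r : R"
 show "\<pi> (w r) : \<C>" "ev (rtrg r) \<otimes> \<pi> (w r) = \<pi> (w r)" using w[OF r] rtrg[OF r] by (simp_all add: \<pi>_mult[symmetric])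
 qed
 have "g2 v = u"
 proof (rule corner_functions_eqI)
 show "g2 v : corner_functions C (arcs Q) ha" using mod_hom_closed[OF g2_hom v] by simp
 show "u : corner_functions C (arcs Q) ha" using u by simp
 fix a assume a: "a : arcs Q"
 have rw: "(\<Oplus>\<^sub>A r\<in>R. r \<otimes>\<^sub>A w r) : \<A>" "(\<Oplus>\<^sub>A r\<in>R. der a r \<otimes>\<^sub>A w r) : \<A>"
 using w R_carrier a by (intro A.finsum_closed Pi_I A.m_closed der_closed; blast)+
 have "f a = der a ?z" using der_sum_arr[of f a] f a by simp
 also have "... = der a (\<Oplus>\<^sub>A r\<in>R. r \<otimes>\<^sub>A w r) \<oplus>\<^sub>A der a (\<Oplus>\<^sub>A a\<in>arcs Q. arr a \<otimes>\<^sub>A i a)"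
 unfolding eq using rw ic by (intro der_add) auto
 also have "... = (\<Oplus>\<^sub>A r\<in>R. der a r \<otimes>\<^sub>A w r) \<oplus>\<^sub>A vid (head Q a) \<otimes>\<^sub>A i a"
 using der_relation_sum[of w, OF w(1) a] der_sum_arr[of i a] ic a by simp
 finally have "\<pi> (f a) = \<pi> (\<Oplus>\<^sub>A r\<in>R. der a r \<otimes>\<^sub>A w r) \<oplus>\<^sub>C \<pi> (vid (head Q a) \<otimes>\<^sub>A i a)"
 using rw ic a by (simp add: \<pi>_add)
 also have "\<pi> (vid (head Q a) \<otimes>\<^sub>A i a) = \<zero>" using i a by (intro \<pi>_I I.I_l_closed) auto
 also have "\<pi> (\<Oplus>\<^sub>A r\<in>R. der a r \<otimes>\<^sub>A w r) = (\<Oplus>r\<in>R. dv a r \<otimes> v r)"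
 proof -
 have "(\<Oplus>r\<in>R. dv a r \<otimes> \<pi> (w r)) = (\<Oplus>r\<in>R. dv a r \<otimes> v r)"
 using g2_sum_closed[OF v a] by (intro C.finsum_cong') (auto simp: v_def)
 thus ?thesis using \<pi>_der_relation_sum[of w, OF w(1) a] by simp
 qed
 finally show "g2 v a = u a" using a v f[OF a] g2_sum_closed[OF v a] by (simp add: g2_def)
 qed
 thus ?thesis using v by blast
qed

text \<open>If \<open>g2 v\<close> vanishes, all derivatives of the sum \<open>z\<close> of the
  \<open>r w r\<close> lie in \<open>I\<close>. So \<open>z\<close> is a sum of arrows times
  elements of \<open>I\<close>, and \<open>relations_independent\<close> removes the constant terms
  of the coefficients.\<close>

lemma G_minimal:
 assumes v: "v : carrier G2" and z: "g2 v = \<zero>\<^sub>G1" and r0: "r0 : R" shows "v r0 : radf 1"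
proof -
 define w where "w r = vid (rtrg r) \<otimes>\<^sub>A pre (v r)" for r
 have w: "w r : \<A>" "\<pi> (w r) = v r" "vid (rtrg r) \<otimes>\<^sub>A w r = w r" if "r : R" for r
 using that pre[OF G2_closed[OF v that]] G2_fixed[OF v that] rtrg[OF that] by (simp_all add: w_def \<pi>_mult A.m_assoc[symmetric] vid_mult_vid)
 define i where "i a = (\<Oplus>\<^sub>A r\<in>R. der a r \<otimes>\<^sub>A w r)" for a
 let ?z = "\<Oplus>\<^sub>A r\<in>R. r \<otimes>\<^sub>A w r"
 have zI: "?z : I" using finite_R w R_I by (intro ideal_finsum[OF ideal_I] I.I_r_closed) auto
 have i: "i a : I" if a: "a : arcs Q" for a
 proof -
 have "i a : \<A>" using w R_carrier a unfolding i_def by (intro A.finsum_closed Pi_I A.m_closed der_closed; blast)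
 moreover have "\<pi> (i a) = (\<Oplus>r\<in>R. dv a r \<otimes> \<pi> (w r))" unfolding i_def by (rule \<pi>_der_relation_sum[OF w(1) a])
 moreover have "(\<Oplus>r\<in>R. dv a r \<otimes> \<pi> (w r)) = (\<Oplus>r\<in>R. dv a r \<otimes> v r)" using w g2_sum_closed[OF v a] by (intro C.finsum_cong') auto
 moreover have "(\<Oplus>r\<in>R. dv a r \<otimes> v r) = \<zero>" using fun_cong[OF z, of a] v a by (simp add: g2_def)
 ultimately show ?thesis using \<pi>_ker by simp
 qed
 have "?z = (\<Oplus>\<^sub>A a\<in>arcs Q. arr a \<otimes>\<^sub>A der a ?z)" by (rule expand_filt_1[OF I_filt_1[OF zI]])
 also have "... = (\<Oplus>\<^sub>A a\<in>arcs Q. arr a \<otimes>\<^sub>A i a)"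
 using i I_carrier der_relation_sum[of w, OF w(1)] by (intro A.finsum_cong') (auto simp: i_def[symmetric])
 finally have eq: "?z = (\<Oplus>\<^sub>A a\<in>arcs Q. arr a \<otimes>\<^sub>A i a)" .
 have "w r0 (rtrg r0, []) = \<zero>\<^sub>K" by (rule relations_independent[OF finite_R subset_refl w(1,3) i eq r0])
 hence "w r0 (x, []) = \<zero>\<^sub>K" for x using vid_fixed_val[OF w(1,3)[OF r0]] by (cases "x = rtrg r0") auto
 hence "w r0 : filt 1" using filt_1_iff[OF w(1)[OF r0]] by simp
 thus ?thesis using w(2)[OF r0] unfolding radf_def by (metis imageI)
qed
end

section \<open>Injectivity of the second differential of the minimal resolution\<close>

lemma (in abelian_group) add_minus_minus:
 assumes "a : carrier G" "b : carrier G" shows "a \<oplus> b \<ominus> a \<ominus> b = \<zero>"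
proof -
 have "a \<oplus> b = b \<oplus> a" using assms by (rule a_comm)
 hence "a \<oplus> b \<ominus> a = b" using assms by (simp add: a_minus_def a_assoc r_neg)
 thus ?thesis using assms by (simp add: a_minus_def r_neg)
qed

lemma (in abelian_group) zero_minus_minus_add:
 assumes "a : carrier G" shows "\<zero> \<ominus> a \<ominus> \<zero> \<oplus> a = \<zero>"
proof -
 have z: "\<ominus> \<zero> = \<zero>" by (rule minus_equality[OF l_zero]) auto
 have "\<zero> \<ominus> a \<ominus> \<zero> = \<ominus> a" unfolding a_minus_def z using assms by simp
 thus ?thesis using assms by (simp only: l_neg)
qed

context bound_quiver_algebra
begin
interpretation K: field K by (rule field_K)
interpretation Q: fin_digraph Q by (rule fin_Q)
interpretation A: ring "path_algebra K Q" by (rule ring_A)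
interpretation C: ring C by (rule kalgebraD(2)[OF kalgebra_C])
interpretation kC: kalgebra K C by (rule kalgebra_C)

lemma radf_1_image:
 assumes "c : radf 1" shows "c : g1 ` carrier G1"
proof -
 obtain f where f: "f : filt 1" "c = \<pi> f" using assms by (auto simp: radf_def)
 have fc: "f : \<A>" using f(1) by (rule filt_carrier)
 let ?u = "\<lambda>a\<in>arcs Q. dv a f"
 have u: "?u : carrier G1" using dv_corner fc by (auto intro!: corner_functionsI)
 have "c = (\<Oplus>a\<in>arcs Q. \<pi> (arr a \<otimes>\<^sub>A der a f))"
 using \<pi>_finsum[of "arcs Q" "%a. arr a \<otimes>\<^sub>A der a f"] expand_filt_1[OF f(1)] fc f(2) by simp
 also have "... = (\<Oplus>a\<in>arcs Q. av a \<otimes> ?u a)" using fc by (intro C.finsum_cong') (auto simp: \<pi>_mult)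
 also have "... = g1 ?u" using u by (simp add: g1_def)
 finally show ?thesis using u by blast
qed

lemma av_radf: "a : arcs Q ==> av a : radf 1" using arr_filt by (auto simp: radf_def)

lemma g1_radf: "u : carrier G1 ==> g1 u : radf 1" using av_radf G1_closed unfolding g1_def by (auto intro!: radf_finsum radf_1_mult_right simp del: One_nat_def)

text \<open>The kernel of \<^term>\<open>g2\<close> lies in the radical by minimality, and it vanishes up to homotopy since
 the semisimple quotient of \<open>C\<close> has projective dimension at most two. By nilpotency of the radical
 it is zero.\<close>

lemma g2_injective:
 assumes gl: "gl_dim_le C 2" and v: "v : carrier G2" and g2v: "g2 v = \<zero>\<^sub>G1" shows "v = \<zero>\<^sub>G2"
proof -
 define n where "n = card V"
 obtain \<nu> where \<nu>: "bij_betw \<nu> {..<n} V" using ex_bij_betw_nat_finite[OF Q.finite_verts] by (auto simp: atLeast0LessThan n_def)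
 have \<nu>V: "\<nu> i : V" if "i < n" for i using \<nu> that by (auto simp: bij_betw_def)
 \<comment> \<open>The top of \<open>C\<close> as a module with elements of the type over which
   \<open>gl_dim_le\<close> quantifies: the points are numbered by \<open>\<nu>\<close>, and
   \<open>c\<close> acts on coordinate \<open>i\<close> through the character at
   \<open>\<nu> i\<close>.\<close>
 define S :: "('c, nat => 'k) module" where "S = \<lparr>carrier = {..<n} \<rightarrow>\<^sub>E carrier K, mult = undefined,
 one = undefined, zero = (\<lambda>i\<in>{..<n}. \<zero>\<^sub>K), add = (%f g. \<lambda>i\<in>{..<n}. f i \<oplus>\<^sub>K g i),
 smult = (%c f. \<lambda>i\<in>{..<n}. f i \<otimes>\<^sub>K cf (\<nu> i) c)\<rparr>"
 have S_simps: "carrier S = {..<n} \<rightarrow>\<^sub>E carrier K" "\<zero>\<^sub>S = (\<lambda>i\<in>{..<n}. \<zero>\<^sub>K)"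
 "f \<oplus>\<^sub>S g = (\<lambda>i\<in>{..<n}. f i \<oplus>\<^sub>K g i)" "c \<odot>\<^sub>S f = (\<lambda>i\<in>{..<n}. f i \<otimes>\<^sub>K cf (\<nu> i) c)" for f g c
 by (simp_all add: S_def)
 have S_eqI: "f = g" if "f : carrier S" "g : carrier S" "!!i. i < n ==> f i = g i" for f g using that unfolding S_simps by (meson PiE_ext lessThan_iff)
 have S_val: "f i : carrier K" if "f : carrier S" "i < n" for f i using that by (auto simp: S_simps)
 have Sm: "right_module C S"
 proof (intro right_module.intro right_module_axioms.intro)
 show "abelian_group S"
 proof (rule abelian_groupI)
 fix f assume f: "f : carrier S"
 show "\<zero>\<^sub>S \<oplus>\<^sub>S f = f" using S_val[OF f] f by (intro S_eqI) (auto simp: S_simps)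
 show "EX g:carrier S. g \<oplus>\<^sub>S f = \<zero>\<^sub>S" using S_val[OF f]
 by (intro bexI[of _ "\<lambda>i\<in>{..<n}. \<ominus>\<^sub>K f i"]) (auto simp: S_simps fun_eq_iff K.l_neg)
 next
 show "f \<oplus>\<^sub>S g : carrier S" if "f : carrier S" "g : carrier S" for f g
 using S_val[OF that(1)] S_val[OF that(2)] by (auto simp: S_simps)
 show "\<zero>\<^sub>S : carrier S" by (auto simp: S_simps)
 show "f \<oplus>\<^sub>S g = g \<oplus>\<^sub>S f" if "f : carrier S" "g : carrier S" for f g
 using S_val[OF that(1)] S_val[OF that(2)] by (auto simp: S_simps fun_eq_iff intro: K.a_comm)
 show "f \<oplus>\<^sub>S g \<oplus>\<^sub>S k = f \<oplus>\<^sub>S (g \<oplus>\<^sub>S k)"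
 if "f : carrier S" "g : carrier S" "k : carrier S" for f g k
 using S_val[OF that(1)] S_val[OF that(2)] S_val[OF that(3)] by (auto simp: S_simps fun_eq_iff intro: K.a_assoc)
 qed
 show "\<one> \<odot>\<^sub>S f = f" if f: "f : carrier S" for f
 proof (rule S_eqI)
 fix i assume i: "i < n"
 hence "cf (\<nu> i) \<one> = \<one>\<^sub>K" using cf_\<pi>[of "\<one>\<^sub>A" "\<nu> i"] \<nu>V by (simp add: \<pi>_one val_one)
 thus "(\<one> \<odot>\<^sub>S f) i = f i" using i S_val[OF f i] by (simp add: S_simps)
 qed (use f S_val[OF f] cf_closed in \<open>auto simp: S_simps\<close>)
 show "ring C" by (rule C.ring_axioms)
 next
 fix c d f g assume c: "c : \<C>" and f: "f : carrier S"
 note v = S_val[OF f] cf_closed[OF c]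
 show "c \<odot>\<^sub>S f : carrier S" using v by (auto simp: S_simps)
 show "c \<odot>\<^sub>S (f \<oplus>\<^sub>S g) = c \<odot>\<^sub>S f \<oplus>\<^sub>S c \<odot>\<^sub>S g" if "g : carrier S"
 using v S_val[OF that] by (auto simp: S_simps fun_eq_iff intro: K.l_distr)
 assume d: "d : \<C>"
 show "(c \<oplus>\<^sub>C d) \<odot>\<^sub>S f = c \<odot>\<^sub>S f \<oplus>\<^sub>S d \<odot>\<^sub>S f"
 using v cf_closed[OF d] c d by (auto simp: S_simps fun_eq_iff cf_add intro: K.r_distr)
 show "(c \<otimes> d) \<odot>\<^sub>S f = d \<odot>\<^sub>S (c \<odot>\<^sub>S f)"
 using v cf_closed[OF d] c d by (auto simp: S_simps fun_eq_iff cf_mult K.m_assoc)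
 qed
 interpret S: right_module C S by (rule Sm)
 define ge where "ge = (\<lambda>c\<in>\<C>. \<lambda>i\<in>{..<n}. cf (\<nu> i) c)"
 have G0m: "right_module C G0" by (rule right_module_regular[OF C.ring_axioms])
 have ge: "ge : mod_hom_set C G0 S" unfolding ge_def using cf_closed by (intro mod_homI) (auto simp: S_simps fun_eq_iff cf_add cf_mult)
 have ge_surj: "carrier S \<subseteq> ge ` carrier G0"
 proof
 fix f assume f: "f : carrier S"
 let ?c = "\<Oplus>i\<in>{..<n}. f i \<odot> ev (\<nu> i)"
 have t: "f i \<odot> ev (\<nu> i) : \<C>" if "i < n" for i using S_val[OF f that] \<nu>V[OF that] by simp
 have c: "?c : \<C>" using t by auto
 have "ge ?c = f"
 proof (rule S_eqI[OF _ f])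
 show "ge ?c : carrier S" using mod_hom_closed[OF ge] c by simp
 fix i assume i: "i < n"
 have "cf (\<nu> i) ?c = (\<Oplus>\<^sub>K j\<in>{..<n}. cf (\<nu> i) (f j \<odot> ev (\<nu> j)))" using t by (intro cf_finsum) auto
 also have "... = (\<Oplus>\<^sub>K j\<in>{..<n}. if i = j then f j else \<zero>\<^sub>K)"
 proof (rule K.finsum_cong')
 fix j assume "j : {..<n}"
 moreover from this have "\<nu> i = \<nu> j \<longleftrightarrow> i = j" using \<nu> i by (auto simp: bij_betw_def inj_on_def)
 ultimately show "cf (\<nu> i) (f j \<odot> ev (\<nu> j)) = (if i = j then f j else \<zero>\<^sub>K)" using S_val[OF f] \<nu>V by (simp add: cf_smult cf_ev)
 qed (use S_val[OF f] in auto)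
 also have "... = f i" using i S_val[OF f] by (intro K.finsum_singleton) auto
 finally show "ge ?c i = f i" using c i by (simp add: ge_def)
 qed
 moreover have "ge ?c : ge ` carrier G0" using c by (intro imageI) simp
 ultimately show "f : ge ` carrier G0" by simp
 qed
 have ge_rad: "ge c = \<zero>\<^sub>S \<longleftrightarrow> c : radf 1" if c: "c : \<C>" for c
 proof -
 have "ge c = \<zero>\<^sub>S \<longleftrightarrow> (\<forall>i<n. cf (\<nu> i) c = \<zero>\<^sub>K)" using c by (auto simp: ge_def S_simps fun_eq_iff)
 also have "... \<longleftrightarrow> (ALL x:V. cf x c = \<zero>\<^sub>K)" using \<nu> unfolding bij_betw_def by (metis image_iff lessThan_iff)
 finally show ?thesis using radf_1_iff[OF c] by simp
 qed
 have ge_g1: "ALL x:carrier G1. ge (g1 x) = \<zero>\<^sub>S" using ge_rad[OF radf_carrier[OF g1_radf]] g1_radf by blast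
 have g12: "ALL x:carrier G2. g1 (g2 x) = \<zero>\<^sub>G0" using g1_g2 unfolding regular_module_simps by blast
 have ge_ker: "ALL x:carrier G0. ge x = \<zero>\<^sub>S --> x : g1 ` carrier G1" unfolding regular_module_simps using ge_rad radf_1_image by blast
 have g1_ker: "ALL x:carrier G1. g1 x = \<zero>\<^sub>G0 --> x : g2 ` carrier G2" unfolding regular_module_simps using G_exact_1 by blast
 have Gx: "three_term C S G0 G1 G2 ge g1 g2" unfolding three_term_def by (intro conjI Sm G0m G1_module G2_module ge g1_hom g2_hom ge_g1 g12)
 hence Gex: "exact_three C S G0 G1 G2 ge g1 g2" unfolding exact_three_def by (intro conjI ge_surj ge_ker g1_ker)
 have "fin_gen_module C S"
 proof -
 let ?F = "free_module C 1"
 have Fm: "right_module C ?F" by (rule right_module_free[OF C.ring_axioms])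
 have p: "(\<lambda>u\<in>carrier ?F. u 0) : mod_hom_set C ?F G0" by (rule mod_hom_restrictI[OF Fm]) (auto simp: free_module_eq)
 have "compose (carrier ?F) ge (\<lambda>u\<in>carrier ?F. u 0) ` carrier ?F = carrier S"
 proof
 show "compose (carrier ?F) ge (\<lambda>u\<in>carrier ?F. u 0) ` carrier ?F \<subseteq> carrier S" using mod_hom_closed[OF mod_hom_compose[OF Fm p ge]] by auto
 show "carrier S \<subseteq> compose (carrier ?F) ge (\<lambda>u\<in>carrier ?F. u 0) ` carrier ?F"
 proof
 fix f assume "f : carrier S"
 then obtain c where c: "c : \<C>" "f = ge c" using ge_surj by auto
 let ?u = "\<lambda>i\<in>{..<1}. c"
 have u: "?u : carrier ?F" using c by (auto simp: free_module_eq)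
 hence "compose (carrier ?F) ge (\<lambda>u\<in>carrier ?F. u 0) ?u = f" using c by (simp add: compose_eq)
 thus "f : compose (carrier ?F) ge (\<lambda>u\<in>carrier ?F. u 0) ` carrier ?F" using u by blast
 qed
 qed
 thus ?thesis unfolding fin_gen_module_def using Sm mod_hom_compose[OF Fm p ge] by blast
 qed
 then obtain P :: "('c, nat => 'k, nat => 'k) resolution" where P: "projective_resolution C S P"
 and P0: "!!m. m > 2 ==> carrier (terms P m) = {\<zero>\<^bsub>terms P m\<^esub>}" using gl unfolding gl_dim_le_def by blast
 note t = projective_resolution_terms[OF P]
 note Pex = projective_resolution_exact[OF Sm P]
 \<comment> \<open>The third term of \<open>P\<close> is zero, so the boundary map out of the second
   term is injective.\<close>
 have Pinj: "p = \<zero>\<^bsub>terms P 2\<^esub>" if p: "p : carrier (terms P 2)" "boundary P 1 p = \<zero>\<^bsub>terms P 1\<^esub>" for p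
 proof -
 have "boundary P 2 ` carrier (terms P 3) = {p : carrier (terms P 2). boundary P 1 p = \<zero>\<^bsub>terms P 1\<^esub>}"
 using P unfolding projective_resolution_def by (simp add: numeral_2_eq_2 numeral_3_eq_3)
 hence "p : boundary P 2 ` {\<zero>\<^bsub>terms P 3\<^esub>}" using p P0[of 3] by simp
 thus ?thesis using mod_hom_zero[OF t(2)[of 3] t(2)[of 2]] t(3)[of 2] by (simp add: numeral_3_eq_3 numeral_2_eq_2)
 qed
 have G0d: "has_dual_basis C G0" by (rule has_dual_basis_regular[OF C.ring_axioms])
 have Px: "three_term C S (terms P 0) (terms P 1) (terms P 2) (augmentation P) (boundary P 0) (boundary P 1)" using Pex by (simp add: exact_three_def)
 note idS = mod_hom_id[OF Sm]
 obtain a0 a1 a2 where a: "a0 : mod_hom_set C G0 (terms P 0)" "a1 : mod_hom_set C G1 (terms P 1)" "a2 : mod_hom_set C G2 (terms P 2)"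
 and ac: "!!x. x : carrier G0 ==> augmentation P (a0 x) = (\<lambda>x\<in>carrier S. x) (ge x)"
 "!!x. x : carrier G1 ==> boundary P 0 (a1 x) = a0 (g1 x)"
 "!!x. x : carrier G2 ==> boundary P 1 (a2 x) = a1 (g2 x)" using comparison[OF Gx G0d G1_dual G2_dual Pex idS] by blast
 obtain b0 b1 b2 where b: "b0 : mod_hom_set C (terms P 0) G0" "b1 : mod_hom_set C (terms P 1) G1" "b2 : mod_hom_set C (terms P 2) G2"
 and bc: "!!x. x : carrier (terms P 0) ==> ge (b0 x) = (\<lambda>x\<in>carrier S. x) (augmentation P x)"
 "!!x. x : carrier (terms P 1) ==> g1 (b1 x) = b0 (boundary P 0 x)"
 "!!x. x : carrier (terms P 2) ==> g2 (b2 x) = b1 (boundary P 1 x)" using comparison[OF Px t(1) t(1) t(1) Gex idS] by blast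
 note acl = mod_hom_closed[OF a(1)] mod_hom_closed[OF a(2)] mod_hom_closed[OF a(3)] and bcl = mod_hom_closed[OF b(1)] mod_hom_closed[OF b(2)] mod_hom_closed[OF b(3)]
 and gcl = mod_hom_closed[OF ge] mod_hom_closed[OF g1_hom] mod_hom_closed[OF g2_hom]
 note f = mod_hom_compose[OF G0m a(1) b(1)] mod_hom_compose[OF G1_module a(2) b(2)] mod_hom_compose[OF G2_module a(3) b(3)]
 and i = mod_hom_id[OF G0m] mod_hom_id[OF G1_module] mod_hom_id[OF G2_module]
 \<comment> \<open>The composite of the two comparison maps and the identity both cover the identity
   of \<open>S\<close>, hence are homotopic.\<close>
 obtain h where h: "h : mod_hom_set C G1 G2"
 "!!x. x : carrier G2 ==> g2 (compose (carrier G2) b2 a2 x) = g2 ((\<lambda>x\<in>carrier G2. x) x \<oplus>\<^sub>G2 h (g2 x))"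
 proof (rule homotopy[OF Gx G0d G1_dual Gex f i])
 show "ge (compose (carrier G0) b0 a0 x) = ge ((\<lambda>x\<in>carrier G0. x) x)" if "x : carrier G0" for x
 using that acl(1)[OF that] gcl(1)[OF that] ac(1)[OF that] by (simp add: compose_eq bc del: regular_module_simps)
 show "g1 (compose (carrier G1) b1 a1 x) = compose (carrier G0) b0 a0 (g1 x)" if "x : carrier G1" for x
 using that acl(2)[OF that] gcl(2)[OF that] ac(2)[OF that] by (simp add: compose_eq bc del: regular_module_simps fun_module_simps)
 show "g2 (compose (carrier G2) b2 a2 x) = compose (carrier G1) b1 a1 (g2 x)" if "x : carrier G2" for x
 using that acl(3)[OF that] gcl(3)[OF that] ac(3)[OF that] by (simp add: compose_eq bc del: fun_module_simps)
 show "g1 ((\<lambda>x\<in>carrier G1. x) x) = (\<lambda>x\<in>carrier G0. x) (g1 x)" if "x : carrier G1" for x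
 using that gcl(2)[OF that] by (simp del: regular_module_simps fun_module_simps)
 show "g2 ((\<lambda>x\<in>carrier G2. x) x) = (\<lambda>x\<in>carrier G1. x) (g2 x)" if "x : carrier G2" for x
 using that gcl(3)[OF that] by (simp del: fun_module_simps)
 qed (use that in blast)
 interpret G1: right_module C G1 by (rule G1_module)
 interpret G2: right_module C G2 by (rule G2_module)
 note hcl = mod_hom_closed[OF h(1)]
 note s1 = mod_hom_sub[OF G2_module G2_module f(3) i(3)]
 note s2 = mod_hom_compose[OF G2_module g2_hom h(1)]
 \<comment> \<open>\<open>s\<close> measures how far \<open>b2 a2\<close> is from the identity after
   the homotopy correction; the homotopy formula places its values in the kernel of
   \<open>g2\<close>.\<close>
 define s where "s = (\<lambda>x\<in>carrier G2. (\<lambda>x\<in>carrier G2. compose (carrier G2) b2 a2 x \<ominus>\<^sub>G2 (\<lambda>x\<in>carrier G2. x) x) x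
 \<ominus>\<^sub>G2 compose (carrier G2) h g2 x)"
 have s: "s : mod_hom_set C G2 G2" unfolding s_def by (rule mod_hom_sub[OF G2_module G2_module s1 s2])
 have sx: "s x = b2 (a2 x) \<ominus>\<^sub>G2 x \<ominus>\<^sub>G2 h (g2 x)" if "x : carrier G2" for x
 using that by (simp add: s_def compose_eq del: fun_module_simps)
 have cl: "b2 (a2 x) : carrier G2" "h (g2 x) : carrier G2" if "x : carrier G2" for x using that by (intro mod_hom_closed[OF b(3)] mod_hom_closed[OF a(3)]
 mod_hom_closed[OF h(1)] mod_hom_closed[OF g2_hom]; assumption)+
 have s_ker: "g2 (s x) = \<zero>\<^sub>G1" if x: "x : carrier G2" for x
 proof -
 have e: "g2 (b2 (a2 x)) = g2 x \<oplus>\<^sub>G1 g2 (h (g2 x))" using h(2)[OF x] x cl[OF x] mod_hom_add[OF g2_hom x cl(2)[OF x]]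
 by (simp add: compose_eq del: fun_module_simps)
 have m: "b2 (a2 x) \<ominus>\<^sub>G2 x : carrier G2" using cl[OF x] x by (simp add: a_minus_def del: fun_module_simps)
 have "g2 (s x) = g2 (b2 (a2 x)) \<ominus>\<^sub>G1 g2 x \<ominus>\<^sub>G1 g2 (h (g2 x))"
 using x cl[OF x] m mod_hom_minus[OF G2_module G1_module g2_hom] by (simp add: sx del: fun_module_simps)
 thus ?thesis unfolding e using G1.M.add_minus_minus[OF gcl(3)[OF x] gcl(3)[OF cl(2)[OF x]]] by simp
 qed
 \<comment> \<open>On the kernel of \<open>g2\<close> both \<open>a2\<close> and the correction
   vanish, so \<open>s\<close> acts there as minus the identity.\<close>
 have s_neg: "s x \<oplus>\<^sub>G2 x = \<zero>\<^sub>G2" if x: "x : carrier G2" "g2 x = \<zero>\<^sub>G1" for x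
 proof -
 have "boundary P 1 (a2 x) = \<zero>\<^bsub>terms P 1\<^esub>" using ac(3)[OF x(1)] x(2) mod_hom_zero[OF G1_module t(2) a(2)] by (simp del: fun_module_simps)
 hence "a2 x = \<zero>\<^bsub>terms P 2\<^esub>" using acl(3)[OF x(1)] by (intro Pinj)
 hence "b2 (a2 x) = \<zero>\<^sub>G2" using mod_hom_zero[OF t(2) G2_module b(3)] by (simp del: fun_module_simps)
 moreover have "h (g2 x) = \<zero>\<^sub>G2" using x(2) mod_hom_zero[OF G1_module G2_module h(1)] by (simp del: fun_module_simps)
 ultimately have "s x = \<zero>\<^sub>G2 \<ominus>\<^sub>G2 x \<ominus>\<^sub>G2 \<zero>\<^sub>G2" using sx[OF x(1)] by metis
 thus ?thesis using G2.M.zero_minus_minus_add[OF x(1)] by metis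
 qed
 have ev_t: "ev (rtrg r) : \<C>" "ev (rtrg r) \<otimes> ev (rtrg r) = ev (rtrg r)" if "r : R" for r using rtrg[OF that] by (simp_all add: ev_mult)
 \<comment> \<open>An element \<open>x\<close> of the kernel has coefficients in the radical, while
   \<open>s\<close> of each generator lies in the kernel and so has entries in
   \<open>radf m\<close>. Since \<open>x = - s x\<close>, it lies one step deeper in the
   filtration.\<close>
 have "ALL x:carrier G2. g2 x = \<zero>\<^sub>G1 --> (ALL r:R. x r : radf m)" for m
 proof (induction m)
 case 0
 thus ?case using G2_closed by (simp add: radf_0 del: fun_module_simps)
 next
 case (Suc m)
 show ?case
 proof (intro ballI impI)
 fix x r assume x: "x : carrier G2" "g2 x = \<zero>\<^sub>G1" and r: "r : R"
 let ?u = "corner_unit C R tr1"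
 have u: "?u j : carrier G2" if "j : R" for j using corner_unit_mem[OF C.ring_axioms finite_R, of "%r. ev (rtrg r)"] ev_t that by simp
 have xc: "x j : \<C>" if "j : R" for j using G2_closed[OF x(1) that] .
 have su: "s (?u j) : carrier G2" if "j : R" for j using mod_hom_closed[OF s u[OF that]] .
 have "s x = s (\<Oplus>\<^sub>G2 j\<in>R. x j \<odot>\<^sub>G2 ?u j)"
 using corner_free_expand[OF C.ring_axioms finite_R, of "%r. ev (rtrg r)" x] ev_t x(1) by simp
 also have "... = (\<Oplus>\<^sub>G2 j\<in>R. s (x j \<odot>\<^sub>G2 ?u j))"
 using u xc by (intro mod_hom_finsum[OF G2_module G2_module s finite_R] Pi_I G2.act_closed)
 also have "... = (\<Oplus>\<^sub>G2 j\<in>R. x j \<odot>\<^sub>G2 s (?u j))" using u xc su mod_hom_act[OF s]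
 by (intro G2.M.finsum_cong' Pi_I G2.act_closed) (simp_all del: fun_module_simps)
 also have "... = (\<lambda>r\<in>R. \<Oplus>j\<in>R. (x j \<odot>\<^sub>G2 s (?u j)) r)"
 using su xc G2.act_closed by (intro finsum_fun_module G2_module finite_R) (auto simp: corner_functions_def)
 finally have sxr: "s x r = (\<Oplus>j\<in>R. s (?u j) r \<otimes> x j)" using r by simp
 have "s (?u j) r \<otimes> x j : radf (m + 1)" if j: "j : R" for j
 proof (rule radf_mult)
 show "x j : radf 1" by (rule G_minimal[OF x j])
 show "s (?u j) r : radf m" using Suc su[OF j] s_ker[OF u[OF j]] r by blast
 qed
 hence "s x r : radf (Suc m)" unfolding sxr using finite_R by (intro radf_finsum) auto
 moreover have "x r = \<ominus> s x r"
 proof -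
 have "(s x \<oplus>\<^sub>G2 x) r = \<zero>" using s_neg[OF x] r by simp
 hence "s x r \<oplus>\<^sub>C x r = \<zero>" using r by simp
 thus ?thesis using C.minus_equality[of "x r" "s x r"] C.a_comm xc[OF r] G2_closed[OF mod_hom_closed[OF s x(1)] r] by auto
 qed
 ultimately show "x r : radf (Suc m)" using radf_neg by simp
 qed
 qed
 from this[of "card V"] have "v r = \<zero>" if "r : R" for r using v g2v that radf_top by blast
 thus ?thesis using v G2.M.zero_closed by (intro corner_functions_eqI[of v C R _ "\<zero>\<^sub>G2"]) auto
qed
end
section \<open>A functorial resolution of the dual\<close>

lemma (in abelian_monoid) finsum_swap:
 assumes "finite S" "finite T" "!!i j. [|i : S; j : T|] ==> g i j : carrier G"
 shows "(\<Oplus>i\<in>S. \<Oplus>j\<in>T. g i j) = (\<Oplus>j\<in>T. \<Oplus>i\<in>S. g i j)" using assms(1,3)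
proof (induction S rule: finite_induct)
 case empty thus ?case by simp
next
 case (insert s S)
 have gs: "g s : T \<rightarrow> carrier G" using insert.prems by auto
 have gS: "(%j. \<Oplus>i\<in>S. g i j) : T \<rightarrow> carrier G" using insert.prems by auto
 have "(\<Oplus>i\<in>insert s S. \<Oplus>j\<in>T. g i j) = (\<Oplus>j\<in>T. g s j) \<oplus> (\<Oplus>j\<in>T. \<Oplus>i\<in>S. g i j)"
 using insert by (subst finsum_insert) auto
 also have "... = (\<Oplus>j\<in>T. g s j \<oplus> (\<Oplus>i\<in>S. g i j))" using gs gS by (rule finsum_addf[symmetric])
 also have "... = (\<Oplus>j\<in>T. \<Oplus>i\<in>insert s S. g i j)" using insert by (intro finsum_cong') auto
 finally show ?case .
qed

section \<open>Truncated elements of the path algebra, preparing the maps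
  \<open>delta\<close>\<close>

context acyclic_path_algebra
begin
interpretation K: field K by (rule field_K)
interpretation Q: fin_digraph Q by (rule fin_Q)
interpretation A: ring "path_algebra K Q" by (rule ring_A)

lemma mult_vid:
 assumes f: "f : \<A>" shows "(f \<otimes>\<^sub>A vid y) (x, p) = (if Q.awlast x p = y then f (x, p) else \<zero>\<^sub>K)"
proof -
 let ?v = "if Q.awlast x p = y then f (x, p) else \<zero>\<^sub>K"
 have "(f \<otimes>\<^sub>A vid y) (x, p) = (\<Oplus>\<^sub>K i\<in>{..length p}. if length p = i then ?v else \<zero>\<^sub>K)"
 unfolding A_mult using A_val[OF f] by (intro K.finsum_cong') (auto simp: path_element_def)
 also have "... = ?v" using A_val[OF f] K.finsum_singleton[of "length p" "{..length p}" "%_. ?v"] by auto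
 finally show ?thesis .
qed

lemma der_mult_vid:
 assumes "f : \<A>" "a : arcs Q" shows "der a (f \<otimes>\<^sub>A vid y) = der a f \<otimes>\<^sub>A vid y"
 using assms by (auto simp: fun_eq_iff mult_vid der_def[of a "f \<otimes>\<^sub>A vid y"]) (auto simp: der_def)
text \<open>Elements supported on paths of length less than \<open>n\<close>; this bounds the depth
  to which \<open>delta\<close> has to be unfolded.\<close>

definition low :: "nat => (('v, 'a) path => 'k) set"
 where "low n = {f : \<A>. ALL x p. n \<le> length p --> f (x, p) = \<zero>\<^sub>K}"

lemma low_carrier: "f : low n ==> f : \<A>" by (simp add: low_def)

lemma low_0: "f : low 0 ==> f = \<zero>\<^sub>A" by (auto simp: low_def fun_eq_iff A_simps)

lemma low_top: "f : \<A> ==> f : low (card (verts Q))"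
proof -
 assume f: "f : \<A>"
 have "f (x, p) = \<zero>\<^sub>K" if "card (verts Q) \<le> length p" for x p
 proof -
 have "(x, p) \<notin> paths Q" using path_length[of x p] that by auto
 thus ?thesis using f unfolding mem_A by blast
 qed
 thus ?thesis using f by (simp add: low_def)
qed

lemma der_low: "[|a : arcs Q; f : low (Suc n)|] ==> der a f : low n" using der_closed[of a f] by (simp add: low_def) (simp add: der_def)

lemma expand_der_source:
 assumes f: "f : \<A>" and x: "x : verts Q" "vid x \<otimes>\<^sub>A f = f"
 shows "f = f (x, []) \<odot>\<^sub>A vid x \<oplus>\<^sub>A (\<Oplus>\<^sub>A a\<in>arcs Q. arr a \<otimes>\<^sub>A der a f)"
proof -
 interpret kA: kalgebra K A by (rule kalgebra_A)
 have "(\<Oplus>\<^sub>A y\<in>verts Q. f (y, []) \<odot>\<^sub>A vid y) = (\<Oplus>\<^sub>A y\<in>verts Q. if x = y then f (y, []) \<odot>\<^sub>A vid y else \<zero>\<^sub>A)"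
 using A_val[OF f] vid_fixed_val[OF f x(2)] by (intro A.finsum_cong') (auto simp: kA.lmult_0)
 also have "... = f (x, []) \<odot>\<^sub>A vid x" using x A_val[OF f] by (intro A.finsum_singleton) auto
 finally show ?thesis using expand_der[OF f] by simp
qed
end

context bound_quiver_algebra
begin
interpretation K: field K by (rule field_K)
interpretation Q: fin_digraph Q by (rule fin_Q)
interpretation A: ring "path_algebra K Q" by (rule ring_A)
interpretation kA: kalgebra K A by (rule kalgebra_A)
interpretation C: ring C by (rule kalgebraD(2)[OF kalgebra_C])
interpretation kC: kalgebra K C by (rule kalgebra_C)

text \<open>For a path \<open>f = c\<^sub>1 \<dots> c\<^sub>m\<close> and large \<open>n\<close>, \<^term>\<open>delta n a f w\<close> is the sum of the maps
 \<open>b \<mapsto> c\<^sub>j\<^sub>+\<^sub>1 \<dots> c\<^sub>m \<cdot> w (c\<^sub>1 \<dots> c\<^sub>j\<^sub>-\<^sub>1 \<cdot> b)\<close> over all \<open>j\<close> with \<open>c\<^sub>j = a\<close>.\<close>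

primrec delta :: "nat => 'a => (('v, 'a) path => 'k) => ('c => 'c) => 'c => 'c" where
 "delta 0 a f w b = \<zero>"
| "delta (Suc n) a f w b = dv a f \<otimes> w b \<oplus>\<^sub>C
 (\<Oplus>c\<in>arcs Q. delta n a (der c f) (%b'. w (av c \<otimes> b')) b)"

context
 fixes a assumes a: "a : arcs Q"
begin
lemma delta_closed:
 "[|f : \<A>; !!b. b : \<C> ==> w b : \<C>; b : \<C>|] ==> delta n a f w b : \<C>"
proof (induction n arbitrary: f w)
 case (Suc n)
 have "delta n a (der c f) (%b'. w (av c \<otimes> b')) b : \<C>" if "c : arcs Q" for c using Suc.prems that by (intro Suc.IH) auto
 thus ?case using Suc.prems a by auto
qed simp

lemma delta_cong:
 "[|f : \<A>; !!b. b : \<C> ==> w b = w' b; !!b. b : \<C> ==> w' b : \<C>; b : \<C>|]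
 ==> delta n a f w b = delta n a f w' b"
proof (induction n arbitrary: f w w')
 case (Suc n)
 have "(\<Oplus>c\<in>arcs Q. delta n a (der c f) (%b'. w (av c \<otimes> b')) b)
 = (\<Oplus>c\<in>arcs Q. delta n a (der c f) (%b'. w' (av c \<otimes> b')) b)"
 proof (rule C.finsum_cong'[OF refl])
 show "(%c. delta n a (der c f) (%b'. w' (av c \<otimes> b')) b) : arcs Q \<rightarrow> \<C>"
 using Suc.prems(1,3,4) by (intro Pi_I delta_closed) auto
 show "delta n a (der c f) (%b'. w (av c \<otimes> b')) b = delta n a (der c f) (%b'. w' (av c \<otimes> b')) b" if "c : arcs Q" for c
 proof (rule Suc.IH)
 show "w (av c \<otimes> b) = w' (av c \<otimes> b)" "w' (av c \<otimes> b) : \<C>" if "b : \<C>" for b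
 using that `c : arcs Q` Suc.prems(2,3) by auto
 qed (use that Suc.prems(1,4) in auto)
 qed
 moreover have "w b = w' b" using Suc.prems(2,4) by blast
 ultimately show ?case by simp
qed simp

lemma delta_zero: "[|!!b. b : \<C> ==> w b : \<C>; b : \<C>|] ==> delta n a \<zero>\<^sub>A w b = \<zero>"
proof (induction n arbitrary: w)
 case (Suc n)
 have "delta n a (der c \<zero>\<^sub>A) (%b'. w (av c \<otimes> b')) b = \<zero>" if "c : arcs Q" for c
 unfolding der_zero using Suc.prems that by (intro Suc.IH) auto
 hence "(\<Oplus>c\<in>arcs Q. delta n a (der c \<zero>\<^sub>A) (%b'. w (av c \<otimes> b')) b) = \<zero>" by (intro C.add.finprod_one_eqI)
 thus ?case using Suc.prems by (simp add: der_zero \<pi>_zero)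
qed simp

lemma delta_add:
 "[|f : \<A>; !!b. b : \<C> ==> w b : \<C>; !!b. b : \<C> ==> w' b : \<C>; b : \<C>|]
 ==> delta n a f (%b. w b \<oplus>\<^sub>C w' b) b = delta n a f w b \<oplus>\<^sub>C delta n a f w' b"
proof (induction n arbitrary: f w w')
 case (Suc n)
 let ?d = "%w c. delta n a (der c f) (%b'. w (av c \<otimes> b')) b"
 have cl: "?d w : arcs Q \<rightarrow> \<C>" "?d w' : arcs Q \<rightarrow> \<C>" using Suc.prems by (intro Pi_I delta_closed; auto)+
 have "(\<Oplus>c\<in>arcs Q. delta n a (der c f) (%b'. w (av c \<otimes> b') \<oplus>\<^sub>C w' (av c \<otimes> b')) b)
 = (\<Oplus>c\<in>arcs Q. ?d w c \<oplus>\<^sub>C ?d w' c)"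
 proof (rule C.finsum_cong'[OF refl])
 show "(%c. ?d w c \<oplus>\<^sub>C ?d w' c) : arcs Q \<rightarrow> \<C>" using cl by (intro Pi_I C.a_closed) auto
 show "delta n a (der c f) (%b'. w (av c \<otimes> b') \<oplus>\<^sub>C w' (av c \<otimes> b')) b = ?d w c \<oplus>\<^sub>C ?d w' c"
 if "c : arcs Q" for c by (rule Suc.IH) (use that Suc.prems in auto)
 qed
 also have "... = finsum C (?d w) (arcs Q) \<oplus>\<^sub>C finsum C (?d w') (arcs Q)" using cl by (rule C.finsum_addf)
 finally show ?case using Suc.prems a C.finsum_closed[OF cl(1)] C.finsum_closed[OF cl(2)] by (simp add: C.r_distr C.a_ac)
qed simp

lemma delta_mult_right:
 "[|f : \<A>; !!b. b : \<C> ==> w b : \<C>; d : \<C>; b : \<C>|]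
 ==> delta n a f (%b. w b \<otimes> d) b = delta n a f w b \<otimes> d"
proof (induction n arbitrary: f w)
 case (Suc n)
 let ?d = "%c. delta n a (der c f) (%b'. w (av c \<otimes> b')) b"
 have cl: "?d : arcs Q \<rightarrow> \<C>" using Suc.prems by (intro Pi_I delta_closed; auto)+
 have "(\<Oplus>c\<in>arcs Q. delta n a (der c f) (%b'. w (av c \<otimes> b') \<otimes> d) b) = (\<Oplus>c\<in>arcs Q. ?d c \<otimes> d)"
 proof (rule C.finsum_cong'[OF refl])
 show "(%c. ?d c \<otimes> d) : arcs Q \<rightarrow> \<C>" using cl Suc.prems(3) by (intro Pi_I C.m_closed) auto
 show "delta n a (der c f) (%b'. w (av c \<otimes> b') \<otimes> d) b = ?d c \<otimes> d" if "c : arcs Q" for c by (rule Suc.IH) (use that Suc.prems in auto)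
 qed
 also have "... = finsum C ?d (arcs Q) \<otimes> d" using Suc.prems cl by (intro C.finsum_ldistr[symmetric]) auto
 finally show ?case using Suc.prems a C.finsum_closed[OF cl] by (simp add: C.l_distr C.m_assoc)
qed simp

lemma delta_mult_left:
 "[|f : \<A>; !!b. b : \<C> ==> w b : \<C>; d : \<C>; b : \<C>|]
 ==> delta n a f (%b. w (b \<otimes> d)) b = delta n a f w (b \<otimes> d)"
proof (induction n arbitrary: f w)
 case (Suc n)
 have "delta n a (der c f) (%b'. w (av c \<otimes> b' \<otimes> d)) b = delta n a (der c f) (%b'. w (av c \<otimes> b')) (b \<otimes> d)"
 if c: "c : arcs Q" for c
 proof -
 have "delta n a (der c f) (%b'. w (av c \<otimes> b' \<otimes> d)) b = delta n a (der c f) (%b'. w (av c \<otimes> (b' \<otimes> d))) b"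
 by (rule delta_cong) (use Suc.prems c in \<open>auto simp: C.m_assoc\<close>)
 also have "... = delta n a (der c f) (%b'. w (av c \<otimes> b')) (b \<otimes> d)" by (rule Suc.IH) (use Suc.prems c in auto)
 finally show ?thesis .
 qed
 moreover have "(%c. delta n a (der c f) (%b'. w (av c \<otimes> b')) (b \<otimes> d)) : arcs Q \<rightarrow> \<C>"
 using Suc.prems by (intro Pi_I delta_closed) auto
 ultimately have "(\<Oplus>c\<in>arcs Q. delta n a (der c f) (%b'. w (av c \<otimes> b' \<otimes> d)) b)
 = (\<Oplus>c\<in>arcs Q. delta n a (der c f) (%b'. w (av c \<otimes> b')) (b \<otimes> d))" by (intro C.finsum_cong'[OF refl])
 thus ?case by simp
qed simp

lemma delta_additive:
 "[|f : \<A>; !!b. b : \<C> ==> w b : \<C>;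
 !!b b'. [|b : \<C>; b' : \<C>|] ==> w (b \<oplus>\<^sub>C b') = w b \<oplus>\<^sub>C w b'; b : \<C>; b' : \<C>|]
 ==> delta n a f w (b \<oplus>\<^sub>C b') = delta n a f w b \<oplus>\<^sub>C delta n a f w b'"
proof (induction n arbitrary: f w)
 case (Suc n)
 let ?d = "%b c. delta n a (der c f) (%b'. w (av c \<otimes> b')) b"
 have cl: "?d b : arcs Q \<rightarrow> \<C>" "?d b' : arcs Q \<rightarrow> \<C>" using Suc.prems by (intro Pi_I delta_closed; auto)+
 have "(\<Oplus>c\<in>arcs Q. ?d (b \<oplus>\<^sub>C b') c) = (\<Oplus>c\<in>arcs Q. ?d b c \<oplus>\<^sub>C ?d b' c)"
 proof (rule C.finsum_cong'[OF refl])
 show "(%c. ?d b c \<oplus>\<^sub>C ?d b' c) : arcs Q \<rightarrow> \<C>" using cl by (intro Pi_I C.a_closed) auto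
 show "?d (b \<oplus>\<^sub>C b') c = ?d b c \<oplus>\<^sub>C ?d b' c" if "c : arcs Q" for c
 by (rule Suc.IH) (use that Suc.prems in \<open>auto simp: C.r_distr\<close>)
 qed
 also have "... = finsum C (?d b) (arcs Q) \<oplus>\<^sub>C finsum C (?d b') (arcs Q)" using cl by (rule C.finsum_addf)
 finally show ?case using Suc.prems a C.finsum_closed[OF cl(1)] C.finsum_closed[OF cl(2)] by (simp add: C.r_distr C.a_ac)
qed simp

lemma delta_linear:
 "[|f : \<A>; !!b. b : \<C> ==> w b : \<C>; k : carrier K;
 !!b. b : \<C> ==> w (k \<odot> b) = k \<odot> w b; b : \<C>|]
 ==> delta n a f w (k \<odot> b) = k \<odot> delta n a f w b"
proof (induction n arbitrary: f w)
 case 0 thus ?case by (simp add: kC.smult_r_null)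
next
 case (Suc n)
 let ?d = "%b c. delta n a (der c f) (%b'. w (av c \<otimes> b')) b"
 have cl: "?d b : arcs Q \<rightarrow> \<C>" using Suc.prems by (intro Pi_I delta_closed; auto)+
 have "(\<Oplus>c\<in>arcs Q. ?d (k \<odot> b) c) = (\<Oplus>c\<in>arcs Q. k \<odot> ?d b c)"
 proof (rule C.finsum_cong'[OF refl])
 show "(%c. k \<odot> ?d b c) : arcs Q \<rightarrow> \<C>" using cl Suc.prems(3) by (intro Pi_I kC.smult_closed) auto
 show "?d (k \<odot> b) c = k \<odot> ?d b c" if "c : arcs Q" for c by (rule Suc.IH) (use that Suc.prems in \<open>auto simp: kC.smult_mult_right[symmetric]\<close>)
 qed
 also have "... = k \<odot> finsum C (?d b) (arcs Q)" using Suc.prems cl by (intro kC.finsum_smult[symmetric]) auto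
 finally show ?case using Suc.prems a C.finsum_closed[OF cl] by (simp add: kC.smult_r_distr kC.smult_mult_right)
qed

text \<open>Each term evaluates \<open>w\<close> at a path ending in the tail of \<open>a\<close>
  times \<open>b\<close>, so the idempotent at that point changes nothing. For the empty prefix the
  hypothesis on \<open>w\<close> takes over.\<close>

lemma delta_source:
 "[|f : \<A>; x : V; vid x \<otimes>\<^sub>A f = f; !!b. b : \<C> ==> w b : \<C>;
 !!b. b : \<C> ==> w (ev x \<otimes> b) = w b; b : \<C>|]
 ==> delta n a f w (ev (tail Q a) \<otimes> b) = delta n a f w b"
proof (induction n arbitrary: f w x)
 case (Suc n)
 have D: "dv a f \<otimes> w (ev (tail Q a) \<otimes> b) = dv a f \<otimes> w b"
 proof (cases "tail Q a = x")
 case True thus ?thesis using Suc.prems by simp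
 next
 case False thus ?thesis using dv_outside[OF Suc.prems(1,3)] Suc.prems a by simp
 qed
 have "delta n a (der c f) (%b'. w (av c \<otimes> b')) (ev (tail Q a) \<otimes> b)
 = delta n a (der c f) (%b'. w (av c \<otimes> b')) b" if c: "c : arcs Q" for c by (rule Suc.IH[of _ "head Q c"])
 (use Suc.prems c av_corner[OF c] Q.head_in_verts[OF c] in \<open>auto simp: vid_der C.m_assoc[symmetric]\<close>)
 moreover have "(%c. delta n a (der c f) (%b'. w (av c \<otimes> b')) b) : arcs Q \<rightarrow> \<C>"
 using Suc.prems by (intro Pi_I delta_closed) auto
 ultimately have "(\<Oplus>c\<in>arcs Q. delta n a (der c f) (%b'. w (av c \<otimes> b')) (ev (tail Q a) \<otimes> b))
 = (\<Oplus>c\<in>arcs Q. delta n a (der c f) (%b'. w (av c \<otimes> b')) b)" by (intro C.finsum_cong'[OF refl])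
 with D show ?case by simp
qed simp

lemma delta_target:
 "[|f : \<A>; !!b. b : \<C> ==> w b : \<C>; b : \<C>|]
 ==> ev (head Q a) \<otimes> delta n a f w b = delta n a f w b"
proof (induction n arbitrary: f w)
 case 0 thus ?case using a by simp
next
 case (Suc n)
 let ?d = "%c. delta n a (der c f) (%b'. w (av c \<otimes> b')) b"
 have cl: "?d : arcs Q \<rightarrow> \<C>" using Suc.prems by (intro Pi_I delta_closed; auto)+
 have h: "ev (head Q a) : \<C>" using a by simp
 have "ev (head Q a) \<otimes> finsum C ?d (arcs Q) = (\<Oplus>c\<in>arcs Q. ev (head Q a) \<otimes> ?d c)" using h cl by (intro C.finsum_rdistr) auto
 also have "... = finsum C ?d (arcs Q)" 
 proof (rule C.finsum_cong'[OF refl cl])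
 show "ev (head Q a) \<otimes> ?d c = ?d c" if "c : arcs Q" for c by (rule Suc.IH) (use that Suc.prems in auto)
 qed
 finally have s: "ev (head Q a) \<otimes> finsum C ?d (arcs Q) = finsum C ?d (arcs Q)" .
 show ?case using Suc.prems h dv_corner[OF a Suc.prems(1)] C.finsum_closed[OF cl] s by (simp add: C.r_distr C.m_assoc[symmetric])
qed

text \<open>All arrows on a path from \<open>x\<close> start at points of level at most that of
  \<open>x\<close>, so \<open>a\<close> does not occur.\<close>

lemma delta_level_less:
 "[|f : \<A>; vid x \<otimes>\<^sub>A f = f; level x < level (tail Q a);
 !!b. b : \<C> ==> w b : \<C>; b : \<C>|] ==> delta n a f w b = \<zero>"
proof (induction n arbitrary: f w x)
 case (Suc n)
 have "tail Q a ~= x" using Suc.prems(3) by blast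
 hence "dv a f = \<zero>" by (rule dv_outside[OF Suc.prems(1,2)])
 moreover have "delta n a (der c f) (%b'. w (av c \<otimes> b')) b = \<zero>" if c: "c : arcs Q" for c
 proof (cases "tail Q c = x")
 case True
 show ?thesis
 proof (rule Suc.IH[of _ "head Q c"])
 show "level (head Q c) < level (tail Q a)" using True Suc.prems(3) level_arr[OF c] by simp
 qed (use Suc.prems(1,4,5) c in \<open>simp_all add: vid_der\<close>)
 next
 case False
 hence z: "der c f = \<zero>\<^sub>A" by (rule der_outside[OF Suc.prems(1,2)])
 show ?thesis unfolding z by (rule delta_zero) (use Suc.prems(4,5) c in simp_all)
 qed
 hence "(\<Oplus>c\<in>arcs Q. delta n a (der c f) (%b'. w (av c \<otimes> b')) b) = \<zero>" by (intro C.add.finprod_one_eqI)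
 ultimately show ?case using Suc.prems by simp
qed simp

text \<open>Later arrows on a path start at lower levels, so \<open>a\<close> can occur only in
  first position. For a relation the surviving factor \<open>dv a f\<close> is an entry of the
  matrix of \<open>g2\<close>, which links the two resolutions.\<close>

lemma delta_leading:
 assumes f: "f : \<A>" "vid x \<otimes>\<^sub>A f = f" and l: "level x \<le> level (tail Q a)"
 and w: "!!b. b : \<C> ==> w b : \<C>" and b: "b : \<C>" shows "delta (Suc n) a f w b = dv a f \<otimes> w b"
proof -
 have "delta n a (der c f) (%b'. w (av c \<otimes> b')) b = \<zero>" if c: "c : arcs Q" for c
 proof (cases "tail Q c = x")
 case True
 show ?thesis
 proof (rule delta_level_less[of _ "head Q c"])
 show "level (head Q c) < level (tail Q a)" using True l level_arr[OF c] by simp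
 qed (use f w b c in \<open>simp_all add: vid_der\<close>)
 next
 case False
 hence z: "der c f = \<zero>\<^sub>A" by (rule der_outside[OF f])
 show ?thesis unfolding z by (rule delta_zero) (use w b c in simp_all)
 qed
 hence "(\<Oplus>c\<in>arcs Q. delta n a (der c f) (%b'. w (av c \<otimes> b')) b) = \<zero>" by (intro C.add.finprod_one_eqI)
 thus ?thesis using a f w b by simp
qed

lemma delta_zero_fun:
 "[|f : \<A>; !!b. b : \<C> ==> w b = \<zero>; b : \<C>|] ==> delta n a f w b = \<zero>"
proof (induction n arbitrary: f w)
 case (Suc n)
 have "delta n a (der c f) (%b'. w (av c \<otimes> b')) b = \<zero>" if "c : arcs Q" for c using Suc.prems that by (intro Suc.IH) auto
 hence "(\<Oplus>c\<in>arcs Q. delta n a (der c f) (%b'. w (av c \<otimes> b')) b) = \<zero>" by (intro C.add.finprod_one_eqI)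
 thus ?case using Suc.prems a by simp
qed simp
end

text \<open>The telescoping identity \<open>w \<circ> L\<^sub>f - L\<^sub>f \<circ> w = \<Sum>\<^sub>a (\<delta>\<^sub>a \<circ> L\<^sub>a - L\<^sub>a \<circ> \<delta>\<^sub>a)\<close> for the left
 multiplications \<open>L\<close> and \<open>\<delta>\<^sub>a = delta n a f w\<close>, with both sides moved so that no subtraction occurs.\<close>

lemma delta_commutator:
 "[|f : low n; x : V; y : V; vid x \<otimes>\<^sub>A f = f; f \<otimes>\<^sub>A vid y = f;
 !!b. b : \<C> ==> w b : \<C>;
 !!b b'. [|b : \<C>; b' : \<C>|] ==> w (b \<oplus>\<^sub>C b') = w b \<oplus>\<^sub>C w b';
 !!k b. [|k : carrier K; b : \<C>|] ==> w (k \<odot> b) = k \<odot> w b;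
 !!b. b : \<C> ==> w (ev x \<otimes> b) = w b;
 !!b. b : \<C> ==> ev y \<otimes> w b = w b; b : \<C>|] ==>
 w (\<pi> f \<otimes> b) \<oplus>\<^sub>C (\<Oplus>a\<in>arcs Q. av a \<otimes> delta n a f w b)
 = \<pi> f \<otimes> w b \<oplus>\<^sub>C (\<Oplus>a\<in>arcs Q. delta n a f w (av a \<otimes> b))"
proof (induction n arbitrary: f w x)
 case 0
 have "w \<zero> \<oplus>\<^sub>C w \<zero> = w \<zero>" using 0(7)[of "\<zero>" "\<zero>"] by simp
 hence "w \<zero> = \<zero>" using 0(6)[of "\<zero>"] by (simp add: C.add.l_cancel_one')
 thus ?case using low_0[OF 0(1)] 0(6)[OF 0(11)] 0(11) by (simp add: \<pi>_zero C.add.finprod_one_eqI)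
next
 case (Suc n)
 note w = Suc.prems(6) and w_add = Suc.prems(7) and w_lin = Suc.prems(8) and wx = Suc.prems(9) and wy = Suc.prems(10)
 note b = Suc.prems(11)
 have f: "f : \<A>" using Suc.prems(1) by (rule low_carrier)
 have w_sum: "w (finsum C g S) = (\<Oplus>s\<in>S. w (g s))" if "finite S" "!!s. s : S ==> g s : \<C>" for g and S :: "'z set" using that
 proof (induction S rule: finite_induct)
 case empty
 have "w \<zero> \<oplus>\<^sub>C w \<zero> = w \<zero>" using w_add[of "\<zero>" "\<zero>"] by simp
 thus ?case using w[of "\<zero>"] by (simp add: C.add.l_cancel_one')
 next
 case (insert s S) thus ?case by (auto simp: Pi_def w_add w)
 qed
 define k where "k = f (x, [])"
 have k: "k : carrier K" using A_val[OF f] by (simp add: k_def)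
 define D where "D c = dv c f" for c
 have D: "D c : \<C>" if "c : arcs Q" for c using dv_corner(1)[OF that f] by (simp add: D_def)
 define dd where "dd c a b = delta n a (der c f) (%b'. w (av c \<otimes> b')) b" for c a b
 have dd: "dd c a b : \<C>" if "c : arcs Q" "a : arcs Q" "b : \<C>" for c a b unfolding dd_def using that w f by (intro delta_closed) auto
 have pf: "\<pi> f = k \<odot> ev x \<oplus>\<^sub>C (\<Oplus>c\<in>arcs Q. av c \<otimes> D c)"
 proof -
 have "\<pi> f = \<pi> (k \<odot>\<^sub>A vid x \<oplus>\<^sub>A (\<Oplus>\<^sub>A a\<in>arcs Q. arr a \<otimes>\<^sub>A der a f))"
 using expand_der_source[OF f Suc.prems(2,4)] by (simp add: k_def)
 also have "... = k \<odot> ev x \<oplus>\<^sub>C \<pi> (\<Oplus>\<^sub>A a\<in>arcs Q. arr a \<otimes>\<^sub>A der a f)"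
 using k f Suc.prems(2) by (subst \<pi>_add) (auto simp: \<pi>_smult)
 also have "\<pi> (\<Oplus>\<^sub>A a\<in>arcs Q. arr a \<otimes>\<^sub>A der a f) = (\<Oplus>c\<in>arcs Q. \<pi> (arr c \<otimes>\<^sub>A der c f))"
 using f by (intro \<pi>_finsum) auto
 also have "... = (\<Oplus>c\<in>arcs Q. av c \<otimes> D c)" using f by (intro C.finsum_cong') (auto simp: \<pi>_mult D_def)
 finally show ?thesis .
 qed
 have aD: "(%c. av c \<otimes> D c) : arcs Q \<rightarrow> \<C>" using D by auto
 have kx: "k \<odot> ev x : \<C>" using k Suc.prems(2) by simp
 have left: "w (\<pi> f \<otimes> b) = k \<odot> w b \<oplus>\<^sub>C (\<Oplus>c\<in>arcs Q. w (av c \<otimes> (D c \<otimes> b)))"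
 proof -
 have "\<pi> f \<otimes> b = k \<odot> ev x \<otimes> b \<oplus>\<^sub>C (\<Oplus>c\<in>arcs Q. av c \<otimes> D c) \<otimes> b"
 unfolding pf using kx C.finsum_closed[OF aD] b by (rule C.l_distr)
 also have "k \<odot> ev x \<otimes> b = k \<odot> (ev x \<otimes> b)" using k b Suc.prems(2) by (simp add: kC.smult_mult_left)
 also have "(\<Oplus>c\<in>arcs Q. av c \<otimes> D c) \<otimes> b = (\<Oplus>c\<in>arcs Q. av c \<otimes> D c \<otimes> b)" using aD b by (intro C.finsum_ldistr) auto
 also have "... = (\<Oplus>c\<in>arcs Q. av c \<otimes> (D c \<otimes> b))" using D b by (intro C.finsum_cong') (auto simp: C.m_assoc)
 finally have e: "\<pi> f \<otimes> b = k \<odot> (ev x \<otimes> b) \<oplus>\<^sub>C (\<Oplus>c\<in>arcs Q. av c \<otimes> (D c \<otimes> b))" .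
 have cl: "(%c. av c \<otimes> (D c \<otimes> b)) : arcs Q \<rightarrow> \<C>" using D b by auto
 have "w (\<pi> f \<otimes> b) = w (k \<odot> (ev x \<otimes> b)) \<oplus>\<^sub>C w (\<Oplus>c\<in>arcs Q. av c \<otimes> (D c \<otimes> b))"
 unfolding e using k b Suc.prems(2) C.finsum_closed[OF cl] by (intro w_add) auto
 also have "w (k \<odot> (ev x \<otimes> b)) = k \<odot> w b" using k b Suc.prems(2) by (simp add: w_lin wx)
 also have "w (\<Oplus>c\<in>arcs Q. av c \<otimes> (D c \<otimes> b)) = (\<Oplus>c\<in>arcs Q. w (av c \<otimes> (D c \<otimes> b)))" using cl by (intro w_sum) auto
 finally show ?thesis .
 qed
 have right: "\<pi> f \<otimes> w b = k \<odot> w b \<oplus>\<^sub>C (\<Oplus>c\<in>arcs Q. av c \<otimes> (D c \<otimes> w b))"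
 proof -
 have "\<pi> f \<otimes> w b = k \<odot> ev x \<otimes> w b \<oplus>\<^sub>C (\<Oplus>c\<in>arcs Q. av c \<otimes> D c) \<otimes> w b"
 unfolding pf using kx C.finsum_closed[OF aD] w[OF b] by (rule C.l_distr)
 also have "k \<odot> ev x \<otimes> w b = k \<odot> w b"
 \<comment> \<open>If the ends of \<open>f\<close> differ, \<open>f\<close> has no trivial path and
   \<open>k\<close> is zero; otherwise the values of \<open>w\<close> are fixed by
   \<open>ev x\<close>.\<close>
 proof (cases "x = y")
 case True
 thus ?thesis using k w[OF b] wy[OF b] Suc.prems(2) by (simp add: kC.smult_mult_left[symmetric])
 next
 case False
 have "k = (f \<otimes>\<^sub>A vid y) (x, [])" using Suc.prems(5) by (simp add: k_def)
 hence "k = \<zero>\<^sub>K" using f False Suc.prems(3) A_val[OF f] by (simp add: val_mult val_vid)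
 thus ?thesis using w[OF b] Suc.prems(2) by (simp add: kC.lmult_0)
 qed
 also have "(\<Oplus>c\<in>arcs Q. av c \<otimes> D c) \<otimes> w b = (\<Oplus>c\<in>arcs Q. av c \<otimes> D c \<otimes> w b)"
 using aD w[OF b] by (intro C.finsum_ldistr) auto
 also have "... = (\<Oplus>c\<in>arcs Q. av c \<otimes> (D c \<otimes> w b))" using D w[OF b] by (intro C.finsum_cong') (auto simp: C.m_assoc)
 finally show ?thesis .
 qed
 let ?S = "%g. finsum C g (arcs Q)"
 define P1 where "P1 = ?S (%c. w (av c \<otimes> (D c \<otimes> b)))"
 define P2 where "P2 = ?S (%c. av c \<otimes> (D c \<otimes> w b))"
 define P3 where "P3 = ?S (%c. D c \<otimes> w (av c \<otimes> b))"
 define Z1 where "Z1 = ?S (%c. ?S (%a. av a \<otimes> dd c a b))"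
 define Z2 where "Z2 = ?S (%c. ?S (%a. dd c a (av a \<otimes> b)))"
 have cl: "P1 : \<C>" "P2 : \<C>" "P3 : \<C>" "Z1 : \<C>" "Z2 : \<C>"
 unfolding P1_def P2_def P3_def Z1_def Z2_def using D w b dd by auto
 \<comment> \<open>For each arrow \<open>c\<close> the induction hypothesis is applied to
   \<open>der c f\<close> and to \<open>w\<close> precomposed with left multiplication by
   \<open>c\<close>, a map with source at the head of \<open>c\<close>.\<close>
 have IH: "P1 \<oplus>\<^sub>C Z1 = P3 \<oplus>\<^sub>C Z2"
 proof -
 have "w (av c \<otimes> (D c \<otimes> b)) \<oplus>\<^sub>C ?S (%a. av a \<otimes> dd c a b)
 = D c \<otimes> w (av c \<otimes> b) \<oplus>\<^sub>C ?S (%a. dd c a (av a \<otimes> b))" if c: "c : arcs Q" for c unfolding dd_def D_def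
 proof (rule Suc.IH[of "der c f" "head Q c"])
 show "der c f : low n" using c Suc.prems(1) by (rule der_low)
 show "der c f \<otimes>\<^sub>A vid y = der c f" using der_mult_vid[OF f c, of y] unfolding Suc.prems(5) by (rule sym)
 show "vid (head Q c) \<otimes>\<^sub>A der c f = der c f" by (rule vid_der[OF c f])
 show "w (av c \<otimes> (ev (head Q c) \<otimes> b)) = w (av c \<otimes> b)" if "b : \<C>" for b
 using that c av_corner[OF c] by (simp add: C.m_assoc[symmetric])
 qed (use c f b Suc.prems(3) Q.head_in_verts[OF c] w wy in
 \<open>simp_all add: C.r_distr w_add w_lin kC.smult_mult_right[symmetric]\<close>)
 hence "?S (%c. w (av c \<otimes> (D c \<otimes> b)) \<oplus>\<^sub>C ?S (%a. av a \<otimes> dd c a b))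
 = ?S (%c. D c \<otimes> w (av c \<otimes> b) \<oplus>\<^sub>C ?S (%a. dd c a (av a \<otimes> b)))"
 using D w b dd by (intro C.finsum_cong') auto
 moreover have "?S (%c. w (av c \<otimes> (D c \<otimes> b)) \<oplus>\<^sub>C ?S (%a. av a \<otimes> dd c a b)) = P1 \<oplus>\<^sub>C Z1"
 unfolding P1_def Z1_def using D w b dd by (intro C.finsum_addf) auto
 moreover have "?S (%c. D c \<otimes> w (av c \<otimes> b) \<oplus>\<^sub>C ?S (%a. dd c a (av a \<otimes> b))) = P3 \<oplus>\<^sub>C Z2"
 unfolding P3_def Z2_def using D w b dd by (intro C.finsum_addf) auto
 ultimately show ?thesis by simp
 qed
 have sum1: "?S (%a. av a \<otimes> delta (Suc n) a f w b) = P2 \<oplus>\<^sub>C Z1"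
 proof -
 have "?S (%a. av a \<otimes> delta (Suc n) a f w b)
 = ?S (%a. av a \<otimes> (D a \<otimes> w b) \<oplus>\<^sub>C ?S (%c. av a \<otimes> dd c a b))"
 proof (rule C.finsum_cong')
 fix a assume a: "a : arcs Q"
 have t: "(%c. dd c a b) : arcs Q \<rightarrow> \<C>" using dd a b by auto
 have "av a \<otimes> delta (Suc n) a f w b = av a \<otimes> (D a \<otimes> w b) \<oplus>\<^sub>C av a \<otimes> ?S (%c. dd c a b)"
 using a D w b C.finsum_closed[OF t] by (simp add: D_def[symmetric] dd_def[symmetric] C.r_distr)
 also have "av a \<otimes> ?S (%c. dd c a b) = ?S (%c. av a \<otimes> dd c a b)" using a t by (intro C.finsum_rdistr) auto
 finally show "av a \<otimes> delta (Suc n) a f w b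
 = av a \<otimes> (D a \<otimes> w b) \<oplus>\<^sub>C ?S (%c. av a \<otimes> dd c a b)" .
 qed (use D w b dd in auto)
 also have "... = P2 \<oplus>\<^sub>C ?S (%a. ?S (%c. av a \<otimes> dd c a b))"
 unfolding P2_def using D w b dd by (intro C.finsum_addf) auto
 also have "?S (%a. ?S (%c. av a \<otimes> dd c a b)) = Z1" unfolding Z1_def using dd b by (intro C.finsum_swap) auto
 finally show ?thesis .
 qed
 have sum2: "?S (%a. delta (Suc n) a f w (av a \<otimes> b)) = P3 \<oplus>\<^sub>C Z2"
 proof -
 have "?S (%a. delta (Suc n) a f w (av a \<otimes> b))
 = ?S (%a. D a \<otimes> w (av a \<otimes> b) \<oplus>\<^sub>C ?S (%c. dd c a (av a \<otimes> b)))" by (simp add: D_def dd_def)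
 also have "... = P3 \<oplus>\<^sub>C ?S (%a. ?S (%c. dd c a (av a \<otimes> b)))"
 unfolding P3_def using D w b dd by (intro C.finsum_addf) auto
 also have "?S (%a. ?S (%c. dd c a (av a \<otimes> b))) = Z2" unfolding Z2_def using dd b by (intro C.finsum_swap) auto
 finally show ?thesis .
 qed
 have kw: "k \<odot> w b : \<C>" using k w b by simp
 have "w (\<pi> f \<otimes> b) \<oplus>\<^sub>C ?S (%a. av a \<otimes> delta (Suc n) a f w b)
 = (k \<odot> w b \<oplus>\<^sub>C P2) \<oplus>\<^sub>C (P1 \<oplus>\<^sub>C Z1)"
 unfolding left sum1 P1_def[symmetric] using kw cl by (simp add: C.a_ac)
 also have "... = \<pi> f \<otimes> w b \<oplus>\<^sub>C ?S (%a. delta (Suc n) a f w (av a \<otimes> b))"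
 unfolding IH right sum2 P2_def[symmetric] ..
 finally show ?case .
qed
end

text \<open>\<open>\<t>\<close> gives coordinate functionals with respect to the finite set
  \<open>B\<close>; linear maps and traces on \<open>C\<close> are expanded along
  \<open>frame\<close>.\<close>

locale bound_quiver_frame = bound_quiver_algebra K Q I R C \<pi> for K :: "'k ring" and Q :: "('v, 'a) pre_digraph" and I R :: "(('v, 'a) path => 'k) set"
 and C :: "('k, 'c) module" (structure) and \<pi> :: "(('v, 'a) path => 'k) => 'c" +
 fixes B :: "'c set" and \<t> :: "'c => 'c => 'k"
 assumes finite_B: "finite B" and B_sub: "B \<subseteq> carrier C" and \<t>_closed: "[|b : B; c : carrier C|] ==> \<t> b c : carrier K"
 and \<t>_add: "[|b : B; c : carrier C; d : carrier C|] ==> \<t> b (c \<oplus>\<^sub>C d) = \<t> b c \<oplus>\<^sub>K \<t> b d"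
 and \<t>_smult: "[|b : B; k : carrier K; c : carrier C|] ==> \<t> b (k \<odot> c) = k \<otimes>\<^sub>K \<t> b c"
 and frame: "c : carrier C ==> (\<Oplus>b\<in>B. \<t> b c \<odot> b) = c"
begin
interpretation K: field K by (rule field_K)
interpretation Q: fin_digraph Q by (rule fin_Q)
interpretation A: ring "path_algebra K Q" by (rule ring_A)
interpretation kA: kalgebra K A by (rule kalgebra_A)
interpretation C: ring C by (rule kalgebraD(2)[OF kalgebra_C])
interpretation kC: kalgebra K C by (rule kalgebra_C)
text \<open>A linear map over \<open>k\<close> from \<open>s C\<close> to \<open>t C\<close>, stored
  as a map on all of \<open>C\<close> that factors through left multiplication by \<open>s\<close>
  and has values fixed by \<open>t\<close>. For idempotents \<open>s\<close> and \<open>t\<close>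
  these maps form the tensor product over \<open>k\<close> of the dual of \<open>s C\<close> with
  \<open>t C\<close>.\<close>

definition bimap :: "'c => 'c => ('c => 'c) => bool"
 where "bimap s t w \<longleftrightarrow> (ALL b:\<C>. w b : \<C> & w (s \<otimes> b) = w b & t \<otimes> w b = w b \<and>
 (\<forall>b'\<in>\<C>. w (b \<oplus>\<^sub>C b') = w b \<oplus>\<^sub>C w b') & (ALL k:carrier K. w (k \<odot> b) = k \<odot> w b))"

lemma bimapI:
 assumes "!!b. b : \<C> ==> w b : \<C>" "!!b. b : \<C> ==> w (s \<otimes> b) = w b" and "!!b. b : \<C> ==> t \<otimes> w b = w b"
 and "!!b b'. [|b : \<C>; b' : \<C>|] ==> w (b \<oplus>\<^sub>C b') = w b \<oplus>\<^sub>C w b'"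
 and "!!k b. [|k : carrier K; b : \<C>|] ==> w (k \<odot> b) = k \<odot> w b" shows "bimap s t w" unfolding bimap_def by (intro ballI conjI assms)

lemma
 assumes "bimap s t w" shows bimap_closed: "b : \<C> ==> w b : \<C>" and bimap_source: "b : \<C> ==> w (s \<otimes> b) = w b"
 and bimap_target: "b : \<C> ==> t \<otimes> w b = w b"
 and bimap_add: "[|b : \<C>; b' : \<C>|] ==> w (b \<oplus>\<^sub>C b') = w b \<oplus>\<^sub>C w b'"
 and bimap_smult: "[|k : carrier K; b : \<C>|] ==> w (k \<odot> b) = k \<odot> w b" using assms unfolding bimap_def by simp_all
abbreviation klin where "klin == bimap \<one> \<one>"

lemma bimap_klin: assumes w: "bimap s t w" shows "klin w" by (rule bimapI) (use bimap_closed[OF w] bimap_add[OF w] bimap_smult[OF w] in simp_all)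

lemma klin_zero: assumes w: "klin w" shows "w \<zero> = \<zero>"
 using bimap_add[OF w, of "\<zero>" "\<zero>"] bimap_closed[OF w, of "\<zero>"] by (simp add: C.add.l_cancel_one')

lemma klin_finsum:
 assumes w: "klin w" shows "[|finite S; !!i. i : S ==> g i : \<C>|] ==> w (finsum C g S) = (\<Oplus>i\<in>S. w (g i))"
proof (induction S rule: finite_induct)
 case empty thus ?case using klin_zero[OF w] by simp
next
 case (insert i S)
 hence "g i : \<C>" "g : S \<rightarrow> \<C>" "w (g i) : \<C>" "(%i. w (g i)) : S \<rightarrow> \<C>"
 using bimap_closed[OF w] by auto
 thus ?case using insert bimap_add[OF w] by simp
qed

lemma bimap_zero: "t : \<C> ==> bimap s t (%b. \<zero>)" by (rule bimapI) simp_all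

lemma bimap_plus:
 assumes t: "t : \<C>" and u: "bimap s t u" and v: "bimap s t v" shows "bimap s t (%b. u b \<oplus>\<^sub>C v b)" by (rule bimapI)
 (use t bimap_closed[OF u] bimap_closed[OF v] in \<open>simp_all add: bimap_source[OF u] bimap_source[OF v]
 bimap_target[OF u] bimap_target[OF v] bimap_add[OF u] bimap_add[OF v] bimap_smult[OF u] bimap_smult[OF v]
 C.r_distr kC.smult_r_distr C.a_ac\<close>)

lemma bimap_left:
 assumes u: "bimap s t u" and c: "c : \<C>" "t' : \<C>" "t' \<otimes> c = c" shows "bimap s t' (%b. c \<otimes> u b)" by (rule bimapI)
 (use c bimap_closed[OF u] in \<open>simp_all add: bimap_source[OF u] bimap_add[OF u] bimap_smult[OF u]
 C.m_assoc[symmetric] C.r_distr kC.smult_mult_right\<close>)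

lemma bimap_right:
 assumes u: "bimap s t u" and c: "c : \<C>" "t : \<C>" shows "bimap s t (%b. u b \<otimes> c)" by (rule bimapI)
 (use c bimap_closed[OF u] in \<open>simp_all add: bimap_source[OF u] bimap_target[OF u] bimap_add[OF u]
 bimap_smult[OF u] C.m_assoc[symmetric] C.l_distr kC.smult_mult_left\<close>)

lemma bimap_uminus:
 assumes u: "bimap s t u" and t: "t : \<C>" shows "bimap s t (%b. \<ominus> u b)"
 by (rule bimapI) (use t bimap_closed[OF u] in \<open>simp_all add: bimap_source[OF u] bimap_target[OF u] bimap_add[OF u]
 bimap_smult[OF u] C.r_minus C.minus_add kC.smult_r_minus\<close>)

lemma bimap_precompose:
 assumes u: "bimap s t u" and g: "klin g" and s: "!!b. b : \<C> ==> u (g (s' \<otimes> b)) = u (g b)" shows "bimap s' t (%b. u (g b))" by (rule bimapI)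
 (use bimap_closed[OF u] bimap_closed[OF g] s in \<open>simp_all add: bimap_target[OF u] bimap_add[OF u]
 bimap_smult[OF u] bimap_add[OF g] bimap_smult[OF g]\<close>)

lemma klin_left: "c : \<C> ==> klin (%b. c \<otimes> b)" by (rule bimapI) (simp_all add: C.r_distr kC.smult_mult_right)

lemma klin_right: "c : \<C> ==> klin (%b. b \<otimes> c)" by (rule bimapI) (simp_all add: C.l_distr kC.smult_mult_left)

lemma bimap_finsum:
 assumes t: "t : \<C>" shows "[|finite S; !!i. i : S ==> bimap s t (w i)|] ==> bimap s t (%b. \<Oplus>i\<in>S. w i b)"
proof (induction S rule: finite_induct)
 case empty thus ?case using bimap_zero[OF t] by simp
next
 case (insert i S)
 have cl: "w j b : \<C>" if "j : insert i S" "b : \<C>" for j b using bimap_closed[OF insert.prems[OF that(1)] that(2)] .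
 have p: "bimap s t (%b. w i b \<oplus>\<^sub>C (\<Oplus>i\<in>S. w i b))" using insert.prems insert.IH by (intro bimap_plus t) auto
 have e: "(\<Oplus>i\<in>insert i S. w i b) = w i b \<oplus>\<^sub>C (\<Oplus>i\<in>S. w i b)" if "b : \<C>" for b
 using insert.hyps cl that by (subst C.finsum_insert) auto
 show ?case
 proof (rule bimapI)
 fix b assume b: "b : \<C>"
 show "(\<Oplus>i\<in>insert i S. w i b) : \<C>" using cl b by (intro C.finsum_closed) auto
 show "(\<Oplus>j\<in>insert i S. w j (s \<otimes> b)) = (\<Oplus>j\<in>insert i S. w j b)"
 using b cl bimap_source[OF insert.prems] by (intro C.finsum_cong'[OF refl]) auto
 show "t \<otimes> (\<Oplus>i\<in>insert i S. w i b) = (\<Oplus>i\<in>insert i S. w i b)" using bimap_target[OF p b] by (simp only: e[OF b])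
 show "(\<Oplus>i\<in>insert i S. w i (b \<oplus>\<^sub>C b')) = (\<Oplus>i\<in>insert i S. w i b) \<oplus>\<^sub>C (\<Oplus>i\<in>insert i S. w i b')"
 if "b' : \<C>" for b' using bimap_add[OF p b that] b that by (simp only: e C.a_closed)
 show "(\<Oplus>i\<in>insert i S. w i (k \<odot> b)) = k \<odot> (\<Oplus>i\<in>insert i S. w i b)" if "k : carrier K" for k
 using bimap_smult[OF p that b] b that by (simp only: e kC.smult_closed)
 qed
qed
subsection \<open>Traces\<close>

lemma frame_expand:
 assumes w: "klin w" and c: "c : \<C>" shows "w c = (\<Oplus>b\<in>B. \<t> b c \<odot> w b)"
proof -
 have t: "\<t> b c \<odot> b : \<C>" if "b : B" for b using \<t>_closed[OF that c] that B_sub by blast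
 have "w c = w (\<Oplus>b\<in>B. \<t> b c \<odot> b)" by (simp only: frame[OF c])
 also have "... = (\<Oplus>b\<in>B. w (\<t> b c \<odot> b))" by (rule klin_finsum[OF w finite_B t])
 also have "... = (\<Oplus>b\<in>B. \<t> b c \<odot> w b)"
 using \<t>_closed c B_sub bimap_closed[OF w] bimap_smult[OF w] by (intro C.finsum_cong'[OF refl]) blast+
 finally show ?thesis .
qed

lemma \<t>_zero: "b : B ==> \<t> b \<zero> = \<zero>\<^sub>K"
 using \<t>_add[of b "\<zero>" "\<zero>"] \<t>_closed[of b "\<zero>"] by (simp add: K.add.l_cancel_one')

lemma \<t>_finsum: "[|b : B; finite S; !!i. i : S ==> g i : \<C>|] ==> \<t> b (finsum C g S) = (\<Oplus>\<^sub>K i\<in>S. \<t> b (g i))"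
proof (induction S rule: infinite_finite_induct)
 case (insert i S)
 hence "g i : \<C>" "g : S \<rightarrow> \<C>" "\<t> b (g i) : carrier K" "(%i. \<t> b (g i)) : S \<rightarrow> carrier K"
 using \<t>_closed by auto
 thus ?case using insert \<t>_add by simp
qed (simp_all add: \<t>_zero)

lemma \<t>_bimap: 
 assumes b: "b : B" and s: "s : \<C>" "s \<otimes> s = s" and c: "c : \<C>" "t \<otimes> c = c" "t : \<C>"
 shows "bimap s t (%d. \<t> b (s \<otimes> d) \<odot> c)"
 by (rule bimapI) (use b s c in \<open>simp_all add: \<t>_closed \<t>_add \<t>_smult C.m_assoc[symmetric] C.r_distr kC.smult_l_distr
 kC.smult_mult_right[symmetric] kC.smult_assoc1\<close>)
definition tr :: "('c => 'c) => 'k" where "tr w = (\<Oplus>\<^sub>K b\<in>B. \<t> b (w b))"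

lemma
 assumes "!!b. b : \<C> ==> w b : \<C>" shows tr_closed: "tr w : carrier K"
 and tr_add: "(!!b. b : \<C> ==> w' b : \<C>) ==> tr (%b. w b \<oplus>\<^sub>C w' b) = tr w \<oplus>\<^sub>K tr w'"
 and tr_smult: "k : carrier K ==> tr (%b. k \<odot> w b) = k \<otimes>\<^sub>K tr w"
 and tr_cong: "(!!b. b : \<C> ==> w' b = w b) ==> tr w' = tr w"
proof -
 have t: "\<t> b (w b) : carrier K" "w b : \<C>" if "b : B" for b using \<t>_closed[OF that assms] assms that B_sub by blast+
 thus "tr w : carrier K" unfolding tr_def by (intro K.finsum_closed) auto
 show "tr (%b. w b \<oplus>\<^sub>C w' b) = tr w \<oplus>\<^sub>K tr w'" if w': "!!b. b : \<C> ==> w' b : \<C>"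
 proof -
 have t': "\<t> b (w' b) : carrier K" "w' b : \<C>" if "b : B" for b using \<t>_closed[OF that w'] w' that B_sub by blast+
 have "tr (%b. w b \<oplus>\<^sub>C w' b) = (\<Oplus>\<^sub>K b\<in>B. \<t> b (w b) \<oplus>\<^sub>K \<t> b (w' b))"
 unfolding tr_def using t t' by (intro K.finsum_cong'[OF refl] Pi_I \<t>_add K.a_closed)
 also have "... = tr w \<oplus>\<^sub>K tr w'" unfolding tr_def using t t' by (intro K.finsum_addf) auto
 finally show ?thesis .
 qed
 show "tr (%b. k \<odot> w b) = k \<otimes>\<^sub>K tr w" if k: "k : carrier K"
 proof -
 have "tr (%b. k \<odot> w b) = (\<Oplus>\<^sub>K b\<in>B. k \<otimes>\<^sub>K \<t> b (w b))"
 unfolding tr_def using t k by (intro K.finsum_cong'[OF refl] Pi_I \<t>_smult K.m_closed)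
 also have "... = k \<otimes>\<^sub>K tr w" unfolding tr_def using t k finite_B by (intro K.finsum_rdistr[symmetric]) auto
 finally show ?thesis .
 qed
 show "tr w' = tr w" if "!!b. b : \<C> ==> w' b = w b"
 proof -
 have "\<t> b (w' b) = \<t> b (w b)" if "b : B" for b using `!!b. b : \<C> ==> w' b = w b`[of b] that B_sub by auto
 thus ?thesis unfolding tr_def using t by (intro K.finsum_cong'[OF refl]) auto
 qed
qed

text \<open>Both sides expand along the frame to the same double sum, up to the order of summation
  and of the factors.\<close>

lemma tr_comm:
 assumes f: "klin f" and g: "klin g" shows "tr (%b. f (g b)) = tr (%b. g (f b))"
proof -
 have half: "tr (%b. f (g b)) = (\<Oplus>\<^sub>K b\<in>B. \<Oplus>\<^sub>K b'\<in>B. \<t> b' (g b) \<otimes>\<^sub>K \<t> b (f b'))" if f: "klin f" and g: "klin g" for f g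
 unfolding tr_def
 proof (rule K.finsum_cong'[OF refl])
 have cl: "f b : \<C>" "g b : \<C>" if "b : B" for b using that B_sub bimap_closed[OF f] bimap_closed[OF g] by blast+
 fix b assume b: "b : B"
 have t: "\<t> b' (g b) \<odot> f b' : \<C>" if "b' : B" for b' using cl b that \<t>_closed by blast
 have "\<t> b (f (g b)) = \<t> b (\<Oplus>b'\<in>B. \<t> b' (g b) \<odot> f b')" using frame_expand[OF f cl(2)[OF b]] by (rule arg_cong)
 also have "... = (\<Oplus>\<^sub>K b'\<in>B. \<t> b (\<t> b' (g b) \<odot> f b'))" by (rule \<t>_finsum[OF b finite_B t])
 also have "... = (\<Oplus>\<^sub>K b'\<in>B. \<t> b' (g b) \<otimes>\<^sub>K \<t> b (f b'))"
 by (intro K.finsum_cong'[OF refl] Pi_I \<t>_smult K.m_closed \<t>_closed cl b)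
 finally show "\<t> b (f (g b)) = (\<Oplus>\<^sub>K b'\<in>B. \<t> b' (g b) \<otimes>\<^sub>K \<t> b (f b'))" .
 next
 have cl: "f b : \<C>" "g b : \<C>" if "b : B" for b using that B_sub bimap_closed[OF f] bimap_closed[OF g] by blast+
 show "(%b. \<Oplus>\<^sub>K b'\<in>B. \<t> b' (g b) \<otimes>\<^sub>K \<t> b (f b')) : B \<rightarrow> carrier K"
 by (intro Pi_I K.finsum_closed K.m_closed \<t>_closed cl)
 qed
 have cl: "f b : \<C>" "g b : \<C>" if "b : B" for b using that B_sub bimap_closed[OF f] bimap_closed[OF g] by blast+
 have "tr (%b. f (g b)) = (\<Oplus>\<^sub>K b'\<in>B. \<Oplus>\<^sub>K b\<in>B. \<t> b' (g b) \<otimes>\<^sub>K \<t> b (f b'))"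
 unfolding half[OF f g] by (intro K.finsum_swap finite_B K.m_closed \<t>_closed cl)
 also have "... = (\<Oplus>\<^sub>K b'\<in>B. \<Oplus>\<^sub>K b\<in>B. \<t> b (f b') \<otimes>\<^sub>K \<t> b' (g b))"
 by (intro K.finsum_cong'[OF refl] Pi_I K.finsum_closed K.m_closed K.m_comm \<t>_closed cl)
 finally show ?thesis unfolding half[OF g f] .
qed
abbreviation "DC == dual_module K C"

lemma DC_simps: "\<zero>\<^sub>DC = (\<lambda>x\<in>\<C>. \<zero>\<^sub>K)" "\<phi> \<oplus>\<^sub>DC \<psi> = (\<lambda>x\<in>\<C>. \<phi> x \<oplus>\<^sub>K \<psi> x)"
 "c \<odot>\<^sub>DC \<phi> = (\<lambda>a\<in>\<C>. \<phi> (c \<otimes> a))" by (simp_all add: dual_module_def)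

lemma DC_I:
 assumes "!!c. c : \<C> ==> \<phi> c : carrier K"
 and "!!c d. [|c : \<C>; d : \<C>|] ==> \<phi> (c \<oplus>\<^sub>C d) = \<phi> c \<oplus>\<^sub>K \<phi> d"
 and "!!k c. [|k : carrier K; c : \<C>|] ==> \<phi> (k \<odot> c) = k \<otimes>\<^sub>K \<phi> c"
 shows "(\<lambda>c\<in>\<C>. \<phi> c) : carrier DC" using assms by (auto simp: dual_module_def)

lemma
 assumes "\<phi> : carrier DC" shows DC_closed: "c : \<C> ==> \<phi> c : carrier K"
 and DC_add: "[|c : \<C>; d : \<C>|] ==> \<phi> (c \<oplus>\<^sub>C d) = \<phi> c \<oplus>\<^sub>K \<phi> d"
 and DC_smult: "[|k : carrier K; c : \<C>|] ==> \<phi> (k \<odot> c) = k \<otimes>\<^sub>K \<phi> c"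
 and DC_ext: "\<phi> : extensional \<C>" using assms by (auto simp: dual_module_def PiE_def)

lemma DC_eqI: "[|\<phi> : carrier DC; \<psi> : carrier DC; !!c. c : \<C> ==> \<phi> c = \<psi> c|] ==> \<phi> = \<psi>"
 using DC_ext extensionalityI by blast

lemma right_module_dual: "right_module C DC"
proof (intro right_module.intro right_module_axioms.intro)
 show "ring C" by (rule C.ring_axioms)
 show "abelian_group DC"
 proof (rule abelian_groupI)
 fix \<phi> assume p: "\<phi> : carrier DC"
 have n: "(\<lambda>c\<in>\<C>. \<ominus>\<^sub>K \<phi> c) : carrier DC"
 using DC_closed[OF p] by (intro DC_I) (simp_all add: DC_add[OF p] DC_smult[OF p] K.minus_add K.r_minus)
 show "\<exists>\<psi>\<in>carrier DC. \<psi> \<oplus>\<^sub>DC \<phi> = \<zero>\<^sub>DC"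
 using n DC_closed[OF p] by (intro bexI[OF _ n]) (auto simp: DC_simps fun_eq_iff K.l_neg)
 show "\<zero>\<^sub>DC \<oplus>\<^sub>DC \<phi> = \<phi>" using DC_closed[OF p] DC_ext[OF p] by (auto simp: DC_simps fun_eq_iff extensional_def)
 fix \<psi> assume q: "\<psi> : carrier DC"
 show "\<phi> \<oplus>\<^sub>DC \<psi> : carrier DC" unfolding DC_simps using DC_closed[OF p] DC_closed[OF q]
 by (intro DC_I) (simp_all add: DC_add[OF p] DC_smult[OF p] DC_add[OF q] DC_smult[OF q] K.a_ac K.r_distr)
 show "\<phi> \<oplus>\<^sub>DC \<psi> = \<psi> \<oplus>\<^sub>DC \<phi>"
 using DC_closed[OF p] DC_closed[OF q] by (auto simp: DC_simps fun_eq_iff K.a_comm)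
 fix \<chi> assume r: "\<chi> : carrier DC"
 show "\<phi> \<oplus>\<^sub>DC \<psi> \<oplus>\<^sub>DC \<chi> = \<phi> \<oplus>\<^sub>DC (\<psi> \<oplus>\<^sub>DC \<chi>)"
 using DC_closed[OF p] DC_closed[OF q] DC_closed[OF r] by (auto simp: DC_simps fun_eq_iff K.a_assoc)
 next
 show "\<zero>\<^sub>DC : carrier DC" unfolding DC_simps by (intro DC_I) simp_all
 qed
next
 fix c \<phi> assume c: "c : \<C>" and p: "\<phi> : carrier DC"
 show "c \<odot>\<^sub>DC \<phi> : carrier DC" unfolding DC_simps
 using c DC_closed[OF p] by (intro DC_I) (simp_all add: C.r_distr DC_add[OF p] kC.smult_mult_right[symmetric] DC_smult[OF p])
 fix d assume d: "d : \<C>"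
 show "(c \<oplus>\<^sub>C d) \<odot>\<^sub>DC \<phi> = c \<odot>\<^sub>DC \<phi> \<oplus>\<^sub>DC d \<odot>\<^sub>DC \<phi>"
 using c d by (auto simp: DC_simps fun_eq_iff C.l_distr DC_add[OF p])
 show "(c \<otimes> d) \<odot>\<^sub>DC \<phi> = d \<odot>\<^sub>DC (c \<odot>\<^sub>DC \<phi>)"
 using c d by (auto simp: DC_simps fun_eq_iff C.m_assoc)
next
 fix c \<phi> \<psi> assume "c : \<C>" "\<phi> : carrier DC" "\<psi> : carrier DC"
 thus "c \<odot>\<^sub>DC (\<phi> \<oplus>\<^sub>DC \<psi>) = c \<odot>\<^sub>DC \<phi> \<oplus>\<^sub>DC c \<odot>\<^sub>DC \<psi>" by (auto simp: DC_simps fun_eq_iff)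
next
 fix \<phi> assume "\<phi> : carrier DC"
 thus "\<one> \<odot>\<^sub>DC \<phi> = \<phi>" using DC_ext[of \<phi>] by (auto simp: DC_simps fun_eq_iff extensional_def)
qed

text \<open>This evaluates the traces of the augmentation: a functional is recovered from the rank
  one maps built from it.\<close>

lemma tr_rank_one:
 assumes \<phi>: "\<phi> : carrier DC" and c: "c : \<C>" shows "tr (%b. \<phi> b \<odot> c) = \<phi> c"
proof -
 have Bc: "b : \<C>" if "b : B" for b using that B_sub by blast
 have t: "\<phi> b : carrier K" "\<t> b c : carrier K" if "b : B" for b using that DC_closed[OF \<phi>] \<t>_closed c Bc by auto
 have sum: "\<phi> (finsum C g S) = (\<Oplus>\<^sub>K b\<in>S. \<phi> (g b))" if "finite S" "!!b. b : S ==> g b : \<C>" for g and S :: "'c set"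
 using that
 proof (induction S rule: finite_induct)
 case empty
 show ?case using DC_add[OF \<phi>, of "\<zero>" "\<zero>"] DC_closed[OF \<phi>, of "\<zero>"] by (simp add: K.add.l_cancel_one')
 next
 case (insert s S)
 hence "g s : \<C>" "g : S \<rightarrow> \<C>" by auto
 moreover from this have "(%b. \<phi> (g b)) : S \<rightarrow> carrier K" using DC_closed[OF \<phi>] by auto
 ultimately show ?case using insert DC_closed[OF \<phi>] by (simp add: DC_add[OF \<phi>])
 qed
 have "\<phi> c = \<phi> (\<Oplus>b\<in>B. \<t> b c \<odot> b)" by (simp only: frame[OF c])
 also have "... = (\<Oplus>\<^sub>K b\<in>B. \<phi> (\<t> b c \<odot> b))" using t Bc by (intro sum finite_B) auto
 also have "... = (\<Oplus>\<^sub>K b\<in>B. \<t> b (\<phi> b \<odot> c))"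
 using t Bc c by (intro K.finsum_cong'[OF refl]) (simp_all add: DC_smult[OF \<phi>] \<t>_smult K.m_comm)
 finally show ?thesis by (simp add: tr_def)
qed
end

lemma (in abelian_group) finsum_minusf:
 assumes "finite S" "!!i. i : S ==> f i : carrier G" "!!i. i : S ==> g i : carrier G"
 shows "(\<Oplus>i\<in>S. f i \<ominus> g i) = finsum G f S \<ominus> finsum G g S"
proof -
 have "finsum G f S = (\<Oplus>i\<in>S. (f i \<ominus> g i) \<oplus> g i)" using assms by (intro finsum_cong'[OF refl]) (auto simp: a_minus_def a_assoc l_neg)
 also have "... = (\<Oplus>i\<in>S. f i \<ominus> g i) \<oplus> finsum G g S" using assms by (intro finsum_addf) auto
 finally have e: "finsum G f S = (\<Oplus>i\<in>S. f i \<ominus> g i) \<oplus> finsum G g S" .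
 have "(\<Oplus>i\<in>S. f i \<ominus> g i) : carrier G" "finsum G g S : carrier G" using assms by (auto intro!: finsum_closed)
 thus ?thesis unfolding e by (simp add: a_minus_def a_assoc r_neg)
qed

context bound_quiver_frame
begin
interpretation K: field K by (rule field_K)
interpretation Q: fin_digraph Q by (rule fin_Q)
interpretation A: ring "path_algebra K Q" by (rule ring_A)
interpretation kA: kalgebra K A by (rule kalgebra_A)
interpretation C: ring C by (rule kalgebraD(2)[OF kalgebra_C])
interpretation kC: kalgebra K C by (rule kalgebra_C)

lemma tr_finsum:
 "[|finite S; !!i b. [|i : S; b : \<C>|] ==> w i b : \<C>|] ==>
 tr (%b. \<Oplus>i\<in>S. w i b) = (\<Oplus>\<^sub>K i\<in>S. tr (w i))"
proof (induction S rule: finite_induct)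
 case empty
 have "tr (%b. \<zero>) = (\<Oplus>\<^sub>K b\<in>B. \<zero>\<^sub>K)" unfolding tr_def by (intro K.finsum_cong'[OF refl]) (simp_all add: \<t>_zero)
 thus ?case by simp
next
 case (insert i S)
 have cl: "w i b : \<C>" "(%j. w j b) : S \<rightarrow> \<C>" if "b : \<C>" for b using insert.prems that by auto
 have tc: "tr (w i) : carrier K" "(%j. tr (w j)) : S \<rightarrow> carrier K" using insert.prems by (auto intro!: tr_closed)
 have "tr (%b. \<Oplus>i\<in>insert i S. w i b) = tr (%b. w i b \<oplus>\<^sub>C (\<Oplus>i\<in>S. w i b))"
 by (rule tr_cong) (use cl insert.hyps in \<open>auto simp: C.finsum_insert\<close>)
 also have "... = tr (w i) \<oplus>\<^sub>K tr (%b. \<Oplus>i\<in>S. w i b)" by (rule tr_add) (use cl in auto)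
 finally show ?case using insert tc by (simp add: K.finsum_insert)
qed
subsection \<open>Modules of families of bimaps\<close>
text \<open>Families of maps indexed by \<open>S\<close> are stored uncurried on
  \<open>S \<times> C\<close>, so that they become elements of a \<open>fun_module\<close>.\<close>

definition pack :: "'i set => ('i => 'c => 'c) => 'i \<times> 'c => 'c"
 where "pack S w = (\<lambda>p\<in>S \<times> \<C>. w (fst p) (snd p))"
definition bimaps :: "'i set => ('i => 'c) => ('i => 'c) => ('i \<times> 'c => 'c) set"
 where "bimaps S s t = {u : S \<times> \<C> \<rightarrow>\<^sub>E \<C>. ALL i:S. bimap (s i) (t i) (%b. u (i, b))}"
abbreviation "Bim S s t == fun_module C (S \<times> \<C>) (bimaps S s t)"

lemma pack_apply [simp]: "[|i : S; b : \<C>|] ==> pack S w (i, b) = w i b" by (simp add: pack_def)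

lemma bimap_cong:
 assumes w: "bimap s t w" and e: "!!b. b : \<C> ==> w' b = w b" and s: "s : \<C>" shows "bimap s t w'" by (rule bimapI)
 (use bimap_closed[OF w] s in \<open>simp_all add: e bimap_source[OF w] bimap_target[OF w] bimap_add[OF w] bimap_smult[OF w]\<close>)

lemma packI:
 assumes "!!i. i : S ==> bimap (s i) (t i) (w i)" "!!i. i : S ==> s i : \<C>" shows "pack S w : bimaps S s t" unfolding bimaps_def
proof (intro CollectI conjI ballI)
 show "pack S w : S \<times> \<C> \<rightarrow>\<^sub>E \<C>" unfolding pack_def using bimap_closed[OF assms(1)] by auto
 show "bimap (s i) (t i) (%b. pack S w (i, b))" if "i : S" for i by (rule bimap_cong[OF assms(1)[OF that] _ assms(2)[OF that]]) (simp add: that)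
qed

lemma bimapsD: "[|u : bimaps S s t; i : S|] ==> bimap (s i) (t i) (%b. u (i, b))" by (simp add: bimaps_def)

lemma bimaps_closed: "[|u : bimaps S s t; i : S; b : \<C>|] ==> u (i, b) : \<C>" using bimap_closed[OF bimapsD] .

lemma bimaps_eqI:
 assumes "u : bimaps S s t" "v : bimaps S s t" "!!i b. [|i : S; b : \<C>|] ==> u (i, b) = v (i, b)" shows "u = v"
proof (rule PiE_ext[of _ "S \<times> \<C>" "%_. \<C>"])
 show "u p = v p" if "p : S \<times> \<C>" for p using that assms(3) by (cases p) simp
qed (use assms in \<open>simp_all add: bimaps_def\<close>)

text \<open>Operations on bimaps compatible with right and left multiplication on \<^term>\<open>C\<close>; they are the
 entries of the differentials.\<close>
definition bim_op :: "'c => 'c => 'c => 'c => (('c => 'c) => 'c => 'c) => bool"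
 where "bim_op s t s' t' F \<longleftrightarrow> (ALL w. bimap s' t' w --> bimap s t (F w) \<and>
 (\<forall>w'. bimap s' t' w' --> (ALL b:\<C>. F (%b. w b \<oplus>\<^sub>C w' b) b = F w b \<oplus>\<^sub>C F w' b)) \<and>
 (ALL c:\<C>. ALL b:\<C>. F (%b. w b \<otimes> c) b = F w b \<otimes> c) \<and>
 (ALL c:\<C>. ALL b:\<C>. F (%b. w (b \<otimes> c)) b = F w (b \<otimes> c)) \<and>
 (\<forall>w'. (ALL b:\<C>. w' b = w b) --> (ALL b:\<C>. F w' b = F w b)))"

lemma
 assumes "bim_op s t s' t' F" "bimap s' t' w" shows bim_op_bimap: "bimap s t (F w)"
 and bim_op_add: "[|bimap s' t' w'; b : \<C>|] ==> F (%b. w b \<oplus>\<^sub>C w' b) b = F w b \<oplus>\<^sub>C F w' b"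
 and bim_op_right: "[|c : \<C>; b : \<C>|] ==> F (%b. w b \<otimes> c) b = F w b \<otimes> c"
 and bim_op_left: "[|c : \<C>; b : \<C>|] ==> F (%b. w (b \<otimes> c)) b = F w (b \<otimes> c)"
 and bim_op_cong: "[|!!b. b : \<C> ==> w' b = w b; b : \<C>|] ==> F w' b = F w b"
proof -
 note * = assms(1)[unfolded bim_op_def, THEN spec, THEN mp, OF assms(2)]
 show "bimap s t (F w)" by (rule conjunct1[OF *])
 show "F (%b. w b \<oplus>\<^sub>C w' b) b = F w b \<oplus>\<^sub>C F w' b" if "bimap s' t' w'" "b : \<C>"
 by (rule *[THEN conjunct2, THEN conjunct1, rule_format, OF that])
 show "F (%b. w b \<otimes> c) b = F w b \<otimes> c" if "c : \<C>" "b : \<C>"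
 by (rule *[THEN conjunct2, THEN conjunct2, THEN conjunct1, rule_format, OF that])
 show "F (%b. w (b \<otimes> c)) b = F w (b \<otimes> c)" if "c : \<C>" "b : \<C>"
 by (rule *[THEN conjunct2, THEN conjunct2, THEN conjunct2, THEN conjunct1, rule_format, OF that])
 show "F w' b = F w b" if "!!b. b : \<C> ==> w' b = w b" "b : \<C>"
 by (rule *[THEN conjunct2, THEN conjunct2, THEN conjunct2, THEN conjunct2, rule_format, OF that])
qed

context
 fixes S :: "'i set" and s t :: "'i => 'c"
 assumes fin_S: "finite S" and s: "!!i. i : S ==> s i : \<C>" "!!i. i : S ==> s i \<otimes> s i = s i"
 and t: "!!i. i : S ==> t i : \<C>" "!!i. i : S ==> t i \<otimes> t i = t i"
begin
lemma right_module_Bim: "right_module C (Bim S s t)"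
proof (rule right_module_fun_module[OF C.ring_axioms])
 have e: "(\<lambda>i\<in>S \<times> \<C>. \<zero>) = pack S (%i b. \<zero>)"
 "(\<lambda>i\<in>S \<times> \<C>. u i \<oplus>\<^sub>C v i) = pack S (%i b. u (i, b) \<oplus>\<^sub>C v (i, b))"
 "(\<lambda>i\<in>S \<times> \<C>. u i \<otimes> c) = pack S (%i b. u (i, b) \<otimes> c)" for u v c by (auto simp: pack_def fun_eq_iff)
 show "(\<lambda>i\<in>S \<times> \<C>. \<zero>) : bimaps S s t" unfolding e by (intro packI bimap_zero s t)
 show "(\<lambda>i\<in>S \<times> \<C>. u i \<oplus>\<^sub>C v i) : bimaps S s t" if "u : bimaps S s t" "v : bimaps S s t" for u v
 unfolding e using that by (intro packI bimap_plus bimapsD s t)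
 show "(\<lambda>i\<in>S \<times> \<C>. u i \<otimes> c) : bimaps S s t" if "c : \<C>" "u : bimaps S s t" for u c
 unfolding e using that by (intro packI bimap_right bimapsD s t)
qed (auto simp: bimaps_def)
text \<open>For \<open>p = (j, b)\<close> this is the rank one map sending \<open>c\<close> to
  \<open>\<t> b (s j c)\<close> times \<open>t j\<close>, placed in component \<open>j\<close>. With
  \<open>b\<close> running through \<open>B\<close>, these maps generate the module.\<close>

definition unit :: "'i \<times> 'c => 'i \<times> 'c => 'c"
 where "unit p = pack S (%j c. if fst p = j then \<t> (snd p) (s j \<otimes> c) \<odot> t j else \<zero>)"

lemma unit_mem: assumes "p : S \<times> B" shows "unit p : bimaps S s t" unfolding unit_def
proof (rule packI[OF _ s(1)])
 fix j assume j: "j : S"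
 show "bimap (s j) (t j) (%c. if fst p = j then \<t> (snd p) (s j \<otimes> c) \<odot> t j else \<zero>)"
 using assms j s t by (cases "fst p = j") (auto intro!: \<t>_bimap bimap_zero)
qed

text \<open>A linear map is determined by its values on \<open>B\<close>, so the elements
  \<open>unit p\<close> and the evaluations at \<open>p\<close> in \<open>S \<times> B\<close> form
  dual bases.\<close>

lemma Bim_expand:
 assumes u: "u : bimaps S s t" shows "u = (\<Oplus>\<^bsub>Bim S s t\<^esub>p\<in>S \<times> B. u p \<odot>\<^bsub>Bim S s t\<^esub> unit p)"
proof -
 have Bc: "b : \<C>" if "b : B" for b using that B_sub by blast
 interpret M: right_module C "Bim S s t" by (rule right_module_Bim)
 have up: "u p : \<C>" if "p : S \<times> B" for p using that bimaps_closed[OF u] Bc by (cases p) auto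
 have m: "u p \<odot>\<^bsub>Bim S s t\<^esub> unit p : bimaps S s t" if "p : S \<times> B" for p using M.act_closed[OF up[OF that]] unit_mem[OF that] by simp
 have e: "(\<Oplus>\<^bsub>Bim S s t\<^esub>p\<in>S \<times> B. u p \<odot>\<^bsub>Bim S s t\<^esub> unit p) = (\<lambda>j\<in>S \<times> \<C>. \<Oplus>p\<in>S \<times> B. (u p \<odot>\<^bsub>Bim S s t\<^esub> unit p) j)"
 using m fin_S finite_B by (intro finsum_fun_module right_module_Bim) (auto simp: bimaps_def)
 show ?thesis
 proof (rule bimaps_eqI[OF u])
 have "(\<Oplus>\<^bsub>Bim S s t\<^esub>p\<in>S \<times> B. u p \<odot>\<^bsub>Bim S s t\<^esub> unit p) : carrier (Bim S s t)"
 by (rule M.M.finsum_closed) (use m in simp)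
 thus "(\<Oplus>\<^bsub>Bim S s t\<^esub>p\<in>S \<times> B. u p \<odot>\<^bsub>Bim S s t\<^esub> unit p) : bimaps S s t" by simp
 fix j c assume j: "j : S" and c: "c : \<C>"
 have sc: "s j \<otimes> c : \<C>" using j c s by simp
 have tc: "\<t> b (s j \<otimes> c) \<odot> u (j, b) : \<C>" if "b : B" for b using that \<t>_closed sc bimaps_closed[OF u j] Bc by simp
 have "(\<Oplus>p\<in>S \<times> B. (u p \<odot>\<^bsub>Bim S s t\<^esub> unit p) (j, c))
 = (\<Oplus>p\<in>{j} \<times> B. \<t> (snd p) (s j \<otimes> c) \<odot> u (j, snd p))"
 proof (rule C.add.finprod_mono_neutral_cong_right)
 show "(u i \<odot>\<^bsub>Bim S s t\<^esub> unit i) (j, c) = \<zero>" if "i : S \<times> B - {j} \<times> B" for i using that j c up[of i] by (auto simp: unit_def)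
 show "(u p \<odot>\<^bsub>Bim S s t\<^esub> unit p) (j, c) = \<t> (snd p) (s j \<otimes> c) \<odot> u (j, snd p)" if "p : {j} \<times> B" for p
 proof -
 from that obtain b where p: "p = (j, b)" "b : B" by auto
 have "(u p \<odot>\<^bsub>Bim S s t\<^esub> unit p) (j, c) = \<t> b (s j \<otimes> c) \<odot> t j \<otimes> u (j, b)" using j c p by (simp add: unit_def)
 also have "... = \<t> b (s j \<otimes> c) \<odot> (t j \<otimes> u (j, b))"
 using t j p \<t>_closed[OF p(2) sc] bimaps_closed[OF u j Bc[OF p(2)]] by (simp add: kC.smult_mult_left)
 also have "t j \<otimes> u (j, b) = u (j, b)" by (rule bimap_target[OF bimapsD[OF u j] Bc[OF p(2)]])
 finally show ?thesis using p by simp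
 qed
 show "(%p. (u p \<odot>\<^bsub>Bim S s t\<^esub> unit p) (j, c)) : S \<times> B \<rightarrow> \<C>" using bimaps_closed[OF m j c] by blast
 qed (use fin_S finite_B j in auto)
 also have "... = (\<Oplus>p\<in>Pair j ` B. \<t> (snd p) (s j \<otimes> c) \<odot> u (j, snd p))" by (rule arg_cong[of _ _ "finsum C _"]) auto
 also have "... = (\<Oplus>b\<in>B. \<t> b (s j \<otimes> c) \<odot> u (j, b))" using tc by (subst C.finsum_reindex) (auto simp: inj_on_def)
 also have "... = u (j, s j \<otimes> c)" by (rule frame_expand[OF bimap_klin[OF bimapsD[OF u j]] sc, symmetric])
 also have "... = u (j, c)" by (rule bimap_source[OF bimapsD[OF u j] c])
 finally show "u (j, c) = (\<Oplus>\<^bsub>Bim S s t\<^esub>p\<in>S \<times> B. u p \<odot>\<^bsub>Bim S s t\<^esub> unit p) (j, c)" unfolding e using j c by simp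
 qed
qed

lemma Bim_dual: "has_dual_basis C (Bim S s t)"
proof (rule has_dual_basisI[OF right_module_Bim, where S = "S \<times> B" and g = unit and f = "%p. \<lambda>u\<in>carrier (Bim S s t). u p"])
 fix p assume p: "p : S \<times> B"
 hence pc: "p : S \<times> \<C>" using B_sub by auto
 show "(\<lambda>u\<in>carrier (Bim S s t). u p) : mod_hom_set C (Bim S s t) (regular_module C)"
 proof (rule mod_hom_restrictI[OF right_module_Bim])
 show "u p : carrier (regular_module C)" if "u : carrier (Bim S s t)" for u using that pc bimaps_closed[of u S s t] by (cases p) simp
 qed (use pc in simp_all)
 show "unit p : carrier (Bim S s t)" using unit_mem[OF p] by simp
next
 fix u assume "u : carrier (Bim S s t)"
 hence u: "u : bimaps S s t" by simp
 have *: "restrict (%u. u p) (carrier (Bim S s t)) u = u p" for p using u by simp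
 show "u = (\<Oplus>\<^bsub>Bim S s t\<^esub>p\<in>S \<times> B. restrict (%u. u p) (carrier (Bim S s t)) u \<odot>\<^bsub>Bim S s t\<^esub> unit p)"
 unfolding * by (rule Bim_expand[OF u])
qed (simp add: fin_S finite_B)
text \<open>The left action of \<open>C\<close> on \<open>DC\<close> carried over to families of
  maps: the dual factor is precomposed with right multiplication by \<open>c\<close>.\<close>

definition lft :: "'c => ('i \<times> 'c => 'c) => 'i \<times> 'c => 'c"
 where "lft c = (\<lambda>u\<in>carrier (Bim S s t). pack S (%i b. u (i, b \<otimes> c)))"

lemma lft_bimap: "[|u : bimaps S s t; c : \<C>; i : S|] ==> bimap (s i) (t i) (%b. u (i, b \<otimes> c))"
 by (rule bimap_precompose[OF bimapsD klin_right])
 (simp_all add: C.m_assoc s bimap_source[OF bimapsD])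

lemma lft_hom: assumes c: "c : \<C>" shows "lft c : mod_hom_set C (Bim S s t) (Bim S s t)" unfolding lft_def
proof (rule mod_hom_restrictI[OF right_module_Bim])
 fix u assume u: "u : carrier (Bim S s t)"
 thus "pack S (%i b. u (i, b \<otimes> c)) : carrier (Bim S s t)" using c by (auto intro!: packI s lft_bimap)
 show "pack S (%i b. (u \<oplus>\<^bsub>Bim S s t\<^esub> v) (i, b \<otimes> c)) =
 pack S (%i b. u (i, b \<otimes> c)) \<oplus>\<^bsub>Bim S s t\<^esub> pack S (%i b. v (i, b \<otimes> c))" for v
 using c by (auto simp: pack_def fun_eq_iff)
 show "pack S (%i b. (d \<odot>\<^bsub>Bim S s t\<^esub> u) (i, b \<otimes> c)) = d \<odot>\<^bsub>Bim S s t\<^esub> pack S (%i b. u (i, b \<otimes> c))" for d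
 using c by (auto simp: pack_def fun_eq_iff)
qed

lemma lft_apply: "[|u : bimaps S s t; i : S; b : \<C>|] ==> lft c u (i, b) = u (i, b \<otimes> c)" by (simp add: lft_def)
end

context
 fixes S :: "'i set" and s t :: "'i => 'c" and S' :: "'j set" and s' t' :: "'j => 'c" and F :: "'i => 'j => ('c => 'c) => 'c => 'c"
 assumes fin_S: "finite S" and s: "!!i. i : S ==> s i : \<C>" "!!i. i : S ==> s i \<otimes> s i = s i"
 and t: "!!i. i : S ==> t i : \<C>" "!!i. i : S ==> t i \<otimes> t i = t i"
 and fin_S': "finite S'" and s': "!!i. i : S' ==> s' i : \<C>" "!!i. i : S' ==> s' i \<otimes> s' i = s' i"
 and t': "!!i. i : S' ==> t' i : \<C>" "!!i. i : S' ==> t' i \<otimes> t' i = t' i"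
 and F: "!!i j. [|i : S; j : S'|] ==> bim_op (s i) (t i) (s' j) (t' j) (F i j)"
begin
definition mat :: "('j \<times> 'c => 'c) => 'i \<times> 'c => 'c"
 where "mat = (\<lambda>u\<in>carrier (Bim S' s' t'). pack S (%i b. \<Oplus>j\<in>S'. F i j (%b. u (j, b)) b))"

lemma mat_apply: "[|u : bimaps S' s' t'; i : S; b : \<C>|] ==> mat u (i, b) = (\<Oplus>j\<in>S'. F i j (%b. u (j, b)) b)" by (simp add: mat_def)
lemma F_bimap: "[|u : bimaps S' s' t'; i : S; j : S'|] ==> bimap (s i) (t i) (F i j (%b. u (j, b)))"
 by (rule bim_op_bimap[OF F]) (simp_all add: bimapsD)

lemma F_closed: "[|u : bimaps S' s' t'; i : S; j : S'; b : \<C>|] ==> F i j (%b. u (j, b)) b : \<C>"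
 by (rule bimap_closed[OF F_bimap])

lemma mat_hom: "mat : mod_hom_set C (Bim S' s' t') (Bim S s t)" unfolding mat_def
proof (rule mod_hom_restrictI[OF right_module_Bim[OF fin_S' s' t']])
 have m: "pack S (%i b. \<Oplus>j\<in>S'. F i j (%b. u (j, b)) b) : carrier (Bim S s t)" if u: "u : bimaps S' s' t'" for u
 unfolding fun_module_simps by (intro packI s t bimap_finsum fin_S' F_bimap u)
 fix u assume "u : carrier (Bim S' s' t')"
 hence u: "u : bimaps S' s' t'" by simp
 show "pack S (%i b. \<Oplus>j\<in>S'. F i j (%b. u (j, b)) b) : carrier (Bim S s t)" by (rule m[OF u])
 { fix v assume "v : carrier (Bim S' s' t')"
 hence v: "v : bimaps S' s' t'" by simp
 have "(\<Oplus>j\<in>S'. F i j (%b. (u \<oplus>\<^bsub>Bim S' s' t'\<^esub> v) (j, b)) b) =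
 (\<Oplus>j\<in>S'. F i j (%b. u (j, b)) b) \<oplus>\<^sub>C (\<Oplus>j\<in>S'. F i j (%b. v (j, b)) b)" if i: "i : S" and b: "b : \<C>" for i b
 proof -
 have "F i j (%b. (u \<oplus>\<^bsub>Bim S' s' t'\<^esub> v) (j, b)) b = F i j (%b. u (j, b)) b \<oplus>\<^sub>C F i j (%b. v (j, b)) b" if j: "j : S'" for j
 proof -
 have "F i j (%b. (u \<oplus>\<^bsub>Bim S' s' t'\<^esub> v) (j, b)) b = F i j (%b. u (j, b) \<oplus>\<^sub>C v (j, b)) b"
 by (rule bim_op_cong[OF F[OF i j] bimap_plus[OF t'(1)[OF j] bimapsD[OF u j] bimapsD[OF v j]] _ b]) (simp add: j)
 also have "... = F i j (%b. u (j, b)) b \<oplus>\<^sub>C F i j (%b. v (j, b)) b"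
 by (rule bim_op_add[OF F[OF i j] bimapsD[OF u j] bimapsD[OF v j] b])
 finally show ?thesis .
 qed
 hence "(\<Oplus>j\<in>S'. F i j (%b. (u \<oplus>\<^bsub>Bim S' s' t'\<^esub> v) (j, b)) b) =
 (\<Oplus>j\<in>S'. F i j (%b. u (j, b)) b \<oplus>\<^sub>C F i j (%b. v (j, b)) b)"
 by (intro C.finsum_cong'[OF refl] Pi_I C.a_closed F_closed[OF u i _ b] F_closed[OF v i _ b])
 also have "... = (\<Oplus>j\<in>S'. F i j (%b. u (j, b)) b) \<oplus>\<^sub>C (\<Oplus>j\<in>S'. F i j (%b. v (j, b)) b)"
 by (intro C.finsum_addf Pi_I F_closed[OF u i _ b] F_closed[OF v i _ b])
 finally show ?thesis .
 qed
 thus "pack S (%i b. \<Oplus>j\<in>S'. F i j (%b. (u \<oplus>\<^bsub>Bim S' s' t'\<^esub> v) (j, b)) b) =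
 pack S (%i b. \<Oplus>j\<in>S'. F i j (%b. u (j, b)) b) \<oplus>\<^bsub>Bim S s t\<^esub> pack S (%i b. \<Oplus>j\<in>S'. F i j (%b. v (j, b)) b)"
 unfolding fun_module_simps pack_def by (intro restrict_ext) (simp add: mem_Times_iff) }
 fix c assume c: "c : \<C>"
 have "(\<Oplus>j\<in>S'. F i j (%b. (c \<odot>\<^bsub>Bim S' s' t'\<^esub> u) (j, b)) b) = (\<Oplus>j\<in>S'. F i j (%b. u (j, b)) b) \<otimes> c"
 if i: "i : S" and b: "b : \<C>" for i b
 proof -
 have "F i j (%b. (c \<odot>\<^bsub>Bim S' s' t'\<^esub> u) (j, b)) b = F i j (%b. u (j, b)) b \<otimes> c" if j: "j : S'" for j
 proof -
 have "F i j (%b. (c \<odot>\<^bsub>Bim S' s' t'\<^esub> u) (j, b)) b = F i j (%b. u (j, b) \<otimes> c) b"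
 by (rule bim_op_cong[OF F[OF i j] bimap_right[OF bimapsD[OF u j] c t'(1)[OF j]] _ b]) (simp add: j)
 also have "... = F i j (%b. u (j, b)) b \<otimes> c" by (rule bim_op_right[OF F[OF i j] bimapsD[OF u j] c b])
 finally show ?thesis .
 qed
 hence "(\<Oplus>j\<in>S'. F i j (%b. (c \<odot>\<^bsub>Bim S' s' t'\<^esub> u) (j, b)) b) = (\<Oplus>j\<in>S'. F i j (%b. u (j, b)) b \<otimes> c)"
 by (intro C.finsum_cong'[OF refl] Pi_I C.m_closed F_closed[OF u i _ b] c)
 also have "... = (\<Oplus>j\<in>S'. F i j (%b. u (j, b)) b) \<otimes> c" by (intro C.finsum_ldistr[symmetric] fin_S' c Pi_I F_closed[OF u i _ b])
 finally show ?thesis .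
 qed
 thus "pack S (%i b. \<Oplus>j\<in>S'. F i j (%b. (c \<odot>\<^bsub>Bim S' s' t'\<^esub> u) (j, b)) b) =
 c \<odot>\<^bsub>Bim S s t\<^esub> pack S (%i b. \<Oplus>j\<in>S'. F i j (%b. u (j, b)) b)"
 unfolding fun_module_simps pack_def by (intro restrict_ext) (simp add: mem_Times_iff)
qed

text \<open>The entries commute with precomposition by right multiplications, hence so does the
  matrix; the action of \<open>C\<close> on \<open>DC\<close> thus lifts strictly to the
  complex.\<close>

lemma mat_lft:
 assumes "u : carrier (Bim S' s' t')" and c: "c : \<C>" shows "mat (lft S' s' t' c u) = lft S s t c (mat u)"
proof -
 have u: "u : bimaps S' s' t'" using assms by simp
 have l: "lft S' s' t' c u : bimaps S' s' t'" using mod_hom_closed[OF lft_hom[OF fin_S' s' t' c] assms(1)] by simp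
 have m: "mat u : bimaps S s t" "mat (lft S' s' t' c u) : bimaps S s t" using mod_hom_closed[OF mat_hom] u l by simp_all
 show ?thesis
 proof (rule bimaps_eqI[OF m(2)])
 show "lft S s t c (mat u) : bimaps S s t" using mod_hom_closed[OF lft_hom[OF fin_S s t c]] m by simp
 fix i b assume i: "i : S" and b: "b : \<C>"
 have "F i j (%b. lft S' s' t' c u (j, b)) b = F i j (%b. u (j, b)) (b \<otimes> c)" if j: "j : S'" for j
 proof -
 have "F i j (%b. lft S' s' t' c u (j, b)) b = F i j (%b. u (j, b \<otimes> c)) b"
 by (rule bim_op_cong[OF F[OF i j] lft_bimap[OF fin_S' s' t' u c j] _ b]) (simp_all add: lft_apply[OF fin_S' s' t' u j])
 also have "... = F i j (%b. u (j, b)) (b \<otimes> c)" by (rule bim_op_left[OF F[OF i j] bimapsD[OF u j] c b])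
 finally show ?thesis .
 qed
 hence "mat (lft S' s' t' c u) (i, b) = (\<Oplus>j\<in>S'. F i j (%b. u (j, b)) (b \<otimes> c))"
 unfolding mat_apply[OF l i b] by (intro C.finsum_cong'[OF refl] Pi_I F_closed[OF u i] C.m_closed b c)
 also have "... = lft S s t c (mat u) (i, b)" using lft_apply[OF fin_S s t m(1) i b] mat_apply[OF u i] b c by simp
 finally show "mat (lft S' s' t' c u) (i, b) = lft S s t c (mat u) (i, b)" .
 qed
qed
end

end

lemma (in abelian_group) add_minus_add:
 "[|p : carrier G; p' : carrier G; q : carrier G; q' : carrier G|] ==> p \<oplus> p' \<ominus> (q \<oplus> q') = p \<ominus> q \<oplus> (p' \<ominus> q')"
 by (simp add: a_minus_def minus_add a_ac)

text \<open>Exactness is checked one layer at a time, \<open>T n u\<close> saying that the layers of \<open>u\<close> from the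
 \<open>n\<close>-th on vanish.\<close>

lemma exact_by_layers:
 assumes L1: "right_module C L1" and L0: "right_module C L0" and M: "right_module C M" and d: "d : mod_hom_set C L1 L0" and e: "e : mod_hom_set C L0 M"
 and ed: "!!v. v : carrier L1 ==> e (d v) = \<zero>\<^sub>M" and base: "!!u. [|u : carrier L0; T 0 u|] ==> u = \<zero>\<^sub>L0"
 and step: "!!n u. [|u : carrier L0; e u = \<zero>\<^sub>M; T (Suc n) u|] ==> EX v:carrier L1. T n (u \<oplus>\<^sub>L0 d v)"
 and u: "u : carrier L0" "e u = \<zero>\<^sub>M" "T n u" shows "u : d ` carrier L1" using u
proof (induction n arbitrary: u)
 interpret L1: right_module C L1 by fact
 interpret L0: right_module C L0 by fact
 interpret M: right_module C M by fact
 note dc = mod_hom_closed[OF d]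
 {
 case 0
 hence "u = d \<zero>\<^sub>L1" using base mod_hom_zero[OF L1 L0 d] by simp
 thus ?case using L1.M.zero_closed by (rule image_eqI)
 next
 case (Suc n)
 obtain v where v: "v : carrier L1" "T n (u \<oplus>\<^sub>L0 d v)" using step[OF Suc.prems] by blast
 have "e (u \<oplus>\<^sub>L0 d v) = \<zero>\<^sub>M" using mod_hom_add[OF e Suc.prems(1) dc[OF v(1)]] Suc.prems(2) ed[OF v(1)] by simp
 then obtain v' where v': "v' : carrier L1" "u \<oplus>\<^sub>L0 d v = d v'"
 using Suc.IH[of "u \<oplus>\<^sub>L0 d v"] Suc.prems(1) dc[OF v(1)] v(2) by auto
 have "d (v' \<ominus>\<^sub>L1 v) = (u \<oplus>\<^sub>L0 d v) \<ominus>\<^sub>L0 d v"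
 unfolding v'(2) by (rule mod_hom_minus[OF L1 L0 d v'(1) v(1)])
 also have "... = u" using Suc.prems(1) dc[OF v(1)] by (simp add: a_minus_def L0.M.a_assoc L0.M.r_neg)
 finally show ?case using L1.M.minus_closed[OF v'(1) v(1)] by (metis imageI)
 }
qed

section \<open>The three-term complex over the dual of \<open>C\<close>\<close>

context bound_quiver_frame
begin
interpretation K: field K by (rule field_K)
interpretation Q: fin_digraph Q by (rule fin_Q)
interpretation A: ring "path_algebra K Q" by (rule ring_A)
interpretation kA: kalgebra K A by (rule kalgebra_A)
interpretation C: ring C by (rule kalgebraD(2)[OF kalgebra_C])
interpretation kC: kalgebra K C by (rule kalgebra_C)
abbreviation "F0 == Bim V ev ev"
abbreviation "F1 == Bim (arcs Q) ta ha"
abbreviation "F2 == Bim R sr tr1"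

lemma F0_c: "finite V" "!!x. x : V ==> ev x : \<C>" "!!x. x : V ==> ev x \<otimes> ev x = ev x"
 "!!x. x : V ==> ev x : \<C>" "!!x. x : V ==> ev x \<otimes> ev x = ev x"
 and F1_c: "finite (arcs Q)" "!!a. a : arcs Q ==> ev (tail Q a) : \<C>"
 "!!a. a : arcs Q ==> ev (tail Q a) \<otimes> ev (tail Q a) = ev (tail Q a)"
 "!!a. a : arcs Q ==> ev (head Q a) : \<C>"
 "!!a. a : arcs Q ==> ev (head Q a) \<otimes> ev (head Q a) = ev (head Q a)" and F2_c: "finite R" "!!r. r : R ==> ev (rsrc r) : \<C>"
 "!!r. r : R ==> ev (rsrc r) \<otimes> ev (rsrc r) = ev (rsrc r)"
 "!!r. r : R ==> ev (rtrg r) : \<C>"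
 "!!r. r : R ==> ev (rtrg r) \<otimes> ev (rtrg r) = ev (rtrg r)" using rsrc rtrg finite_R by (simp_all add: ev_mult)
lemma F0_module: "right_module C F0" and F1_module: "right_module C F1" and F2_module: "right_module C F2"
 by (rule right_module_Bim[OF F0_c] right_module_Bim[OF F1_c] right_module_Bim[OF F2_c]; assumption)+

lemma F0_dual: "has_dual_basis C F0" and F1_dual: "has_dual_basis C F1" and F2_dual: "has_dual_basis C F2"
 by (rule Bim_dual[OF F0_c] Bim_dual[OF F1_c] Bim_dual[OF F2_c]; assumption)+
text \<open>This comes from the bimodule differential sending the generator of \<open>a\<close> to
  \<open>a \<otimes> 1 - 1 \<otimes> a\<close>: left multiplication by \<open>a\<close> before
  \<open>w\<close> lands at the head, after \<open>w\<close> at the tail.\<close>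

definition D1 :: "'v => 'a => ('c => 'c) => 'c => 'c" where
 "D1 x a w b = (if head Q a = x then w (av a \<otimes> b) else \<zero>) \<ominus> (if tail Q a = x then av a \<otimes> w b else \<zero>)"
text \<open>The depth exceeds the length of every path, so all occurrences of \<open>a\<close> in
  \<open>r\<close> are counted, and its successor form fits \<open>delta_leading\<close>.\<close>

definition D2 :: "'a => (('v, 'a) path => 'k) => ('c => 'c) => 'c => 'c" where
 "D2 a r = delta (Suc (card V)) a r"

lemma bim_opI:
 assumes "!!w. bimap s' t' w ==> bimap s t (F w)"
 and "!!w w' b. [|bimap s' t' w; bimap s' t' w'; b : \<C>|] ==> F (%b. w b \<oplus>\<^sub>C w' b) b = F w b \<oplus>\<^sub>C F w' b"
 and "!!w c b. [|bimap s' t' w; c : \<C>; b : \<C>|] ==> F (%b. w b \<otimes> c) b = F w b \<otimes> c"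
 and "!!w c b. [|bimap s' t' w; c : \<C>; b : \<C>|] ==> F (%b. w (b \<otimes> c)) b = F w (b \<otimes> c)"
 and "!!w w' b. [|bimap s' t' w; !!b. b : \<C> ==> w' b = w b; b : \<C>|] ==> F w' b = F w b" shows "bim_op s t s' t' F" unfolding bim_op_def
proof (intro allI impI conjI ballI)
 show "F w' b = F w b" if "bimap s' t' w" "ALL b:\<C>. w' b = w b" "b : \<C>" for w w' b
 by (rule assms(5)[OF that(1) _ that(3)]) (use that(2) in blast)
qed (rule assms; assumption)+

lemma D1_op:
 assumes x: "x : V" and a: "a : arcs Q" shows "bim_op (ev x) (ev x) (ev (tail Q a)) (ev (head Q a)) (D1 x a)"
proof (rule bim_opI)
 fix w assume w: "bimap (ev (tail Q a)) (ev (head Q a)) w"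
 note av = av_corner[OF a]
 note wc = bimap_closed[OF w]
 show "bimap (ev x) (ev x) (D1 x a w)"
 proof -
 have 1: "bimap (ev x) (ev x) (%b. if head Q a = x then w (av a \<otimes> b) else \<zero>)"
 proof (cases "head Q a = x")
 case True
 have "bimap (ev x) (ev (head Q a)) (%b. w (av a \<otimes> b))"
 by (rule bimap_precompose[OF w klin_left[OF av(1)]]) (use av True x in \<open>simp add: C.m_assoc[symmetric]\<close>)
 thus ?thesis using True by simp
 qed (use x in \<open>simp add: bimap_zero\<close>)
 have 2: "bimap (ev x) (ev x) (%b. if tail Q a = x then av a \<otimes> w b else \<zero>)"
 proof (cases "tail Q a = x")
 case True
 have "bimap (ev (tail Q a)) (ev x) (%b. av a \<otimes> w b)" by (rule bimap_left[OF w]) (use av True x in simp_all)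
 thus ?thesis using True by simp
 qed (use x in \<open>simp add: bimap_zero\<close>)
 have "ev x : \<C>" using x by simp
 from bimap_plus[OF this 1 bimap_uminus[OF 2 this]]
 show ?thesis unfolding D1_def[abs_def] a_minus_def .
 qed
 define \<a> where "\<a> = av a"
 have \<a>: "\<a> : \<C>" using av by (simp add: \<a>_def)
 fix b assume b: "b : \<C>"
 show "D1 x a (%b. w b \<oplus>\<^sub>C w' b) b = D1 x a w b \<oplus>\<^sub>C D1 x a w' b"
 if w': "bimap (ev (tail Q a)) (ev (head Q a)) w'" for w'
 proof -
 note e = C.add_minus_add[of "if head Q a = x then w (\<a> \<otimes> b) else \<zero>" "if head Q a = x then w' (\<a> \<otimes> b) else \<zero>"
 "if tail Q a = x then \<a> \<otimes> w b else \<zero>" "if tail Q a = x then \<a> \<otimes> w' b else \<zero>"]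
 show ?thesis unfolding D1_def \<a>_def[symmetric] by (subst e[symmetric]) (use b \<a> wc bimap_closed[OF w'] in \<open>simp_all add: C.r_distr\<close>)
 qed
 show "D1 x a w' b = D1 x a w b" if "!!b. b : \<C> ==> w' b = w b" for w' unfolding D1_def \<a>_def[symmetric] using b \<a> that by simp
 fix c assume c: "c : \<C>"
 show "D1 x a (%b. w b \<otimes> c) b = D1 x a w b \<otimes> c"
 unfolding D1_def \<a>_def[symmetric] using b c \<a> wc by (simp add: a_minus_def C.l_distr C.l_minus C.m_assoc)
 show "D1 x a (%b. w (b \<otimes> c)) b = D1 x a w (b \<otimes> c)" unfolding D1_def \<a>_def[symmetric] using b c \<a> by (simp add: C.m_assoc)
qed

lemma D2_op:
 assumes a: "a : arcs Q" and r: "r : R" shows "bim_op (ev (tail Q a)) (ev (head Q a)) (ev (rsrc r)) (ev (rtrg r)) (D2 a r)" unfolding D2_def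
proof (rule bim_opI)
 note rc = R_carrier[OF r]
 fix w assume w: "bimap (ev (rsrc r)) (ev (rtrg r)) w"
 note wc = bimap_closed[OF w]
 show "bimap (ev (tail Q a)) (ev (head Q a)) (delta (Suc (card V)) a r w)"
 proof (rule bimapI)
 fix b assume b: "b : \<C>"
 show "delta (Suc (card V)) a r w b : \<C>" by (rule delta_closed[where w = w, OF a rc wc b])
 show "delta (Suc (card V)) a r w (ev (tail Q a) \<otimes> b) = delta (Suc (card V)) a r w b"
 by (rule delta_source[where w = w, OF a rc rsrc[OF r] wc bimap_source[OF w] b])
 show "ev (head Q a) \<otimes> delta (Suc (card V)) a r w b = delta (Suc (card V)) a r w b" by (rule delta_target[where w = w, OF a rc wc b])
 show "delta (Suc (card V)) a r w (b \<oplus>\<^sub>C b') = delta (Suc (card V)) a r w b \<oplus>\<^sub>C delta (Suc (card V)) a r w b'"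
 if "b' : \<C>" for b' by (rule delta_additive[where w = w, OF a rc wc bimap_add[OF w] b that])
 show "delta (Suc (card V)) a r w (k \<odot> b) = k \<odot> delta (Suc (card V)) a r w b"
 if "k : carrier K" for k by (rule delta_linear[where w = w, OF a rc wc that bimap_smult[OF w that] b])
 qed
 fix b assume b: "b : \<C>"
 show "delta (Suc (card V)) a r (%b. w b \<oplus>\<^sub>C w' b) b = delta (Suc (card V)) a r w b \<oplus>\<^sub>C delta (Suc (card V)) a r w' b"
 if w': "bimap (ev (rsrc r)) (ev (rtrg r)) w'" for w' by (rule delta_add[where w = w and w' = w', OF a rc wc bimap_closed[OF w'] b])
 show "delta (Suc (card V)) a r w' b = delta (Suc (card V)) a r w b" if "!!b. b : \<C> ==> w' b = w b" for w'
 by (rule delta_cong[where w = w' and w' = w, OF a rc that wc b])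
 show "delta (Suc (card V)) a r (%b. w b \<otimes> c) b = delta (Suc (card V)) a r w b \<otimes> c" if c: "c : \<C>" for c
 by (rule delta_mult_right[where w = w, OF a rc wc c b])
 show "delta (Suc (card V)) a r (%b. w (b \<otimes> c)) b = delta (Suc (card V)) a r w (b \<otimes> c)" if c: "c : \<C>" for c
 by (rule delta_mult_left[where w = w, OF a rc wc c b])
qed
definition d1 where "d1 = mat V (arcs Q) ta ha D1"
definition d2 where "d2 = mat (arcs Q) R sr tr1 D2"
abbreviation "l0 == lft V ev ev"
abbreviation "l1 == lft (arcs Q) ta ha"
abbreviation "l2 == lft R sr tr1"

lemma l0_hom: "c : \<C> ==> l0 c : mod_hom_set C F0 F0" and l1_hom: "c : \<C> ==> l1 c : mod_hom_set C F1 F1"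
 and l2_hom: "c : \<C> ==> l2 c : mod_hom_set C F2 F2" by (rule lft_hom[OF F0_c] lft_hom[OF F1_c] lft_hom[OF F2_c]; assumption)+

lemma l0_apply: "[|u : bimaps V ev ev; x : V; b : \<C>|] ==> l0 c u (x, b) = u (x, b \<otimes> c)" by (rule lft_apply[OF F0_c]; assumption)

lemma l2_apply: "[|u : bimaps R sr tr1; r : R; b : \<C>|] ==> l2 c u (r, b) = u (r, b \<otimes> c)"
 by (rule lft_apply[OF F2_c]; assumption)

lemma d1_hom: "d1 : mod_hom_set C F1 F0" and d2_hom: "d2 : mod_hom_set C F2 F1"
 unfolding d1_def d2_def by (rule mat_hom[OF F0_c F1_c D1_op] mat_hom[OF F1_c F2_c D2_op]; assumption)+

lemma d1_apply:
 "[|u : bimaps (arcs Q) ta ha; x : V; b : \<C>|] ==>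
 d1 u (x, b) = (\<Oplus>a\<in>arcs Q. D1 x a (%b. u (a, b)) b)" unfolding d1_def by (rule mat_apply[OF F0_c F1_c D1_op]; assumption)

lemma d2_apply:
 "[|v : bimaps R sr tr1; a : arcs Q; b : \<C>|] ==>
 d2 v (a, b) = (\<Oplus>r\<in>R. D2 a r (%b. v (r, b)) b)" unfolding d2_def by (rule mat_apply[OF F1_c F2_c D2_op]; assumption)


lemma D2_closed:
 "[|v : bimaps R sr tr1; a : arcs Q; r : R; b : \<C>|] ==>
 D2 a r (%b. v (r, b)) b : \<C>" by (rule F_closed[OF F1_c F2_c D2_op]; assumption)

lemma d1_lft: "[|u : carrier F1; c : \<C>|] ==> d1 (l1 c u) = l0 c (d1 u)" unfolding d1_def by (rule mat_lft[OF F0_c F1_c D1_op]; assumption)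

lemma d2_lft: "[|u : carrier F2; c : \<C>|] ==> d2 (l2 c u) = l1 c (d2 u)" unfolding d2_def by (rule mat_lft[OF F1_c F2_c D2_op]; assumption)

lemma d1_mem: "u : carrier F1 ==> d1 u : carrier F0" and d2_mem: "v : carrier F2 ==> d2 v : carrier F1"
 using mod_hom_closed[OF d1_hom] mod_hom_closed[OF d2_hom] by blast+

lemma ev_av: "[|x : V; a : arcs Q|] ==> ev x \<otimes> av a = (if tail Q a = x then av a else \<zero>)"
 using av_corner[of a] ev_mult[of x "tail Q a"] C.m_assoc[of "ev x" "ev (tail Q a)" "av a"] by auto

lemma ev_fixed: "[|x : V; y : V; c : \<C>; ev y \<otimes> c = c|] ==> ev x \<otimes> c = (if y = x then c else \<zero>)"
 using ev_mult[of x y] C.m_assoc[of "ev x" "ev y" c] by auto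

text \<open>Multiplication by \<open>ev x\<close> performs both case distinctions: values of
  \<open>u (a, _)\<close> start at the head of \<open>a\<close>, and \<open>a\<close> times such a
  value starts at the tail.\<close>

lemma D1_alt:
 assumes u: "u : bimaps (arcs Q) ta ha" and x: "x : V" and a: "a : arcs Q" and b: "b : \<C>"
 shows "D1 x a (%b. u (a, b)) b = ev x \<otimes> (u (a, av a \<otimes> b) \<ominus> av a \<otimes> u (a, b))"
proof -
 note av = av_corner(1)[OF a]
 have c: "u (a, av a \<otimes> b) : \<C>" "u (a, b) : \<C>" using bimaps_closed[OF u a] av b by simp_all
 have 1: "ev x \<otimes> u (a, av a \<otimes> b) = (if head Q a = x then u (a, av a \<otimes> b) else \<zero>)"
 using bimap_target[OF bimapsD[OF u a]] av b by (intro ev_fixed x c Q.head_in_verts a) simp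
 have 2: "ev x \<otimes> (av a \<otimes> u (a, b)) = (if tail Q a = x then av a \<otimes> u (a, b) else \<zero>)"
 using ev_av[OF x a] C.m_assoc[of "ev x" "av a" "u (a, b)"] x av c by auto
 have "ev x \<otimes> (u (a, av a \<otimes> b) \<ominus> av a \<otimes> u (a, b)) =
 ev x \<otimes> u (a, av a \<otimes> b) \<ominus> ev x \<otimes> (av a \<otimes> u (a, b))" using x av c by (simp add: a_minus_def C.r_distr C.r_minus)
 thus ?thesis unfolding D1_def 1 2 by simp
qed

text \<open>With the sums over arrows collected, \<open>d1\<close> is a cut-down sum of commutators
  with left multiplications, the form to which \<open>delta_commutator\<close> and
  \<open>tr_comm\<close> apply.\<close>

lemma d1_alt:
 assumes u: "u : bimaps (arcs Q) ta ha" and x: "x : V" and b: "b : \<C>"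
 shows "d1 u (x, b) = ev x \<otimes> ((\<Oplus>a\<in>arcs Q. u (a, av a \<otimes> b)) \<ominus> (\<Oplus>a\<in>arcs Q. av a \<otimes> u (a, b)))"
proof -
 have c: "u (a, av a \<otimes> b) : \<C>" "av a \<otimes> u (a, b) : \<C>" if "a : arcs Q" for a
 using bimaps_closed[OF u that] av_corner(1)[OF that] b by simp_all
 have xc: "ev x : \<C>" using x by simp
 have "d1 u (x, b) = (\<Oplus>a\<in>arcs Q. ev x \<otimes> (u (a, av a \<otimes> b) \<ominus> av a \<otimes> u (a, b)))"
 unfolding d1_apply[OF u x b] by (intro C.finsum_cong'[OF refl] Pi_I D1_alt[OF u x _ b] C.m_closed C.minus_closed c xc)
 also have "... = ev x \<otimes> (\<Oplus>a\<in>arcs Q. u (a, av a \<otimes> b) \<ominus> av a \<otimes> u (a, b))"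
 by (intro C.finsum_rdistr[symmetric] Q.finite_arcs xc Pi_I C.minus_closed c)
 also have "(\<Oplus>a\<in>arcs Q. u (a, av a \<otimes> b) \<ominus> av a \<otimes> u (a, b)) =
 (\<Oplus>a\<in>arcs Q. u (a, av a \<otimes> b)) \<ominus> (\<Oplus>a\<in>arcs Q. av a \<otimes> u (a, b))" by (intro C.finsum_minusf Q.finite_arcs c)
 finally show ?thesis .
qed

text \<open>The telescoping identity for a relation loses its outer terms because
  \<open>\<pi> r\<close> is zero; summing over \<open>R\<close> gives the claim.\<close>

lemma d1_d2: assumes v': "v : carrier F2" shows "d1 (d2 v) = \<zero>\<^sub>F0"
proof -
 have v: "v : bimaps R sr tr1" using v' by simp
 have dv: "d2 v : bimaps (arcs Q) ta ha" using d2_mem[OF v'] by simp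
 interpret F0: right_module C F0 by (rule F0_module)
 show ?thesis
 proof (rule bimaps_eqI)
 show "d1 (d2 v) : bimaps V ev ev" using d1_mem[OF d2_mem[OF v']] by simp
 show "\<zero>\<^sub>F0 : bimaps V ev ev" using F0.M.zero_closed by simp
 fix x b assume x: "x : V" and b: "b : \<C>"
 let ?\<delta> = "%a r. D2 a r (%b. v (r, b))"
 have cl: "?\<delta> a r c : \<C>" if "a : arcs Q" "r : R" "c : \<C>" for a r c by (rule D2_closed[OF v that])
 have avb: "av a \<otimes> b : \<C>" if "a : arcs Q" for a using av_corner(1)[OF that] b by simp
 have com: "(\<Oplus>a\<in>arcs Q. av a \<otimes> ?\<delta> a r b) = (\<Oplus>a\<in>arcs Q. ?\<delta> a r (av a \<otimes> b))" if r: "r : R" for r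
 proof -
 have w: "bimap (ev (rsrc r)) (ev (rtrg r)) (%b. v (r, b))" by (rule bimapsD[OF v r])
 have low: "r : low (Suc (card V))" using low_top[OF R_carrier[OF r]] by (simp add: low_def)
 have 0: "\<pi> r = \<zero>" by (rule \<pi>_I[OF R_I[OF r]])
 note c = delta_commutator[where w = "%b. v (r, b)", OF low rsrc(1)[OF r] rtrg(1)[OF r] rsrc(2)[OF r] rtrg(2)[OF r]
 bimap_closed[OF w] bimap_add[OF w] bimap_smult[OF w] bimap_source[OF w] bimap_target[OF w] b]
 have "v (r, \<pi> r \<otimes> b) = \<zero>" using klin_zero[OF bimap_klin[OF w]] 0 b by simp
 moreover have "\<pi> r \<otimes> v (r, b) = \<zero>" using 0 bimap_closed[OF w b] by simp
 moreover have "(\<Oplus>a\<in>arcs Q. av a \<otimes> ?\<delta> a r b) : \<C>" "(\<Oplus>a\<in>arcs Q. ?\<delta> a r (av a \<otimes> b)) : \<C>"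
 using cl[OF _ r] b av_corner(1) avb by (intro C.finsum_closed Pi_I C.m_closed; simp)+
 ultimately show ?thesis using c unfolding D2_def by simp
 qed
 have "(\<Oplus>a\<in>arcs Q. d2 v (a, av a \<otimes> b)) = (\<Oplus>a\<in>arcs Q. \<Oplus>r\<in>R. ?\<delta> a r (av a \<otimes> b))"
 by (intro C.finsum_cong'[OF refl] Pi_I C.finsum_closed cl avb d2_apply[OF v])
 also have "... = (\<Oplus>r\<in>R. \<Oplus>a\<in>arcs Q. ?\<delta> a r (av a \<otimes> b))" by (intro C.finsum_swap finite_R Q.finite_arcs cl avb)
 also have "... = (\<Oplus>r\<in>R. \<Oplus>a\<in>arcs Q. av a \<otimes> ?\<delta> a r b)"
 by (intro C.finsum_cong'[OF refl] Pi_I C.finsum_closed C.m_closed cl av_corner(1) b com[symmetric])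
 also have "... = (\<Oplus>a\<in>arcs Q. \<Oplus>r\<in>R. av a \<otimes> ?\<delta> a r b)"
 by (intro C.finsum_swap finite_R Q.finite_arcs C.m_closed cl av_corner(1) b)
 also have "... = (\<Oplus>a\<in>arcs Q. av a \<otimes> d2 v (a, b))"
 proof (rule C.finsum_cong'[OF refl])
 show "(%a. av a \<otimes> d2 v (a, b)) : arcs Q \<rightarrow> \<C>" by (intro Pi_I C.m_closed av_corner(1) bimaps_closed[OF dv] b)
 show "(\<Oplus>r\<in>R. av a \<otimes> ?\<delta> a r b) = av a \<otimes> d2 v (a, b)" if a: "a : arcs Q" for a
 unfolding d2_apply[OF v a b] by (intro C.finsum_rdistr[symmetric] finite_R av_corner(1) a Pi_I cl b)
 qed
 finally have e: "(\<Oplus>a\<in>arcs Q. d2 v (a, av a \<otimes> b)) = (\<Oplus>a\<in>arcs Q. av a \<otimes> d2 v (a, b))" .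
 have "(\<Oplus>a\<in>arcs Q. av a \<otimes> d2 v (a, b)) : \<C>" by (intro C.finsum_closed Pi_I C.m_closed av_corner(1) bimaps_closed[OF dv] b)
 thus "d1 (d2 v) (x, b) = \<zero>\<^sub>F0 (x, b)" unfolding d1_alt[OF dv x b] e using x b by (simp add: a_minus_def C.r_neg)
 qed
qed
text \<open>The evaluation map taking \<open>\<phi> \<otimes> c\<close> to the functional
  \<open>d -> \<phi> (c d)\<close>, written for linear maps as a trace after right multiplication by
  \<open>d\<close>.\<close>

definition aug :: "('v \<times> 'c => 'c) => 'c => 'k" where
 "aug = (\<lambda>u\<in>carrier F0. \<lambda>c\<in>\<C>. tr (%b. (\<Oplus>x\<in>V. u (x, b)) \<otimes> c))"

lemma aug_apply: "[|u : bimaps V ev ev; c : \<C>|] ==> aug u c = tr (%b. (\<Oplus>x\<in>V. u (x, b)) \<otimes> c)" by (simp add: aug_def)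

lemma total_klin: assumes u: "u : bimaps V ev ev" shows "klin (%b. \<Oplus>x\<in>V. u (x, b))"
 by (intro bimap_finsum C.one_closed F0_c(1) bimap_klin[OF bimapsD[OF u]])

lemma aug_hom: "aug : mod_hom_set C F0 DC" unfolding aug_def
proof (rule mod_hom_restrictI[OF F0_module])
 fix u assume "u : carrier F0"
 hence u: "u : bimaps V ev ev" by simp
 let ?W = "%u b. \<Oplus>x\<in>V. u (x, b)"
 note wc = bimap_closed[OF total_klin[OF u]]
 note uc = bimaps_closed[OF u]
 have wcc: "?W u b \<otimes> c : \<C>" if "b : \<C>" "c : \<C>" for b c using that wc by simp
 show "(\<lambda>c\<in>\<C>. tr (%b. ?W u b \<otimes> c)) : carrier DC"
 proof (rule DC_I)
 fix c assume c: "c : \<C>"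
 show "tr (%b. ?W u b \<otimes> c) : carrier K" by (rule tr_closed[OF wcc[OF _ c]])
 show "tr (%b. ?W u b \<otimes> (c \<oplus>\<^sub>C d)) = tr (%b. ?W u b \<otimes> c) \<oplus>\<^sub>K tr (%b. ?W u b \<otimes> d)" if d: "d : \<C>" for d
 proof -
 have "tr (%b. ?W u b \<otimes> (c \<oplus>\<^sub>C d)) = tr (%b. ?W u b \<otimes> c \<oplus>\<^sub>C ?W u b \<otimes> d)"
 by (rule tr_cong) (use c d wc in \<open>simp_all add: C.r_distr\<close>)
 thus ?thesis using tr_add[OF wcc[OF _ c] wcc[OF _ d]] by simp
 qed
 show "tr (%b. ?W u b \<otimes> (k \<odot> c)) = k \<otimes>\<^sub>K tr (%b. ?W u b \<otimes> c)" if k: "k : carrier K" for k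
 proof -
 have "tr (%b. ?W u b \<otimes> (k \<odot> c)) = tr (%b. k \<odot> (?W u b \<otimes> c))"
 by (rule tr_cong) (use c k wc in \<open>simp_all add: kC.smult_mult_right\<close>)
 thus ?thesis using tr_smult[OF wcc[OF _ c] k] by simp
 qed
 qed
 show "(\<lambda>c\<in>\<C>. tr (%b. ?W (u \<oplus>\<^sub>F0 v) b \<otimes> c)) =
 (\<lambda>c\<in>\<C>. tr (%b. ?W u b \<otimes> c)) \<oplus>\<^sub>DC (\<lambda>c\<in>\<C>. tr (%b. ?W v b \<otimes> c))" if "v : carrier F0" for v
 proof -
 have v: "v : bimaps V ev ev" using that by simp
 note vc = bimaps_closed[OF v] and wv = bimap_closed[OF total_klin[OF v]]
 have "tr (%b. ?W (u \<oplus>\<^sub>F0 v) b \<otimes> c) = tr (%b. ?W u b \<otimes> c) \<oplus>\<^sub>K tr (%b. ?W v b \<otimes> c)" if c: "c : \<C>" for c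
 proof -
 have "?W (u \<oplus>\<^sub>F0 v) b = ?W u b \<oplus>\<^sub>C ?W v b" if b: "b : \<C>" for b
 proof -
 have "?W (u \<oplus>\<^sub>F0 v) b = (\<Oplus>x\<in>V. u (x, b) \<oplus>\<^sub>C v (x, b))"
 using b by (intro C.finsum_cong'[OF refl] Pi_I C.a_closed uc vc) simp_all
 also have "... = ?W u b \<oplus>\<^sub>C ?W v b" using b by (intro C.finsum_addf Pi_I uc vc)
 finally show ?thesis .
 qed
 hence "tr (%b. ?W (u \<oplus>\<^sub>F0 v) b \<otimes> c) = tr (%b. ?W u b \<otimes> c \<oplus>\<^sub>C ?W v b \<otimes> c)"
 by (intro tr_cong) (use c wc wv in \<open>simp_all add: C.l_distr\<close>)
 thus ?thesis using c wc wv by (simp add: tr_add)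
 qed
 thus ?thesis by (auto simp: DC_simps fun_eq_iff)
 qed
 show "(\<lambda>c\<in>\<C>. tr (%b. ?W (d \<odot>\<^sub>F0 u) b \<otimes> c)) = d \<odot>\<^sub>DC (\<lambda>c\<in>\<C>. tr (%b. ?W u b \<otimes> c))" if d: "d : \<C>" for d
 proof -
 have "tr (%b. ?W (d \<odot>\<^sub>F0 u) b \<otimes> c) = tr (%b. ?W u b \<otimes> (d \<otimes> c))" if c: "c : \<C>" for c
 proof (rule tr_cong)
 fix b assume b: "b : \<C>"
 have "?W (d \<odot>\<^sub>F0 u) b = (\<Oplus>x\<in>V. u (x, b) \<otimes> d)" using b d by (intro C.finsum_cong'[OF refl] Pi_I C.m_closed uc) simp_all
 also have "... = ?W u b \<otimes> d" using b d by (intro C.finsum_ldistr[symmetric] F0_c(1) Pi_I uc)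
 finally show "?W (d \<odot>\<^sub>F0 u) b \<otimes> c = ?W u b \<otimes> (d \<otimes> c)" using b c d wc by (simp add: C.m_assoc)
 show "?W u b \<otimes> (d \<otimes> c) : \<C>" using b c d wc by simp
 qed
 thus ?thesis using d by (auto simp: DC_simps fun_eq_iff)
 qed
qed

text \<open>Precomposing and postcomposing with left multiplication by \<open>a\<close> give equal
  traces by \<open>tr_comm\<close>.\<close>

lemma aug_d1: assumes u': "u : carrier F1" shows "aug (d1 u) = \<zero>\<^sub>DC"
proof -
 interpret DC: right_module C DC by (rule right_module_dual)
 have u: "u : bimaps (arcs Q) ta ha" using u' by simp
 have du: "d1 u : bimaps V ev ev" using d1_mem[OF u'] by simp
 show ?thesis
 proof (rule DC_eqI[OF _ DC.M.zero_closed])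
 show "aug (d1 u) : carrier DC" by (rule mod_hom_closed[OF aug_hom d1_mem[OF u']])
 fix c assume c: "c : \<C>"
 let ?P = "%b. \<Oplus>a\<in>arcs Q. u (a, av a \<otimes> b)" and ?N = "%b. \<Oplus>a\<in>arcs Q. av a \<otimes> u (a, b)"
 have ac: "av a : \<C>" if "a : arcs Q" for a using av_corner(1)[OF that] .
 have t: "u (a, av a \<otimes> b) : \<C>" "av a \<otimes> u (a, b) : \<C>" if "a : arcs Q" "b : \<C>" for a b
 using bimaps_closed[OF u] ac that by simp_all
 have pn: "?P b : \<C>" "?N b : \<C>" if "b : \<C>" for b using t that by (auto intro!: C.finsum_closed)
 have W: "(\<Oplus>x\<in>V. d1 u (x, b)) \<oplus>\<^sub>C ?N b = ?P b" if b: "b : \<C>" for b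
 proof -
 have d: "?P b \<ominus> ?N b : \<C>" using pn b by simp
 have "(\<Oplus>x\<in>V. d1 u (x, b)) = (\<Oplus>x\<in>V. ev x \<otimes> (?P b \<ominus> ?N b))"
 by (intro C.finsum_cong'[OF refl] Pi_I C.m_closed F0_c(2) d d1_alt[OF u _ b])
 also have "... = (\<Oplus>x\<in>V. ev x) \<otimes> (?P b \<ominus> ?N b)" by (intro C.finsum_ldistr[symmetric] F0_c(1) d Pi_I F0_c(2))
 also have "... = ?P b \<ominus> ?N b" using d by (simp add: ev_sum)
 finally show ?thesis using pn[OF b] by (simp add: a_minus_def C.a_assoc C.l_neg)
 qed
 note wc = bimap_closed[OF total_klin[OF du]]
 have "tr (%b. ?P b \<otimes> c) = (\<Oplus>\<^sub>K a\<in>arcs Q. tr (%b. u (a, av a \<otimes> b) \<otimes> c))"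
 proof -
 have "tr (%b. ?P b \<otimes> c) = tr (%b. \<Oplus>a\<in>arcs Q. u (a, av a \<otimes> b) \<otimes> c)"
 by (rule tr_cong) (use t c in \<open>auto intro!: C.finsum_ldistr C.finsum_closed\<close>)
 also have "... = (\<Oplus>\<^sub>K a\<in>arcs Q. tr (%b. u (a, av a \<otimes> b) \<otimes> c))" by (intro tr_finsum Q.finite_arcs C.m_closed t c)
 finally show ?thesis .
 qed
 also have "... = (\<Oplus>\<^sub>K a\<in>arcs Q. tr (%b. av a \<otimes> u (a, b) \<otimes> c))"
 proof (rule K.finsum_cong'[OF refl])
 fix a assume a: "a : arcs Q"
 have "tr (%b. u (a, av a \<otimes> b) \<otimes> c) = tr (%b. av a \<otimes> (u (a, b) \<otimes> c))"
 by (rule tr_comm[OF bimap_right[OF bimap_klin[OF bimapsD[OF u a]] c C.one_closed] klin_left[OF ac[OF a]]])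
 also have "... = tr (%b. av a \<otimes> u (a, b) \<otimes> c)"
 by (rule tr_cong) (use t[OF a] bimaps_closed[OF u a] ac[OF a] c in \<open>simp_all add: C.m_assoc\<close>)
 finally show "tr (%b. u (a, av a \<otimes> b) \<otimes> c) = tr (%b. av a \<otimes> u (a, b) \<otimes> c)" .
 qed (intro Pi_I tr_closed C.m_closed t c)
 also have "... = tr (%b. ?N b \<otimes> c)"
 proof -
 have "tr (%b. ?N b \<otimes> c) = tr (%b. \<Oplus>a\<in>arcs Q. av a \<otimes> u (a, b) \<otimes> c)"
 by (rule tr_cong) (use t c in \<open>auto intro!: C.finsum_ldistr C.finsum_closed\<close>)
 also have "... = (\<Oplus>\<^sub>K a\<in>arcs Q. tr (%b. av a \<otimes> u (a, b) \<otimes> c))" by (intro tr_finsum Q.finite_arcs C.m_closed t c)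
 finally show ?thesis by simp
 qed
 finally have e: "tr (%b. ?P b \<otimes> c) = tr (%b. ?N b \<otimes> c)" .
 have "tr (%b. ?P b \<otimes> c) = tr (%b. (\<Oplus>x\<in>V. d1 u (x, b)) \<otimes> c \<oplus>\<^sub>C ?N b \<otimes> c)"
 by (rule tr_cong) (use W[symmetric] wc pn c in \<open>simp_all add: C.l_distr\<close>)
 also have "... = tr (%b. (\<Oplus>x\<in>V. d1 u (x, b)) \<otimes> c) \<oplus>\<^sub>K tr (%b. ?N b \<otimes> c)"
 by (intro tr_add C.m_closed wc pn c)
 also have "tr (%b. (\<Oplus>x\<in>V. d1 u (x, b)) \<otimes> c) = aug (d1 u) c" by (rule aug_apply[OF du c, symmetric])
 finally have "aug (d1 u) c \<oplus>\<^sub>K tr (%b. ?N b \<otimes> c) = tr (%b. ?N b \<otimes> c)" unfolding e by (rule sym)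
 moreover have "tr (%b. ?N b \<otimes> c) : carrier K" by (intro tr_closed C.m_closed pn c)
 moreover have "aug (d1 u) c : carrier K" unfolding aug_apply[OF du c] by (intro tr_closed C.m_closed wc c)
 ultimately have "aug (d1 u) c = \<zero>\<^sub>K" by (simp add: K.add.r_cancel_one')
 thus "aug (d1 u) c = \<zero>\<^sub>DC c" using c by (simp add: DC_simps)
 qed
qed

text \<open>A functional \<open>\<phi>\<close> is hit by the family of rank one maps sending
  \<open>b\<close> to \<open>\<phi> (ev x b)\<close> times \<open>ev x\<close>; their traces add up
  to \<open>\<phi>\<close> because the idempotents add up to one.\<close>

lemma aug_surj: "carrier DC \<subseteq> aug ` carrier F0"
proof
 fix \<phi> assume \<phi>: "\<phi> : carrier DC"
 define u where "u = pack V (%x b. \<phi> (ev x \<otimes> b) \<odot> ev x)"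
 have \<phi>c: "\<phi> c : carrier K" if "c : \<C>" for c by (rule DC_closed[OF \<phi> that])
 have u: "u : bimaps V ev ev" unfolding u_def
 proof (rule packI[OF _ F0_c(2)])
 fix x assume x: "x : V"
 show "bimap (ev x) (ev x) (%b. \<phi> (ev x \<otimes> b) \<odot> ev x)"
 by (rule bimapI) (use x F0_c(3)[OF x] \<phi>c in \<open>simp_all add: DC_add[OF \<phi>] DC_smult[OF \<phi>] C.m_assoc[symmetric] C.r_distr
 kC.smult_l_distr kC.smult_mult_right[symmetric] kC.smult_assoc1\<close>)
 qed
 have "aug u = \<phi>"
 proof (rule DC_eqI[OF mod_hom_closed[OF aug_hom] \<phi>])
 show "u : carrier F0" using u by simp
 fix c assume c: "c : \<C>"
 have t: "\<phi> (ev x \<otimes> b) \<odot> (ev x \<otimes> c) : \<C>" if "x : V" "b : \<C>" for x b using that c \<phi>c by simp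
 have "aug u c = tr (%b. \<Oplus>x\<in>V. \<phi> (ev x \<otimes> b) \<odot> (ev x \<otimes> c))" unfolding aug_apply[OF u c]
 proof (rule tr_cong)
 fix b assume b: "b : \<C>"
 show "(\<Oplus>x\<in>V. \<phi> (ev x \<otimes> b) \<odot> (ev x \<otimes> c)) : \<C>" by (intro C.finsum_closed Pi_I t b)
 have "(\<Oplus>x\<in>V. u (x, b)) \<otimes> c = (\<Oplus>x\<in>V. u (x, b) \<otimes> c)" by (intro C.finsum_ldistr F0_c(1) c Pi_I bimaps_closed[OF u] b)
 also have "... = (\<Oplus>x\<in>V. \<phi> (ev x \<otimes> b) \<odot> (ev x \<otimes> c))"
 proof (rule C.finsum_cong'[OF refl])
 show "u (x, b) \<otimes> c = \<phi> (ev x \<otimes> b) \<odot> (ev x \<otimes> c)" if x: "x : V" for x using x b c \<phi>c by (simp add: u_def kC.smult_mult_left)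
 qed (intro Pi_I t b)
 finally show "(\<Oplus>x\<in>V. u (x, b)) \<otimes> c = (\<Oplus>x\<in>V. \<phi> (ev x \<otimes> b) \<odot> (ev x \<otimes> c))" .
 qed
 also have "... = (\<Oplus>\<^sub>K x\<in>V. tr (%b. \<phi> (ev x \<otimes> b) \<odot> (ev x \<otimes> c)))" by (intro tr_finsum F0_c(1) t)
 also have "... = (\<Oplus>\<^sub>K x\<in>V. \<phi> (ev x \<otimes> c))"
 proof (rule K.finsum_cong'[OF refl])
 fix x assume x: "x : V"
 have r: "(\<lambda>b\<in>\<C>. \<phi> (ev x \<otimes> b)) : carrier DC"
 by (rule DC_I) (use x \<phi>c in \<open>simp_all add: DC_add[OF \<phi>] DC_smult[OF \<phi>] C.r_distr kC.smult_mult_right[symmetric]\<close>)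
 have "tr (%b. \<phi> (ev x \<otimes> b) \<odot> (ev x \<otimes> c))
 = tr (%b. (\<lambda>b\<in>\<C>. \<phi> (ev x \<otimes> b)) b \<odot> (ev x \<otimes> c))" by (rule tr_cong) (use t[OF x] in simp_all)
 also have "... = (\<lambda>b\<in>\<C>. \<phi> (ev x \<otimes> b)) (ev x \<otimes> c)" by (rule tr_rank_one[OF r]) (use x c in simp)
 also have "... = \<phi> (ev x \<otimes> c)" using x c F0_c(3)[OF x] by (simp add: C.m_assoc[symmetric])
 finally show "tr (%b. \<phi> (ev x \<otimes> b) \<odot> (ev x \<otimes> c)) = \<phi> (ev x \<otimes> c)" .
 qed (use c \<phi>c in simp)
 also have "... = \<phi> c"
 proof -
 have "(\<Oplus>\<^sub>K x\<in>S. \<phi> (ev x \<otimes> c)) = \<phi> (\<Oplus>x\<in>S. ev x \<otimes> c)" if "finite S" "S \<subseteq> V" for S using that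
 proof (induction S rule: finite_induct)
 case empty
 show ?case using DC_add[OF \<phi>, of "\<zero>" "\<zero>"] \<phi>c[of "\<zero>"] by (simp add: K.add.l_cancel_one')
 next
 case (insert x S)
 hence "ev x \<otimes> c : \<C>" "(%x. ev x \<otimes> c) : S \<rightarrow> \<C>" "(%x. \<phi> (ev x \<otimes> c)) : S \<rightarrow> carrier K"
 using c \<phi>c by auto
 thus ?case using insert \<phi>c by (simp add: DC_add[OF \<phi>])
 qed
 moreover have "(\<Oplus>x\<in>V. ev x \<otimes> c) = (\<Oplus>x\<in>V. ev x) \<otimes> c" by (intro C.finsum_ldistr[symmetric] F0_c(1) c Pi_I F0_c(2))
 ultimately show ?thesis using F0_c(1) c by (simp add: ev_sum)
 qed
 finally show "aug u c = \<phi> c" .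
 qed
 thus "\<phi> : aug ` carrier F0" using u by auto
qed

section \<open>Exactness of the complex, layer by layer\<close>

lemma corner_level_C:
 assumes c: "c : \<C>" and x: "x : V" and y: "y : V" and l: "level y \<le> level x"
 shows "ev y \<otimes> c \<otimes> ev x = (if y = x then cf x c \<odot> ev x else \<zero>)"
proof -
 note p = pre[OF c]
 have k: "pre c (x, []) : carrier K" using A_val[OF p(1)] .
 have "ev y \<otimes> c \<otimes> ev x = \<pi> (vid y \<otimes>\<^sub>A pre c \<otimes>\<^sub>A vid x)" using p x y by (simp add: \<pi>_mult)
 also have "... = (if y = x then cf x c \<odot> ev x else \<zero>)" using x k by (simp add: corner_level[OF p(1) x y l] \<pi>_zero \<pi>_smult cf_def)
 finally show ?thesis .
qed

lemma expand_rad: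
 assumes c: "c : radf 1" shows "(\<Oplus>a\<in>arcs Q. av a \<otimes> dv a (pre c)) = c"
proof -
 have cc: "c : \<C>" by (rule radf_carrier[OF c])
 note p = pre[OF cc]
 have f: "pre c : filt 1" using c radf_1_iff[OF cc] filt_1_iff[OF p(1)] unfolding cf_def by blast
 have "(\<Oplus>a\<in>arcs Q. av a \<otimes> dv a (pre c)) = (\<Oplus>a\<in>arcs Q. \<pi> (arr a \<otimes>\<^sub>A der a (pre c)))"
 using p by (intro C.finsum_cong'[OF refl]) (auto simp: \<pi>_mult)
 also have "... = \<pi> (\<Oplus>\<^sub>A a\<in>arcs Q. arr a \<otimes>\<^sub>A der a (pre c))" using p by (intro \<pi>_finsum[symmetric]) auto
 also have "... = c" using expand_filt_1[OF f] p(2) by metis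
 finally show ?thesis .
qed

lemma level_bounded: obtains m where "!!x. x : V ==> level x < m" using finite_nat_set_iff_bounded[of "level ` V"] F0_c(1) by auto

text \<open>Testing \<open>aug u\<close> on \<open>ev x c\<close> isolates the component at
  \<open>x\<close>: components of higher level vanish by assumption, and components at other points
  of level at most that of \<open>x\<close> have no part ending at \<open>x\<close>. What is left is
  the trace of a rank one map, equal to the coefficient of \<open>u (x, c)\<close> at
  \<open>x\<close>.\<close>

lemma aug_rad:
 assumes u: "u : bimaps V ev ev" and z: "aug u = \<zero>\<^sub>DC"
 and top: "!!y b. [|y : V; level x < level y; b : \<C>|] ==> u (y, b) = \<zero>" and x: "x : V" and c: "c : \<C>" shows "u (x, c) : radf 1"
proof -
 note ux = bimapsD[OF u x]
 note uc = bimaps_closed[OF u]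
 have \<phi>: "(\<lambda>b\<in>\<C>. cf x (u (x, b))) : carrier DC"
 by (rule DC_I) (use uc[OF x] in \<open>simp_all add: cf_closed bimap_add[OF ux] bimap_smult[OF ux] cf_add cf_smult\<close>)
 have xc: "ev x \<otimes> c : \<C>" using x c by simp
 have "aug u (ev x \<otimes> c) = tr (%b. (\<lambda>b\<in>\<C>. cf x (u (x, b))) b \<odot> (ev x \<otimes> c))" unfolding aug_apply[OF u xc]
 proof (rule tr_cong)
 fix b assume b: "b : \<C>"
 show "(\<lambda>b\<in>\<C>. cf x (u (x, b))) b \<odot> (ev x \<otimes> c) : \<C>" using b xc uc[OF x b] cf_closed by simp
 have e: "u (y, b) \<otimes> ev x = (if x = y then cf x (u (x, b)) \<odot> ev x else \<zero>)" if y: "y : V" for y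
 proof (cases "level x < level y")
 case True
 thus ?thesis using top[OF y True b] x by auto
 next
 case False
 have "u (y, b) \<otimes> ev x = ev y \<otimes> u (y, b) \<otimes> ev x" using bimap_target[OF bimapsD[OF u y] b] by simp
 thus ?thesis using corner_level_C[OF uc[OF y b] x y] False by auto
 qed
 have "(\<Oplus>y\<in>V. u (y, b)) \<otimes> ev x = (\<Oplus>y\<in>V. u (y, b) \<otimes> ev x)" by (intro C.finsum_ldistr F0_c(1) F0_c(2)[OF x] Pi_I uc b)
 also have "... = (\<Oplus>y\<in>V. if x = y then cf x (u (x, b)) \<odot> ev x else \<zero>)"
 using x uc[OF x b] cf_closed by (intro C.finsum_cong'[OF refl]) (auto simp: e)
 also have "... = cf x (u (x, b)) \<odot> ev x" using x F0_c(1) uc[OF x b] cf_closed by (intro C.finsum_singleton) auto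
 finally have e2: "(\<Oplus>y\<in>V. u (y, b)) \<otimes> ev x = cf x (u (x, b)) \<odot> ev x" .
 have "(\<Oplus>y\<in>V. u (y, b)) \<otimes> (ev x \<otimes> c) = (\<Oplus>y\<in>V. u (y, b)) \<otimes> ev x \<otimes> c"
 using x c bimap_closed[OF total_klin[OF u] b] by (simp add: C.m_assoc)
 thus "(\<Oplus>y\<in>V. u (y, b)) \<otimes> (ev x \<otimes> c) = (\<lambda>b\<in>\<C>. cf x (u (x, b))) b \<odot> (ev x \<otimes> c)"
 unfolding e2 using x b c uc[OF x b] by (simp add: kC.smult_mult_left cf_closed)
 qed
 also have "... = cf x (u (x, c))" unfolding tr_rank_one[OF \<phi> xc] using xc bimap_source[OF ux c] by simp
 finally have cx: "cf x (u (x, c)) = \<zero>\<^sub>K" using z xc by (simp add: DC_simps)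
 have "cf y (u (x, c)) = \<zero>\<^sub>K" if y: "y : V" for y
 proof (cases "y = x")
 case False
 have "cf y (ev x \<otimes> u (x, c)) = \<zero>\<^sub>K" using False x y uc[OF x c] by (simp add: cf_mult cf_ev cf_closed)
 thus ?thesis using bimap_target[OF ux c] by simp
 qed (use cx in simp)
 thus ?thesis using radf_1_iff[OF uc[OF x c]] by blast
qed

text \<open>On its highest layer a kernel element has values in the radical by
  \<open>aug_rad\<close> and is therefore a combination of arrows; the factors behind the arrows
  form the correction \<open>v\<close>. Lower layers may change, which the layer argument
  permits.\<close>

lemma F0_exact:
 assumes u: "u : carrier F0" and z: "aug u = \<zero>\<^sub>DC" shows "u : d1 ` carrier F1"
proof -
 obtain m where m: "!!x. x : V ==> level x < m" using level_bounded by blast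
 interpret F0: right_module C F0 by (rule F0_module)
 show ?thesis
 proof (rule exact_by_layers[OF F1_module F0_module right_module_dual d1_hom aug_hom,
 where T = "%n u. ALL x:V. n \<le> level x --> (ALL b:\<C>. u (x, b) = \<zero>)" and n = m])
 fix u assume "u : carrier F0" "ALL x:V. 0 \<le> level x --> (ALL b:\<C>. u (x, b) = \<zero>)"
 thus "u = \<zero>\<^sub>F0" using F0.M.zero_closed by (intro bimaps_eqI[of u V ev ev "\<zero>\<^sub>F0"]) auto
 next
 fix n u assume "u : carrier F0" and z: "aug u = \<zero>\<^sub>DC"
 and top: "ALL x:V. Suc n \<le> level x --> (ALL b:\<C>. u (x, b) = \<zero>)"
 hence u: "u : bimaps V ev ev" by simp
 note uc = bimaps_closed[OF u]
 have Bc: "b : \<C>" if "b : B" for b using that B_sub by blast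
 have rad: "u (x, b) : radf 1" if "x : V" "level x = n" "b : \<C>" for x b by (rule aug_rad[OF u z _ that(1,3)]) (use top that in simp)
 \<comment> \<open>The derivatives involve chosen preimages and are not linear in \<open>b\<close>,
   so they are taken at the frame vectors and extended linearly.\<close>
 define v where "v = pack (arcs Q) (%a b. if level (tail Q a) = n
 then \<Oplus>b'\<in>B. \<t> b' (ev (tail Q a) \<otimes> b) \<odot> dv a (pre (u (tail Q a, b'))) else \<zero>)"
 have pc: "pre (u (x, b)) : \<A>" if "x : V" "b : B" for x b using pre(1)[OF uc[OF that(1) Bc[OF that(2)]]] .
 have v: "v : bimaps (arcs Q) ta ha" unfolding v_def
 proof (rule packI[OF _ F1_c(2)])
 fix a assume a: "a : arcs Q"
 have "bimap (ev (tail Q a)) (ev (head Q a)) (%b. \<Oplus>b'\<in>B. \<t> b' (ev (tail Q a) \<otimes> b) \<odot> dv a (pre (u (tail Q a, b'))))"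
 by (intro bimap_finsum F1_c(4)[OF a] finite_B \<t>_bimap F1_c(2,3)[OF a] dv_corner[OF a] pc Q.tail_in_verts[OF a])
 thus "bimap (ev (tail Q a)) (ev (head Q a)) (%b. if level (tail Q a) = n
 then \<Oplus>b'\<in>B. \<t> b' (ev (tail Q a) \<otimes> b) \<odot> dv a (pre (u (tail Q a, b'))) else \<zero>)"
 using bimap_zero[OF F1_c(4)[OF a]] by (cases "level (tail Q a) = n") simp_all
 qed
 have v0: "v (a, b) = \<zero>" if "a : arcs Q" "b : \<C>" "level (tail Q a) ~= n" for a b using that by (simp add: v_def)
 \<comment> \<open>An arrow ending in layer \<open>n\<close> or above starts strictly above layer
   \<open>n\<close>, where \<open>v\<close> is zero; only the tail term of \<open>D1\<close>
   survives.\<close>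
 have D1v: "D1 x a (%b. v (a, b)) b = \<zero> \<ominus> (if tail Q a = x then av a \<otimes> v (a, b) else \<zero>)"
 if "x : V" "n \<le> level x" "a : arcs Q" "b : \<C>" for x a b
 proof -
 have "head Q a = x ==> v (a, av a \<otimes> b) = \<zero>" using level_arr[OF that(3)] that av_corner(1)[OF that(3)] by (intro v0) auto
 hence e: "(if head Q a = x then v (a, av a \<otimes> b) else \<zero>) = \<zero>" by (cases "head Q a = x") simp_all
 show ?thesis unfolding D1_def e ..
 qed
 have step: "u (x, b) \<oplus>\<^sub>C d1 v (x, b) = \<zero>" if x: "x : V" "n \<le> level x" and b: "b : \<C>" for x b
 proof -
 have if_mem: "(if P then p else q) : S" if "p : S" "q : S" for P and p q :: 'c and S using that by simp
 define Y where "Y a = (if tail Q a = x then av a \<otimes> v (a, b) else \<zero>)" for a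
 have Yc: "Y a : \<C>" if "a : arcs Q" for a unfolding Y_def by (rule if_mem) (intro C.m_closed av_corner(1)[OF that] bimaps_closed[OF v that b], simp)
 have "d1 v (x, b) = (\<Oplus>a\<in>arcs Q. \<zero> \<ominus> Y a)" unfolding d1_apply[OF v x(1) b] using Yc D1v[OF x _ b]
 by (intro C.finsum_cong'[OF refl] Pi_I C.minus_closed C.zero_closed) (auto simp: Y_def)
 also have "... = (\<Oplus>a\<in>arcs Q. \<zero>) \<ominus> finsum C Y (arcs Q)" by (intro C.finsum_minusf F1_c(1) C.zero_closed Yc)
 finally have d: "d1 v (x, b) = \<zero> \<ominus> finsum C Y (arcs Q)" by simp
 have "finsum C Y (arcs Q) = u (x, b)"
 proof (cases "level x = n")
 case False
 have "Y a = \<zero>" if a: "a : arcs Q" for a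
 proof (cases "tail Q a = x")
 case t: True
 have "v (a, b) = \<zero>" using v0[OF a b] t False by blast
 thus ?thesis unfolding Y_def if_P[OF t] using C.r_null[OF av_corner(1)[OF a]] by metis
 qed (simp add: Y_def)
 hence "finsum C Y (arcs Q) = \<zero>" by (intro C.add.finprod_one_eqI)
 thus ?thesis using top x False b by simp
 next
 case True
 have xb: "ev x \<otimes> b : \<C>" using x b by simp
 let ?k = "%b'. \<t> b' (ev x \<otimes> b)" and ?f = "%b'. pre (u (x, b'))"
 have k: "?k b' : carrier K" if "b' : B" for b' by (rule \<t>_closed[OF that xb])
 have df: "dv a (?f b') : \<C>" "av a \<otimes> dv a (?f b') : \<C>" if "a : arcs Q" "b' : B" for a b'
 using dv_corner(1)[OF that(1) pc[OF x(1) that(2)]] av_corner(1)[OF that(1)] by simp_all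
 have t: "?k b' \<odot> (ev x \<otimes> (av a \<otimes> dv a (?f b'))) : \<C>" if "a : arcs Q" "b' : B" for a b'
 using k[OF that(2)] df[OF that] x by simp
 have "Y a = (\<Oplus>b'\<in>B. ?k b' \<odot> (ev x \<otimes> (av a \<otimes> dv a (?f b'))))" if a: "a : arcs Q" for a
 proof -
 have e: "ev x \<otimes> (av a \<otimes> dv a (?f b')) = (if tail Q a = x then av a \<otimes> dv a (?f b') else \<zero>)" if "b' : B" for b'
 using ev_av[OF x(1) a] C.m_assoc[of "ev x" "av a" "dv a (?f b')"] x av_corner(1)[OF a] df(1)[OF a that] by auto
 show ?thesis
 proof (cases "tail Q a = x")
 case t: True
 have "Y a = av a \<otimes> (\<Oplus>b'\<in>B. ?k b' \<odot> dv a (?f b'))" using a b True t by (simp add: Y_def v_def)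
 also have "... = (\<Oplus>b'\<in>B. av a \<otimes> (?k b' \<odot> dv a (?f b')))"
 by (intro C.finsum_rdistr finite_B av_corner(1)[OF a] Pi_I kC.smult_closed k df(1)[OF a])
 also have "... = (\<Oplus>b'\<in>B. ?k b' \<odot> (ev x \<otimes> (av a \<otimes> dv a (?f b'))))"
 proof (rule C.finsum_cong'[OF refl])
 show "av a \<otimes> (?k b' \<odot> dv a (?f b')) = ?k b' \<odot> (ev x \<otimes> (av a \<otimes> dv a (?f b')))" if "b' : B" for b'
 unfolding e[OF that] if_P[OF t] by (rule kC.smult_mult_right[symmetric, OF k[OF that] av_corner(1)[OF a] df(1)[OF a that]])
 qed (intro Pi_I `!!a b'. [|a : arcs Q; b' : B|] ==> ?k b' \<odot> (ev x \<otimes> (av a \<otimes> dv a (?f b'))) : \<C>` a)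
 finally show ?thesis .
 next
 case False
 have "?k b' \<odot> (ev x \<otimes> (av a \<otimes> dv a (?f b'))) = \<zero>" if "b' : B" for b'
 unfolding e[OF that] if_not_P[OF False] using k[OF that] by (rule kC.smult_r_null)
 hence "(\<Oplus>b'\<in>B. ?k b' \<odot> (ev x \<otimes> (av a \<otimes> dv a (?f b')))) = \<zero>" by (intro C.add.finprod_one_eqI)
 thus ?thesis using False by (simp add: Y_def)
 qed
 qed
 hence "finsum C Y (arcs Q) = (\<Oplus>a\<in>arcs Q. \<Oplus>b'\<in>B. ?k b' \<odot> (ev x \<otimes> (av a \<otimes> dv a (?f b'))))"
 by (intro C.finsum_cong'[OF refl] Pi_I C.finsum_closed t)
 also have "... = (\<Oplus>b'\<in>B. \<Oplus>a\<in>arcs Q. ?k b' \<odot> (ev x \<otimes> (av a \<otimes> dv a (?f b'))))"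
 by (intro C.finsum_swap F1_c(1) finite_B t)
 also have "... = (\<Oplus>b'\<in>B. ?k b' \<odot> u (x, b'))"
 proof (rule C.finsum_cong'[OF refl])
 fix b' assume b': "b' : B"
 have xdf: "ev x \<otimes> (av a \<otimes> dv a (?f b')) : \<C>" if "a : arcs Q" for a using df(2)[OF that b'] x by simp
 have "(\<Oplus>a\<in>arcs Q. ?k b' \<odot> (ev x \<otimes> (av a \<otimes> dv a (?f b')))) =
 ?k b' \<odot> (\<Oplus>a\<in>arcs Q. ev x \<otimes> (av a \<otimes> dv a (?f b')))" by (intro kC.finsum_smult[symmetric] F1_c(1) k b' Pi_I xdf)
 also have "(\<Oplus>a\<in>arcs Q. ev x \<otimes> (av a \<otimes> dv a (?f b'))) = ev x \<otimes> (\<Oplus>a\<in>arcs Q. av a \<otimes> dv a (?f b'))"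
 by (intro C.finsum_rdistr[symmetric] F1_c(1) F0_c(2) x Pi_I df(2) b')
 also have "... = u (x, b')" unfolding expand_rad[OF rad[OF x(1) True Bc[OF b']]] by (rule bimap_target[OF bimapsD[OF u x(1)] Bc[OF b']])
 finally show "(\<Oplus>a\<in>arcs Q. ?k b' \<odot> (ev x \<otimes> (av a \<otimes> dv a (?f b')))) = ?k b' \<odot> u (x, b')" .
 qed (intro Pi_I kC.smult_closed k uc[OF x(1) Bc])
 also have "... = u (x, ev x \<otimes> b)" by (rule frame_expand[OF bimap_klin[OF bimapsD[OF u x(1)]] xb, symmetric])
 also have "... = u (x, b)" by (rule bimap_source[OF bimapsD[OF u x(1)] b])
 finally show ?thesis .
 qed
 thus ?thesis unfolding d using uc[OF x(1) b] by (simp add: a_minus_def C.r_neg)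
 qed
 show "EX v:carrier F1. ALL x:V. n \<le> level x --> (ALL b:\<C>. (u \<oplus>\<^sub>F0 d1 v) (x, b) = \<zero>)"
 by (rule bexI[of _ v]) (use v step in simp_all)
 next
 show "ALL x:V. m \<le> level x --> (ALL b:\<C>. u (x, b) = \<zero>)" using m leD by blast
 show "aug (d1 v) = \<zero>\<^sub>DC" if "v : carrier F1" for v by (rule aug_d1[OF that])
 qed (fact u, fact z)
qed

lemma ev_zeroI:
 assumes c: "c : \<C>" and z: "!!x. x : V ==> ev x \<otimes> c = \<zero>" shows "c = \<zero>"
proof -
 have "(\<Oplus>x\<in>V. ev x) \<otimes> c = (\<Oplus>x\<in>V. ev x \<otimes> c)" by (intro C.finsum_ldistr F0_c(1) c Pi_I F0_c(2))
 also have "... = \<zero>" using z by (intro C.add.finprod_one_eqI)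
 finally show ?thesis using c by (simp add: ev_sum)
qed

lemma dv_relation_outside: "[|r : R; tail Q a ~= rsrc r|] ==> dv a r = \<zero>" by (rule dv_outside[OF R_carrier rsrc(2)])

lemma D2_low:
 assumes v: "bimap (ev (rsrc r)) (ev (rtrg r)) w" and a: "a : arcs Q" and r: "r : R" and b: "b : \<C>" and l: "level (rsrc r) \<le> level (tail Q a)"
 shows "D2 a r w b = dv a r \<otimes> w b" unfolding D2_def by (rule delta_leading[OF a R_carrier[OF r] rsrc(2)[OF r] l bimap_closed[OF v] b])

lemma D2_zero: "[|a : arcs Q; r : R; !!b. b : \<C> ==> w b = \<zero>; b : \<C>|] ==> D2 a r w b = \<zero>"
 unfolding D2_def by (rule delta_zero_fun[OF _ R_carrier])

text \<open>For every \<open>b\<close>, the top layer of a kernel element of \<open>d1\<close> is a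
  kernel element of \<open>g1\<close>. Preimages under \<open>g2\<close>, chosen at the frame
  vectors and extended linearly, give the correction, since \<open>D2\<close> acts on that layer
  through its leading term.\<close>

lemma F1_exact:
 assumes u: "u : carrier F1" and z: "d1 u = \<zero>\<^sub>F0" shows "u : d2 ` carrier F2"
proof -
 obtain m where m: "!!x. x : V ==> level x < m" using level_bounded by blast
 interpret F1: right_module C F1 by (rule F1_module)
 show ?thesis
 proof (rule exact_by_layers[OF F2_module F1_module F0_module d2_hom d1_hom,
 where T = "%n u. ALL a:arcs Q. n \<le> level (tail Q a) --> (ALL b:\<C>. u (a, b) = \<zero>)" and n = m])
 fix u assume "u : carrier F1" "ALL a:arcs Q. 0 \<le> level (tail Q a) --> (ALL b:\<C>. u (a, b) = \<zero>)"
 thus "u = \<zero>\<^sub>F1" using F1.M.zero_closed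
 by (intro bimaps_eqI[of u "arcs Q" "%a. ev (tail Q a)" "%a. ev (head Q a)" "\<zero>\<^sub>F1"]) auto
 next
 fix n u assume "u : carrier F1" and z: "d1 u = \<zero>\<^sub>F0"
 and top: "ALL a:arcs Q. Suc n \<le> level (tail Q a) --> (ALL b:\<C>. u (a, b) = \<zero>)"
 hence u: "u : bimaps (arcs Q) ta ha" by simp
 note uc = bimaps_closed[OF u]
 have Bc: "b : \<C>" if "b : B" for b using that B_sub by blast
 define y where "y b = (\<lambda>a\<in>arcs Q. if level (tail Q a) = n then u (a, b) else \<zero>)" for b
 have y: "y b : carrier G1" if b: "b : \<C>" for b unfolding y_def fun_module_simps
 proof (rule corner_functionsI)
 fix a assume a: "a : arcs Q"
 show "(if level (tail Q a) = n then u (a, b) else \<zero>) : \<C>" using uc[OF a b] by simp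
 show "ev (head Q a) \<otimes> (if level (tail Q a) = n then u (a, b) else \<zero>) = (if level (tail Q a) = n then u (a, b) else \<zero>)"
 using bimap_target[OF bimapsD[OF u a] b] F1_c(4)[OF a] by simp
 qed
 have g1y: "g1 (y b) = \<zero>" if b: "b : \<C>" for b
 proof (rule ev_zeroI)
 show "g1 (y b) : \<C>" using mod_hom_closed[OF g1_hom y[OF b]] by simp
 fix x assume x: "x : V"
 have yc: "y b a : \<C>" if "a : arcs Q" for a using G1_closed[OF y[OF b] that] .
 have "ev x \<otimes> g1 (y b) = ev x \<otimes> (\<Oplus>a\<in>arcs Q. av a \<otimes> y b a)" using y[OF b] by (simp add: g1_def)
 also have "... = (\<Oplus>a\<in>arcs Q. ev x \<otimes> (av a \<otimes> y b a))" by (intro C.finsum_rdistr F1_c(1) F0_c(2) x Pi_I C.m_closed av_corner(1) yc)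
 finally have e: "ev x \<otimes> g1 (y b) = (\<Oplus>a\<in>arcs Q. ev x \<otimes> (av a \<otimes> y b a))" .
 have ex: "ev x \<otimes> (av a \<otimes> c) = (if tail Q a = x then av a \<otimes> c else \<zero>)" if "a : arcs Q" "c : \<C>" for a c
 using ev_av[OF x that(1)] C.m_assoc[of "ev x" "av a" c] x av_corner(1)[OF that(1)] that(2) by auto
 show "ev x \<otimes> g1 (y b) = \<zero>"
 proof (cases "level x = n")
 case False
 have "ev x \<otimes> (av a \<otimes> y b a) = \<zero>" if a: "a : arcs Q" for a
 proof (cases "tail Q a = x")
 case True
 hence "y b a = \<zero>" using False a by (simp add: y_def)
 thus ?thesis using av_corner(1)[OF a] x by simp
 qed (simp add: ex[OF a yc[OF a]])
 thus ?thesis unfolding e by (intro C.add.finprod_one_eqI)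
 next
 case True
 have D: "D1 x a (%b. u (a, b)) b = \<zero> \<ominus> ev x \<otimes> (av a \<otimes> y b a)" if a: "a : arcs Q" for a
 proof -
 have "head Q a = x ==> u (a, av a \<otimes> b) = \<zero>" using level_arr[OF a] True top a b av_corner(1)[OF a] by auto
 hence h: "(if head Q a = x then u (a, av a \<otimes> b) else \<zero>) = \<zero>" by (cases "head Q a = x") simp_all
 have t: "(if tail Q a = x then av a \<otimes> u (a, b) else \<zero>) = (if tail Q a = x then av a \<otimes> y b a else \<zero>)"
 using True a by (cases "tail Q a = x") (simp_all add: y_def)
 show ?thesis unfolding D1_def h t ex[OF a yc[OF a]] ..
 qed
 have xc: "ev x \<otimes> (av a \<otimes> y b a) : \<C>" if "a : arcs Q" for a using x av_corner(1)[OF that] yc[OF that] by simp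
 have "\<zero> = d1 u (x, b)" using x b z by simp
 also have "... = (\<Oplus>a\<in>arcs Q. \<zero> \<ominus> ev x \<otimes> (av a \<otimes> y b a))"
 unfolding d1_apply[OF u x b] by (intro C.finsum_cong'[OF refl] Pi_I C.minus_closed C.zero_closed xc D)
 also have "... = (\<Oplus>a\<in>arcs Q. \<zero>) \<ominus> ev x \<otimes> g1 (y b)" unfolding e by (intro C.finsum_minusf F1_c(1) C.zero_closed xc)
 finally have s: "\<zero> = \<zero> \<ominus> ev x \<otimes> g1 (y b)" by simp
 have g: "ev x \<otimes> g1 (y b) : \<C>" using x mod_hom_closed[OF g1_hom y[OF b]] by simp
 have "ev x \<otimes> g1 (y b) = \<zero> \<ominus> ev x \<otimes> g1 (y b) \<oplus>\<^sub>C ev x \<otimes> g1 (y b)" unfolding s[symmetric] using g by simp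
 also have "... = \<zero>" using g by (simp add: a_minus_def C.l_neg)
 finally show ?thesis .
 qed
 qed
 have ez: "EX z. z : carrier G2 & g2 z = y b" if b: "b : B" for b
 proof -
 obtain x where "y b = g2 x" "x : carrier G2" using G_exact_1[OF y[OF Bc[OF b]] g1y[OF Bc[OF b]]] by (rule imageE)
 thus ?thesis by (intro exI[of _ x] conjI) (assumption, rule sym)
 qed
 have z: "(SOME z. z : carrier G2 & g2 z = y b) : carrier G2 & g2 (SOME z. z : carrier G2 & g2 z = y b) = y b"
 if "b : B" for b by (rule someI_ex[OF ez[OF that]])
 define z where "z b = (SOME z. z : carrier G2 & g2 z = y b)" for b
 have z: "z b : carrier G2" "g2 (z b) = y b" if "b : B" for b using z[OF that] unfolding z_def by blast+
 have zc: "z b r : \<C>" "ev (rtrg r) \<otimes> z b r = z b r" if "b : B" "r : R" for b r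
 using G2_closed[OF z(1)[OF that(1)] that(2)] G2_fixed[OF z(1)[OF that(1)] that(2)] by simp_all
 define s where "s r b = (\<Oplus>b'\<in>B. \<t> b' (ev (rsrc r) \<otimes> b) \<odot> z b' r)" for r b
 define v where "v = pack R (%r b. if level (rsrc r) = n then \<ominus> s r b else \<zero>)"
 have sb: "bimap (ev (rsrc r)) (ev (rtrg r)) (s r)" if r: "r : R" for r
 unfolding s_def by (intro bimap_finsum F2_c(4)[OF r] finite_B \<t>_bimap F2_c(2,3)[OF r] zc r)
 have v: "v : bimaps R sr tr1" unfolding v_def
 proof (rule packI[OF _ F2_c(2)])
 fix r assume r: "r : R"
 show "bimap (ev (rsrc r)) (ev (rtrg r)) (%b. if level (rsrc r) = n then \<ominus> s r b else \<zero>)"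
 using bimap_uminus[OF sb[OF r] F2_c(4)[OF r]] bimap_zero[OF F2_c(4)[OF r]] by (cases "level (rsrc r) = n") simp_all
 qed
 have v0: "v (r, b) = \<zero>" if "r : R" "b : \<C>" "level (rsrc r) ~= n" for r b using that by (simp add: v_def)
 \<comment> \<open>The minus sign in \<open>v\<close> is needed because the leading term of
   \<open>D2\<close> has a plus sign. Arrows starting above layer \<open>n\<close> have zero
   derivative on relations starting in layer \<open>n\<close>.\<close>
 have step: "u (a, b) \<oplus>\<^sub>C d2 v (a, b) = \<zero>" if a: "a : arcs Q" "n \<le> level (tail Q a)" and b: "b : \<C>" for a b
 proof (cases "level (tail Q a) = n")
 case False
 have "D2 a r (%b. v (r, b)) b = \<zero>" if r: "r : R" for r
 proof (cases "level (rsrc r) = n")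
 case True
 have "tail Q a ~= rsrc r" "level (rsrc r) \<le> level (tail Q a)" using True False a(2) by auto
 thus ?thesis using D2_low[OF bimapsD[OF v r] a(1) r b] dv_relation_outside[OF r] bimaps_closed[OF v r b] by simp
 next
 case False
 thus ?thesis by (intro D2_zero[OF a(1) r _ b] v0[OF r])
 qed
 hence "d2 v (a, b) = \<zero>" unfolding d2_apply[OF v a(1) b] by (intro C.add.finprod_one_eqI)
 thus ?thesis using top a b False by simp
 next
 case True
 have tb: "ev (tail Q a) \<otimes> b : \<C>" using F1_c(2)[OF a(1)] b by simp
 let ?k = "%b'. \<t> b' (ev (tail Q a) \<otimes> b)"
 have k: "?k b' : carrier K" if "b' : B" for b' by (rule \<t>_closed[OF that tb])
 have dz: "dv a r \<otimes> z b' r : \<C>" if "b' : B" "r : R" for b' r using dvR[OF a(1) that(2)] zc(1)[OF that] by simp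
 define Y where "Y r = (\<Oplus>b'\<in>B. ?k b' \<odot> (dv a r \<otimes> z b' r))" for r
 have Yc: "Y r : \<C>" if "r : R" for r unfolding Y_def by (intro C.finsum_closed Pi_I kC.smult_closed k dz that)
 have D: "D2 a r (%b. v (r, b)) b = \<zero> \<ominus> Y r" if r: "r : R" for r
 proof (cases "rsrc r = tail Q a")
 case t: True
 have "D2 a r (%b. v (r, b)) b = dv a r \<otimes> v (r, b)" using t by (intro D2_low[OF bimapsD[OF v r] a(1) r b]) simp
 also have "... = \<zero> \<ominus> dv a r \<otimes> s r b" using t True r b dvR[OF a(1) r] bimap_closed[OF sb[OF r] b] by (simp add: v_def C.r_minus a_minus_def)
 also have "dv a r \<otimes> s r b = (\<Oplus>b'\<in>B. dv a r \<otimes> (?k b' \<odot> z b' r))"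
 unfolding s_def t by (intro C.finsum_rdistr finite_B dvR[OF a(1) r] Pi_I kC.smult_closed k zc(1) r)
 also have "... = Y r" unfolding Y_def using k zc(1)[OF _ r] dvR[OF a(1) r] by (intro C.finsum_cong'[OF refl]) (auto simp: kC.smult_mult_right)
 finally show ?thesis .
 next
 case t: False
 have d0: "dv a r = \<zero>" using t by (intro dv_relation_outside r) simp
 have "Y r = \<zero>" unfolding Y_def d0 using k zc(1)[OF _ r] by (intro C.add.finprod_one_eqI) (simp add: kC.smult_r_null)
 moreover have "D2 a r (%b. v (r, b)) b = \<zero>"
 proof (cases "level (rsrc r) = n")
 case l: True
 show ?thesis using D2_low[OF bimapsD[OF v r] a(1) r b] l True d0 bimaps_closed[OF v r b] by simp
 next
 case False thus ?thesis by (intro D2_zero[OF a(1) r _ b] v0[OF r])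
 qed
 ultimately show ?thesis by (simp add: a_minus_def)
 qed
 have "d2 v (a, b) = (\<Oplus>r\<in>R. \<zero> \<ominus> Y r)" unfolding d2_apply[OF v a(1) b] by (intro C.finsum_cong'[OF refl] Pi_I C.minus_closed C.zero_closed Yc D)
 also have "... = (\<Oplus>r\<in>R. \<zero>) \<ominus> finsum C Y R" by (intro C.finsum_minusf finite_R C.zero_closed Yc)
 finally have d: "d2 v (a, b) = \<zero> \<ominus> finsum C Y R" by simp
 have "finsum C Y R = (\<Oplus>b'\<in>B. \<Oplus>r\<in>R. ?k b' \<odot> (dv a r \<otimes> z b' r))"
 unfolding Y_def by (intro C.finsum_swap finite_R finite_B kC.smult_closed k dz)
 also have "... = (\<Oplus>b'\<in>B. ?k b' \<odot> u (a, b'))"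
 proof (rule C.finsum_cong'[OF refl])
 fix b' assume b': "b' : B"
 have "(\<Oplus>r\<in>R. ?k b' \<odot> (dv a r \<otimes> z b' r)) = ?k b' \<odot> (\<Oplus>r\<in>R. dv a r \<otimes> z b' r)"
 by (intro kC.finsum_smult[symmetric] finite_R k b' Pi_I dz)
 also have "(\<Oplus>r\<in>R. dv a r \<otimes> z b' r) = g2 (z b') a" using z(1)[OF b'] a(1) by (simp add: g2_def)
 also have "... = u (a, b')" unfolding z(2)[OF b'] using True a(1) by (simp add: y_def)
 finally show "(\<Oplus>r\<in>R. ?k b' \<odot> (dv a r \<otimes> z b' r)) = ?k b' \<odot> u (a, b')" .
 qed (intro Pi_I kC.smult_closed k uc[OF a(1) Bc])
 also have "... = u (a, ev (tail Q a) \<otimes> b)" by (rule frame_expand[OF bimap_klin[OF bimapsD[OF u a(1)]] tb, symmetric])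
 also have "... = u (a, b)" by (rule bimap_source[OF bimapsD[OF u a(1)] b])
 finally show ?thesis unfolding d using uc[OF a(1) b] by (simp add: a_minus_def C.r_neg)
 qed
 show "EX v:carrier F2. ALL a:arcs Q. n \<le> level (tail Q a) --> (ALL b:\<C>. (u \<oplus>\<^sub>F1 d2 v) (a, b) = \<zero>)"
 by (rule bexI[of _ v]) (use v step in simp_all)
 next
 show "ALL a:arcs Q. m \<le> level (tail Q a) --> (ALL b:\<C>. u (a, b) = \<zero>)" using m[OF Q.tail_in_verts] leD by blast
 show "d1 (d2 v) = \<zero>\<^sub>F0" if "v : carrier F2" for v by (rule d1_d2[OF that])
 qed (fact u, fact z)
qed

text \<open>Descending induction on the level of the starting point: once all higher components
  vanish, \<open>d2\<close> acts on the next layer as \<open>g2\<close>, which is injective by the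
  bound on the global dimension.\<close>

lemma d2_injective:
 assumes gl: "gl_dim_le C 2" and v': "v : carrier F2" and z: "d2 v = \<zero>\<^sub>F1" shows "v = \<zero>\<^sub>F2"
proof -
 have v: "v : bimaps R sr tr1" using v' by simp
 obtain m where m: "!!x. x : V ==> level x < m" using level_bounded by blast
 have "ALL r:R. m \<le> level (rsrc r) + j --> (ALL b:\<C>. v (r, b) = \<zero>)" for j
 proof (induction j)
 case 0
 thus ?case using m[OF rsrc(1)] leD by (metis add.right_neutral)
 next
 case (Suc j)
 show ?case
 proof (intro ballI impI)
 fix r0 b assume r0: "r0 : R" and l0: "m \<le> level (rsrc r0) + Suc j" and b: "b : \<C>"
 show "v (r0, b) = \<zero>"
 proof (cases "m \<le> level (rsrc r0) + j")
 case True thus ?thesis using Suc r0 b by blast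
 next
 case False
 define n where "n = level (rsrc r0)"
 have top: "v (r, b) = \<zero>" if "r : R" "n < level (rsrc r)" "b : \<C>" for r b using Suc that l0 by (auto simp: n_def)
 define y where "y = (\<lambda>r\<in>R. if level (rsrc r) = n then v (r, b) else \<zero>)"
 have y: "y : carrier G2" unfolding y_def fun_module_simps
 proof (rule corner_functionsI)
 fix r assume r: "r : R"
 show "(if level (rsrc r) = n then v (r, b) else \<zero>) : \<C>" using bimaps_closed[OF v r b] by simp
 show "ev (rtrg r) \<otimes> (if level (rsrc r) = n then v (r, b) else \<zero>) = (if level (rsrc r) = n then v (r, b) else \<zero>)"
 using bimap_target[OF bimapsD[OF v r] b] F2_c(4)[OF r] by simp
 qed
 have yc: "y r : \<C>" if "r : R" for r using G2_closed[OF y that] .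
 have "(\<Oplus>r\<in>R. dv a r \<otimes> y r) = \<zero>" if a: "a : arcs Q" for a
 proof (cases "level (tail Q a) = n")
 case False
 have "dv a r \<otimes> y r = \<zero>" if r: "r : R" for r
 proof (cases "tail Q a = rsrc r")
 case True
 hence "y r = \<zero>" using False r by (simp add: y_def)
 thus ?thesis using dvR[OF a r] by simp
 qed (use dv_relation_outside[OF r] yc[OF r] in simp)
 thus ?thesis by (intro C.add.finprod_one_eqI)
 next
 case True
 have "dv a r \<otimes> y r = D2 a r (%b. v (r, b)) b" if r: "r : R" for r
 proof -
 \<comment> \<open>A relation from a lower layer has zero derivative at \<open>a\<close>, and a
   component of \<open>v\<close> from a higher layer vanishes by induction; so only the layer
   \<open>n\<close> itself is seen.\<close>
 consider "level (rsrc r) < n" | "level (rsrc r) = n" | "n < level (rsrc r)" by linarith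
 thus ?thesis
 proof cases
 case 1
 hence t: "tail Q a ~= rsrc r" using True by auto
 show ?thesis using D2_low[OF bimapsD[OF v r] a r b] 1 True dv_relation_outside[OF r t] yc[OF r] bimaps_closed[OF v r b] by simp
 next
 case 2
 thus ?thesis using D2_low[OF bimapsD[OF v r] a r b] True r by (simp add: y_def)
 next
 case 3
 hence "D2 a r (%b. v (r, b)) b = \<zero>" by (intro D2_zero[OF a r _ b] top[OF r])
 moreover have "y r = \<zero>" using 3 r by (simp add: y_def)
 ultimately show ?thesis using dvR[OF a r] by simp
 qed
 qed
 hence "(\<Oplus>r\<in>R. dv a r \<otimes> y r) = (\<Oplus>r\<in>R. D2 a r (%b. v (r, b)) b)"
 by (intro C.finsum_cong'[OF refl] Pi_I D2_closed[OF v a _ b])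
 also have "... = \<zero>" using z a b d2_apply[OF v a b] by simp
 finally show ?thesis .
 qed
 hence "g2 y = \<zero>\<^sub>G1" using y by (auto simp: g2_def fun_eq_iff)
 hence "y = \<zero>\<^sub>G2" by (rule g2_injective[OF gl y])
 hence "y r0 = \<zero>" using r0 by simp
 thus ?thesis using r0 by (simp add: y_def n_def)
 qed
 qed
 qed
 from this[of m] have "v (r, b) = \<zero>" if "r : R" "b : \<C>" for r b using that by simp
 moreover interpret F2: right_module C F2 by (rule F2_module)
 have "\<zero>\<^sub>F2 : bimaps R sr tr1" using F2.M.zero_closed by simp
 ultimately show ?thesis by (intro bimaps_eqI[OF v]) simp_all
qed

text \<open>Moving the right multiplication by \<open>c\<close> around the trace turns the
  precomposition into the argument \<open>d c\<close> of the functional.\<close>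

lemma aug_lft:
 assumes "u : carrier F0" and c: "c : \<C>" shows "aug (l0 c u) = dual_left_action C c (aug u)"
proof -
 have u: "u : bimaps V ev ev" using assms(1) by simp
 have lu: "l0 c u : bimaps V ev ev" using mod_hom_closed[OF l0_hom[OF c] assms(1)] by simp
 let ?W = "%b. \<Oplus>x\<in>V. u (x, b)"
 note W = total_klin[OF u]
 have "aug (l0 c u) d = aug u (d \<otimes> c)" if d: "d : \<C>" for d
 proof -
 have "aug (l0 c u) d = tr (%b. ?W (b \<otimes> c) \<otimes> d)" unfolding aug_apply[OF lu d]
 proof (rule tr_cong)
 fix b assume b: "b : \<C>"
 have bc: "b \<otimes> c : \<C>" using b c by simp
 have "(\<Oplus>x\<in>V. l0 c u (x, b)) = ?W (b \<otimes> c)" by (intro C.finsum_cong'[OF refl] Pi_I bimaps_closed[OF u] bc l0_apply[OF u _ b])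
 thus "(\<Oplus>x\<in>V. l0 c u (x, b)) \<otimes> d = ?W (b \<otimes> c) \<otimes> d" by simp
 show "?W (b \<otimes> c) \<otimes> d : \<C>" using bimap_closed[OF W bc] d by simp
 qed
 also have "... = tr (%b. ?W b \<otimes> d \<otimes> c)" by (rule tr_comm[OF bimap_right[OF W d C.one_closed] klin_right[OF c]])
 also have "... = tr (%b. ?W b \<otimes> (d \<otimes> c))" by (rule tr_cong) (use bimap_closed[OF W] c d in \<open>simp_all add: C.m_assoc\<close>)
 finally show ?thesis using aug_apply[OF u, of "d \<otimes> c"] c d by simp
 qed
 moreover have "aug (l0 c u) : extensional \<C>" using lu by (simp add: aug_def)
 ultimately show ?thesis unfolding dual_left_action_def by (intro extensionalityI[of _ "\<C>"]) auto
qed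

lemma F_exact: "exact_three C DC F0 F1 F2 aug d1 d2" unfolding exact_three_def three_term_def
 by (intro conjI ballI impI right_module_dual F0_module F1_module F2_module aug_hom d1_hom d2_hom aug_d1 d1_d2
 aug_surj F0_exact F1_exact)
end
section \<open>Trivial extensions\<close>

context split_nil_algebra
begin
interpretation K: field K by (rule kalgebraD(1)[OF kalgebra])
interpretation R: ring A by (rule kalgebraD(2)[OF kalgebra])
interpretation A: kalgebra K A by (rule kalgebra)

text \<open>Next to \<open>n\<close>, the factor \<open>a\<close> may be replaced by
  \<open>a e s\<close>, which differs from the scalar \<open>\<k> s a\<close> times
  \<open>e s\<close> by an element of \<open>N\<close>; likewise for \<open>b\<close>. All errors
  lie in the square of \<open>N\<close>.\<close>

lemma mult_between:
 assumes n: "n : N" and s: "s : V" "e s \<otimes> n = n" and t: "t : V" "n \<otimes> e t = n" and a: "a : carrier A" and b: "b : carrier A"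
 obtains z where "z : N2" "a \<otimes> n \<otimes> b = (\<k> s a \<otimes>\<^sub>K \<k> t b) \<odot> n \<oplus> z"
proof -
 note nc = N_carrier[OF n] and es = e_closed[OF s(1)] and et = e_closed[OF t(1)]
 have k: "\<k> s a : carrier K" "\<k> t b : carrier K" using \<k>_closed s t a b by auto
 define a' where "a' = a \<otimes> e s \<ominus> \<k> s a \<odot> e s"
 define b' where "b' = e t \<otimes> b \<ominus> \<k> t b \<odot> e t"
 have cl: "a \<otimes> e s : carrier A" "\<k> s a \<odot> e s : carrier A" "e t \<otimes> b : carrier A" "\<k> t b \<odot> e t : carrier A"
 using a b es et k by simp_all
 have a': "a' : N" and b': "b' : N" using cl k a b es et s t \<k>_closed
 by (auto simp: N_def a'_def b'_def a_minus_def \<k>_add \<k>_neg \<k>_mult \<k>_smult \<k>_e K.r_neg)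
 have ae: "a \<otimes> e s = \<k> s a \<odot> e s \<oplus> a'" and be: "e t \<otimes> b = \<k> t b \<odot> e t \<oplus> b'"
 using cl by (simp_all add: a'_def b'_def a_minus_def R.a_ac R.r_neg2 R.r_neg1 R.add.m_lcomm R.r_neg)
 have "a \<otimes> n = a \<otimes> e s \<otimes> n" using s a es nc by (simp add: R.m_assoc)
 also have "... = \<k> s a \<odot> n \<oplus> a' \<otimes> n"
 unfolding ae using cl N_carrier[OF a'] nc k es s by (simp add: R.l_distr A.smult_mult_left[symmetric])
 finally have an: "a \<otimes> n = \<k> s a \<odot> n \<oplus> a' \<otimes> n" .
 have "n \<otimes> b = n \<otimes> (e t \<otimes> b)" using t b et nc by (simp add: R.m_assoc[symmetric])
 also have "... = \<k> t b \<odot> n \<oplus> n \<otimes> b'"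
 unfolding be using cl N_carrier[OF b'] nc k et t by (simp add: R.r_distr A.smult_mult_right[symmetric])
 finally have nb: "n \<otimes> b = \<k> t b \<odot> n \<oplus> n \<otimes> b'" .
 define z where "z = \<k> s a \<odot> (n \<otimes> b') \<oplus> a' \<otimes> n \<otimes> b"
 have "z : N2" unfolding z_def by (intro N2_sum N2_smult N2_mult_right N2_prod n a' b' k b)
 moreover have "a \<otimes> n \<otimes> b = \<k> s a \<odot> (n \<otimes> b) \<oplus> a' \<otimes> n \<otimes> b"
 unfolding an using nc N_carrier[OF a'] b k by (simp add: R.l_distr A.smult_mult_left)
 hence "a \<otimes> n \<otimes> b = (\<k> s a \<otimes>\<^sub>K \<k> t b) \<odot> n \<oplus> z"
 unfolding nb z_def using nc N_carrier[OF a'] N_carrier[OF b'] b k by (simp add: A.smult_r_distr A.smult_assoc1 R.a_assoc)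
 ultimately show thesis by (rule that)
qed

text \<open>Spanning modulo the square is deduced from generation as an ideal: by
  \<open>mult_between\<close>, each product \<open>a n i b\<close> is a scalar multiple of
  \<open>n i\<close> up to the square. Generation enters as an induction rule, which avoids explicit
  sums of products.\<close>

lemma dim_arrow_space_generated:
 assumes S: "finite S" and n: "!!i. i : S ==> n i : N" and src: "!!i. i : S ==> src i : V" "!!i. i : S ==> e (src i) \<otimes> n i = n i"
 and trg: "!!i. i : S ==> trg i : V" "!!i. i : S ==> n i \<otimes> e (trg i) = n i"
 and \<chi>: "!!i a. [|i : S; a : N|] ==> \<chi> i a : carrier K"
 and \<chi>_add: "!!i a b. [|i : S; a : N; b : N|] ==> \<chi> i (a \<oplus> b) = \<chi> i a \<oplus>\<^sub>K \<chi> i b"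
 and \<chi>_smult: "!!i c a. [|i : S; c : carrier K; a : N|] ==> \<chi> i (c \<odot> a) = c \<otimes>\<^sub>K \<chi> i a"
 and \<chi>_prod: "!!i a b. [|i : S; a : N; b : N|] ==> \<chi> i (a \<otimes> b) = \<zero>\<^sub>K"
 and \<chi>_n: "!!i j. [|i : S; j : S|] ==> \<chi> i (n j) = (if i = j then \<one>\<^sub>K else \<zero>\<^sub>K)"
 and gen: "!!a P. [|a : N; P \<zero>;
 !!i a b. [|i : S; a : carrier A; b : carrier A|] ==> P (a \<otimes> n i \<otimes> b);
 !!a b. [|a : N; b : N; P a; P b|] ==> P (a \<oplus> b)|] ==> P a" and xy: "x : V" "y : V"
 shows "vectorspace.dim K (arrow_space A (e x) (e y)) = card {i : S. src i = x & trg i = y}"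
proof (rule dim_arrow_space[OF S n src trg \<chi> \<chi>_add \<chi>_smult \<chi>_prod \<chi>_n _ xy])
 let ?s = "%a. \<Oplus>i\<in>S. \<chi> i a \<odot> n i"
 have nc: "n i : carrier A" if "i : S" for i using N_carrier[OF n[OF that]] .
 have t: "\<chi> i a \<odot> n i : carrier A" if "i : S" "a : N" for i a using \<chi>[OF that] nc[OF that(1)] by simp
 have sc: "?s a : carrier A" if "a : N" for a by (intro R.finsum_closed Pi_I t that)
 have \<chi>N2: "\<chi> i a = \<zero>\<^sub>K" if "a : N2" "i : S" for i a
 using that by (induction rule: N2_induct) (auto simp: \<chi>_prod \<chi>_add N2_N)
 have s_add: "?s (a \<oplus> b) = ?s a \<oplus> ?s b" if "a : N" "b : N" for a b
 proof -
 have "?s (a \<oplus> b) = (\<Oplus>i\<in>S. \<chi> i a \<odot> n i \<oplus> \<chi> i b \<odot> n i)"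
 using t that \<chi> nc by (intro R.finsum_cong'[OF refl]) (simp_all add: \<chi>_add A.smult_l_distr)
 also have "... = ?s a \<oplus> ?s b" using that by (intro R.finsum_addf Pi_I t)
 finally show ?thesis .
 qed
 have s_N2: "?s a = \<zero>" if "a : N2" for a using \<chi>N2[OF that] nc by (intro R.add.finprod_one_eqI) (simp add: A.lmult_0)
 have comb: "(a \<oplus> b) \<ominus> ?s (a \<oplus> b) : N2" if "a : N" "b : N" "a \<ominus> ?s a : N2" "b \<ominus> ?s b : N2" for a b
 using N2_sum[OF that(3,4)] sc[OF that(1)] sc[OF that(2)] N_carrier[OF that(1)] N_carrier[OF that(2)] by (simp add: s_add[OF that(1,2)] R.add_minus_add)
 have N2P: "a \<ominus> ?s a : N2" if "a : N2" for a using that N_carrier[OF N2_N[OF that]] by (simp add: s_N2 a_minus_def)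
 show "a \<ominus> ?s a : N2" if "a : N" for a
 proof (rule gen[OF that])
 show "\<zero> \<ominus> ?s \<zero> : N2" by (rule N2P[OF N2_zero])
 fix i a b assume i: "i : S" and a: "a : carrier A" and b: "b : carrier A"
 obtain z where z: "z : N2" "a \<otimes> n i \<otimes> b = (\<k> (src i) a \<otimes>\<^sub>K \<k> (trg i) b) \<odot> n i \<oplus> z"
 using mult_between[OF n[OF i] src[OF i] trg[OF i] a b] by blast
 define k where "k = \<k> (src i) a \<otimes>\<^sub>K \<k> (trg i) b"
 have k: "k : carrier K" using \<k>_closed src(1)[OF i] trg(1)[OF i] a b by (simp add: k_def)
 have kn: "k \<odot> n i : N" by (rule N_smult[OF k n[OF i]])
 have "?s (k \<odot> n i) = (\<Oplus>j\<in>S. if i = j then k \<odot> n j else \<zero>)"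
 using k nc i n by (intro R.finsum_cong'[OF refl]) (auto simp: \<chi>_smult \<chi>_n A.lmult_0)
 also have "... = k \<odot> n i" using i S k nc by (intro R.finsum_singleton) auto
 finally have "k \<odot> n i \<ominus> ?s (k \<odot> n i) : N2" using N_carrier[OF kn] N2_zero by (simp add: a_minus_def R.r_neg)
 thus "a \<otimes> n i \<otimes> b \<ominus> ?s (a \<otimes> n i \<otimes> b) : N2"
 unfolding z(2) k_def[symmetric] by (rule comb[OF kn N2_N[OF z(1)] _ N2P[OF z(1)]])
 qed (rule comb)
qed
end

lemma fin_dimI:
 assumes V: "vectorspace K V" and T: "finite T" "T \<subseteq> carrier V"
 and gen: "!!v P. [|v : carrier V; P \<zero>\<^sub>V; !!k t. [|k : carrier K; t : T|] ==> P (k \<odot>\<^sub>V t);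
 !!v w. [|v : carrier V; w : carrier V; P v; P w|] ==> P (v \<oplus>\<^sub>V w)|] ==> P v" shows "vectorspace.fin_dim K V"
proof -
 interpret V: vectorspace K V by fact
 interpret S: submodule K "LinearCombinations.module.span K V T" V by (rule V.span_is_submodule[OF T(2)])
 have "v : V.span T" if "v : carrier V" for v
 proof (rule gen[OF that])
 show "k \<odot>\<^sub>V t : V.span T" if "k : carrier K" "t : T" for k t using S.smult_closed that V.in_own_span[OF T(2)] by blast
 show "v \<oplus>\<^sub>V w : V.span T" if "v : V.span T" "w : V.span T" for v w using S.m_closed that by blast
 qed (rule S.zero_closed)
 thus ?thesis unfolding V.fin_dim_def using T V.span_is_subset2[OF T(2)] by (intro exI[of _ T]) auto
qed

lemma module_pointwise:
 fixes K :: "'k ring" and C :: "('k, 'c) module" and W :: "('k, 'x => 'c) module"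
 assumes C: "module K C" and sub: "carrier W \<subseteq> D \<rightarrow>\<^sub>E carrier C"
 and zero: "\<zero>\<^sub>W = (\<lambda>x\<in>D. \<zero>\<^sub>C)"
 and add: "!!f g. f \<oplus>\<^sub>W g = (\<lambda>x\<in>D. f x \<oplus>\<^sub>C g x)"
 and smult: "!!a f. [|a : carrier K; f : carrier W|] ==> a \<odot>\<^sub>W f = (\<lambda>x\<in>D. a \<odot>\<^sub>C f x)"
 and zero_mem: "\<zero>\<^sub>W : carrier W"
 and add_mem: "!!f g. [|f : carrier W; g : carrier W|] ==> f \<oplus>\<^sub>W g : carrier W"
 and smult_mem: "!!a f. [|a : carrier K; f : carrier W|] ==> a \<odot>\<^sub>W f : carrier W" shows "module K W"
proof -
 interpret C: module K C by fact
 have v: "f x : carrier C" if "f : carrier W" "x : D" for f x using that sub by blast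
 have eq: "f = g" if "f : carrier W" "g : carrier W" "!!x. x : D ==> f x = g x" for f g using that sub by (meson PiE_ext subsetD)
 have A: "(f \<oplus>\<^sub>W g) x = f x \<oplus>\<^sub>C g x" if "x : D" for f g x using that by (simp add: add)
 have M: "(a \<odot>\<^sub>W f) x = a \<odot>\<^sub>C f x" if "a : carrier K" "f : carrier W" "x : D" for a f x using that by (simp add: smult)
 have Z: "\<zero>\<^sub>W x = \<zero>\<^sub>C" if "x : D" for x using that by (simp add: zero)
 show ?thesis
 proof (rule moduleI)
 show "cring K" by (rule C.R.is_cring)
 show "abelian_group W"
 proof (rule abelian_groupI)
 fix f assume f: "f : carrier W"
 have n: "(\<ominus>\<^sub>K \<one>\<^sub>K) \<odot>\<^sub>W f : carrier W" using f by (intro smult_mem) auto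
 have "(\<ominus>\<^sub>K \<one>\<^sub>K) \<odot>\<^sub>W f \<oplus>\<^sub>W f = \<zero>\<^sub>W"
 by (rule eq[OF add_mem[OF n f] zero_mem]) (use f v in \<open>simp add: A M Z C.smult_l_minus C.smult_one C.M.l_neg\<close>)
 thus "EX g:carrier W. g \<oplus>\<^sub>W f = \<zero>\<^sub>W" using n by blast
 show "\<zero>\<^sub>W \<oplus>\<^sub>W f = f" by (rule eq[OF add_mem[OF zero_mem f] f]) (use f v in \<open>simp add: A Z\<close>)
 fix g assume g: "g : carrier W"
 show "f \<oplus>\<^sub>W g = g \<oplus>\<^sub>W f" by (rule eq[OF add_mem[OF f g] add_mem[OF g f]]) (use f g v in \<open>simp add: A C.M.a_comm\<close>)
 fix h assume h: "h : carrier W"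
 show "f \<oplus>\<^sub>W g \<oplus>\<^sub>W h = f \<oplus>\<^sub>W (g \<oplus>\<^sub>W h)"
 by (rule eq[OF add_mem[OF add_mem[OF f g] h] add_mem[OF f add_mem[OF g h]]]) (use f g h v in \<open>simp add: A C.M.a_assoc\<close>)
 qed (fact zero_mem add_mem)+
 fix a f assume a: "a : carrier K" and f: "f : carrier W"
 show "a \<odot>\<^sub>W f : carrier W" by (rule smult_mem[OF a f])
 show "a \<odot>\<^sub>W (f \<oplus>\<^sub>W g) = a \<odot>\<^sub>W f \<oplus>\<^sub>W a \<odot>\<^sub>W g" if g: "g : carrier W" for g
 by (rule eq[OF smult_mem[OF a add_mem[OF f g]] add_mem[OF smult_mem[OF a f] smult_mem[OF a g]]])
 (use a f g v in \<open>simp add: A M add_mem C.smult_r_distr\<close>)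
 fix b assume b: "b : carrier K"
 have ab: "a \<oplus>\<^sub>K b : carrier K" "a \<otimes>\<^sub>K b : carrier K" using a b by simp_all
 show "(a \<oplus>\<^sub>K b) \<odot>\<^sub>W f = a \<odot>\<^sub>W f \<oplus>\<^sub>W b \<odot>\<^sub>W f"
 by (rule eq[OF smult_mem[OF ab(1) f] add_mem[OF smult_mem[OF a f] smult_mem[OF b f]]])
 (use a b f v in \<open>simp add: A M C.smult_l_distr\<close>)
 show "(a \<otimes>\<^sub>K b) \<odot>\<^sub>W f = a \<odot>\<^sub>W (b \<odot>\<^sub>W f)"
 by (rule eq[OF smult_mem[OF ab(2) f] smult_mem[OF a smult_mem[OF b f]]])
 (use a b f v in \<open>simp add: M smult_mem C.smult_assoc1\<close>)
 next
 show "\<one>\<^sub>K \<odot>\<^sub>W f = f" if f: "f : carrier W" for f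
 by (rule eq[OF smult_mem[OF _ f] f]) (use f v in \<open>simp_all add: M\<close>)
 qed
qed

section \<open>Trivial extensions by a bimodule\<close>

locale bimodule_algebra =
 fixes K :: "'k ring" and C :: "('k, 'c) module" and E :: "('k, 'e) module" and lact :: "'c => 'e => 'e" and ract :: "'e => 'c => 'e"
 assumes kalgebra_C: "kalgebra K C" and module_E: "module K E" and lact_closed: "[|c : carrier C; m : carrier E|] ==> lact c m : carrier E"
 and ract_closed: "[|c : carrier C; m : carrier E|] ==> ract m c : carrier E"
 and lact_add: "[|c : carrier C; m : carrier E; m' : carrier E|] ==> lact c (m \<oplus>\<^sub>E m') = lact c m \<oplus>\<^sub>E lact c m'"
 and ract_add: "[|c : carrier C; m : carrier E; m' : carrier E|] ==> ract (m \<oplus>\<^sub>E m') c = ract m c \<oplus>\<^sub>E ract m' c"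
 and add_lact: "[|c : carrier C; d : carrier C; m : carrier E|] ==> lact (c \<oplus>\<^sub>C d) m = lact c m \<oplus>\<^sub>E lact d m"
 and add_ract: "[|c : carrier C; d : carrier C; m : carrier E|] ==> ract m (c \<oplus>\<^sub>C d) = ract m c \<oplus>\<^sub>E ract m d"
 and lact_mult: "[|c : carrier C; d : carrier C; m : carrier E|] ==> lact (c \<otimes>\<^sub>C d) m = lact c (lact d m)"
 and ract_mult: "[|c : carrier C; d : carrier C; m : carrier E|] ==> ract m (c \<otimes>\<^sub>C d) = ract (ract m c) d"
 and lact_ract: "[|c : carrier C; d : carrier C; m : carrier E|] ==> lact c (ract m d) = ract (lact c m) d"
 and lact_one: "m : carrier E ==> lact \<one>\<^sub>C m = m" and ract_one: "m : carrier E ==> ract m \<one>\<^sub>C = m"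
 and lact_smult: "[|k : carrier K; c : carrier C; m : carrier E|] ==> lact c (k \<odot>\<^sub>E m) = k \<odot>\<^sub>E lact c m"
 and smult_lact: "[|k : carrier K; c : carrier C; m : carrier E|] ==> lact (k \<odot>\<^sub>C c) m = k \<odot>\<^sub>E lact c m"
 and ract_smult: "[|k : carrier K; c : carrier C; m : carrier E|] ==> ract (k \<odot>\<^sub>E m) c = k \<odot>\<^sub>E ract m c"
 and smult_ract: "[|k : carrier K; c : carrier C; m : carrier E|] ==> ract m (k \<odot>\<^sub>C c) = k \<odot>\<^sub>E ract m c"
begin
interpretation C: ring C by (rule kalgebraD(2)[OF kalgebra_C])
interpretation kC: kalgebra K C by (rule kalgebra_C)
interpretation E: module K E by (rule module_E)
abbreviation "TE == trivial_extension C E lact ract"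

lemma TE_simps: "carrier TE = carrier C \<times> carrier E" "\<one>\<^sub>TE = (\<one>\<^sub>C, \<zero>\<^sub>E)" "\<zero>\<^sub>TE = (\<zero>\<^sub>C, \<zero>\<^sub>E)"
 "(c, m) \<otimes>\<^sub>TE (c', m') = (c \<otimes>\<^sub>C c', lact c m' \<oplus>\<^sub>E ract m c')"
 "(c, m) \<oplus>\<^sub>TE (c', m') = (c \<oplus>\<^sub>C c', m \<oplus>\<^sub>E m')" "k \<odot>\<^sub>TE (c, m) = (k \<odot>\<^sub>C c, k \<odot>\<^sub>E m)"
 by (simp_all add: trivial_extension_def)

lemma lact_zero: "c : carrier C ==> lact c \<zero>\<^sub>E = \<zero>\<^sub>E"
 using lact_add[of c "\<zero>\<^sub>E" "\<zero>\<^sub>E"] lact_closed[of c "\<zero>\<^sub>E"] by (simp add: E.M.add.l_cancel_one')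
lemma ract_zero: "c : carrier C ==> ract \<zero>\<^sub>E c = \<zero>\<^sub>E"
 using ract_add[of c "\<zero>\<^sub>E" "\<zero>\<^sub>E"] ract_closed[of c "\<zero>\<^sub>E"] by (simp add: E.M.add.l_cancel_one')
lemma zero_lact: "m : carrier E ==> lact \<zero>\<^sub>C m = \<zero>\<^sub>E"
 using add_lact[of "\<zero>\<^sub>C" "\<zero>\<^sub>C" m] lact_closed[of "\<zero>\<^sub>C" m] by (simp add: E.M.add.l_cancel_one')
lemma zero_ract: "m : carrier E ==> ract m \<zero>\<^sub>C = \<zero>\<^sub>E"
 using add_ract[of "\<zero>\<^sub>C" "\<zero>\<^sub>C" m] ract_closed[of "\<zero>\<^sub>C" m] by (simp add: E.M.add.l_cancel_one')

lemma kalgebra_TE: "kalgebra K TE"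
proof -
 note cl = lact_closed ract_closed
 have ag: "abelian_group TE"
 proof (rule abelian_groupI)
 fix x assume x: "x : carrier TE"
 thus "EX y:carrier TE. y \<oplus>\<^sub>TE x = \<zero>\<^sub>TE"
 by (intro bexI[of _ "(\<ominus>\<^sub>C fst x, \<ominus>\<^sub>E snd x)"]) (auto simp: TE_simps C.l_neg E.M.l_neg)
 qed (auto simp: TE_simps C.a_ac E.M.a_ac)
 have "monoid TE" by (rule monoidI) (auto simp: TE_simps cl lact_one ract_one lact_zero ract_zero C.m_assoc
 lact_add ract_add lact_mult ract_mult lact_ract E.M.a_assoc)
 hence rg: "ring TE" by (intro ringI ag) (auto simp: TE_simps cl C.l_distr C.r_distr lact_add ract_add add_lact add_ract E.M.a_ac)
 have "module K TE" by (rule moduleI[OF module.axioms(1)[OF module_E] ag]) (auto simp: TE_simps kC.smult_l_distr E.smult_l_distr kC.smult_r_distr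
 E.smult_r_distr kC.smult_assoc1 E.smult_assoc1)
 hence "vectorspace K TE" by (intro vectorspace.intro kC.field_axioms)
 thus ?thesis by (intro kalgebra.intro rg kalgebra_axioms.intro)
 (auto simp: TE_simps cl kC.smult_mult_left[symmetric] kC.smult_mult_right[symmetric] smult_lact smult_ract lact_smult ract_smult E.smult_r_distr)
qed

lemma TE_finsum:
 "[|finite S; !!i. i : S ==> f i : carrier C|] ==> finsum TE (%i. (f i, \<zero>\<^sub>E)) S = (finsum C f S, \<zero>\<^sub>E)"
proof (induction S rule: finite_induct)
 interpret T: ring TE by (rule kalgebraD(2)[OF kalgebra_TE])
 case empty thus ?case by (simp add: TE_simps)
next
 interpret T: ring TE by (rule kalgebraD(2)[OF kalgebra_TE])
 case (insert i S)
 hence "(f i, \<zero>\<^sub>E) : carrier TE" "(%i. (f i, \<zero>\<^sub>E)) : S \<rightarrow> carrier TE" "f i : carrier C" "f : S \<rightarrow> carrier C"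
 by (auto simp: TE_simps)
 thus ?case using insert by (simp add: TE_simps)
qed

text \<open>The \<open>k\<close>-th power of \<open>(c, m)\<close> has first component zero, and the
  product of two such elements is zero, so the exponent \<open>k + k\<close> suffices.\<close>

lemma nil_TE:
 assumes "(c, m) : carrier TE" "c [^]\<^bsub>C\<^esub> (k::nat) = \<zero>\<^sub>C"
 shows "\<exists>k::nat. (c, m) [^]\<^bsub>TE\<^esub> k = \<zero>\<^sub>TE"
proof -
 interpret T: ring TE by (rule kalgebraD(2)[OF kalgebra_TE])
 have "\<exists>m'\<in>carrier E. (c, m) [^]\<^bsub>TE\<^esub> k = (c [^]\<^bsub>C\<^esub> k, m')" for k :: nat
 proof (induction k)
 case 0
 have "(c, m) [^]\<^bsub>TE\<^esub> (0::nat) = (\<one>\<^sub>C, \<zero>\<^sub>E)" using T.nat_pow_0[of "(c, m)"] by (simp only: TE_simps)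
 thus ?case by auto
 next
 case (Suc k)
 then obtain m' where "m' : carrier E" "(c, m) [^]\<^bsub>TE\<^esub> k = (c [^]\<^bsub>C\<^esub> k, m')" by blast
 thus ?case using assms(1) T.nat_pow_Suc[of "(c, m)" k] by (auto simp: TE_simps lact_closed ract_closed)
 qed
 then obtain m' where m': "m' : carrier E" "(c, m) [^]\<^bsub>TE\<^esub> k = (\<zero>\<^sub>C, m')" using assms(2) by metis
 have "(c, m) [^]\<^bsub>TE\<^esub> (k + k) = (\<zero>\<^sub>C, m') \<otimes>\<^sub>TE (\<zero>\<^sub>C, m')"
 using T.nat_pow_mult[OF assms(1), of k k] m'(2) by simp
 also have "... = \<zero>\<^sub>TE" using m'(1) by (simp add: TE_simps zero_lact zero_ract)
 finally show ?thesis by blast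
qed
end
section \<open>The second extension group\<close>

text \<open>The maps \<open>\<a>\<close> and \<open>\<b>\<close> compare the concrete complex with
  the given resolution in both directions over the identity of \<open>DC\<close>. They make Ext
  computed from \<open>P\<close> accessible through homomorphisms out of \<open>F2\<close>.\<close>

locale relation_extension_frame = bound_quiver_frame K Q I R C \<pi> B \<t> for K :: "'k ring" and Q :: "('v, 'a) pre_digraph" and I R :: "(('v, 'a) path => 'k) set"
 and C :: "('k, 'c) module" (structure) and \<pi> :: "(('v, 'a) path => 'k) => 'c" and B :: "'c set" and \<t> :: "'c => 'c => 'k" +
 fixes P :: "('c, 'p, 'c => 'k) resolution" and \<a>0 :: "('v \<times> 'c => 'c) => 'p" and \<a>1 :: "('a \<times> 'c => 'c) => 'p"
 and \<a>2 :: "((('v, 'a) path => 'k) \<times> 'c => 'c) => 'p" and \<b>0 :: "'p => 'v \<times> 'c => 'c" and \<b>1 :: "'p => 'a \<times> 'c => 'c"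
 and \<b>2 :: "'p => (('v, 'a) path => 'k) \<times> 'c => 'c"
 assumes gl: "gl_dim_le C 2" and P: "projective_resolution C DC P"
 and \<a>: "\<a>0 : mod_hom_set C F0 (terms P 0)" "\<a>1 : mod_hom_set C F1 (terms P 1)" "\<a>2 : mod_hom_set C F2 (terms P 2)"
 and \<a>_aug: "x : carrier F0 ==> augmentation P (\<a>0 x) = aug x" and \<a>_d1: "u : carrier F1 ==> boundary P 0 (\<a>1 u) = \<a>0 (d1 u)"
 and \<a>_d2: "v : carrier F2 ==> boundary P 1 (\<a>2 v) = \<a>1 (d2 v)"
 and \<b>: "\<b>0 : mod_hom_set C (terms P 0) F0" "\<b>1 : mod_hom_set C (terms P 1) F1" "\<b>2 : mod_hom_set C (terms P 2) F2"
 and \<b>_aug: "p : carrier (terms P 0) ==> aug (\<b>0 p) = augmentation P p"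
 and \<b>_d1: "p : carrier (terms P 1) ==> d1 (\<b>1 p) = \<b>0 (boundary P 0 p)"
 and \<b>_d2: "p : carrier (terms P 2) ==> d2 (\<b>2 p) = \<b>1 (boundary P 1 p)"
begin
interpretation K: field K by (rule field_K)
interpretation Q: fin_digraph Q by (rule fin_Q)
interpretation A: ring "path_algebra K Q" by (rule ring_A)
interpretation C: ring C by (rule kalgebraD(2)[OF kalgebra_C])
interpretation kC: kalgebra K C by (rule kalgebra_C)
abbreviation "T == terms P"
abbreviation "bd == boundary P"
abbreviation "Z == cocycles C P 2 G0"
abbreviation "HZ == (hom_space C (T 2) G0)\<lparr>carrier := Z\<rparr>"
abbreviation "Bd == coboundaries C P 2 G0"
abbreviation "E == Ext C P 2 G0"
abbreviation "Hom2 == mod_hom_set C F2 G0"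

lemma G0_module: "right_module C G0" by (rule right_module_regular[OF C.ring_axioms])
lemma T_module: "right_module C (T n)" by (rule projective_resolution_terms(2)[OF P])
lemma bd1: "bd 1 : mod_hom_set C (T 2) (T 1)" and bd2: "bd 2 : mod_hom_set C (T 3) (T 2)" and bd0: "bd 0 : mod_hom_set C (T 1) (T 0)"
 using projective_resolution_terms(3)[OF P, of 0] projective_resolution_terms(3)[OF P, of 1] projective_resolution_terms(3)[OF P, of 2]
 by (simp_all add: numeral_2_eq_2 numeral_3_eq_3)

lemma bd2_image: "bd 2 ` carrier (T 3) = {p : carrier (T 2). bd 1 p = \<zero>\<^bsub>T 1\<^esub>}"
 using P unfolding projective_resolution_def by (simp add: numeral_2_eq_2 numeral_3_eq_3)

lemma bd1_bd2: "y : carrier (T 3) ==> bd 1 (bd 2 y) = \<zero>\<^bsub>T 1\<^esub>" using bd2_image by blast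

lemma hom_closed: "[|f : mod_hom_set C M G0; m : carrier M|] ==> f m : \<C>" using mod_hom_closed[of f C M G0 m] by simp

lemma hom_add: "[|f : mod_hom_set C M G0; m : carrier M; m' : carrier M|] ==> f (m \<oplus>\<^sub>M m') = f m \<oplus>\<^sub>C f m'"
 using mod_hom_add[of f C M G0 m m'] by simp

lemma hom_act: "[|f : mod_hom_set C M G0; c : \<C>; m : carrier M|] ==> f (c \<odot>\<^sub>M m) = f m \<otimes> c"
 using mod_hom_act[of f C M G0 c m] by simp

lemma hom_zero: "[|right_module C M; f : mod_hom_set C M G0|] ==> f \<zero>\<^sub>M = \<zero>" using mod_hom_zero[OF _ G0_module, of M f] by simp

lemma hom_compose: "[|right_module C M; f : mod_hom_set C M N; g : mod_hom_set C N L|] ==> compose (carrier M) g f : mod_hom_set C M L"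
 by (rule mod_hom_compose)

lemma hom_plus:
 assumes M: "right_module C M" and f: "f : mod_hom_set C M G0" and g: "g : mod_hom_set C M G0"
 shows "(\<lambda>m\<in>carrier M. f m \<oplus>\<^sub>C g m) : mod_hom_set C M G0" by (rule mod_hom_restrictI[OF M])
 (use hom_closed[OF f] hom_closed[OF g] in \<open>simp_all add: hom_add[OF f] hom_add[OF g] hom_act[OF f] hom_act[OF g] C.a_ac C.l_distr\<close>)

lemma hom_left:
 assumes M: "right_module C M" and f: "f : mod_hom_set C M G0" and c: "c : \<C>" shows "(\<lambda>m\<in>carrier M. c \<otimes> f m) : mod_hom_set C M G0"
 by (rule mod_hom_restrictI[OF M])
 (use c hom_closed[OF f] in \<open>simp_all add: hom_add[OF f] hom_act[OF f] C.r_distr C.m_assoc\<close>)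

lemma hom_smult:
 assumes M: "right_module C M" and f: "f : mod_hom_set C M G0" and k: "k : carrier K" shows "(\<lambda>m\<in>carrier M. k \<odot> f m) : mod_hom_set C M G0"
 by (rule mod_hom_restrictI[OF M])
 (use k hom_closed[OF f] in \<open>simp_all add: hom_add[OF f] hom_act[OF f] kC.smult_r_distr kC.smult_mult_left\<close>)

lemma Z_I: "[|f : mod_hom_set C (T 2) G0; !!y. y : carrier (T 3) ==> f (bd 2 y) = \<zero>|] ==> f : Z"
 by (simp add: cocycles_def numeral_3_eq_3 numeral_2_eq_2)

lemma Z_hom: "f : Z ==> f : mod_hom_set C (T 2) G0" by (simp add: cocycles_def)

lemma Z_bd: "[|f : Z; y : carrier (T 3)|] ==> f (bd 2 y) = \<zero>" by (simp add: cocycles_def numeral_3_eq_3 numeral_2_eq_2)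

lemma bd2_mem: "y : carrier (T 3) ==> bd 2 y : carrier (T 2)" by (rule mod_hom_closed[OF bd2])
lemma Z_plus: "[|f : Z; g : Z|] ==> (\<lambda>m\<in>carrier (T 2). f m \<oplus>\<^sub>C g m) : Z"
 by (rule Z_I[OF hom_plus[OF T_module Z_hom Z_hom]]) (simp_all add: Z_bd bd2_mem)

lemma Z_smult: "[|f : Z; k : carrier K|] ==> (\<lambda>m\<in>carrier (T 2). k \<odot> f m) : Z"
 by (rule Z_I[OF hom_smult[OF T_module Z_hom]]) (simp_all add: Z_bd bd2_mem kC.smult_r_null)

lemma Z_left: "[|f : Z; c : \<C>|] ==> (\<lambda>m\<in>carrier (T 2). c \<otimes> f m) : Z"
 by (rule Z_I[OF hom_left[OF T_module Z_hom]]) (simp_all add: Z_bd bd2_mem)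

lemma zero_hom: "right_module C M ==> (\<lambda>m\<in>carrier M. \<zero>) : mod_hom_set C M G0" by (rule mod_hom_restrictI) simp_all

lemma HZ_simps: "carrier HZ = Z" "\<zero>\<^sub>HZ = (\<lambda>m\<in>carrier (T 2). \<zero>)"
 "f \<oplus>\<^sub>HZ g = (\<lambda>m\<in>carrier (T 2). f m \<oplus>\<^sub>C g m)" by (simp_all add: hom_space_def)

lemma HZ_smult: "[|f : Z; k : carrier K|] ==> k \<odot>\<^sub>HZ f = (\<lambda>m\<in>carrier (T 2). k \<odot> f m)"
 using hom_closed[OF Z_hom] by (auto simp: hom_space_def fun_eq_iff kC.smult_mult_right[symmetric])

lemma module_HZ: "module K HZ"
proof (rule module_pointwise[OF kalgebraD(3)[OF kalgebra_C], where D = "carrier (T 2)"])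
 show "carrier HZ \<subseteq> carrier (T 2) \<rightarrow>\<^sub>E \<C>" unfolding HZ_simps using hom_closed[OF Z_hom] mod_hom_ext[OF Z_hom] by (auto simp: PiE_def)
 show "\<zero>\<^sub>HZ : carrier HZ" unfolding HZ_simps by (rule Z_I[OF zero_hom[OF T_module]]) (simp add: bd2_mem)
 show "f \<oplus>\<^sub>HZ g : carrier HZ" if "f : carrier HZ" "g : carrier HZ" for f g using that unfolding HZ_simps by (rule Z_plus)
 show "k \<odot>\<^sub>HZ f : carrier HZ" "k \<odot>\<^sub>HZ f = (\<lambda>m\<in>carrier (T 2). k \<odot> f m)" if "k : carrier K" "f : carrier HZ" for k f
 using that Z_smult HZ_smult unfolding HZ_simps by simp_all
qed (rule HZ_simps)+

lemma Bd_eq: "Bd = (%k. compose (carrier (T 2)) k (bd 1)) ` mod_hom_set C (T 1) G0" by (simp add: numeral_2_eq_2)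

lemma submodule_Bd: "submodule K Bd HZ"
proof (rule submodule.intro, goal_cases)
 case 1 show ?case by (rule module_HZ)
next
 case 2
 show ?case unfolding HZ_simps Bd_eq
 proof clarify
 fix k assume k: "k : mod_hom_set C (T 1) G0"
 show "compose (carrier (T 2)) k (bd 1) : Z"
 proof (rule Z_I[OF hom_compose[OF T_module bd1 k]])
 show "compose (carrier (T 2)) k (bd 1) (bd 2 y) = \<zero>" if "y : carrier (T 3)" for y
 using that by (simp only: compose_eq[OF bd2_mem] bd1_bd2 hom_zero[OF T_module k])
 qed
 qed
next
 case (3 v w)
 then obtain k l where k: "k : mod_hom_set C (T 1) G0" "v = compose (carrier (T 2)) k (bd 1)"
 and l: "l : mod_hom_set C (T 1) G0" "w = compose (carrier (T 2)) l (bd 1)" unfolding Bd_eq by blast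
 have "v \<oplus>\<^sub>HZ w = compose (carrier (T 2)) (\<lambda>m\<in>carrier (T 1). k m \<oplus>\<^sub>C l m) (bd 1)"
 unfolding HZ_simps k(2) l(2) using mod_hom_closed[OF bd1] by (auto simp: compose_def fun_eq_iff)
 thus ?case unfolding Bd_eq using hom_plus[OF T_module k(1) l(1)] by blast
next
 case 4
 have "\<zero>\<^sub>HZ = compose (carrier (T 2)) (\<lambda>m\<in>carrier (T 1). \<zero>) (bd 1)"
 unfolding HZ_simps using mod_hom_closed[OF bd1] by (auto simp: compose_def fun_eq_iff)
 thus ?case unfolding Bd_eq using zero_hom[OF T_module] by blast
next
 case (5 c v)
 then obtain k where k: "k : mod_hom_set C (T 1) G0" "v = compose (carrier (T 2)) k (bd 1)" unfolding Bd_eq by blast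
 have kc: "k (bd 1 m) : \<C>" if "m : carrier (T 2)" for m using hom_closed[OF k(1) mod_hom_closed[OF bd1 that]] .
 have "c \<odot>\<^sub>HZ v = compose (carrier (T 2)) (\<lambda>m\<in>carrier (T 1). c \<odot> k m) (bd 1)" unfolding k(2) using 5 mod_hom_closed[OF bd1] kc
 by (auto simp: compose_def fun_eq_iff hom_space_def kC.smult_mult_right[symmetric])
 thus ?case unfolding Bd_eq using hom_smult[OF T_module k(1) 5(1)] by blast
qed

section \<open>Classes in Ext and their representatives on the concrete complex\<close>

definition cls :: "('p => 'c) => ('p => 'c) set" where "cls f = Bd +>\<^bsub>HZ\<^esub> f"

lemma coset_hom_space: "Bd +>\<^bsub>hom_space C (T 2) G0\<^esub> f = cls f" by (simp add: cls_def a_r_coset_def')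

lemma module_E: "module K E" unfolding Ext_def by (rule module_quotient[OF submodule_Bd])

lemma carrier_E: "carrier E = cls ` Z" unfolding Ext_def carrier_quotient_module cls_def HZ_simps ..

lemma cls_mem: "f : Z ==> f' : cls f \<longleftrightarrow> f' : Z & cls f' = cls f"
 unfolding cls_def using coset_mem_iff[OF submodule_Bd, of f f'] by (simp only: HZ_simps)

lemma cls_add: "[|f : Z; g : Z|] ==> cls f \<oplus>\<^sub>E cls g = cls (\<lambda>m\<in>carrier (T 2). f m \<oplus>\<^sub>C g m)"
 unfolding cls_def Ext_def using quotient_add[OF submodule_Bd, of f g] by (simp only: HZ_simps)

lemma cls_smult: "[|f : Z; k : carrier K|] ==> k \<odot>\<^sub>E cls f = cls (\<lambda>m\<in>carrier (T 2). k \<odot> f m)"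
 unfolding cls_def Ext_def using quotient_smult[OF submodule_Bd, of k f] by (simp only: HZ_simps HZ_smult)

lemma cls_eqI:
 assumes f: "f : Z" "f' : Z" and k: "k : mod_hom_set C (T 1) G0" and e: "!!x. x : carrier (T 2) ==> f' x = k (bd 1 x) \<oplus>\<^sub>C f x"
 shows "cls f' = cls f"
proof -
 have "f' = (\<lambda>m\<in>carrier (T 2). compose (carrier (T 2)) k (bd 1) m \<oplus>\<^sub>C f m)"
 using e mod_hom_ext[OF Z_hom[OF f(2)]] by (auto simp: fun_eq_iff compose_def extensional_def)
 hence "f' : cls f" unfolding cls_def a_r_coset_def' HZ_simps Bd_eq using k by blast
 thus ?thesis using cls_mem[OF f(1)] by blast
qed

lemma cls_eqD:
 assumes f: "f : Z" "f' : Z" and e: "cls f' = cls f"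
 obtains k where "k : mod_hom_set C (T 1) G0" "!!x. x : carrier (T 2) ==> f' x = k (bd 1 x) \<oplus>\<^sub>C f x"
proof -
 have "f' : cls f" using cls_mem[OF f(1)] f(2) e by blast
 then obtain k where k: "k : mod_hom_set C (T 1) G0" and "f' = (\<lambda>m\<in>carrier (T 2). compose (carrier (T 2)) k (bd 1) m \<oplus>\<^sub>C f m)"
 unfolding cls_def a_r_coset_def' HZ_simps Bd_eq by blast
 hence "f' x = k (bd 1 x) \<oplus>\<^sub>C f x" if "x : carrier (T 2)" for x using that by (simp add: compose_eq)
 thus thesis by (rule that[OF k])
qed

lemma d2_inj: assumes u: "u : carrier F2" and v: "v : carrier F2" and e: "d2 u = d2 v" shows "u = v"
proof -
 interpret F2: right_module C F2 by (rule F2_module)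
 interpret F1: right_module C F1 by (rule F1_module)
 have "d2 (u \<ominus>\<^sub>F2 v) = d2 v \<ominus>\<^sub>F1 d2 v" using mod_hom_minus[OF F2_module F1_module d2_hom u v] e by metis
 also have "... = \<zero>\<^sub>F1" unfolding a_minus_def by (rule F1.M.r_neg[OF d2_mem[OF v]])
 finally have z: "u \<ominus>\<^sub>F2 v = \<zero>\<^sub>F2" by (rule d2_injective[OF gl F2.M.minus_closed[OF u v]])
 have "u = (u \<ominus>\<^sub>F2 v) \<oplus>\<^sub>F2 v"
 by (simp only: a_minus_def F2.M.a_assoc[OF u F2.M.a_inv_closed[OF v] v] F2.M.l_neg[OF v] F2.M.r_zero[OF u])
 thus ?thesis unfolding z F2.M.l_zero[OF v] .
qed
text \<open>The concrete complex has no third term, so every homomorphism from \<open>F2\<close> to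
  \<open>C\<close> counts as a cocycle; pulling it back along \<open>\<b>2\<close> gives its class
  in Ext computed from \<open>P\<close>.\<close>

definition \<Phi> :: "(((('v, 'a) path => 'k) \<times> 'c => 'c) => 'c) => ('p => 'c) set"
 where "\<Phi> g = cls (compose (carrier (T 2)) g \<b>2)"

lemma \<b>2_mem: "p : carrier (T 2) ==> \<b>2 p : carrier F2" by (rule mod_hom_closed[OF \<b>(3)])

text \<open>Boundaries of \<open>P\<close> are mapped by \<open>\<b>2\<close> into the kernel of
  \<open>d2\<close>, which is zero.\<close>

lemma \<Phi>_Z: assumes g: "g : Hom2" shows "compose (carrier (T 2)) g \<b>2 : Z"
proof (rule Z_I[OF hom_compose[OF T_module \<b>(3) g]])
 fix y assume y: "y : carrier (T 3)"
 interpret F2: right_module C F2 by (rule F2_module)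
 have "d2 (\<b>2 (bd 2 y)) = \<b>1 \<zero>\<^bsub>T 1\<^esub>" using \<b>_d2[OF bd2_mem[OF y]] bd1_bd2[OF y] by metis
 also have "... = \<zero>\<^sub>F1" by (rule mod_hom_zero[OF T_module F1_module \<b>(2)])
 finally have "\<b>2 (bd 2 y) = \<zero>\<^sub>F2" by (rule d2_injective[OF gl \<b>2_mem[OF bd2_mem[OF y]]])
 thus "compose (carrier (T 2)) g \<b>2 (bd 2 y) = \<zero>" using hom_zero[OF F2_module g] by (simp only: compose_eq[OF bd2_mem[OF y]])
qed

lemma \<Phi>_closed: "g : Hom2 ==> \<Phi> g : carrier E" unfolding \<Phi>_def carrier_E by (intro imageI \<Phi>_Z)

lemma \<Phi>_mem: 
 assumes g: "g : Hom2" and f: "f : \<Phi> g"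
 obtains k where "f : Z" "k : mod_hom_set C (T 1) G0" "!!x. x : carrier (T 2) ==> f x = k (bd 1 x) \<oplus>\<^sub>C g (\<b>2 x)"
proof -
 from f have f: "f : Z" "cls f = cls (compose (carrier (T 2)) g \<b>2)" unfolding \<Phi>_def cls_mem[OF \<Phi>_Z[OF g]] by auto
 from cls_eqD[OF \<Phi>_Z[OF g] this] obtain k where "k : mod_hom_set C (T 1) G0"
 "!!x. x : carrier (T 2) ==> f x = k (bd 1 x) \<oplus>\<^sub>C compose (carrier (T 2)) g \<b>2 x" by blast
 thus thesis using that[of k] f(1) by (simp add: compose_eq)
qed

lemma \<Phi>_eqI:
 assumes g: "g : Hom2" and f: "f : Z" and k: "k : mod_hom_set C (T 1) G0"
 and e: "!!x. x : carrier (T 2) ==> f x = k (bd 1 x) \<oplus>\<^sub>C g (\<b>2 x)" shows "cls f = \<Phi> g"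
 unfolding \<Phi>_def by (rule cls_eqI[OF \<Phi>_Z[OF g] f k]) (simp add: e compose_eq)

lemma \<Phi>_nonempty: "g : Hom2 ==> compose (carrier (T 2)) g \<b>2 : \<Phi> g" unfolding \<Phi>_def using cls_mem[OF \<Phi>_Z[of g]] \<Phi>_Z[of g] by blast

lemma \<Phi>_add: assumes g: "g : Hom2" and g': "g' : Hom2"
 shows "\<Phi> g \<oplus>\<^sub>E \<Phi> g' = \<Phi> (\<lambda>u\<in>carrier F2. g u \<oplus>\<^sub>C g' u)"
proof -
 have "\<Phi> g \<oplus>\<^sub>E \<Phi> g' = cls (\<lambda>m\<in>carrier (T 2). compose (carrier (T 2)) g \<b>2 m \<oplus>\<^sub>C compose (carrier (T 2)) g' \<b>2 m)"
 unfolding \<Phi>_def by (rule cls_add[OF \<Phi>_Z[OF g] \<Phi>_Z[OF g']])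
 also have "(\<lambda>m\<in>carrier (T 2). compose (carrier (T 2)) g \<b>2 m \<oplus>\<^sub>C compose (carrier (T 2)) g' \<b>2 m) =
 compose (carrier (T 2)) (\<lambda>u\<in>carrier F2. g u \<oplus>\<^sub>C g' u) \<b>2"
 unfolding compose_def using \<b>2_mem by (intro restrict_ext) (simp del: fun_module_simps)
 finally show ?thesis unfolding \<Phi>_def .
qed

lemma \<Phi>_smult: assumes g: "g : Hom2" and k: "k : carrier K" shows "k \<odot>\<^sub>E \<Phi> g = \<Phi> (\<lambda>u\<in>carrier F2. k \<odot> g u)"
proof -
 have "k \<odot>\<^sub>E \<Phi> g = cls (\<lambda>m\<in>carrier (T 2). k \<odot> compose (carrier (T 2)) g \<b>2 m)"
 unfolding \<Phi>_def by (rule cls_smult[OF \<Phi>_Z[OF g] k])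
 also have "(\<lambda>m\<in>carrier (T 2). k \<odot> compose (carrier (T 2)) g \<b>2 m) = compose (carrier (T 2)) (\<lambda>u\<in>carrier F2. k \<odot> g u) \<b>2"
 unfolding compose_def using \<b>2_mem by (intro restrict_ext) (simp del: fun_module_simps)
 finally show ?thesis unfolding \<Phi>_def .
qed

lemma P_exact: "exact_three C DC (T 0) (T 1) (T 2) (augmentation P) (bd 0) (bd 1)" by (rule projective_resolution_exact[OF right_module_dual P])

lemma P_three: "three_term C DC (T 0) (T 1) (T 2) (augmentation P) (bd 0) (bd 1)" and F_three: "three_term C DC F0 F1 F2 aug d1 d2"
 using P_exact F_exact by (simp_all only: exact_three_def)

lemmas T_dual = projective_resolution_terms(1)[OF P]

lemma \<a>_mem: "x : carrier F0 ==> \<a>0 x : carrier (T 0)" "u : carrier F1 ==> \<a>1 u : carrier (T 1)" "v : carrier F2 ==> \<a>2 v : carrier (T 2)"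
 and \<b>_mem: "p : carrier (T 0) ==> \<b>0 p : carrier F0" "q : carrier (T 1) ==> \<b>1 q : carrier F1"
 by (rule mod_hom_closed[OF \<a>(1)] mod_hom_closed[OF \<a>(2)] mod_hom_closed[OF \<a>(3)]
 mod_hom_closed[OF \<b>(1)] mod_hom_closed[OF \<b>(2)]; assumption)+

lemma bd_mem: "q : carrier (T 1) ==> bd 0 q : carrier (T 0)" "p : carrier (T 2) ==> bd 1 p : carrier (T 1)"
 by (rule mod_hom_closed[OF bd0] mod_hom_closed[OF bd1]; assumption)+

text \<open>A cocycle \<open>f\<close> is cohomologous to \<open>f \<a>2 \<b>2\<close>, because
  \<open>\<a> \<b>\<close> is homotopic to the identity of \<open>P\<close>; so
  \<open>f \<a>2\<close> represents its class.\<close>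

lemma \<Phi>_surj: assumes "z : carrier E" obtains g where "g : Hom2" "z = \<Phi> g"
proof -
 from assms obtain f where f: "f : Z" "z = cls f" unfolding carrier_E by blast
 interpret T1: right_module C "T 1" by (rule T_module)
 interpret T2: right_module C "T 2" by (rule T_module)
 obtain h where h: "h : mod_hom_set C (T 1) (T 2)"
 "!!x. x : carrier (T 2) ==> bd 1 (compose (carrier (T 2)) \<a>2 \<b>2 x) = bd 1 ((\<lambda>x\<in>carrier (T 2). x) x \<oplus>\<^bsub>T 2\<^esub> h (bd 1 x))"
 proof (rule homotopy[OF P_three T_dual T_dual P_exact hom_compose[OF T_module \<b>(1) \<a>(1)] hom_compose[OF T_module \<b>(2) \<a>(2)]
 hom_compose[OF T_module \<b>(3) \<a>(3)] mod_hom_id[OF T_module] mod_hom_id[OF T_module] mod_hom_id[OF T_module]])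
 show "augmentation P (compose (carrier (T 0)) \<a>0 \<b>0 x) = augmentation P ((\<lambda>x\<in>carrier (T 0). x) x)" if "x : carrier (T 0)" for x
 using that by (simp add: compose_eq \<a>_aug[OF \<b>_mem(1)] \<b>_aug)
 show "bd 0 (compose (carrier (T 1)) \<a>1 \<b>1 x) = compose (carrier (T 0)) \<a>0 \<b>0 (bd 0 x)" if "x : carrier (T 1)" for x
 using that by (simp only: compose_eq bd_mem \<a>_d1[OF \<b>_mem(2)] \<b>_d1)
 show "bd 1 (compose (carrier (T 2)) \<a>2 \<b>2 x) = compose (carrier (T 1)) \<a>1 \<b>1 (bd 1 x)" if "x : carrier (T 2)" for x
 using that by (simp only: compose_eq bd_mem \<a>_d2[OF \<b>2_mem] \<b>_d2)
 show "bd 0 ((\<lambda>x\<in>carrier (T 1). x) x) = (\<lambda>x\<in>carrier (T 0). x) (bd 0 x)" if "x : carrier (T 1)" for x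
 using that by (simp only: restrict_apply' bd_mem)
 show "bd 1 ((\<lambda>x\<in>carrier (T 2). x) x) = (\<lambda>x\<in>carrier (T 1). x) (bd 1 x)" if "x : carrier (T 2)" for x
 using that by (simp only: restrict_apply' bd_mem)
 qed (use that in blast)
 note fh = Z_hom[OF f(1)]
 let ?g = "compose (carrier F2) f \<a>2"
 have g: "?g : Hom2" by (rule hom_compose[OF F2_module \<a>(3) fh])
 have "\<Phi> ?g = cls f" unfolding \<Phi>_def
 proof (rule cls_eqI[OF f(1) \<Phi>_Z[OF g] hom_compose[OF T_module h(1) fh]])
 fix x assume x: "x : carrier (T 2)"
 have ab: "\<a>2 (\<b>2 x) : carrier (T 2)" by (rule \<a>_mem(3)[OF \<b>2_mem[OF x]])
 have hx: "h (bd 1 x) : carrier (T 2)" by (rule mod_hom_closed[OF h(1) bd_mem(2)[OF x]])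
 have xh: "x \<oplus>\<^bsub>T 2\<^esub> h (bd 1 x) : carrier (T 2)" using x hx by simp
 have e: "bd 1 (\<a>2 (\<b>2 x)) = bd 1 (x \<oplus>\<^bsub>T 2\<^esub> h (bd 1 x))" using h(2)[OF x] x by (simp only: compose_eq restrict_apply')
 \<comment> \<open>The homotopy formula is available after \<open>bd 1\<close> only; the difference
   is a boundary from the third term and is killed by the cocycle.\<close>
 have "bd 1 (\<a>2 (\<b>2 x) \<ominus>\<^bsub>T 2\<^esub> (x \<oplus>\<^bsub>T 2\<^esub> h (bd 1 x))) = \<zero>\<^bsub>T 1\<^esub>"
 unfolding mod_hom_minus[OF T_module T_module bd1 ab xh] e by (unfold a_minus_def) (rule T1.M.r_neg[OF bd_mem(2)[OF xh]])
 hence "\<a>2 (\<b>2 x) \<ominus>\<^bsub>T 2\<^esub> (x \<oplus>\<^bsub>T 2\<^esub> h (bd 1 x)) : bd 2 ` carrier (T 3)"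
 unfolding bd2_image using T2.M.minus_closed[OF ab xh] by blast
 hence "f (\<a>2 (\<b>2 x) \<ominus>\<^bsub>T 2\<^esub> (x \<oplus>\<^bsub>T 2\<^esub> h (bd 1 x))) = \<zero>" using Z_bd[OF f(1)] by force
 moreover have "\<a>2 (\<b>2 x) = (\<a>2 (\<b>2 x) \<ominus>\<^bsub>T 2\<^esub> (x \<oplus>\<^bsub>T 2\<^esub> h (bd 1 x))) \<oplus>\<^bsub>T 2\<^esub> (x \<oplus>\<^bsub>T 2\<^esub> h (bd 1 x))"
 using ab xh by (simp add: a_minus_def T2.M.a_assoc T2.M.l_neg)
 ultimately have "f (\<a>2 (\<b>2 x)) = f (x \<oplus>\<^bsub>T 2\<^esub> h (bd 1 x))"
 using hom_add[OF fh T2.M.minus_closed[OF ab xh] xh] hom_closed[OF fh xh] by simp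
 also have "... = f (h (bd 1 x)) \<oplus>\<^sub>C f x" using hom_add[OF fh x hx] hom_closed[OF fh x] hom_closed[OF fh hx] by (simp add: C.a_comm)
 finally show "compose (carrier (T 2)) ?g \<b>2 x = compose (carrier (T 1)) f h (bd 1 x) \<oplus>\<^sub>C f x"
 using x by (simp only: compose_eq bd_mem \<b>2_mem)
 qed
 thus thesis using that[OF g] f(2) by simp
qed

text \<open>The induced map is a union over representatives. Each representative is
  \<open>g \<b>2\<close> plus a coboundary, and left multiplication preserves both parts, so the
  union is constant.\<close>

lemma lact_\<Phi>:
 assumes g: "g : Hom2" and c: "c : \<C>"
 shows "Ext_covariant C P 2 G0 (\<lambda>a\<in>\<C>. c \<otimes> a) (\<Phi> g) = \<Phi> (\<lambda>u\<in>carrier F2. c \<otimes> g u)"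
 unfolding Ext_covariant_def coset_hom_space
proof (rule UN_constant_eq[OF \<Phi>_nonempty[OF g]], intro ballI)
 fix f assume "f : \<Phi> g"
 then obtain k where f: "f : Z" "k : mod_hom_set C (T 1) G0" "!!x. x : carrier (T 2) ==> f x = k (bd 1 x) \<oplus>\<^sub>C g (\<b>2 x)"
 using \<Phi>_mem[OF g] by blast
 have e: "compose (carrier (T 2)) (\<lambda>a\<in>\<C>. c \<otimes> a) f = (\<lambda>m\<in>carrier (T 2). c \<otimes> f m)"
 unfolding compose_def using hom_closed[OF Z_hom[OF f(1)]] by (intro restrict_ext) simp
 show "cls (compose (carrier (T 2)) (\<lambda>a\<in>\<C>. c \<otimes> a) f) = \<Phi> (\<lambda>u\<in>carrier F2. c \<otimes> g u)" unfolding e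
 proof (rule \<Phi>_eqI[OF hom_left[OF F2_module g c] Z_left[OF f(1) c] hom_left[OF T_module f(2) c]])
 fix x assume x: "x : carrier (T 2)"
 have "c \<otimes> f x = c \<otimes> k (bd 1 x) \<oplus>\<^sub>C c \<otimes> g (\<b>2 x)"
 unfolding f(3)[OF x] by (rule C.r_distr[OF hom_closed[OF f(2) bd_mem(2)[OF x]] hom_closed[OF g \<b>2_mem[OF x]] c])
 thus "(\<lambda>m\<in>carrier (T 2). c \<otimes> f m) x =
 (\<lambda>m\<in>carrier (T 1). c \<otimes> k m) (bd 1 x) \<oplus>\<^sub>C (\<lambda>u\<in>carrier F2. c \<otimes> g u) (\<b>2 x)"
 using x by (simp only: restrict_apply' bd_mem \<b>2_mem)
 qed
qed

lemma dual_left_action_hom: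
 assumes c: "c : \<C>" shows "restrict (dual_left_action C c) (carrier DC) : mod_hom_set C DC DC"
proof (rule mod_hom_restrictI[OF right_module_dual])
 fix \<phi> assume \<phi>: "\<phi> : carrier DC"
 show "dual_left_action C c \<phi> : carrier DC" unfolding dual_left_action_def by (rule DC_I)
 (use c DC_closed[OF \<phi>] in \<open>simp_all add: C.l_distr DC_add[OF \<phi>] DC_smult[OF \<phi>] kC.smult_mult_left[symmetric]\<close>)
 show "dual_left_action C c (\<phi> \<oplus>\<^sub>DC \<psi>) = dual_left_action C c \<phi> \<oplus>\<^sub>DC dual_left_action C c \<psi>" for \<psi>
 using c by (auto simp: dual_left_action_def DC_simps fun_eq_iff)
 show "dual_left_action C c (d \<odot>\<^sub>DC \<phi>) = d \<odot>\<^sub>DC dual_left_action C c \<phi>" if "d : \<C>" for d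
 using c that by (auto simp: dual_left_action_def DC_simps fun_eq_iff C.m_assoc)
qed

text \<open>After \<open>\<b>\<close>, any lift \<open>l\<close> of the action to \<open>P\<close>
  and the strict lift \<open>l2 c\<close> become homotopic, as both cover the same endomorphism of
  \<open>DC\<close>. Hence all members of the double union are the class of \<open>g\<close>
  precomposed with \<open>l2 c\<close>.\<close>

lemma ract_\<Phi>:
 assumes g: "g : Hom2" and c: "c : \<C>" shows "Ext_contravariant C P 2 G0 (dual_left_action C c) (\<Phi> g) = \<Phi> (compose (carrier F2) g (l2 c))"
 unfolding Ext_contravariant_def coset_hom_space
proof (rule UN_constant_eq[OF \<Phi>_nonempty[OF g]], intro ballI)
 fix f assume "f : \<Phi> g"
 then obtain k where f: "f : Z" "k : mod_hom_set C (T 1) G0" "!!x. x : carrier (T 2) ==> f x = k (bd 1 x) \<oplus>\<^sub>C g (\<b>2 x)"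
 using \<Phi>_mem[OF g] by blast
 note eC = projective_resolution_terms(4)[OF P]
 have "chain_lifts C P (dual_left_action C c) = chain_lifts C P (restrict (dual_left_action C c) (carrier DC))"
 unfolding chain_lifts_def using mod_hom_closed[OF eC] by simp
 hence "chain_lifts C P (dual_left_action C c) ~= {}" using chain_lift_exists[OF right_module_dual P dual_left_action_hom[OF c]] by simp
 then obtain l' where l': "l' : chain_lifts C P (dual_left_action C c)" by blast
 show "(\<Union>l\<in>chain_lifts C P (dual_left_action C c). cls (compose (carrier (T 2)) f (l 2))) = \<Phi> (compose (carrier F2) g (l2 c))"
 proof (rule UN_constant_eq[OF l'], intro ballI)
 fix l assume l: "l : chain_lifts C P (dual_left_action C c)"
 have lh: "l n : mod_hom_set C (T n) (T n)" for n using l by (simp add: chain_lifts_def)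
 have l0: "augmentation P (l 0 p) = dual_left_action C c (augmentation P p)" if "p : carrier (T 0)" for p using l that by (simp add: chain_lifts_def)
 have lS: "bd n (l (Suc n) p) = l n (bd n p)" if "p : carrier (T (Suc n))" for n p using l that by (simp add: chain_lifts_def)
 have l1': "bd 0 (l 1 p) = l 0 (bd 0 p)" if "p : carrier (T 1)" for p using lS[of p 0] that by simp
 have l2': "bd 1 (l 2 p) = l 1 (bd 1 p)" if "p : carrier (T 2)" for p using lS[of p 1] that by (simp add: numeral_2_eq_2)
 have l3': "bd 2 (l 3 p) = l 2 (bd 2 p)" if "p : carrier (T 3)" for p using lS[of p 2] that by (simp add: numeral_2_eq_2 numeral_3_eq_3)
 note lc = mod_hom_closed[OF lh]
 note dc = mod_hom_closed[OF l0_hom[OF c]] mod_hom_closed[OF l1_hom[OF c]] mod_hom_closed[OF l2_hom[OF c]]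
 obtain h where h: "h : mod_hom_set C (T 1) F2"
 "!!x. x : carrier (T 2) ==> d2 (compose (carrier (T 2)) \<b>2 (l 2) x) = d2 (compose (carrier (T 2)) (l2 c) \<b>2 x \<oplus>\<^sub>F2 h (bd 1 x))"
 proof (rule homotopy[OF P_three T_dual T_dual F_exact hom_compose[OF T_module lh \<b>(1)] hom_compose[OF T_module lh \<b>(2)]
 hom_compose[OF T_module lh \<b>(3)] hom_compose[OF T_module \<b>(1) l0_hom[OF c]] hom_compose[OF T_module \<b>(2) l1_hom[OF c]]
 hom_compose[OF T_module \<b>(3) l2_hom[OF c]]])
 show "aug (compose (carrier (T 0)) \<b>0 (l 0) x) = aug (compose (carrier (T 0)) (l0 c) \<b>0 x)" if "x : carrier (T 0)" for x
 using that by (simp only: compose_eq \<b>_aug[OF lc] l0 aug_lft[OF \<b>_mem(1) c] \<b>_aug)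
 show "d1 (compose (carrier (T 1)) \<b>1 (l 1) x) = compose (carrier (T 0)) \<b>0 (l 0) (bd 0 x)" if "x : carrier (T 1)" for x
 using that by (simp only: compose_eq bd_mem \<b>_d1[OF lc] l1')
 show "d2 (compose (carrier (T 2)) \<b>2 (l 2) x) = compose (carrier (T 1)) \<b>1 (l 1) (bd 1 x)" if "x : carrier (T 2)" for x
 using that by (simp only: compose_eq bd_mem \<b>_d2[OF lc] l2')
 show "d1 (compose (carrier (T 1)) (l1 c) \<b>1 x) = compose (carrier (T 0)) (l0 c) \<b>0 (bd 0 x)" if "x : carrier (T 1)" for x
 using that by (simp only: compose_eq bd_mem d1_lft[OF \<b>_mem(2) c] \<b>_d1)
 show "d2 (compose (carrier (T 2)) (l2 c) \<b>2 x) = compose (carrier (T 1)) (l1 c) \<b>1 (bd 1 x)" if "x : carrier (T 2)" for x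
 using that by (simp only: compose_eq bd_mem d2_lft[OF \<b>2_mem c] \<b>_d2)
 qed (use that in blast)
 interpret F2: right_module C F2 by (rule F2_module)
 \<comment> \<open>Injectivity of \<open>d2\<close> turns the homotopy relation into an equation in
   \<open>F2\<close>.\<close>
 have \<b>l: "\<b>2 (l 2 x) = l2 c (\<b>2 x) \<oplus>\<^sub>F2 h (bd 1 x)" if x: "x : carrier (T 2)" for x
 proof (rule d2_inj)
 show "\<b>2 (l 2 x) : carrier F2" by (rule \<b>2_mem[OF lc[OF x]])
 show "l2 c (\<b>2 x) \<oplus>\<^sub>F2 h (bd 1 x) : carrier F2"
 by (rule F2.M.a_closed[OF dc(3)[OF \<b>2_mem[OF x]] mod_hom_closed[OF h(1) bd_mem(2)[OF x]]])
 show "d2 (\<b>2 (l 2 x)) = d2 (l2 c (\<b>2 x) \<oplus>\<^sub>F2 h (bd 1 x))" using h(2)[OF x] x by (simp only: compose_eq)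
 qed
 have fl: "compose (carrier (T 2)) f (l 2) : Z"
 proof (rule Z_I[OF hom_compose[OF T_module lh Z_hom[OF f(1)]]])
 show "compose (carrier (T 2)) f (l 2) (bd 2 y) = \<zero>" if y: "y : carrier (T 3)" for y
 using Z_bd[OF f(1) lc[OF y]] l3'[OF y] by (simp only: compose_eq[OF bd2_mem[OF y]])
 qed
 let ?k = "\<lambda>m\<in>carrier (T 1). compose (carrier (T 1)) k (l 1) m \<oplus>\<^sub>C compose (carrier (T 1)) g h m"
 show "cls (compose (carrier (T 2)) f (l 2)) = \<Phi> (compose (carrier F2) g (l2 c))"
 proof (rule \<Phi>_eqI[OF hom_compose[OF F2_module l2_hom[OF c] g] fl
 hom_plus[OF T_module hom_compose[OF T_module lh f(2)] hom_compose[OF T_module h(1) g]]])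
 fix x assume x: "x : carrier (T 2)"
 note b = bd_mem(2)[OF x] and lb = l2'[OF x]
 have hb: "h (bd 1 x) : carrier F2" by (rule mod_hom_closed[OF h(1) b])
 have cl: "k (l 1 (bd 1 x)) : \<C>" "g (h (bd 1 x)) : \<C>" "g (l2 c (\<b>2 x)) : \<C>"
 using hom_closed[OF f(2) lc[OF b]] hom_closed[OF g hb] hom_closed[OF g dc(3)[OF \<b>2_mem[OF x]]] by auto
 have "f (l 2 x) = k (l 1 (bd 1 x)) \<oplus>\<^sub>C g (l2 c (\<b>2 x) \<oplus>\<^sub>F2 h (bd 1 x))"
 using f(3)[OF lc[OF x]] lb \<b>l[OF x] by metis
 also have "... = k (l 1 (bd 1 x)) \<oplus>\<^sub>C g (h (bd 1 x)) \<oplus>\<^sub>C g (l2 c (\<b>2 x))"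
 unfolding hom_add[OF g dc(3)[OF \<b>2_mem[OF x]] hb] using cl by (simp add: C.a_ac)
 finally show "compose (carrier (T 2)) f (l 2) x = ?k (bd 1 x) \<oplus>\<^sub>C compose (carrier F2) g (l2 c) (\<b>2 x)"
 using x b by (simp only: compose_eq restrict_apply' \<b>2_mem)
 qed
 qed
qed
end

section \<open>The bimodule structure of Ext, its generators and their dual functionals\<close>

context relation_extension_frame
begin
interpretation K: field K by (rule field_K)
interpretation Q: fin_digraph Q by (rule fin_Q)
interpretation A: ring "path_algebra K Q" by (rule ring_A)
interpretation C: ring C by (rule kalgebraD(2)[OF kalgebra_C])
interpretation kC: kalgebra K C by (rule kalgebra_C)
interpretation E: module K E by (rule module_E)
interpretation F2: right_module C F2 by (rule F2_module)
abbreviation "lact == %c. Ext_covariant C P 2 G0 (\<lambda>a\<in>\<C>. c \<otimes> a)"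
abbreviation "ract == %m c. Ext_contravariant C P 2 G0 (dual_left_action C c) m"


lemma l2_mem: "[|c : \<C>; u : carrier F2|] ==> l2 c u : carrier F2" by (rule mod_hom_closed[OF l2_hom])

lemma F2_eqI:
 assumes "u : carrier F2" "v : carrier F2" "!!r b. [|r : R; b : \<C>|] ==> u (r, b) = v (r, b)" shows "u = v"
 by (rule bimaps_eqI[of u R "%r. ev (rsrc r)" "%r. ev (rtrg r)"]) (use assms in simp_all)

lemma l2_val: "[|u : carrier F2; r : R; b : \<C>|] ==> l2 c u (r, b) = u (r, b \<otimes> c)" by (rule l2_apply) simp

lemma F2_val: "[|u : carrier F2; r : R; b : \<C>|] ==> u (r, b) : \<C>"
 using bimaps_closed[of u R "%r. ev (rsrc r)" "%r. ev (rtrg r)" r b] by simp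

lemma F2_bimap: "[|u : carrier F2; r : R|] ==> bimap (ev (rsrc r)) (ev (rtrg r)) (%b. u (r, b))"
 using bimapsD[of u R "%r. ev (rsrc r)" "%r. ev (rtrg r)" r] by simp

lemma F2_add_val: "[|r : R; b : \<C>|] ==> (u \<oplus>\<^sub>F2 v) (r, b) = u (r, b) \<oplus>\<^sub>C v (r, b)"
 and F2_act_val: "[|r : R; b : \<C>|] ==> (c \<odot>\<^sub>F2 u) (r, b) = u (r, b) \<otimes> c" by simp_all
lemma l2_add: "[|c : \<C>; d : \<C>; u : carrier F2|] ==> l2 (c \<oplus>\<^sub>C d) u = l2 c u \<oplus>\<^sub>F2 l2 d u"
 by (intro F2_eqI F2.M.a_closed l2_mem C.a_closed; (assumption | simp only: F2_add_val l2_val C.r_distr bimap_add[OF F2_bimap] C.m_closed))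

lemma l2_mult: "[|c : \<C>; d : \<C>; u : carrier F2|] ==> l2 (c \<otimes> d) u = l2 c (l2 d u)"
 by (intro F2_eqI l2_mem C.m_closed; (assumption | simp only: l2_val l2_mem C.m_assoc C.m_closed))

lemma l2_one: "u : carrier F2 ==> l2 \<one> u = u" by (intro F2_eqI l2_mem C.one_closed; (assumption | simp only: l2_val C.r_one))

lemma smult_one_mult: "[|k : carrier K; c : \<C>|] ==> c \<otimes> (k \<odot> \<one>) = k \<odot> c" by (simp add: kC.smult_mult_right[symmetric])

lemma l2_smult:
 assumes k: "k : carrier K" and c: "c : \<C>" and u: "u : carrier F2" shows "l2 (k \<odot> c) u = (k \<odot> \<one>) \<odot>\<^sub>F2 l2 c u"
proof (rule F2_eqI)
 have kc: "k \<odot> c : \<C>" "k \<odot> \<one> : \<C>" using k c by simp_all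
 show "l2 (k \<odot> c) u : carrier F2" "(k \<odot> \<one>) \<odot>\<^sub>F2 l2 c u : carrier F2"
 by (rule l2_mem[OF kc(1) u] F2.act_closed[OF kc(2) l2_mem[OF c u]])+
 fix r b assume r: "r : R" and b: "b : \<C>"
 have bc: "b \<otimes> c : \<C>" using b c by simp
 have "u (r, b \<otimes> (k \<odot> c)) = k \<odot> u (r, b \<otimes> c)" using kC.smult_mult_right[OF k b c] bimap_smult[OF F2_bimap[OF u r] k bc] by simp
 thus "l2 (k \<odot> c) u (r, b) = ((k \<odot> \<one>) \<odot>\<^sub>F2 l2 c u) (r, b)"
 unfolding F2_act_val[OF r b] l2_val[OF u r b] smult_one_mult[OF k F2_val[OF u r bc]] .
qed

lemma right_hom: "[|g : Hom2; c : \<C>|] ==> compose (carrier F2) g (l2 c) : Hom2" by (rule hom_compose[OF F2_module l2_hom])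

lemmas F2_hom = hom_plus[OF F2_module] hom_left[OF F2_module] hom_smult[OF F2_module] right_hom

text \<open>Every class has a representative on \<open>F2\<close>, where the left action multiplies
  values and the right action precomposes with \<open>l2\<close>; the bimodule laws are then
  identities between such functions.\<close>

lemma bimodule: "bimodule_algebra K C E lact ract"
proof (rule bimodule_algebra.intro)
 show "kalgebra K C" "module K E" by (rule kalgebra_C module_E)+
 note hc = hom_closed
 fix c m assume c: "c : \<C>" and m: "m : carrier E"
 from \<Phi>_surj[OF m] obtain g where g: "g : Hom2" "m = \<Phi> g" by blast
 note gc = hc[OF g(1)]
 show "lact c m : carrier E" "ract m c : carrier E" unfolding g(2) lact_\<Phi>[OF g(1) c] ract_\<Phi>[OF g(1) c] by (intro \<Phi>_closed F2_hom g(1) c)+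
 { fix m' assume m': "m' : carrier E"
 from \<Phi>_surj[OF m'] obtain g' where g': "g' : Hom2" "m' = \<Phi> g'" by blast
 note gc' = hc[OF g'(1)]
 show "lact c (m \<oplus>\<^sub>E m') = lact c m \<oplus>\<^sub>E lact c m'"
 unfolding g(2) g'(2) \<Phi>_add[OF g(1) g'(1)] lact_\<Phi>[OF g(1) c] lact_\<Phi>[OF g'(1) c] lact_\<Phi>[OF F2_hom(1)[OF g(1) g'(1)] c]
 \<Phi>_add[OF F2_hom(2)[OF g(1) c] F2_hom(2)[OF g'(1) c]]
 by (intro arg_cong[of _ _ \<Phi>] restrict_ext) (use c gc gc' in \<open>simp del: fun_module_simps add: C.r_distr\<close>)
 show "ract (m \<oplus>\<^sub>E m') c = ract m c \<oplus>\<^sub>E ract m' c"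
 unfolding g(2) g'(2) \<Phi>_add[OF g(1) g'(1)] ract_\<Phi>[OF g(1) c] ract_\<Phi>[OF g'(1) c] ract_\<Phi>[OF F2_hom(1)[OF g(1) g'(1)] c]
 \<Phi>_add[OF right_hom[OF g(1) c] right_hom[OF g'(1) c]]
 by (unfold compose_def, intro arg_cong[of _ _ \<Phi>] restrict_ext) (use l2_mem[OF c] in \<open>simp del: fun_module_simps\<close>) }
 { fix d assume d: "d : \<C>"
 have cd: "c \<oplus>\<^sub>C d : \<C>" "c \<otimes> d : \<C>" using c d by simp_all
 show "lact (c \<oplus>\<^sub>C d) m = lact c m \<oplus>\<^sub>E lact d m"
 unfolding g(2) lact_\<Phi>[OF g(1) c] lact_\<Phi>[OF g(1) d] lact_\<Phi>[OF g(1) cd(1)] \<Phi>_add[OF F2_hom(2)[OF g(1) c] F2_hom(2)[OF g(1) d]]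
 by (intro arg_cong[of _ _ \<Phi>] restrict_ext) (use c d gc in \<open>simp del: fun_module_simps add: C.l_distr\<close>)
 show "ract m (c \<oplus>\<^sub>C d) = ract m c \<oplus>\<^sub>E ract m d"
 unfolding g(2) ract_\<Phi>[OF g(1) c] ract_\<Phi>[OF g(1) d] ract_\<Phi>[OF g(1) cd(1)] \<Phi>_add[OF right_hom[OF g(1) c] right_hom[OF g(1) d]]
 by (unfold compose_def, intro arg_cong[of _ _ \<Phi>] restrict_ext)
 (use hom_add[OF g(1) l2_mem[OF c] l2_mem[OF d]] l2_add[OF c d] in \<open>simp del: fun_module_simps\<close>)
 show "lact (c \<otimes> d) m = lact c (lact d m)" unfolding g(2) lact_\<Phi>[OF g(1) d] lact_\<Phi>[OF g(1) cd(2)] lact_\<Phi>[OF F2_hom(2)[OF g(1) d] c]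
 by (intro arg_cong[of _ _ \<Phi>] restrict_ext) (use c d gc in \<open>simp del: fun_module_simps add: C.m_assoc\<close>)
 show "ract m (c \<otimes> d) = ract (ract m c) d" unfolding g(2) ract_\<Phi>[OF g(1) c] ract_\<Phi>[OF g(1) cd(2)] ract_\<Phi>[OF right_hom[OF g(1) c] d]
 by (unfold compose_def, intro arg_cong[of _ _ \<Phi>] restrict_ext) (use l2_mem[OF d] l2_mult[OF c d] in \<open>simp del: fun_module_simps\<close>)
 show "lact c (ract m d) = ract (lact c m) d"
 unfolding g(2) lact_\<Phi>[OF g(1) c] ract_\<Phi>[OF g(1) d] lact_\<Phi>[OF right_hom[OF g(1) d] c] ract_\<Phi>[OF F2_hom(2)[OF g(1) c] d]
 by (unfold compose_def, intro arg_cong[of _ _ \<Phi>] restrict_ext) (use l2_mem[OF d] in \<open>simp del: fun_module_simps\<close>) }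
 { fix k assume k: "k : carrier K"
 have kc: "k \<odot> c : \<C>" "k \<odot> \<one> : \<C>" using k c by simp_all
 show "lact c (k \<odot>\<^sub>E m) = k \<odot>\<^sub>E lact c m"
 unfolding g(2) \<Phi>_smult[OF g(1) k] lact_\<Phi>[OF g(1) c] lact_\<Phi>[OF F2_hom(3)[OF g(1) k] c] \<Phi>_smult[OF F2_hom(2)[OF g(1) c] k]
 by (intro arg_cong[of _ _ \<Phi>] restrict_ext) (use c k gc in \<open>simp del: fun_module_simps add: kC.smult_mult_right\<close>)
 show "lact (k \<odot> c) m = k \<odot>\<^sub>E lact c m"
 unfolding g(2) lact_\<Phi>[OF g(1) c] lact_\<Phi>[OF g(1) kc(1)] \<Phi>_smult[OF F2_hom(2)[OF g(1) c] k]
 by (intro arg_cong[of _ _ \<Phi>] restrict_ext) (use c k gc in \<open>simp del: fun_module_simps add: kC.smult_mult_left\<close>)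
 show "ract (k \<odot>\<^sub>E m) c = k \<odot>\<^sub>E ract m c"
 unfolding g(2) \<Phi>_smult[OF g(1) k] ract_\<Phi>[OF g(1) c] ract_\<Phi>[OF F2_hom(3)[OF g(1) k] c] \<Phi>_smult[OF right_hom[OF g(1) c] k]
 by (unfold compose_def, intro arg_cong[of _ _ \<Phi>] restrict_ext) (use l2_mem[OF c] in \<open>simp del: fun_module_simps\<close>)
 have "g (l2 (k \<odot> c) u) = k \<odot> g (l2 c u)" if u: "u : carrier F2" for u
 unfolding l2_smult[OF k c u] hom_act[OF g(1) kc(2) l2_mem[OF c u]] by (rule smult_one_mult[OF k gc[OF l2_mem[OF c u]]])
 thus "ract m (k \<odot> c) = k \<odot>\<^sub>E ract m c"
 unfolding g(2) ract_\<Phi>[OF g(1) c] ract_\<Phi>[OF g(1) kc(1)] \<Phi>_smult[OF right_hom[OF g(1) c] k]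
 by (unfold compose_def, intro arg_cong[of _ _ \<Phi>] restrict_ext) (simp del: fun_module_simps) }
next
 fix m assume m: "m : carrier E"
 from \<Phi>_surj[OF m] obtain g where g: "g : Hom2" "m = \<Phi> g" by blast
 have "(\<lambda>u\<in>carrier F2. \<one> \<otimes> g u) = g" "compose (carrier F2) g (l2 \<one>) = g"
 by (rule extensionalityI[OF restrict_extensional mod_hom_ext[OF g(1)]],
 simp only: restrict_apply' C.l_one hom_closed[OF g(1)])
 (rule extensionalityI[OF compose_extensional mod_hom_ext[OF g(1)]], simp only: compose_eq l2_one)
 thus "lact \<one> m = m" "ract m \<one> = m" unfolding g(2) lact_\<Phi>[OF g(1) C.one_closed] ract_\<Phi>[OF g(1) C.one_closed] by simp_all
qed
text \<open>A test element: in component \<open>r\<close>, the rank one map built from the character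
  at the source and the idempotent at the target of \<open>r\<close>. Evaluating a homomorphism on
  it will give the coefficient belonging to \<open>r\<close>.\<close>

definition ur :: "(('v, 'a) path => 'k) => (('v, 'a) path => 'k) \<times> 'c => 'c"
 where "ur r = pack R (%r' b. if r' = r then cf (rsrc r) b \<odot> ev (rtrg r) else \<zero>)"

lemma ur_val: "[|r' : R; b : \<C>|] ==> ur r (r', b) = (if r' = r then cf (rsrc r) b \<odot> ev (rtrg r) else \<zero>)" by (simp add: ur_def)

lemma ur_mem: assumes r: "r : R" shows "ur r : carrier F2" unfolding ur_def fun_module_simps
proof (rule packI[OF _ F2_c(2)])
 fix r' assume r': "r' : R"
 have "bimap (ev (rsrc r)) (ev (rtrg r)) (%b. cf (rsrc r) b \<odot> ev (rtrg r))"
 by (rule bimapI) (use rsrc(1)[OF r] rtrg(1)[OF r] F2_c(5)[OF r] in \<open>simp_all add: cf_closed cf_add cf_mult cf_smult cf_ev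
 kC.smult_l_distr kC.smult_mult_right[symmetric] kC.smult_assoc1\<close>)
 thus "bimap (ev (rsrc r')) (ev (rtrg r')) (%b. if r' = r then cf (rsrc r) b \<odot> ev (rtrg r) else \<zero>)"
 using bimap_zero[OF F2_c(4)[OF r']] by (cases "r' = r") simp_all
qed

text \<open>The character kills every arrow, so terms of \<open>delta\<close> with a nonempty prefix
  vanish. The leading term carries \<open>dv a r\<close>, which lies in the radical because
  relations have no paths of length below two.\<close>

lemma d2_ur: assumes r: "r : R" and a: "a : arcs Q" and b: "b : \<C>" shows "d2 (ur r) (a, b) : radf 1"
proof -
 have u: "ur r : bimaps R sr tr1" using ur_mem[OF r] by simp
 have "D2 a r' (%b. ur r (r', b)) b : radf 1" if r': "r' : R" for r'
 proof (cases "r' = r")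
 case False
 hence "D2 a r' (%b. ur r (r', b)) b = \<zero>" by (intro D2_zero[OF a r' _ b]) (simp add: ur_val r')
 thus ?thesis using radf_zero by metis
 next
 case True
 let ?w = "%b. ur r (r, b)"
 have wc: "?w b : \<C>" if "b : \<C>" for b using bimaps_closed[OF u r that] .
 have "delta (card V) a (der c r) (%b'. ?w (av c \<otimes> b')) b = \<zero>" if c: "c : arcs Q" for c
 proof (rule delta_zero_fun[OF a der_closed[OF c R_carrier[OF r]] _ b])
 fix b' assume b': "b' : \<C>"
 have ac: "av c : \<C>" by (rule av_corner(1)[OF c])
 have ar: "arr c : \<A>" using c by simp
 have "cf (rsrc r) (av c) = \<zero>\<^sub>K" unfolding cf_\<pi>[OF ar] by (simp add: path_element_def)
 hence "cf (rsrc r) (av c \<otimes> b') = \<zero>\<^sub>K" using cf_mult[OF ac b', of "rsrc r"] cf_closed[OF b', of "rsrc r"] by simp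
 thus "?w (av c \<otimes> b') = \<zero>" using ur_val[OF r C.m_closed[OF ac b'], of r] F2_c(4)[OF r] by (simp add: kC.lmult_0)
 qed
 hence "(\<Oplus>c\<in>arcs Q. delta (card V) a (der c r) (%b'. ?w (av c \<otimes> b')) b) = \<zero>" by (intro C.add.finprod_one_eqI)
 hence e: "D2 a r ?w b = dv a r \<otimes> ?w b" unfolding D2_def using dvR[OF a r] wc[OF b] by simp
 have "r : filt 2" using R_I[OF r] I_filt by blast
 hence "der a r : filt 1" using der_closed[OF a R_carrier[OF r]] by (auto simp: filt_def der_def)
 hence "dv a r : radf 1" unfolding radf_def by (rule imageI)
 thus ?thesis unfolding True e by (rule radf_1_mult_right[OF wc[OF b]])
 qed
 thus ?thesis unfolding d2_apply[OF u a b] by (intro radf_finsum finite_R)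
qed

text \<open>By right linearity and the dual basis of \<open>F1\<close>, a homomorphism sends a
  family with values in the radical into the radical.\<close>

lemma hom_rad: assumes m: "m : mod_hom_set C F1 G0" and r: "r : R" shows "m (d2 (ur r)) : radf 1"
proof -
 let ?u = "d2 (ur r)" and ?e = "unit (arcs Q) ta ha"
 have u: "?u : bimaps (arcs Q) ta ha" using d2_mem[OF ur_mem[OF r]] by simp
 interpret F1: right_module C F1 by (rule F1_module)
 have Bc: "b : \<C>" if "b : B" for b using that B_sub by blast
 have up: "?u p : radf 1" if "p : arcs Q \<times> B" for p using that d2_ur[OF r] Bc by (cases p) simp
 have ec: "?e p : carrier F1" if "p : arcs Q \<times> B" for p
 using unit_mem[OF F1_c(1), of "%a. ev (tail Q a)" "%a. ev (head Q a)" p] F1_c that by simp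
 have x: "?u = (\<Oplus>\<^sub>F1 p\<in>arcs Q \<times> B. ?u p \<odot>\<^sub>F1 ?e p)" by (rule Bim_expand[OF F1_c u])
 have "m ?u = m (\<Oplus>\<^sub>F1 p\<in>arcs Q \<times> B. ?u p \<odot>\<^sub>F1 ?e p)" using x by (rule arg_cong)
 also have "... = (\<Oplus>\<^sub>G0 p\<in>arcs Q \<times> B. m (?u p \<odot>\<^sub>F1 ?e p))"
 by (intro mod_hom_finsum[OF F1_module G0_module m] finite_cartesian_product F1_c(1) finite_B Pi_I F1.act_closed radf_carrier[OF up] ec)
 also have "... = (\<Oplus>p\<in>arcs Q \<times> B. m (?u p \<odot>\<^sub>F1 ?e p))" by (rule finsum_regular[OF C.ring_axioms])
 also have "... : radf 1"
 proof (rule radf_finsum)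
 show "m (?u p \<odot>\<^sub>F1 ?e p) : radf 1" if p: "p : arcs Q \<times> B" for p unfolding hom_act[OF m radf_carrier[OF up[OF p]] ec[OF p]]
 by (rule radf_1_mult_left[OF hom_closed[OF m ec[OF p]] up[OF p]])
 qed (use F1_c(1) finite_B in simp)
 finally show ?thesis .
qed

text \<open>Representatives of one class differ by coboundary and homotopy terms. All of these
  factor through \<open>d2\<close>, so on \<open>ur r\<close> they take values in the radical and do
  not affect the coefficient.\<close>

lemma \<Phi>_coefficient:
 assumes g: "g : Hom2" "g' : Hom2" and e: "\<Phi> g = \<Phi> g'" and r: "r : R" and x: "x : V" shows "cf x (g (ur r)) = cf x (g' (ur r))"
proof -
 obtain h where h: "h : mod_hom_set C F1 F2"
 "!!u. u : carrier F2 ==> d2 (compose (carrier F2) \<b>2 \<a>2 u) = d2 ((\<lambda>x\<in>carrier F2. x) u \<oplus>\<^sub>F2 h (d2 u))"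
 proof (rule homotopy[OF F_three F0_dual F1_dual F_exact hom_compose[OF F0_module \<a>(1) \<b>(1)] hom_compose[OF F1_module \<a>(2) \<b>(2)]
 hom_compose[OF F2_module \<a>(3) \<b>(3)] mod_hom_id[OF F0_module] mod_hom_id[OF F1_module] mod_hom_id[OF F2_module]])
 show "aug (compose (carrier F0) \<b>0 \<a>0 x) = aug ((\<lambda>x\<in>carrier F0. x) x)" if "x : carrier F0" for x
 using that by (simp only: compose_eq restrict_apply' \<b>_aug[OF \<a>_mem(1)] \<a>_aug)
 show "d1 (compose (carrier F1) \<b>1 \<a>1 x) = compose (carrier F0) \<b>0 \<a>0 (d1 x)" if "x : carrier F1" for x
 using that by (simp only: compose_eq d1_mem \<b>_d1[OF \<a>_mem(2)] \<a>_d1)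
 show "d2 (compose (carrier F2) \<b>2 \<a>2 x) = compose (carrier F1) \<b>1 \<a>1 (d2 x)" if "x : carrier F2" for x
 using that by (simp only: compose_eq d2_mem \<b>_d2[OF \<a>_mem(3)] \<a>_d2)
 show "d1 ((\<lambda>x\<in>carrier F1. x) x) = (\<lambda>x\<in>carrier F0. x) (d1 x)" if "x : carrier F1" for x using that by (simp only: restrict_apply' d1_mem)
 show "d2 ((\<lambda>x\<in>carrier F2. x) x) = (\<lambda>x\<in>carrier F1. x) (d2 x)" if "x : carrier F2" for x using that by (simp only: restrict_apply' d2_mem)
 qed (use that in blast)
 note u = ur_mem[OF r] and du = d2_mem[OF ur_mem[OF r]]
 have hu: "h (d2 (ur r)) : carrier F2" by (rule mod_hom_closed[OF h(1) du])
 have au: "\<a>2 (ur r) : carrier (T 2)" by (rule \<a>_mem(3)[OF u])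
 have ba: "\<b>2 (\<a>2 (ur r)) = ur r \<oplus>\<^sub>F2 h (d2 (ur r))"
 by (rule d2_inj[OF \<b>2_mem[OF au] F2.M.a_closed[OF u hu]]) (use h(2)[OF u] u in \<open>simp only: compose_eq restrict_apply'\<close>)
 have "cls (compose (carrier (T 2)) g \<b>2) = cls (compose (carrier (T 2)) g' \<b>2)" using e by (simp add: \<Phi>_def)
 then obtain k where k: "k : mod_hom_set C (T 1) G0"
 "!!x. x : carrier (T 2) ==> compose (carrier (T 2)) g \<b>2 x = k (bd 1 x) \<oplus>\<^sub>C compose (carrier (T 2)) g' \<b>2 x"
 using cls_eqD[OF \<Phi>_Z[OF g(2)] \<Phi>_Z[OF g(1)]] by blast
 have "g (\<b>2 (\<a>2 (ur r))) = k (\<a>1 (d2 (ur r))) \<oplus>\<^sub>C g' (\<b>2 (\<a>2 (ur r)))"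
 using k(2)[OF au] au by (simp only: compose_eq \<a>_d2[OF u])
 hence eq: "g (ur r) \<oplus>\<^sub>C g (h (d2 (ur r))) = k (\<a>1 (d2 (ur r))) \<oplus>\<^sub>C (g' (ur r) \<oplus>\<^sub>C g' (h (d2 (ur r))))"
 unfolding ba hom_add[OF g(1) u hu] hom_add[OF g(2) u hu] .
 have rad: "g (h (d2 (ur r))) : radf 1" "g' (h (d2 (ur r))) : radf 1" "k (\<a>1 (d2 (ur r))) : radf 1"
 using hom_rad[OF hom_compose[OF F1_module h(1) g(1)] r] hom_rad[OF hom_compose[OF F1_module h(1) g(2)] r]
 hom_rad[OF hom_compose[OF F1_module \<a>(2) k(1)] r] by (simp_all only: compose_eq[OF du])
 have z: "cf x c = \<zero>\<^sub>K" if "c : radf 1" for c using radf_1_iff[OF radf_carrier[OF that]] that x by blast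
 note gu = hom_closed[OF g(1) u] hom_closed[OF g(2) u]
 from arg_cong[OF eq, of "cf x"] show ?thesis using gu radf_carrier[OF rad(1)] radf_carrier[OF rad(2)] radf_carrier[OF rad(3)]
 by (simp add: cf_add z[OF rad(1)] z[OF rad(2)] z[OF rad(3)] cf_closed)
qed
definition \<tau> :: "(('v, 'a) path => 'k) => ('p => 'c) set => 'k"
 where "\<tau> r m = cf (rtrg r) ((SOME g. g : Hom2 & \<Phi> g = m) (ur r))"

lemma \<tau>_\<Phi>: assumes g: "g : Hom2" and r: "r : R" shows "\<tau> r (\<Phi> g) = cf (rtrg r) (g (ur r))"
proof -
 have "(SOME g'. g' : Hom2 & \<Phi> g' = \<Phi> g) : Hom2 & \<Phi> (SOME g'. g' : Hom2 & \<Phi> g' = \<Phi> g) = \<Phi> g"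
 by (rule someI[of "%g'. g' : Hom2 & \<Phi> g' = \<Phi> g" g]) (use g in blast)
 thus ?thesis unfolding \<tau>_def using \<Phi>_coefficient[OF _ g _ r rtrg(1)[OF r]] by blast
qed

text \<open>Both actions reach \<open>\<tau> r\<close> through characters of \<open>C\<close>, so
  \<open>\<tau> r\<close> vanishes on products with the radical from either side. For the right
  action the reason is that \<open>l2 c\<close> scales \<open>ur r\<close> by the character at the
  source.\<close>

lemma
 assumes r: "r : R" and m: "m : carrier E" shows \<tau>_closed: "\<tau> r m : carrier K"
 and \<tau>_add: "m' : carrier E ==> \<tau> r (m \<oplus>\<^sub>E m') = \<tau> r m \<oplus>\<^sub>K \<tau> r m'"
 and \<tau>_smult: "k : carrier K ==> \<tau> r (k \<odot>\<^sub>E m) = k \<otimes>\<^sub>K \<tau> r m"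
 and \<tau>_lact: "c : \<C> ==> \<tau> r (lact c m) = cf (rtrg r) c \<otimes>\<^sub>K \<tau> r m"
 and \<tau>_ract: "c : \<C> ==> \<tau> r (ract m c) = cf (rsrc r) c \<otimes>\<^sub>K \<tau> r m"
proof -
 from \<Phi>_surj[OF m] obtain g where g: "g : Hom2" "m = \<Phi> g" by blast
 note u = ur_mem[OF r] and gc = hom_closed[OF g(1) ur_mem[OF r]]
 show "\<tau> r m : carrier K" unfolding g(2) \<tau>_\<Phi>[OF g(1) r] by (rule cf_closed[OF gc])
 show "\<tau> r (m \<oplus>\<^sub>E m') = \<tau> r m \<oplus>\<^sub>K \<tau> r m'" if "m' : carrier E"
 proof -
 from \<Phi>_surj[OF that] obtain g' where g': "g' : Hom2" "m' = \<Phi> g'" by blast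
 show ?thesis unfolding g(2) g'(2) \<Phi>_add[OF g(1) g'(1)] \<tau>_\<Phi>[OF g(1) r] \<tau>_\<Phi>[OF g'(1) r] \<tau>_\<Phi>[OF F2_hom(1)[OF g(1) g'(1)] r] restrict_apply'[OF u]
 by (rule cf_add[OF gc hom_closed[OF g'(1) u]])
 qed
 show "\<tau> r (k \<odot>\<^sub>E m) = k \<otimes>\<^sub>K \<tau> r m" if k: "k : carrier K"
 unfolding g(2) \<Phi>_smult[OF g(1) k] \<tau>_\<Phi>[OF g(1) r] \<tau>_\<Phi>[OF F2_hom(3)[OF g(1) k] r] restrict_apply'[OF u] by (rule cf_smult[OF k gc])
 show "\<tau> r (lact c m) = cf (rtrg r) c \<otimes>\<^sub>K \<tau> r m" if c: "c : \<C>"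
 unfolding g(2) lact_\<Phi>[OF g(1) c] \<tau>_\<Phi>[OF g(1) r] \<tau>_\<Phi>[OF F2_hom(2)[OF g(1) c] r] restrict_apply'[OF u] by (rule cf_mult[OF c gc])
 show "\<tau> r (ract m c) = cf (rsrc r) c \<otimes>\<^sub>K \<tau> r m" if c: "c : \<C>"
 proof -
 have k: "cf (rsrc r) c : carrier K" by (rule cf_closed[OF c])
 have k1: "cf (rsrc r) c \<odot> \<one> : \<C>" using k by simp
 have "l2 c (ur r) = (cf (rsrc r) c \<odot> \<one>) \<odot>\<^sub>F2 ur r"
 proof (rule F2_eqI[OF l2_mem[OF c u] F2.act_closed[OF k1 u]])
 fix r' b assume r': "r' : R" and b: "b : \<C>"
 have kb: "cf (rsrc r) b : carrier K" by (rule cf_closed[OF b])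
 show "l2 c (ur r) (r', b) = ((cf (rsrc r) c \<odot> \<one>) \<odot>\<^sub>F2 ur r) (r', b)"
 unfolding F2_act_val[OF r' b] l2_val[OF u r' b] ur_val[OF r' b] ur_val[OF r' C.m_closed[OF b c]] cf_mult[OF b c]
 K.m_comm[OF kb k] using smult_one_mult[OF k kC.smult_closed[OF kb F2_c(4)[OF r]]] kC.smult_assoc1[OF k kb F2_c(4)[OF r]] k1 by simp
 qed
 hence "g (l2 c (ur r)) = cf (rsrc r) c \<odot> g (ur r)" using hom_act[OF g(1) k1 u] smult_one_mult[OF k gc] by metis
 thus ?thesis
 unfolding g(2) ract_\<Phi>[OF g(1) c] \<tau>_\<Phi>[OF g(1) r] \<tau>_\<Phi>[OF right_hom[OF g(1) c] r] compose_eq[OF u] using cf_smult[OF k gc] by metis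
 qed
qed
text \<open>Evaluation of the component \<open>r\<close> at the idempotent of its source; the class
  of this homomorphism is the generator attached to \<open>r\<close>.\<close>

definition gr :: "(('v, 'a) path => 'k) => ((('v, 'a) path => 'k) \<times> 'c => 'c) => 'c"
 where "gr r = (\<lambda>u\<in>carrier F2. u (r, ev (rsrc r)))"
definition \<rho> where "\<rho> r = \<Phi> (gr r)"

lemma gr_hom: assumes r: "r : R" shows "gr r : Hom2" unfolding gr_def
proof (rule mod_hom_restrictI[OF F2_module])
 show "u (r, ev (rsrc r)) : carrier G0" if "u : carrier F2" for u using F2_val[OF that r F2_c(2)[OF r]] by simp
qed (use F2_add_val[OF r F2_c(2)[OF r]] F2_act_val[OF r F2_c(2)[OF r]] in \<open>simp_all del: fun_module_simps\<close>)

lemma \<rho>_closed: "r : R ==> \<rho> r : carrier E" unfolding \<rho>_def by (intro \<Phi>_closed gr_hom)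

text \<open>Acting from the right moves the point of evaluation from the idempotent to
  \<open>b\<close>, so the class of every evaluation in component \<open>r\<close> lies in the
  bimodule generated by \<open>\<rho> r\<close>.\<close>

lemma gr_right: assumes r: "r : R" and b: "b : \<C>" shows "compose (carrier F2) (gr r) (l2 b) = (\<lambda>u\<in>carrier F2. u (r, b))" unfolding compose_def
proof (rule restrict_ext)
 fix u assume u: "u : carrier F2"
 have "gr r (l2 b u) = u (r, ev (rsrc r) \<otimes> b)" unfolding gr_def restrict_apply'[OF l2_mem[OF b u]] by (rule l2_val[OF u r F2_c(2)[OF r]])
 thus "gr r (l2 b u) = u (r, b)" unfolding bimap_source[OF F2_bimap[OF u r] b] .
qed

text \<open>Values in component \<open>r\<close> are fixed by the target idempotent. Together with
  \<open>\<rho>_source\<close> this shows that the new arrow runs against the relation, from its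
  target to its source.\<close>

lemma \<rho>_target: "r : R ==> lact (ev (rtrg r)) (\<rho> r) = \<rho> r" unfolding \<rho>_def lact_\<Phi>[OF gr_hom F2_c(4)]
 by (intro arg_cong[of _ _ \<Phi>], subst gr_def, subst gr_def, intro restrict_ext)
 (simp only: restrict_apply' bimap_target[OF F2_bimap] F2_c(2))

lemma \<rho>_source: "r : R ==> ract (\<rho> r) (ev (rsrc r)) = \<rho> r"
 unfolding \<rho>_def ract_\<Phi>[OF gr_hom F2_c(2)] gr_right[OF _ F2_c(2)] by (simp only: gr_def)

lemma \<tau>_\<rho>: assumes r: "r : R" and r': "r' : R" shows "\<tau> r (\<rho> r') = (if r = r' then \<one>\<^sub>K else \<zero>\<^sub>K)"
proof -
 have "\<tau> r (\<rho> r') = cf (rtrg r) (ur r (r', ev (rsrc r')))"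
 unfolding \<rho>_def \<tau>_\<Phi>[OF gr_hom[OF r'] r] by (subst gr_def) (simp only: restrict_apply'[OF ur_mem[OF r]])
 thus ?thesis unfolding ur_val[OF r' F2_c(2)[OF r']] using rsrc(1)[OF r'] rtrg(1)[OF r'] by (auto simp: cf_ev cf_smult cf_zero)
qed

text \<open>The dual basis of \<open>F2\<close> writes a homomorphism as a sum of
  \<open>g (unit p)\<close> times evaluation at \<open>p\<close>, and evaluation at
  \<open>(r, b)\<close> has class \<open>\<rho> r\<close> acted on by \<open>b\<close> from the
  right. Generation is phrased as an induction rule to match
  \<open>dim_arrow_space_generated\<close>.\<close>

lemma E_span:
 assumes m: "m : carrier E" and 0: "S \<zero>\<^sub>E" and gen: "!!r c b. [|r : R; c : \<C>; b : B|] ==> S (lact c (ract (\<rho> r) b))"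
 and plus: "!!m m'. [|m : carrier E; m' : carrier E; S m; S m'|] ==> S (m \<oplus>\<^sub>E m')" shows "S m"
proof -
 from \<Phi>_surj[OF m] obtain g where g: "g : Hom2" "m = \<Phi> g" by blast
 let ?e = "unit R sr tr1"
 have Bc: "b : \<C>" if "b : B" for b using that B_sub by blast
 have ec: "?e p : carrier F2" if "p : R \<times> B" for p using unit_mem[OF F2_c(1), of "%r. ev (rsrc r)" "%r. ev (rtrg r)" p] F2_c that by simp
 have up: "u p : \<C>" if "u : carrier F2" "p : R \<times> B" for u p using F2_val[OF that(1)] that(2) Bc by (cases p) simp
 have gu: "g (?e p) : \<C>" if "p : R \<times> B" for p by (rule hom_closed[OF g(1) ec[OF that]])
 let ?g = "%D. \<lambda>u\<in>carrier F2. \<Oplus>p\<in>D. g (?e p) \<otimes> u p"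
 have "?g D : Hom2 & S (\<Phi> (?g D))" if "finite D" "D \<subseteq> R \<times> B" for D using that
 proof (induction D rule: finite_induct)
 case empty
 define z where "z = (\<lambda>u\<in>carrier F2. \<zero>)"
 have z: "z : Hom2" unfolding z_def by (rule zero_hom[OF F2_module])
 have "(\<lambda>u\<in>carrier F2. z u \<oplus>\<^sub>C z u) = z" unfolding z_def by (intro restrict_ext) (simp only: restrict_apply' C.r_zero C.zero_closed)
 hence "\<Phi> z \<oplus>\<^sub>E \<Phi> z = \<Phi> z" using \<Phi>_add[OF z z] by metis
 hence "\<Phi> z = \<zero>\<^sub>E" using \<Phi>_closed[OF z] by (metis E.M.add.l_cancel_one')
 moreover have "?g {} = z" unfolding z_def by (intro restrict_ext) (rule C.finsum_empty)
 ultimately show ?case using 0 z by metis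
 next
 case (insert p D)
 hence p: "p : R \<times> B" and D: "D \<subseteq> R \<times> B" by auto
 note IH = conjunct1[OF insert.IH[OF D]] conjunct2[OF insert.IH[OF D]]
 obtain r b where rb: "p = (r, b)" "r : R" "b : B" using p by blast
 have h: "compose (carrier F2) (gr r) (l2 b) : Hom2" by (rule right_hom[OF gr_hom[OF rb(2)] Bc[OF rb(3)]])
 have e1: "\<Phi> (\<lambda>u\<in>carrier F2. g (?e p) \<otimes> compose (carrier F2) (gr r) (l2 b) u) = lact (g (?e p)) (ract (\<rho> r) b)"
 unfolding \<rho>_def ract_\<Phi>[OF gr_hom[OF rb(2)] Bc[OF rb(3)]] lact_\<Phi>[OF h gu[OF p]] ..
 have e2: "(\<lambda>u\<in>carrier F2. g (?e p) \<otimes> compose (carrier F2) (gr r) (l2 b) u) = (\<lambda>u\<in>carrier F2. g (?e p) \<otimes> u p)"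
 unfolding gr_right[OF rb(2) Bc[OF rb(3)]] by (intro restrict_ext) (simp only: restrict_apply' rb(1))
 have S1: "S (\<Phi> (\<lambda>u\<in>carrier F2. g (?e p) \<otimes> u p))" using gen[OF rb(2) gu[OF p] rb(3)] unfolding e1[symmetric] e2 .
 have h1: "(\<lambda>u\<in>carrier F2. g (?e p) \<otimes> u p) : Hom2" using F2_hom(2)[OF h gu[OF p]] unfolding e2 .
 have e3: "?g (insert p D) = (\<lambda>u\<in>carrier F2. (\<lambda>u\<in>carrier F2. g (?e p) \<otimes> u p) u \<oplus>\<^sub>C ?g D u)"
 proof (rule restrict_ext)
 fix u assume u: "u : carrier F2"
 have "(\<Oplus>p\<in>insert p D. g (?e p) \<otimes> u p) = g (?e p) \<otimes> u p \<oplus>\<^sub>C (\<Oplus>p\<in>D. g (?e p) \<otimes> u p)"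
 using insert.hyps D p gu up[OF u] by (intro C.finsum_insert Pi_I C.m_closed) blast+
 thus "(\<Oplus>p\<in>insert p D. g (?e p) \<otimes> u p) = (\<lambda>u\<in>carrier F2. g (?e p) \<otimes> u p) u \<oplus>\<^sub>C ?g D u"
 by (simp only: restrict_apply'[OF u])
 qed
 show ?case unfolding e3 \<Phi>_add[OF h1 IH(1), symmetric] by (intro conjI F2_hom(1)[OF h1 IH(1)] plus[OF \<Phi>_closed[OF h1] \<Phi>_closed[OF IH(1)] S1 IH(2)])
 qed
 hence S: "S (\<Phi> (?g (R \<times> B)))" using finite_cartesian_product[OF finite_R finite_B] subset_refl by blast
 have "?g (R \<times> B) = g"
 proof (rule extensionalityI[of _ "carrier F2"])
 fix u assume u: "u : carrier F2"
 have x: "u = (\<Oplus>\<^sub>F2 p\<in>R \<times> B. u p \<odot>\<^sub>F2 ?e p)" by (rule Bim_expand[OF F2_c]) (use u in simp_all)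
 have "g u = g (\<Oplus>\<^sub>F2 p\<in>R \<times> B. u p \<odot>\<^sub>F2 ?e p)" using x by (rule arg_cong)
 also have "... = (\<Oplus>\<^sub>G0 p\<in>R \<times> B. g (u p \<odot>\<^sub>F2 ?e p))"
 by (intro mod_hom_finsum[OF F2_module G0_module g(1)] finite_cartesian_product finite_R finite_B Pi_I F2.act_closed up[OF u] ec)
 also have "... = (\<Oplus>p\<in>R \<times> B. g (u p \<odot>\<^sub>F2 ?e p))" by (rule finsum_regular[OF C.ring_axioms])
 also have "... = (\<Oplus>p\<in>R \<times> B. g (?e p) \<otimes> u p)" by (intro C.finsum_cong'[OF refl] Pi_I C.m_closed gu up[OF u] hom_act[OF g(1) up[OF u] ec])
 finally show "?g (R \<times> B) u = g u" unfolding restrict_apply'[OF u] by (rule sym)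
 qed (simp_all only: restrict_extensional mod_hom_ext[OF g(1)])
 thus ?thesis using S g(2) by metis
qed
end
section \<open>The quiver of the relation extension\<close>

lemma fin_digraph_add_arrows:
 assumes "fin_digraph Q" shows "fin_digraph (add_arrows Q n)"
proof -
 interpret fin_digraph Q by fact
 have "{Inr (x, y, i) | x y i. x : verts Q & y : verts Q & i < n x y}
 \<subseteq> Inr ` (SIGMA x:verts Q. SIGMA y:verts Q. {..<n x y})" by auto
 hence f: "finite {Inr (x, y, i) | x y i. x : verts Q & y : verts Q & i < n x y}" by (rule finite_subset) auto
 show ?thesis by unfold_locales (use f in \<open>auto simp: add_arrows_def\<close>)
qed

lemma card_arrows_add_arrows:
 fixes Q :: "('a, 'b) pre_digraph"
 assumes "fin_digraph Q" "x : verts Q" "y : verts Q" shows "card (arrows (add_arrows Q n) x y) = card (arrows Q x y) + n x y"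
proof -
 interpret fin_digraph Q by fact
 have "arrows (add_arrows Q n) x y = Inl ` arrows Q x y \<union> (%i. Inr (x, y, i)) ` {..<n x y}" using assms(2,3) by (auto simp: arrows_def add_arrows_def)
 moreover have "finite (arrows Q x y)" by (simp add: arrows_def)
 moreover have "Inl ` arrows Q x y \<inter> (%i. Inr (x, y, i)) ` {..<n x y} = {}" by auto
 moreover have "card (Inl ` arrows Q x y :: ('b + 'a \<times> 'a \<times> nat) set) = card (arrows Q x y)"
 "card ((%i. Inr (x, y, i) :: 'b + 'a \<times> 'a \<times> nat) ` {..<n x y}) = n x y" by (simp_all add: card_image inj_on_def)
 ultimately show ?thesis by (simp add: card_Un_disjoint)
qed

context relation_extension_frame
begin
interpretation K: field K by (rule field_K)
interpretation Q: fin_digraph Q by (rule fin_Q)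
interpretation A: ring "path_algebra K Q" by (rule ring_A)
interpretation kA: kalgebra K A by (rule kalgebra_A)
interpretation C: ring C by (rule kalgebraD(2)[OF kalgebra_C])
interpretation kC: kalgebra K C by (rule kalgebra_C)
interpretation E: module K E by (rule module_E)
interpretation BM: bimodule_algebra K C E lact ract by (rule bimodule)
abbreviation "RE == relation_extension C P"

lemma RE_eq: "RE = trivial_extension C E lact ract" by (simp add: relation_extension_def)

lemmas RE_simps = BM.TE_simps[folded RE_eq]
lemmas kalgebra_RE = BM.kalgebra_TE[folded RE_eq]
interpretation RE: ring RE by (rule kalgebraD(2)[OF kalgebra_RE])

text \<open>The characters of \<open>C\<close> are composed with the projection to \<open>C\<close>;
  elements in their common kernel are nilpotent by \<open>nil_radf\<close> and
  \<open>nil_TE\<close>.\<close>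

lemma split_nil_RE: "split_nil_algebra K RE V (%x. (ev x, \<zero>\<^sub>E)) (%x a. cf x (fst a))"
proof (rule split_nil_algebra.intro)
 show "finsum RE (%x. (ev x, \<zero>\<^sub>E)) V = \<one>\<^sub>RE"
 using BM.TE_finsum[folded RE_eq, of V ev] F0_c(1,2) by (simp add: RE_simps ev_sum)
 show "\<exists>k::nat. a [^]\<^bsub>RE\<^esub> k = \<zero>\<^sub>RE" if a: "a : carrier RE" "!!x. x : V ==> cf x (fst a) = \<zero>\<^sub>K" for a
 proof -
 obtain c m where cm: "a = (c, m)" "c : \<C>" using a(1) by (auto simp: RE_simps)
 hence "c : radf 1" using a(2) radf_1_iff by auto
 thus ?thesis using nil_radf BM.nil_TE[folded RE_eq] a(1) unfolding cm(1) by blast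
 qed
qed (auto simp: kalgebra_RE RE_simps ev_mult BM.lact_zero BM.ract_zero cf_closed cf_add cf_mult cf_smult cf_ev)
interpretation S: split_nil_algebra K RE V "%x. (ev x, \<zero>\<^sub>E)" "%x a. cf x (fst a)" by (rule split_nil_RE)

lemma N_iff: "(c, m) : S.N \<longleftrightarrow> c : radf 1 & m : carrier E" using radf_1_iff radf_carrier by (auto simp: S.N_def RE_simps simp del: One_nat_def)
text \<open>The coefficient of an element of \<open>C\<close> at the arrow \<open>a\<close>,
  independent of the preimage because elements of \<open>I\<close> have no terms of length below
  two.\<close>

definition ac :: "'a => 'c => 'k" where "ac a c = pre c (tail Q a, [a])"

lemma ac_\<pi>: assumes f: "f : \<A>" shows "ac a (\<pi> f) = f (tail Q a, [a])"
proof -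
 let ?g = "pre (\<pi> f)"
 have g: "?g : \<A>" "\<pi> ?g = \<pi> f" using pre[of "\<pi> f"] f by auto
 have "\<pi> (?g \<ominus>\<^sub>A f) = \<zero>" using f g by (simp add: a_minus_def \<pi>_add \<pi>_neg C.r_neg)
 hence "?g \<ominus>\<^sub>A f : filt 2" using \<pi>_ker[of "?g \<ominus>\<^sub>A f"] f g I_filt by auto
 hence "(?g \<ominus>\<^sub>A f) (tail Q a, [a]) = \<zero>\<^sub>K" by (simp add: filt_def)
 hence "?g (tail Q a, [a]) \<ominus>\<^sub>K f (tail Q a, [a]) = \<zero>\<^sub>K" using f by (simp add: A_simps a_minus_def A_neg)
 thus ?thesis using A_val[OF f] A_val[OF g(1)] by (simp add: ac_def)
qed

lemma
 assumes c: "c : \<C>" shows ac_closed: "ac a c : carrier K"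
 and ac_add: "d : \<C> ==> ac a (c \<oplus>\<^sub>C d) = ac a c \<oplus>\<^sub>K ac a d"
 and ac_smult: "k : carrier K ==> ac a (k \<odot> c) = k \<otimes>\<^sub>K ac a c"
proof -
 note p = pre[OF c]
 show "ac a c : carrier K" unfolding ac_def by (rule A_val[OF p(1)])
 show "ac a (c \<oplus>\<^sub>C d) = ac a c \<oplus>\<^sub>K ac a d" if d: "d : \<C>"
 using ac_\<pi>[of "pre c \<oplus>\<^sub>A pre d" a] p pre[OF d] by (simp add: \<pi>_add A_simps ac_def[of a c] ac_def[of a d])
 show "ac a (k \<odot> c) = k \<otimes>\<^sub>K ac a c" if k: "k : carrier K"
 using ac_\<pi>[of "k \<odot>\<^sub>A pre c" a] p k by (simp add: \<pi>_smult A_simps ac_def[of a c])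
qed

lemma ac_prod: assumes "c : radf 1" "d : radf 1" shows "ac a (c \<otimes> d) = \<zero>\<^sub>K"
proof -
 have "c \<otimes> d : radf 2" using radf_mult[OF assms] by (simp add: numeral_2_eq_2)
 then obtain f where f: "f : filt 2" "c \<otimes> d = \<pi> f" by (auto simp: radf_def)
 show ?thesis unfolding f(2) ac_\<pi>[OF filt_carrier[OF f(1)]] using f(1) by (simp add: filt_def)
qed

lemma ac_av: "[|a : arcs Q; a' : arcs Q|] ==> ac a (av a') = (if a = a' then \<one>\<^sub>K else \<zero>\<^sub>K)"
 using ac_\<pi>[of "arr a'" a] by simp (auto simp: path_element_def)

lemma RE_split: "[|c : \<C>; m : carrier E|] ==> (c, m) = (c, \<zero>\<^sub>E) \<oplus>\<^sub>RE (\<zero>, m)" by (simp add: RE_simps)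

lemma RE_sandwich: "[|c : \<C>; m : carrier E; b : \<C>|] ==>
 (\<zero>, lact c (ract m b)) = (c, \<zero>\<^sub>E) \<otimes>\<^sub>RE (\<zero>, m) \<otimes>\<^sub>RE (b, \<zero>\<^sub>E)"
 by (simp add: RE_simps BM.lact_zero BM.ract_zero BM.zero_lact BM.zero_ract BM.lact_closed BM.ract_closed BM.lact_ract)

text \<open>The radical consists of the radical of \<open>C\<close> and the whole bimodule: the
  former is generated by arrows through \<open>expand_rad\<close>, the latter by the classes of
  relations through \<open>E_span\<close>.\<close>

lemma N_generated:
 assumes a: "a : S.N" and 0: "U \<zero>\<^sub>RE"
 and arrow: "!!a x y. [|a : arcs Q; x : carrier RE; y : carrier RE|] ==> U (x \<otimes>\<^sub>RE (av a, \<zero>\<^sub>E) \<otimes>\<^sub>RE y)"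
 and relation: "!!r x y. [|r : R; x : carrier RE; y : carrier RE|] ==> U (x \<otimes>\<^sub>RE (\<zero>, \<rho> r) \<otimes>\<^sub>RE y)"
 and plus: "!!a b. [|a : S.N; b : S.N; U a; U b|] ==> U (a \<oplus>\<^sub>RE b)" shows "U a"
proof -
 obtain c m where cm: "a = (c, m)" "c : radf 1" "m : carrier E" using a N_iff by (metis surj_pair)
 have cc: "c : \<C>" by (rule radf_carrier[OF cm(2)])
 have t: "av a \<otimes> dv a (pre c) : radf 1" "dv a (pre c) : \<C>" if a: "a : arcs Q" for a
 using radf_1_mult_right[OF dv_corner(1)[OF a pre(1)[OF cc]] av_radf[OF a]] dv_corner(1)[OF a pre(1)[OF cc]] by simp_all
 have "(\<Oplus>a\<in>D. av a \<otimes> dv a (pre c)) : radf 1 & U (\<Oplus>a\<in>D. av a \<otimes> dv a (pre c), \<zero>\<^sub>E)" if "finite D" "D \<subseteq> arcs Q" for D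
 using that
 proof (induction D rule: finite_induct)
 case empty thus ?case using 0 radf_zero by (simp add: RE_simps)
 next
 case (insert a D)
 hence a: "a : arcs Q" and D: "D \<subseteq> arcs Q" by auto
 have cl: "(%a. av a \<otimes> dv a (pre c)) : D \<rightarrow> \<C>" "av a \<otimes> dv a (pre c) : \<C>"
 using radf_carrier[OF t(1)] a D by auto
 have "(av a \<otimes> dv a (pre c), \<zero>\<^sub>E) = \<one>\<^sub>RE \<otimes>\<^sub>RE (av a, \<zero>\<^sub>E) \<otimes>\<^sub>RE (dv a (pre c), \<zero>\<^sub>E)"
 using av_corner(1)[OF a] t(2)[OF a] by (simp add: RE_simps BM.lact_zero BM.ract_zero)
 moreover have "U (\<one>\<^sub>RE \<otimes>\<^sub>RE (av a, \<zero>\<^sub>E) \<otimes>\<^sub>RE (dv a (pre c), \<zero>\<^sub>E))"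
 by (rule arrow[OF a RE.one_closed]) (simp add: RE_simps t(2)[OF a])
 ultimately have U: "U (av a \<otimes> dv a (pre c), \<zero>\<^sub>E)" by simp
 have IH: "(\<Oplus>a\<in>D. av a \<otimes> dv a (pre c)) : radf 1" "U (\<Oplus>a\<in>D. av a \<otimes> dv a (pre c), \<zero>\<^sub>E)"
 using insert.IH D by auto
 have s: "(\<Oplus>a\<in>insert a D. av a \<otimes> dv a (pre c)) = av a \<otimes> dv a (pre c) \<oplus>\<^sub>C (\<Oplus>a\<in>D. av a \<otimes> dv a (pre c))"
 by (rule C.finsum_insert[OF insert.hyps cl])
 have "U ((av a \<otimes> dv a (pre c), \<zero>\<^sub>E) \<oplus>\<^sub>RE (\<Oplus>a\<in>D. av a \<otimes> dv a (pre c), \<zero>\<^sub>E))"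
 by (rule plus[OF _ _ U IH(2)]) (simp_all only: N_iff t(1)[OF a] IH(1) E.M.zero_closed simp_thms)
 thus ?case unfolding s using radf_add[OF t(1)[OF a] IH(1)] by (simp add: RE_simps)
 qed
 from this[OF Q.finite_arcs subset_refl] have 1: "U (c, \<zero>\<^sub>E)" unfolding expand_rad[OF cm(2)] by blast
 have 2: "U (\<zero>, m)"
 proof (rule E_span[OF cm(3), where S = "%m. U (\<zero>, m)"])
 show "U (\<zero>, \<zero>\<^sub>E)" using 0 by (simp add: RE_simps)
 show "U (\<zero>, lact c (ract (\<rho> r) b))" if "r : R" "c : \<C>" "b : B" for r c b
 proof -
 have b: "b : \<C>" using that(3) B_sub by blast
 show ?thesis unfolding RE_sandwich[OF that(2) \<rho>_closed[OF that(1)] b] by (rule relation[OF that(1)]) (use that(2) b in \<open>simp_all add: RE_simps\<close>)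
 qed
 show "U (\<zero>, m \<oplus>\<^sub>E m')" if "m : carrier E" "m' : carrier E" "U (\<zero>, m)" "U (\<zero>, m')" for m m'
 using plus[OF _ _ that(3,4)] that(1,2) radf_zero by (simp add: N_iff RE_simps del: One_nat_def)
 qed
 show ?thesis unfolding cm(1) RE_split[OF cc cm(3)] by (rule plus[OF _ _ 1 2]) (simp_all only: N_iff cm(2,3) radf_zero E.M.zero_closed simp_thms)
qed

text \<open>The basis criterion is applied to the arrows of \<open>C\<close> and the classes of
  relations, with the functionals \<open>ac\<close> and \<open>\<tau>\<close>. A relation is counted
  from its target to its source.\<close>

lemma dim_RE:
 assumes xy: "x : V" "y : V"
 shows "vectorspace.dim K (arrow_space RE (ev x, \<zero>\<^sub>E) (ev y, \<zero>\<^sub>E)) = card (arrows Q x y) + card {r : R. rtrg r = x & rsrc r = y}"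
proof -
 let ?S = "Inl ` arcs Q \<union> Inr ` R"
 let ?n = "case_sum (%a. (av a, \<zero>\<^sub>E)) (%r. (\<zero>, \<rho> r))"
 let ?src = "case_sum (tail Q) rtrg" and ?trg = "case_sum (head Q) rsrc"
 let ?\<chi> = "case_sum (%a x. ac a (fst x)) (%r x. \<tau> r (snd x))"
 have S_cases: "U i" if "i : ?S" "!!a. a : arcs Q ==> U (Inl a)" "!!r. r : R ==> U (Inr r)" for U i using that by blast
 have N_cases: "U a" if "a : S.N" "!!c m. [|c : radf 1; c : \<C>; m : carrier E|] ==> U (c, m)" for U a
 using that N_iff radf_carrier by (metis surj_pair)
 have cf0: "cf x c = \<zero>\<^sub>K" if "c : radf 1" "x : V" for x c using radf_1_iff[OF radf_carrier[OF that(1)]] that by blast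
 have "vectorspace.dim K (arrow_space RE (ev x, \<zero>\<^sub>E) (ev y, \<zero>\<^sub>E)) = card {i : ?S. ?src i = x & ?trg i = y}"
 proof (rule S.dim_arrow_space_generated[where n = ?n and \<chi> = ?\<chi>])
 show "finite ?S" using finite_R by simp
 fix i assume i: "i : ?S"
 show "?n i : S.N" using i by (rule S_cases) (simp_all only: sum.case N_iff av_radf radf_zero \<rho>_closed E.M.zero_closed simp_thms)
 show "?src i : V" "?trg i : V" using i rsrc(1) rtrg(1) by auto
 show "(ev (?src i), \<zero>\<^sub>E) \<otimes>\<^sub>RE ?n i = ?n i"
 using i by (rule S_cases) (simp_all add: RE_simps av_corner BM.lact_zero BM.ract_zero \<rho>_target \<rho>_closed F2_c(4))
 show "?n i \<otimes>\<^sub>RE (ev (?trg i), \<zero>\<^sub>E) = ?n i"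
 using i by (rule S_cases) (simp_all add: RE_simps av_corner BM.lact_zero BM.ract_zero \<rho>_source \<rho>_closed F2_c(2))
 show "?\<chi> i (?n j) = (if i = j then \<one>\<^sub>K else \<zero>\<^sub>K)" if j: "j : ?S" for j
 proof -
 have z: "ac a \<zero> = \<zero>\<^sub>K" for a using ac_smult[of "\<zero>" "\<zero>\<^sub>K" a] ac_closed[of "\<zero>" a] by (simp add: kC.lmult_0)
 have z': "\<tau> r \<zero>\<^sub>E = \<zero>\<^sub>K" if "r : R" for r
 using \<tau>_smult[OF that E.M.zero_closed, of "\<zero>\<^sub>K"] \<tau>_closed[OF that E.M.zero_closed] by (simp add: E.smult_r_null)
 show ?thesis using i j by (auto simp: z z' ac_av \<tau>_\<rho> split: if_splits)
 qed
 fix a assume a: "a : S.N"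
 show "?\<chi> i a : carrier K" using a by (rule N_cases) (rule S_cases[OF i]; simp add: ac_closed \<tau>_closed)
 show "?\<chi> i (k \<odot>\<^sub>RE a) = k \<otimes>\<^sub>K ?\<chi> i a" if k: "k : carrier K" for k
 using a by (rule N_cases) (rule S_cases[OF i]; simp add: RE_simps ac_smult \<tau>_smult k)
 fix b assume b: "b : S.N"
 show "?\<chi> i (a \<oplus>\<^sub>RE b) = ?\<chi> i a \<oplus>\<^sub>K ?\<chi> i b"
 using a by (rule N_cases) (rule N_cases[OF b], rule S_cases[OF i]; simp add: RE_simps ac_add \<tau>_add)
 show "?\<chi> i (a \<otimes>\<^sub>RE b) = \<zero>\<^sub>K" using a
 proof (rule N_cases)
 fix c m assume c: "c : radf 1" "c : \<C>" and m: "m : carrier E"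
 show "?\<chi> i ((c, m) \<otimes>\<^sub>RE b) = \<zero>\<^sub>K"
 proof (rule N_cases[OF b])
 fix d m' assume d: "d : radf 1" "d : \<C>" and m': "m' : carrier E"
 \<comment> \<open>The bimodule component of a product of radical elements is
   \<open>c m' + m d\<close> with \<open>c\<close> and \<open>d\<close> in the radical of
   \<open>C\<close>, where the characters vanish.\<close>
 have \<tau>0: "\<tau> r (lact c m' \<oplus>\<^sub>E ract m d) = \<zero>\<^sub>K" if r: "r : R" for r
 unfolding \<tau>_add[OF r BM.lact_closed[OF c(2) m'] BM.ract_closed[OF d(2) m]] \<tau>_lact[OF r m' c(2)] \<tau>_ract[OF r m d(2)]
 cf0[OF c(1) rtrg(1)[OF r]] cf0[OF d(1) rsrc(1)[OF r]] using \<tau>_closed[OF r m] \<tau>_closed[OF r m'] by simp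
 from i consider (arrow) a where "i = Inl a" "a : arcs Q" | (relation) r where "i = Inr r" "r : R" by blast
 thus "?\<chi> i ((c, m) \<otimes>\<^sub>RE (d, m')) = \<zero>\<^sub>K"
 proof cases
 case arrow
 show ?thesis unfolding arrow(1) using ac_prod[OF c(1) d(1)] by (simp add: RE_simps)
 next
 case relation
 show ?thesis unfolding relation(1) using \<tau>0[OF relation(2)] by (simp add: RE_simps)
 qed
 qed
 qed
 next
 fix a U assume aN: "a : S.N" and U0: "U \<zero>\<^sub>RE"
 and gen: "!!i a b. [|i : ?S; a : carrier RE; b : carrier RE|] ==> U (a \<otimes>\<^sub>RE ?n i \<otimes>\<^sub>RE b)"
 and plus: "!!a b. [|a : S.N; b : S.N; U a; U b|] ==> U (a \<oplus>\<^sub>RE b)"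
 show "U a"
 proof (rule N_generated[where U = U, OF aN U0])
 show "U (x \<otimes>\<^sub>RE (av a, \<zero>\<^sub>E) \<otimes>\<^sub>RE y)" if "a : arcs Q" "x : carrier RE" "y : carrier RE" for a x y
 using gen[of "Inl a" x y] that by simp
 show "U (x \<otimes>\<^sub>RE (\<zero>, \<rho> r) \<otimes>\<^sub>RE y)" if "r : R" "x : carrier RE" "y : carrier RE" for r x y
 using gen[of "Inr r" x y] that by simp
 qed (rule plus)
 qed (rule xy)+
 also have "{i : ?S. ?src i = x & ?trg i = y} = Inl ` arrows Q x y \<union> Inr ` {r : R. rtrg r = x & rsrc r = y}" by (auto simp: arrows_def)
 also have "card ... = card (arrows Q x y) + card {r : R. rtrg r = x & rsrc r = y}"
 using finite_R by (subst card_Un_disjoint) (auto simp: card_image arrows_def)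
 finally show ?thesis .
qed

text \<open>\<open>E_span\<close> leaves the left factor arbitrary; expanding it along the frame
  gives a finite spanning set.\<close>

lemma fin_dim_RE: "vectorspace.fin_dim K RE"
proof (rule fin_dimI[OF kalgebraD(4)[OF kalgebra_RE]])
 let ?T1 = "(%b. (b, \<zero>\<^sub>E)) ` B" and ?T2 = "(%(r, b', b). (\<zero>, lact b' (ract (\<rho> r) b))) ` (R \<times> B \<times> B)"
 have Bc: "b : \<C>" if "b : B" for b using that B_sub by blast
 show "finite (?T1 \<union> ?T2)" using finite_B finite_R by simp
 show "?T1 \<union> ?T2 \<subseteq> carrier RE" using Bc by (auto simp: RE_simps \<rho>_closed BM.lact_closed BM.ract_closed)
 fix v U assume v: "v : carrier RE" and 0: "U \<zero>\<^sub>RE"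
 and smult: "!!k t. [|k : carrier K; t : ?T1 \<union> ?T2|] ==> U (k \<odot>\<^sub>RE t)"
 and plus: "!!v w. [|v : carrier RE; w : carrier RE; U v; U w|] ==> U (v \<oplus>\<^sub>RE w)"
 obtain c m where cm: "v = (c, m)" "c : \<C>" "m : carrier E" using v by (auto simp: RE_simps)
 \<comment> \<open>\<open>f\<close> is an additive map from \<open>C\<close>, so closure under
   addition carries \<open>U\<close> from scaled frame vectors to a full expansion. It is used for
   the embedding of \<open>C\<close> and for left multiplication on a fixed class.\<close>
 have sum: "U (f (\<Oplus>b\<in>B. \<t> b c \<odot> b))"
 if f: "!!c d. [|c : \<C>; d : \<C>|] ==> f (c \<oplus>\<^sub>C d) = f c \<oplus>\<^sub>RE f d" "f \<zero> = \<zero>\<^sub>RE"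
 "!!c. c : \<C> ==> f c : carrier RE" "!!b. b : B ==> U (f (\<t> b c \<odot> b))" and c: "c : \<C>" for f c
 proof -
 have t: "\<t> b c \<odot> b : \<C>" if "b : B" for b using \<t>_closed[OF that c] Bc[OF that] by simp
 have "(\<Oplus>b\<in>D. \<t> b c \<odot> b) : \<C> & U (f (\<Oplus>b\<in>D. \<t> b c \<odot> b))" if "finite D" "D \<subseteq> B" for D using that
 proof (induction D rule: finite_induct)
 case empty thus ?case using 0 by (simp add: f(2))
 next
 case (insert b D)
 hence b: "b : B" and D: "D \<subseteq> B" by auto
 have s: "(\<Oplus>b\<in>insert b D. \<t> b c \<odot> b) = \<t> b c \<odot> b \<oplus>\<^sub>C (\<Oplus>b\<in>D. \<t> b c \<odot> b)"
 by (rule C.finsum_insert[OF insert.hyps]) (use t b D in auto)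
 have IH: "(\<Oplus>b\<in>D. \<t> b c \<odot> b) : \<C>" "U (f (\<Oplus>b\<in>D. \<t> b c \<odot> b))" using insert.IH D by auto
 show ?case unfolding s f(1)[OF t[OF b] IH(1)] by (intro conjI C.a_closed t[OF b] IH(1) plus f(3) f(4)[OF b] IH(2))
 qed
 thus ?thesis using finite_B by blast
 qed
 have 1: "U (c, \<zero>\<^sub>E)"
 proof -
 have "U (\<Oplus>b\<in>B. \<t> b c \<odot> b, \<zero>\<^sub>E)"
 proof (rule sum[of "%c. (c, \<zero>\<^sub>E)"])
 show "U (\<t> b c \<odot> b, \<zero>\<^sub>E)" if b: "b : B" for b
 using smult[OF \<t>_closed[OF b cm(2)], of "(b, \<zero>\<^sub>E)"] b \<t>_closed[OF b cm(2)] by (simp add: RE_simps E.smult_r_null)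
 qed (simp_all add: RE_simps cm(2))
 thus ?thesis unfolding frame[OF cm(2)] .
 qed
 have 2: "U (\<zero>, m)"
 proof (rule E_span[OF cm(3), where S = "%m. U (\<zero>, m)"])
 show "U (\<zero>, \<zero>\<^sub>E)" using 0 by (simp add: RE_simps)
 show "U (\<zero>, m \<oplus>\<^sub>E m')" if "m : carrier E" "m' : carrier E" "U (\<zero>, m)" "U (\<zero>, m')" for m m'
 using plus[OF _ _ that(3,4)] that(1,2) by (simp add: RE_simps)
 fix r c b assume r: "r : R" and c: "c : \<C>" and b: "b : B"
 have rb: "ract (\<rho> r) b : carrier E" by (rule BM.ract_closed[OF Bc[OF b] \<rho>_closed[OF r]])
 have "U (\<zero>, lact (\<Oplus>b\<in>B. \<t> b c \<odot> b) (ract (\<rho> r) b))"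
 proof (rule sum[of "%c. (\<zero>, lact c (ract (\<rho> r) b))"])
 show "U (\<zero>, lact (\<t> b' c \<odot> b') (ract (\<rho> r) b))" if b': "b' : B" for b'
 proof -
 have k: "\<t> b' c : carrier K" by (rule \<t>_closed[OF b' c])
 have "U (\<t> b' c \<odot>\<^sub>RE (\<zero>, lact b' (ract (\<rho> r) b)))" by (rule smult[OF k]) (use r b b' in force)
 thus ?thesis unfolding BM.smult_lact[OF k Bc[OF b'] rb] using k by (simp add: RE_simps kC.smult_r_null)
 qed
 qed (use rb c in \<open>simp_all add: RE_simps BM.add_lact BM.zero_lact BM.lact_closed\<close>)
 thus "U (\<zero>, lact c (ract (\<rho> r) b))" unfolding frame[OF c] .
 qed
 show "U v" unfolding cm(1) RE_split[OF cm(2,3)] by (rule plus[OF _ _ 1 2]) (use cm(2,3) in \<open>simp_all add: RE_simps\<close>)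
qed

text \<open>A nonzero element has at most one pair of endpoints, so membership in the corner is
  decided by the chosen source and target. The points appear in opposite order because a new arrow
  from \<open>x\<close> to \<open>y\<close> stems from a relation from \<open>y\<close> to
  \<open>x\<close>.\<close>

lemma relations_in_corner:
 assumes x: "x : V" and y: "y : V" shows "R \<inter> corner K Q y I x = {r : R. rtrg r = x & rsrc r = y}"
proof (intro equalityI subsetI)
 fix r assume "r : R \<inter> corner K Q y I x"
 then obtain f where r: "r : R" and f: "f : I" "r = vid y \<otimes>\<^sub>A f \<otimes>\<^sub>A vid x" by (auto simp: corner_def)
 note fc = I_carrier[OF f(1)]
 have yr: "vid y \<otimes>\<^sub>A r = r" and rx: "r \<otimes>\<^sub>A vid x = r"
 unfolding f(2) using fc x y by (simp_all add: A.m_assoc vid_mult_vid) (simp add: A.m_assoc[symmetric] vid_mult_vid)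
 have "rsrc r = y"
 proof (rule ccontr)
 assume n: "rsrc r ~= y"
 have "r = vid y \<otimes>\<^sub>A (vid (rsrc r) \<otimes>\<^sub>A r)" by (simp only: rsrc(2)[OF r] yr)
 also have "... = \<zero>\<^sub>A" using n y rsrc(1)[OF r] R_carrier[OF r] by (simp add: A.m_assoc[symmetric] vid_mult_vid)
 finally show False using R_nonzero[OF r] by contradiction
 qed
 moreover have "rtrg r = x"
 proof (rule ccontr)
 assume n: "rtrg r ~= x"
 have "r = r \<otimes>\<^sub>A vid (rtrg r) \<otimes>\<^sub>A vid x" by (simp only: rtrg(2)[OF r] rx)
 also have "... = \<zero>\<^sub>A" using n x rtrg(1)[OF r] R_carrier[OF r] by (simp add: A.m_assoc vid_mult_vid)
 finally show False using R_nonzero[OF r] by contradiction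
 qed
 ultimately show "r : {r : R. rtrg r = x & rsrc r = y}" using r by simp
next
 fix r assume "r : {r : R. rtrg r = x & rsrc r = y}"
 hence r: "r : R" "rtrg r = x" "rsrc r = y" by auto
 have "r = vid y \<otimes>\<^sub>A r \<otimes>\<^sub>A vid x" using rsrc(2)[OF r(1)] rtrg(2)[OF r(1)] r(2,3) by metis
 thus "r : R \<inter> corner K Q y I x" unfolding corner_def using r(1) R_I[OF r(1)] by blast
qed

lemma is_quiver_of_RE:
 "is_quiver_of K RE (add_arrows Q (%x y. card (R \<inter> corner K Q y I x))) (%x. (ev x, \<zero>\<^sub>E))" unfolding is_quiver_of_def
proof (intro conjI ballI)
 have v: "verts (add_arrows Q n) = V" for n by (simp add: add_arrows_def)
 show "kalgebra K RE" "vectorspace.fin_dim K RE" "basic_algebra RE" by (rule kalgebra_RE fin_dim_RE S.basic)+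
 show "fin_digraph (add_arrows Q (%x y. card (R \<inter> corner K Q y I x)))" by (rule fin_digraph_add_arrows[OF fin_Q])
 show "complete_primitive_orthogonal RE (verts (add_arrows Q (%x y. card (R \<inter> corner K Q y I x)))) (%x. (ev x, \<zero>\<^sub>E))"
 unfolding v by (rule S.complete_primitive)
 fix x y assume "x : verts (add_arrows Q (%x y. card (R \<inter> corner K Q y I x)))" "y : verts (add_arrows Q (%x y. card (R \<inter> corner K Q y I x)))"
 hence xy: "x : V" "y : V" by (simp_all only: v)
 show "card (arrows (add_arrows Q (%x y. card (R \<inter> corner K Q y I x))) x y) =
 vectorspace.dim K (arrow_space RE (ev x, \<zero>\<^sub>E) (ev y, \<zero>\<^sub>E))"
 unfolding card_arrows_add_arrows[OF fin_Q xy] dim_RE[OF xy] relations_in_corner[OF xy] ..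
qed
end

text \<open>This turns the admissibility of \<open>I\<close> into the coefficient condition
  \<open>I \<subseteq> filt 2\<close>.\<close>

lemma (in acyclic_path_algebra) arrow_ideal_power_filt: "ideal_power (path_algebra K Q) (arrow_ideal K Q) n \<subseteq> filt n"
proof (induction n)
 case 0 thus ?case by (simp add: filt_0)
next
 case (Suc n)
 interpret A: ring "path_algebra K Q" by (rule ring_A)
 have J: "arrow_ideal K Q \<subseteq> filt 1" unfolding arrow_ideal_def by (rule A.genideal_minimal[OF filt_ideal]) (use arr_filt in auto)
 show ?case
 proof
 fix f assume "f : ideal_power (path_algebra K Q) (arrow_ideal K Q) (Suc n)"
 hence "f : ideal_prod (path_algebra K Q) (ideal_power (path_algebra K Q) (arrow_ideal K Q) n) (arrow_ideal K Q)" by simp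
 thus "f : filt (Suc n)"
 proof (induction rule: ideal_prod.induct)
 case (prod i j)
 hence "i : filt n" "j : filt 1" using Suc J by blast+
 thus ?case using filt_mult[of i n j 1] by simp
 next
 case (sum s1 s2) thus ?case by (intro filt_add)
 qed
 qed
qed

theorem theorem2p6:
  fixes K :: "'k ring"
    and Q :: "('v, 'a) pre_digraph"
    and I R :: "(('v, 'a) path \<Rightarrow> 'k) set"
    and C :: "('k, 'c) module"
    and h :: "(('v, 'a) path \<Rightarrow> 'k) set \<Rightarrow> 'c"
    and e :: "'v \<Rightarrow> 'c"
    and P :: "('c, 'p, 'c \<Rightarrow> 'k) resolution"
  assumes "algebraically_closed K"
    and "fin_digraph Q"
    and "admissible_ideal K Q I"
    and "algebra_iso K (quotient_module (path_algebra K Q) I) C h"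
    and "\<And>x. e x = h (I +>\<^bsub>path_algebra K Q\<^esub> vertex_idempotent K x)"
    and "is_quiver_of K C Q e"
    and "connected_algebra C"
    and "gl_dim_le C 2"
    and "acyclic_quiver Q"
    and "system_of_relations K Q I R"
    and "projective_resolution C (dual_module K C) P"
  shows "is_quiver_of K (relation_extension C P)
    (add_arrows Q (\<lambda>x y. card (R \<inter> corner K Q y I x)))
    (\<lambda>x. (e x, \<zero>\<^bsub>Ext C P 2 (regular_module C)\<^esub>))"
proof -
 have kC: "kalgebra K C" and fd: "vectorspace.fin_dim K C" using assms(6) by (auto simp: is_quiver_of_def)
 have id: "ideal I (path_algebra K Q)" and sub: "I \<subseteq> ideal_power (path_algebra K Q) (arrow_ideal K Q) 2" using assms(3) by (auto simp: admissible_ideal_def)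
 interpret acyclic_path_algebra K Q by (rule acyclic_path_algebra.intro[OF kalgebraD(1)[OF kC] assms(2,9) ideal.axioms(2)[OF id]])
 interpret quiver_relations K Q I R by (intro quiver_relations.intro quiver_relations_axioms.intro acyclic_path_algebra_axioms id assms(10)
 order_trans[OF sub arrow_ideal_power_filt])
 interpret I: ideal I "path_algebra K Q" by (rule id)
 interpret kA: kalgebra K "path_algebra K Q" by (rule kalgebra_A)
 interpret C: ring C by (rule kalgebraD(2)[OF kC])
 \<comment> \<open>A scalar acts as multiplication by a multiple of the unit, so a ring ideal is a
   subspace.\<close>
 have smult_I: "k \<odot>\<^sub>A f : I" if "k : carrier K" "f : I" for k f
 proof -
 have "k \<odot>\<^sub>A f = (k \<odot>\<^sub>A \<one>\<^sub>A) \<otimes>\<^sub>A f"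
 using kA.smult_mult_left[OF that(1) _ I_carrier[OF that(2)], of "\<one>\<^sub>A"] I_carrier[OF that(2)] by simp
 thus ?thesis using I.I_l_closed[OF that(2), of "k \<odot>\<^sub>A \<one>\<^sub>A"] that(1) by simp
 qed
 have sm: "submodule K I A" by (rule submodule.intro[OF kalgebraD(3)[OF kalgebra_A]]) (use I_carrier I.a_closed I.zero_closed smult_I in auto)
 define \<pi> where "\<pi> f = h (I +>\<^bsub>A\<^esub> f)" for f
 let ?q = "quotient_module A I"
 have hr: "h : ring_hom ?q C" and bij: "bij_betw h (carrier ?q) (carrier C)"
 and hs: "!!k S. [|k : carrier K; S : carrier ?q|] ==> h (k \<odot>\<^bsub>?q\<^esub> S) = k \<odot>\<^sub>C h S"
 using assms(4) by (auto simp: algebra_iso_def ring_iso_def)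
 have qc: "I +>\<^bsub>A\<^esub> f : carrier ?q" if "f : carrier A" for f unfolding carrier_quotient_module using that by (rule imageI)
 have \<pi>a: "\<pi> (f \<oplus>\<^sub>A g) = \<pi> f \<oplus>\<^sub>C \<pi> g" if "f : carrier A" "g : carrier A" for f g
 unfolding \<pi>_def quotient_add[OF sm that, symmetric] by (rule ring_hom_add[OF hr qc[OF that(1)] qc[OF that(2)]])
 have \<pi>m: "\<pi> (f \<otimes>\<^sub>A g) = \<pi> f \<otimes>\<^sub>C \<pi> g" if "f : carrier A" "g : carrier A" for f g
 proof -
 have "(I +>\<^bsub>A\<^esub> f) \<otimes>\<^bsub>?q\<^esub> (I +>\<^bsub>A\<^esub> g) = I +>\<^bsub>A\<^esub> (f \<otimes>\<^sub>A g)"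
 using I.rcoset_mult_add[OF that] by (simp add: quotient_module_def FactRing_def)
 thus ?thesis unfolding \<pi>_def using ring_hom_mult[OF hr qc[OF that(1)] qc[OF that(2)]] by metis
 qed
 have \<pi>s: "\<pi> (k \<odot>\<^sub>A f) = k \<odot>\<^sub>C \<pi> f" if "k : carrier K" "f : carrier A" for k f
 unfolding \<pi>_def quotient_smult[OF sm that, symmetric] by (rule hs[OF that(1) qc[OF that(2)]])
 have \<pi>1: "\<pi> \<one>\<^sub>A = \<one>\<^sub>C" using ring_hom_one[OF hr] by (simp add: \<pi>_def quotient_module_def FactRing_def)
 have \<pi>im: "\<pi> ` carrier A = carrier C" using bij unfolding bij_betw_def carrier_quotient_module \<pi>_def by (simp add: image_image)
 have \<pi>k: "\<pi> f = \<zero>\<^sub>C \<longleftrightarrow> f : I" if f: "f : carrier A" for f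
 proof -
 have z: "\<zero>\<^sub>A : carrier A" by simp
 have "\<pi> \<zero>\<^sub>A : carrier C" using \<pi>im z by blast
 hence "\<pi> \<zero>\<^sub>A = \<zero>\<^sub>C" using \<pi>a[OF z z] by (simp add: C.add.l_cancel_one')
 hence "\<pi> f = \<zero>\<^sub>C \<longleftrightarrow> \<pi> f = \<pi> \<zero>\<^sub>A" by simp
 also have "... \<longleftrightarrow> I +>\<^bsub>A\<^esub> f = I +>\<^bsub>A\<^esub> \<zero>\<^sub>A"
 unfolding \<pi>_def by (rule inj_on_eq_iff[OF bij_betw_imp_inj_on[OF bij] qc[OF f] qc[OF z]])
 also have "... \<longleftrightarrow> f : I" unfolding coset_eq_iff[OF sm f z] using f by (simp add: a_minus_def)
 finally show ?thesis .
 qed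
 have bqa: "bound_quiver_algebra K Q I R C \<pi>"
 by (intro bound_quiver_algebra.intro quiver_relations_axioms bound_quiver_algebra_axioms.intro kC fd \<pi>im \<pi>a \<pi>m \<pi>s \<pi>1 \<pi>k)
 obtain B \<t> where "finite B" "B \<subseteq> carrier C"
 "!!b v. [|b : B; v : carrier C|] ==> \<t> b v : carrier K"
 "!!b v w. [|b : B; v : carrier C; w : carrier C|] ==> \<t> b (v \<oplus>\<^sub>C w) = \<t> b v \<oplus>\<^sub>K \<t> b w"
 "!!b c v. [|b : B; c : carrier K; v : carrier C|] ==> \<t> b (c \<odot>\<^sub>C v) = c \<otimes>\<^sub>K \<t> b v"
 "!!v. v : carrier C ==> (\<Oplus>\<^sub>C b\<in>B. \<t> b v \<odot>\<^sub>C b) = v"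
 using coordinate_functionals[OF kalgebraD(4)[OF kC] fd] by blast
 then interpret F: bound_quiver_frame K Q I R C \<pi> B \<t> by (intro bound_quiver_frame.intro bqa bound_quiver_frame_axioms.intro)
 have M: "right_module C (dual_module K C)" by (rule F.right_module_dual)
 note Px = projective_resolution_exact[OF M assms(11)] and Pd = projective_resolution_terms(1)[OF assms(11)]
 note idm = mod_hom_id[OF M] and ac = mod_hom_closed[OF projective_resolution_terms(4)[OF assms(11)]]
 have F3: "three_term C (dual_module K C) F.F0 F.F1 F.F2 F.aug F.d1 F.d2"
 and P3: "three_term C (dual_module K C) (terms P 0) (terms P 1) (terms P 2) (augmentation P) (boundary P 0) (boundary P 1)"
 using F.F_exact Px by (simp_all only: exact_three_def)
 \<comment> \<open>Both complexes have terms with dual bases and are exact in low degrees, so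
   comparison maps over the identity of \<open>DC\<close> exist in both directions.\<close>
 obtain a0 a1 a2 where a: "a0 : mod_hom_set C F.F0 (terms P 0)" "a1 : mod_hom_set C F.F1 (terms P 1)" "a2 : mod_hom_set C F.F2 (terms P 2)"
 and a0: "!!x. x : carrier F.F0 ==> augmentation P (a0 x) = (\<lambda>x\<in>carrier (dual_module K C). x) (F.aug x)"
 and a12: "!!x. x : carrier F.F1 ==> boundary P 0 (a1 x) = a0 (F.d1 x)"
 "!!x. x : carrier F.F2 ==> boundary P 1 (a2 x) = a1 (F.d2 x)" using comparison[OF F3 F.F0_dual F.F1_dual F.F2_dual Px idm] by blast
 obtain b0 b1 b2 where b: "b0 : mod_hom_set C (terms P 0) F.F0" "b1 : mod_hom_set C (terms P 1) F.F1" "b2 : mod_hom_set C (terms P 2) F.F2"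
 and b0: "!!x. x : carrier (terms P 0) ==> F.aug (b0 x) = (\<lambda>x\<in>carrier (dual_module K C). x) (augmentation P x)"
 and b12: "!!x. x : carrier (terms P 1) ==> F.d1 (b1 x) = b0 (boundary P 0 x)"
 "!!x. x : carrier (terms P 2) ==> F.d2 (b2 x) = b1 (boundary P 1 x)" using comparison[OF P3 Pd Pd Pd F.F_exact idm] by blast
 have a0': "augmentation P (a0 x) = F.aug x" if "x : carrier F.F0" for x using a0[OF that] by (simp only: restrict_apply'[OF mod_hom_closed[OF F.aug_hom that]])
 have b0': "F.aug (b0 x) = augmentation P x" if "x : carrier (terms P 0)" for x using b0[OF that] by (simp only: restrict_apply'[OF ac[OF that]])
 interpret E: relation_extension_frame K Q I R C \<pi> B \<t> P a0 a1 a2 b0 b1 b2 by (rule relation_extension_frame.intro[OF F.bound_quiver_frame_axioms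
 relation_extension_frame_axioms.intro[OF assms(8,11) a a0' a12 b b0' b12]])
 have "e = (%x. \<pi> (vertex_idempotent K x))" using assms(5) by (auto simp: \<pi>_def)
 thus ?thesis using E.is_quiver_of_RE by simp
qed

end
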